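(* Let $n\ge2$, $s>0$, let $A\in\mathbb{R}^{n\times n}$ be a symmetric positive definite matrix, and let $E:=\{x\in\mathbb{R}^n: Ax\cdot x<1\}$. Let $j\in\mathbb{Z}$ with $j\ge-\lfloor s\rfloor-1$ and $s+j>-1$, and let $u_{s+j}(x)=(1-Ax\cdot x)_+^{s+j}$ for $x\in\mathbb{R}^n$. Then $u_{s+j}$ solves pointwise $$(-\Delta)^su_{s+j}=f_j\quad\text{in }E,\qquad u_{s+j}=0\quad\text{in }\mathbb{R}^n\setminus E,$$ where $f_j$ is the polynomial of degree $(2j)_+$ given as follows: $f_j(x)=0$ if $j\le-1$, and, if $j\ge0$, $$f_j(x)=C_{n,s,j}\sum_{k=0}^{j}(-1)^k\frac{\Gamma(s+\frac12+k)}{\Gamma(\frac12+k)}\binom jk\int_{\partial E}\frac{\big(u_1(x)+(Ax\cdot\theta)^2\big)^{j-k}(Ax\cdot\theta)^{2k}}{|\theta|^{n+2s}\,|A\theta|}\,d\theta ,$$ where $$C_{n,s,j}=\frac{2^{2s-1}\,\Gamma(\frac n2+s)\,\Gamma(1+s+j)}{\pi^{(n-1)/2}\,\Gamma(\frac12+s)\,\Gamma(1+j)} .$$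
   Context: $f_+$ denotes the positive part; for an exponent $\beta>-1$, $(1-Ax\cdot x)_+^\beta$ equals $(1-Ax\cdot x)^\beta$ for $x\in E$ and $0$ for $x\notin E$; in particular $u_1(x)=1-Ax\cdot x$ in $E$. $d\theta$ is the surface measure on $\partial E$. Here $\mathbb{N}=\{1,2,\dots\}$. Pointwise fractional Laplacian: for $s>0$, $$(-\Delta)^s u(x)=\frac{c_{n,m,s}}{2}\int_{\mathbb{R}^n}\frac{\delta_m u(x,y)}{|y|^{n+2s}}\,dy,\qquad \delta_m u(x,y):=\sum_{k=-m}^m(-1)^k\binom{2m}{m-k}u(x+ky),$$ where $m\in\mathbb{N}$ is any integer with $m>s$ (the value does not depend on this choice), and $c_{n,m,s}$ is the positive constant $$c_{n,m,s}=\begin{cases}\dfrac{4^{s}\Gamma(\frac n2+s)}{\pi^{n/2}\Gamma(-s)}\Big(\sum_{k=1}^{m}(-1)^{k}\binom{2m}{m-k}k^{2s}\Big)^{-1}, & s\in(0,m)\setminus\mathbb{N},\\[2mm] \dfrac{4^{s}\Gamma(\frac n2+s)\,s!}{2\pi^{n/2}}\Big(\sum_{k=2}^m(-1)^{k-s+1}\binom{2m}{m-k}k^{2s}\ln k\Big)^{-1}, & s\in\{1,\dots,m-1\}.\end{cases}$$ *)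

theory Defs
  imports "HOL-Analysis.Analysis" "HOL-Library.Poly_Mapping"
begin

section \<open>Hausdorff measure and surface measure\<close>

text \<open>
  The \<open>d\<close>-dimensional Hausdorff measure, normalised by the volume of the \<open>d\<close>-dimensional unit
  ball, so that it agrees with \<open>d\<close>-dimensional surface area on embedded \<open>C\<^sup>1\<close> submanifolds.
  The requirement \<^const>\<open>bounded\<close> is needed since \<^const>\<open>diameter\<close> carries no information for
  unbounded sets. Empty sets contribute nothing, also for \<open>d = 0\<close>, so finite covers are included.
\<close>

definition hausdorff_content :: "nat \<Rightarrow> real \<Rightarrow> 'a::metric_space set \<Rightarrow> ennreal" where
  "hausdorff_content d \<delta> B =
     (INF C \<in> {C :: nat \<Rightarrow> 'a set. B \<subseteq> (\<Union>i. C i) \<and> (\<forall>i. bounded (C i) \<and> diameter (C i) \<le> \<delta>)}.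
        suminf (\<lambda>i. if C i = {} then 0 else ennreal (unit_ball_vol (real d) * (diameter (C i) / 2) ^ d)))"

definition hausdorff_measure :: "nat \<Rightarrow> 'a::metric_space measure" where
  "hausdorff_measure d = measure_of UNIV (sets borel) (\<lambda>B. SUP \<delta>\<in>{0<..}. hausdorff_content d \<delta> B)"

definition surface_measure :: "'a::euclidean_space set \<Rightarrow> 'a measure" where
  "surface_measure S = restrict_space (hausdorff_measure (DIM('a) - 1)) S"


section \<open>Polynomials on \<open>\<real>\<^sup>n\<close> and their degree\<close>

text \<open>
  A multi-index is a function \<open>'n \<Rightarrow> nat\<close>. As \<open>\<real>\<close> is infinite, the coefficients are determined
  by the polynomial function. The zero polynomial has degree 0.
\<close>

definition eval_poly :: "(('n::finite \<Rightarrow> nat) \<Rightarrow>\<^sub>0 real) \<Rightarrow> real ^ 'n \<Rightarrow> real" where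
  "eval_poly p x = (\<Sum>\<alpha>\<in>Poly_Mapping.keys p. Poly_Mapping.lookup p \<alpha> * (\<Prod>i\<in>UNIV. (x $ i) ^ \<alpha> i))"

definition total_degree :: "(('n::finite \<Rightarrow> nat) \<Rightarrow>\<^sub>0 real) \<Rightarrow> nat" where
  "total_degree p = Max (insert 0 ((\<lambda>\<alpha>. \<Sum>i\<in>UNIV. \<alpha> i) ` Poly_Mapping.keys p))"

definition polynomial_of_degree :: "(real ^ 'n \<Rightarrow> real) \<Rightarrow> nat \<Rightarrow> bool" where
  "polynomial_of_degree f d \<longleftrightarrow> (\<exists>p. f = eval_poly p \<and> total_degree p = d)"


section \<open>The pointwise fractional Laplacian\<close>

definition central_diff :: "nat \<Rightarrow> ('a::real_vector \<Rightarrow> real) \<Rightarrow> 'a \<Rightarrow> 'a \<Rightarrow> real" where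
  "central_diff m u x y =
     (\<Sum>k = - int m..int m.
        (-1) powi k * real ((2 * m) choose nat (int m - k)) * u (x + of_int k *\<^sub>R y))"

definition frac_laplacian_const :: "nat \<Rightarrow> nat \<Rightarrow> real \<Rightarrow> real" where
  "frac_laplacian_const n m s =
     (if s \<in> \<nat>
      then 4 powr s * Gamma (real n / 2 + s) * fact (nat \<lfloor>s\<rfloor>) / (2 * pi powr (real n / 2))
           * inverse (\<Sum>k = 2..m. (-1) powi (int k - \<lfloor>s\<rfloor> + 1) * real ((2 * m) choose (m - k))
                                    * real k powr (2 * s) * ln (real k))
      else 4 powr s * Gamma (real n / 2 + s) / (pi powr (real n / 2) * Gamma (- s))
           * inverse (\<Sum>k = 1..m. (-1) ^ k * real ((2 * m) choose (m - k)) * real k powr (2 * s)))"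

text \<open>
  \<open>has_frac_laplacian m s u x v\<close>: the integral defining \<open>(-\<Delta>)\<^sup>s u(x)\<close>, with differences of
  order \<open>2 m\<close>, converges absolutely and \<open>(-\<Delta>)\<^sup>s u(x) = v\<close>. It is meant for \<open>0 < s < m\<close>.
\<close>

definition has_frac_laplacian ::
    "nat \<Rightarrow> real \<Rightarrow> ('a::euclidean_space \<Rightarrow> real) \<Rightarrow> 'a \<Rightarrow> real \<Rightarrow> bool" where
  "has_frac_laplacian m s u x v \<longleftrightarrow>
     integrable lborel (\<lambda>y. central_diff m u x y / norm y powr (real DIM('a) + 2 * s)) \<and>
     frac_laplacian_const DIM('a) m s / 2
       * (LINT y|lborel. central_diff m u x y / norm y powr (real DIM('a) + 2 * s)) = v"


section \<open>Ellipsoids\<close>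

definition ellipsoid :: "real ^ 'n ^ 'n \<Rightarrow> (real ^ 'n) set" where
  "ellipsoid A = {x. (A *v x) \<bullet> x < 1}"

definition ellipsoid_power :: "real ^ 'n ^ 'n \<Rightarrow> real \<Rightarrow> real ^ 'n \<Rightarrow> real" where
  "ellipsoid_power A \<beta> x = (if x \<in> ellipsoid A then (1 - (A *v x) \<bullet> x) powr \<beta> else 0)"

definition rhs_const :: "nat \<Rightarrow> real \<Rightarrow> nat \<Rightarrow> real" where
  "rhs_const n s j =
     2 powr (2 * s - 1) * Gamma (real n / 2 + s) * Gamma (1 + s + real j)
     / (pi powr ((real n - 1) / 2) * Gamma (1 / 2 + s) * Gamma (1 + real j))"

text \<open>
  In the right-hand side, \<open>u\<^sub>1(x)\<close> is written as the polynomial \<open>1 - Ax \<cdot> x\<close>, with which it coincides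
  on the ellipsoid; this makes the right-hand side a polynomial on the whole space.
\<close>

definition rhs_poly :: "real ^ 'n ^ 'n \<Rightarrow> real \<Rightarrow> int \<Rightarrow> real ^ 'n \<Rightarrow> real" where
  "rhs_poly A s j x =
     (if j < 0 then 0 else
      rhs_const CARD('n) s (nat j) *
      (\<Sum>k = 0..nat j.
         (-1) ^ k * (Gamma (s + 1 / 2 + real k) / Gamma (1 / 2 + real k)) * real (nat j choose k) *
         (LINT \<theta>|surface_measure (frontier (ellipsoid A)).
            (1 - (A *v x) \<bullet> x + ((A *v x) \<bullet> \<theta>)\<^sup>2) ^ (nat j - k) * ((A *v x) \<bullet> \<theta>) ^ (2 * k)
            / (norm \<theta> powr (real CARD('n) + 2 * s) * norm (A *v \<theta>)))))"

end

theory Submission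
  imports Defs "HOL-Complex_Analysis.Complex_Analysis" "HOL-Real_Asymp.Real_Asymp"
begin

text \<open>
  Fix \<open>x\<close> in the ellipsoid \<open>E\<close> and put \<open>\<beta> = s + j\<close>. Let \<open>\<rho>\<close> be the norm with unit ball \<open>E\<close>, so that
  every \<open>y \<noteq> 0\<close> is \<open>t \<theta>\<close> with \<open>t = \<rho> y > 0\<close> and \<open>\<theta>\<close> on the boundary of \<open>E\<close>. In these polar coordinates
  Lebesgue measure is the product of \<open>t\<^sup>n\<^sup>-\<^sup>1 dt\<close> and the cone measure of the boundary (\<open>integral_polar\<close>),
  and the cone measure is surface measure divided by \<open>|A \<theta>|\<close> (\<open>surface_integral_cone\<close>); this is where
  the weight in the right-hand side comes from. On the line through \<open>x\<close> in direction \<open>\<theta>\<close> the function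
  is \<open>v(\<tau>) = (u - 2 b \<tau> - \<tau>\<^sup>2)\<^sub>+\<^sup>\<beta>\<close> with \<open>u = 1 - Ax \<cdot> x > 0\<close> and \<open>b = Ax \<cdot> \<theta>\<close>, because \<open>\<rho> \<theta> = 1\<close>. So the
  theorem follows once the one-dimensional integral \<open>J(b)\<close> of \<open>\<delta>\<^sub>m v(t) t\<^sup>-\<^sup>1\<^sup>-\<^sup>2\<^sup>s\<close> over \<open>t > 0\<close> is known
  (\<open>difference_integral_value\<close>) and the integral of the absolute value is bounded uniformly in \<open>b\<close>
  (\<open>central_diff_slice_uniform_bound\<close>).

  To compute \<open>J(b)\<close>, cut the integral off at \<open>\<epsilon>\<close>. Then it may be expanded term by term, and dilations turn
  it, up to a multiple of \<open>\<epsilon>\<^sup>-\<^sup>2\<^sup>s\<close>, into the sum of \<open>c\<^sub>k k\<^sup>2\<^sup>s W(k \<epsilon>)\<close>, where \<open>W(\<epsilon>)\<close> is the integral of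
  \<open>(v(t) + v(-t)) t\<^sup>-\<^sup>1\<^sup>-\<^sup>2\<^sup>s\<close> over \<open>t > \<epsilon>\<close>. The limit is found by comparing finite parts at \<open>\<epsilon> = 0\<close>.

  If \<open>s\<close> is not an integer, \<open>W\<close> has a finite part \<open>F\<close>, and \<open>J(b) = F (\<Sum>\<^sub>k c\<^sub>k k\<^sup>2\<^sup>s)\<close>; the sum is not 0
  (\<open>power_moment_nonzero\<close>), and it is cancelled by the normalising constant. The finite part is
  computed for all exponents of the form \<open>l - 2 \<beta>\<close>, with an integer \<open>l\<close>, at once: integration by parts and \<open>v\<^sub>\<beta>\<^sub>+\<^sub>1 = (u - 2 b t - t\<^sup>2) v\<^sub>\<beta>\<close> give linear
  recurrences in \<open>l\<close> and \<open>\<beta>\<close>, whose boundary terms have finite part 0. They reduce everything to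
  \<open>-1 < \<beta> < 0\<close> and \<open>l \<in> {-1, 0}\<close>, where the substitution \<open>\<sigma> = 1/t - b/u\<close> yields 0 and a Beta integral.
  The result is 0 for \<open>l < 0\<close>, and \<open>\<Gamma>(\<beta> + 1) \<Gamma>(-\<beta>)\<close> times the coefficient of \<open>\<tau>\<^sup>l\<close> in
  \<open>(1 + 2 b \<tau> - u \<tau>\<^sup>2)\<^sup>\<beta>\<close> for \<open>l \<ge> 0\<close> (\<open>finite_part_mellin_pair_value\<close>). As \<open>l = 2 j\<close> is the case of interest,
  the right-hand side vanishes for negative \<open>j\<close>, and for \<open>j \<ge> 0\<close> it is polynomial in \<open>u\<close> and \<open>b\<^sup>2\<close>.

  If \<open>s\<close> is an integer, the sum of \<open>c\<^sub>k k\<^sup>2\<^sup>s\<close> is 0, and \<open>v\<close> is a polynomial near 0. Now only the logarithm in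
  \<open>W\<close> matters: through \<open>ln (k \<epsilon>) = ln k + ln \<epsilon>\<close> it produces the sum of \<open>c\<^sub>k k\<^sup>2\<^sup>s ln k\<close> in the normalising
  constant, times the coefficient of \<open>t\<^sup>2\<^sup>s\<close> in \<open>(u - 2 b t - t\<^sup>2)\<^sup>\<beta>\<close>.

  The surface measure is a Hausdorff measure, so its identification with the cone measure needs two
  estimates. A small set \<open>S\<close> on the boundary spans a cone whose sections are nearly copies of \<open>S\<close>, and by
  the isodiametric inequality its volume is bounded in terms of the diameter of \<open>S\<close>; hence Hausdorff measure
  is not smaller than the cone measure with density \<open>|A \<theta>|\<close>. Conversely, the cones over
  small caps have nearly the expected volume, and Vitali's covering lemma shows that the total masses
  agree, which settles equality on all Borel sets (\<open>hausdorff_eq_area\<close>).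

  The degree: integrating powers of \<open>Ax \<cdot> \<theta>\<close> over the boundary gives polynomials in \<open>x\<close>. Along a ray, the
  terms of order \<open>2 j\<close> all have the sign \<open>(-1)\<^sup>j\<close>, as \<open>(Ax \<cdot> \<theta>)\<^sup>2 \<le> Ax \<cdot> x\<close>, so that they cannot cancel
  (\<open>rhs_combination_degree\<close>).
\<close>

section \<open>Hausdorff measure is a Borel measure\<close>

text \<open>
  Outer measures are assumed to be subadditive on disjoint families only; disjointing removes
  the restriction.
\<close>

lemma outer_measure_space_UN:
  fixes X :: "nat \<Rightarrow> 'a set"
  assumes out: "outer_measure_space UNIV f"
  shows "f (\<Union>i. X i) \<le> suminf (\<lambda>i. f (X i))"
proof -
  have "f (\<Union>i. X i) = f (\<Union>i. disjointed X i)" by (simp add: UN_disjointed_eq)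
  also have "\<dots> \<le> suminf (\<lambda>i. f (disjointed X i))"
    using out disjoint_family_disjointed[of X]
    unfolding outer_measure_space_def countably_subadditive_def by simp
  also have "\<dots> \<le> suminf (\<lambda>i. f (X i))"
    using out disjointed_subset[of X]
    by (intro suminf_le) (auto simp: outer_measure_space_def increasing_def)
  finally show ?thesis .
qed

text \<open>
  Caratheodory's argument. Let \<open>R k\<close> be the layer of points whose distance from \<open>C\<close> is between
  \<open>1 / (k + 2)\<close> and \<open>1 / (k + 1)\<close>. Layers of the same parity have positive distances from each
  other, so the outer measures of the layers have a finite sum. Hence \<open>T - C\<close> is approximated by
  its parts \<open>S k\<close> at distance at least \<open>1 / (k + 1)\<close> from \<open>C\<close>.
\<close>

lemma metric_outer_measure_closed_split:
  fixes f :: "'a::metric_space set \<Rightarrow> ennreal"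
  assumes out: "outer_measure_space UNIV f"
    and sep: "\<And>A B e. 0 < e \<Longrightarrow> (\<And>a b. a \<in> A \<Longrightarrow> b \<in> B \<Longrightarrow> e \<le> dist a b) \<Longrightarrow> f A + f B \<le> f (A \<union> B)"
    and C: "closed C"
  shows "f (T \<inter> C) + f (T - C) \<le> f T"
proof (cases "C = {} \<or> f T = \<infinity>")
  case True
  have "f {} = 0" using out by (auto simp: outer_measure_space_def positive_def)
  with True show ?thesis by auto
next
  case False
  then have ne: "C \<noteq> {}" and fin: "f T < \<infinity>" by (auto simp: less_top)
  have mono: "f X \<le> f Y" if "X \<subseteq> Y" for X Y
    using out that by (auto simp: outer_measure_space_def increasing_def)
  have csub: "f (\<Union>i. X i) \<le> (suminf (\<lambda>i. f (X i)))" for X :: "nat \<Rightarrow> 'a set"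
    by (rule outer_measure_space_UN[OF out])
  have f0: "f {} = 0" using out by (auto simp: outer_measure_space_def positive_def)
  have sub2: "f (X \<union> Y) \<le> f X + f Y" for X Y
  proof -
    have "f (X \<union> Y) = f (\<Union>i. (if i = 0 then X else if i = Suc 0 then Y else {}))"
      by (rule arg_cong[where f=f]) (auto split: if_splits)
    also have "\<dots> \<le> (suminf (\<lambda>i. f (if i = 0 then X else if i = Suc 0 then Y else {})))"
      by (rule csub)
    also have "\<dots> = (\<Sum>i<2. f (if i = 0 then X else if i = Suc 0 then Y else {}))"
      by (rule suminf_finite) (auto simp: f0)
    finally show ?thesis by (simp add: numeral_2_eq_2)
  qed
  define S where "S k = {x \<in> T. 1 / real (Suc k) \<le> infdist x C}" for k
  define R where "R k = S (Suc k) - S k" for k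
  have RT: "R k \<subseteq> T" for k by (auto simp: R_def S_def)
  have Sbound: "f (T \<inter> C) + f (S k) \<le> f T" for k
  proof -
    have "f (T \<inter> C) + f (S k) \<le> f (T \<inter> C \<union> S k)"
    proof (rule sep[of "1 / real (Suc k)"])
      fix a b assume "a \<in> T \<inter> C" "b \<in> S k"
      then have "1 / real (Suc k) \<le> infdist b C" "infdist b C \<le> dist b a"
        by (auto simp: S_def infdist_le)
      then show "1 / real (Suc k) \<le> dist a b" by (simp add: dist_commute)
    qed simp
    also have "\<dots> \<le> f T" by (rule mono) (auto simp: S_def)
    finally show ?thesis .
  qed
  have Rsep: "1 / real (k+2) - 1 / real (k+3) \<le> dist a b" if "a \<in> R k" "b \<in> R l" "k + 2 \<le> l" for k l a b
  proof -
    have "1 / real (k+2) \<le> infdist a C" using that by (auto simp: R_def S_def)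
    moreover have "infdist b C < 1 / real (l+1)" using that by (auto simp: R_def S_def)
    moreover have "1 / real (l+1) \<le> 1 / real (k+3)" using that by (intro divide_left_mono) auto
    moreover have "infdist a C \<le> infdist b C + dist a b"
      using infdist_triangle[of a C b] by simp
    ultimately show ?thesis by linarith
  qed
  have fin_part: "(\<Sum>i<n. f (R (2*i+p))) \<le> f T" for p n
  proof -
    have "(\<Sum>i<n. f (R (2*i+p))) \<le> f (\<Union>i<n. R (2*i+p))"
    proof (induction n)
      case (Suc n)
      have a: "f (\<Union>i<n. R (2*i+p)) + f (R (2*n+p)) \<le> f ((\<Union>i<n. R (2*i+p)) \<union> R (2*n+p))"
      proof (rule sep[of "1 / real (2*n+p+1) - 1 / real (2*n+p+2)"])
        fix a b assume "a \<in> (\<Union>i<n. R (2*i+p))" and b: "b \<in> R (2*n+p)"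
        then obtain i where i: "i < n" "a \<in> R (2*i+p)" by auto
        then have "1 / real (2*i+p+2) - 1 / real (2*i+p+3) \<le> dist a b"
          using Rsep[OF i(2) b] by auto
        moreover have "1 / real (2*n+p+1) - 1 / real (2*n+p+2) \<le> 1 / real (2*i+p+2) - 1 / real (2*i+p+3)"
        proof -
          define x y where "x = real (2*i+p+2)" and "y = real (2*n+p+1)"
          have xy: "0 < x" "x \<le> y" using i by (auto simp: x_def y_def)
          have "1 / y - 1 / (y+1) = 1 / (y * (y+1))" "1 / x - 1 / (x+1) = 1 / (x * (x+1))"
            using xy by (auto simp: field_simps)
          moreover have "1 / (y * (y+1)) \<le> 1 / (x * (x+1))"
            using xy by (intro divide_left_mono mult_mono mult_pos_pos) auto
          ultimately show ?thesis by (simp add: x_def y_def algebra_simps)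
        qed
        ultimately show "1 / real (2*n+p+1) - 1 / real (2*n+p+2) \<le> dist a b" by linarith
      qed (simp add: divide_strict_left_mono)
      have b: "(\<Union>i<n. R (2*i+p)) \<union> R (2*n+p) = (\<Union>i<Suc n. R (2*i+p))"
        by (auto simp: less_Suc_eq)
      have c: "(\<Sum>i<Suc n. f (R (2*i+p))) \<le> f (\<Union>i<n. R (2*i+p)) + f (R (2*n+p))"
        by (simp only: sum.lessThan_Suc) (rule add_right_mono[OF Suc])
      show ?case by (rule order_trans[OF c a[unfolded b]])
    qed (simp add: f0)
    also have "\<dots> \<le> f T" by (rule mono) (use RT in auto)
    finally show ?thesis .
  qed
  define r where "r i = enn2real (f (R i))" for i
  have fR: "f (R i) = ennreal (r i)" for i
    unfolding r_def using fin mono[OF RT[of i]] by (intro ennreal_enn2real[symmetric]) (auto simp: less_top[symmetric] top_unique)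
  have r0: "0 \<le> r i" for i by (simp add: r_def)
  have "summable r"
  proof (rule summableI_nonneg_bounded[where x="2 * enn2real (f T)"])
    fix n
    have *: "(\<Sum>i<n. r (2*i+p)) \<le> enn2real (f T)" for p n
    proof -
      have "ennreal (\<Sum>i<n. r (2*i+p)) \<le> f T"
        using fin_part[of p n] by (simp add: fR r0 sum_ennreal)
      then have "enn2real (ennreal (\<Sum>i<n. r (2*i+p))) \<le> enn2real (f T)"
        using fin by (intro enn2real_mono) (auto simp: infinity_ennreal_def)
      then show ?thesis by (simp add: sum_nonneg r0)
    qed
    have "(\<Sum>i<n. r i) \<le> (\<Sum>i<2*n. r i)" by (rule sum_mono2) (auto simp: r0)
    also have "\<dots> = (\<Sum>i<n. r (2*i+0)) + (\<Sum>i<n. r (2*i+1))"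
      by (induction n) auto
    also have "\<dots> \<le> 2 * enn2real (f T)" using *[of 0 n] *[of 1 n] by linarith
    finally show "(\<Sum>i<n. r i) \<le> 2 * enn2real (f T)" .
  qed (rule r0)
  have tail: "f (T - C) \<le> f (S k) + ennreal (suminf (\<lambda>i. r (i + k)))" for k
  proof -
    have "T - C \<subseteq> S k \<union> (\<Union>i. R (i + k))"
    proof
      fix x assume x: "x \<in> T - C"
      then have "infdist x C > 0" using C ne
        by (auto simp: in_closed_iff_infdist_zero[OF C ne] order_less_le infdist_nonneg)
      then obtain l where l: "1 / real (Suc l) < infdist x C"
        using nat_approx_posE by blast
      have ex: "\<exists>l. x \<in> S l" using l x by (auto simp: S_def intro!: exI[of _ l])
      define l0 where "l0 = (LEAST l. x \<in> S l)"
      have l0: "x \<in> S l0" using ex unfolding l0_def by (rule LeastI_ex)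
      have Sm: "S i \<subseteq> S j" if "i \<le> j" for i j
      proof -
        have "1 / real (Suc j) \<le> 1 / real (Suc i)" using that by (intro divide_left_mono) auto
        then show ?thesis unfolding S_def by fastforce
      qed
      show "x \<in> S k \<union> (\<Union>i. R (i + k))"
      proof (cases "l0 \<le> k")
        case True then show ?thesis using l0 Sm by blast
      next
        case False
        then obtain l1 where l1: "l0 = Suc l1" "k \<le> l1" by (cases l0) auto
        then have "x \<notin> S l1" using not_less_Least[of l1 "\<lambda>l. x \<in> S l"] by (auto simp: l0_def)
        then have "x \<in> R l1" using l0 l1 by (auto simp: R_def)
        then have "x \<in> R ((l1 - k) + k)" using l1 by simp
        then show ?thesis by blast
      qed
    qed
    then have "f (T - C) \<le> f (S k) + f (\<Union>i. R (i + k))"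
      by (rule order_trans[OF mono sub2])
    also have "f (\<Union>i. R (i + k)) \<le> (suminf (\<lambda>i. f (R (i + k))))" by (rule csub)
    also have "\<dots> = ennreal (suminf (\<lambda>i. r (i + k)))"
      unfolding fR using \<open>summable r\<close> by (intro suminf_ennreal2) (auto simp: r0 summable_iff_shift)
    finally show ?thesis by (simp add: add_left_mono)
  qed
  show ?thesis
  proof (rule ennreal_le_epsilon)
    fix e :: real assume "0 < e"
    obtain k where k: "norm (suminf (\<lambda>i. r (i + k))) < e"
      using suminf_exist_split[OF \<open>0 < e\<close> \<open>summable r\<close>] by blast
    have "f (T \<inter> C) + f (T - C) \<le> f (T \<inter> C) + (f (S k) + ennreal (suminf (\<lambda>i. r (i + k))))"
      by (intro add_left_mono tail)
    also have "\<dots> \<le> f T + ennreal e"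
      unfolding add.assoc[symmetric] using k by (intro add_mono Sbound ennreal_leI) auto
    finally show "f (T \<inter> C) + f (T - C) \<le> f T + ennreal e" .
  qed
qed

text \<open>
  Closed sets satisfy the measurability condition of Caratheodory, hence so does the
  sigma-algebra that they generate.
\<close>

lemma metric_outer_measure_borel:
  fixes f :: "'a::metric_space set \<Rightarrow> ennreal"
  assumes out: "outer_measure_space UNIV f"
    and sep: "\<And>A B e. 0 < e \<Longrightarrow> (\<And>a b. a \<in> A \<Longrightarrow> b \<in> B \<Longrightarrow> e \<le> dist a b) \<Longrightarrow> f A + f B \<le> f (A \<union> B)"
  shows "measure_space UNIV (sets borel) f"
proof -
  have out': "outer_measure_space (Pow UNIV) f" using out by simp
  have sa: "sigma_algebra UNIV (Pow (UNIV :: 'a set))" by (rule sigma_algebra_Pow)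
  have ms: "measure_space UNIV (lambda_system UNIV (Pow UNIV) f) f"
    by (rule sigma_algebra.caratheodory_lemma[OF sa out'])
  then have sl: "sigma_algebra UNIV (lambda_system UNIV (Pow UNIV) f)"
    by (simp add: measure_space_def)
  have f0: "f {} = 0" using out by (auto simp: outer_measure_space_def positive_def)
  have cl_eq: "f (C \<inter> T) + f ((UNIV - C) \<inter> T) = f T" if "closed C" for C T
  proof -
    have le: "f (T \<inter> C) + f (T - C) \<le> f T"
      by (rule metric_outer_measure_closed_split[OF out sep that])
    have csub: "f (\<Union>i. X i) \<le> (suminf (\<lambda>i. f (X i)))" for X :: "nat \<Rightarrow> 'a set"
      by (rule outer_measure_space_UN[OF out])
    have "f T = f (\<Union>i. (if i = 0 then T \<inter> C else if i = Suc 0 then T - C else {}))"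
      by (rule arg_cong[where f=f]) (auto split: if_splits)
    also have "\<dots> \<le> (suminf (\<lambda>i. f (if i = 0 then T \<inter> C else if i = Suc 0 then T - C else {})))"
      by (rule csub)
    also have "\<dots> = (\<Sum>i<2. f (if i = 0 then T \<inter> C else if i = Suc 0 then T - C else {}))"
      by (rule suminf_finite) (auto simp: f0)
    finally have "f T \<le> f (T \<inter> C) + f (T - C)" by (simp add: numeral_2_eq_2)
    with le have "f (T \<inter> C) + f (T - C) = f T" by simp
    moreover have "C \<inter> T = T \<inter> C" "(UNIV - C) \<inter> T = T - C" by auto
    ultimately show ?thesis by simp
  qed
  have cl: "C \<in> lambda_system UNIV (Pow UNIV) f" if "closed C" for C
    using cl_eq[OF that] by (auto simp: lambda_system_def)
  have "sigma_sets UNIV {S :: 'a set. closed S} \<subseteq> lambda_system UNIV (Pow UNIV) f"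
    using cl by (intro sigma_algebra.sigma_sets_subset[OF sl]) auto
  then have sub: "sets borel \<subseteq> lambda_system UNIV (Pow UNIV) f"
    by (simp add: borel_eq_closed)
  have "sigma_algebra UNIV (sets (borel :: 'a measure))"
    using sets.sigma_algebra_axioms[of "borel :: 'a measure"] by simp
  from measure_down[OF ms this sub] show ?thesis .
qed

lemma hausdorff_content_mono:
  "A \<subseteq> B \<Longrightarrow> hausdorff_content d \<delta> A \<le> hausdorff_content d \<delta> B"
  unfolding hausdorff_content_def by (rule INF_superset_mono) auto

lemma hausdorff_content_antimono:
  "\<delta> \<le> \<delta>' \<Longrightarrow> hausdorff_content d \<delta>' A \<le> hausdorff_content d \<delta> A"
  unfolding hausdorff_content_def by (rule INF_superset_mono[OF _ order_refl]) (auto intro: order_trans)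

lemma hausdorff_content_le:
  assumes "B \<subseteq> (\<Union>i. C i)" "\<And>i. bounded (C i)" "\<And>i. diameter (C i) \<le> \<delta>"
  shows "hausdorff_content d \<delta> B \<le>
    (suminf (\<lambda>i. if C i = {} then 0 else ennreal (unit_ball_vol (real d) * (diameter (C i) / 2) ^ d)))"
  unfolding hausdorff_content_def by (rule INF_lower) (use assms in auto)

text \<open>
  Almost optimal covers of the sets \<open>A i\<close>, with errors \<open>e / 2\<^sup>i\<^sup>+\<^sup>1\<close>, are merged into one cover
  along a pairing of the indices.
\<close>

lemma hausdorff_content_subadditive:
  assumes "\<delta> > 0"
  shows "hausdorff_content d \<delta> (\<Union>i. A i) \<le> (suminf (\<lambda>i. hausdorff_content d \<delta> (A i)))"
proof (cases "(suminf (\<lambda>i. hausdorff_content d \<delta> (A i))) = \<infinity>")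
  case True then show ?thesis by simp
next
  case False
  let ?w = "\<lambda>C. if C = {} then 0 else ennreal (unit_ball_vol (real d) * (diameter C / 2) ^ d)"
  show ?thesis
  proof (rule ennreal_le_epsilon)
    fix e :: real assume e: "0 < e"
    have fin: "hausdorff_content d \<delta> (A i) < \<infinity>" for i
      using False ennreal_suminf_lessD[of "\<lambda>i. hausdorff_content d \<delta> (A i)" \<infinity> i] by (auto simp: less_top)
    have "\<exists>C. (A i \<subseteq> (\<Union>k. C k) \<and> (\<forall>k. bounded (C k) \<and> diameter (C k) \<le> \<delta>)) \<and>
        (suminf (\<lambda>k. ?w (C k))) < hausdorff_content d \<delta> (A i) + ennreal (e * (1/2) ^ Suc i)" for i
    proof -
      have "hausdorff_content d \<delta> (A i) < hausdorff_content d \<delta> (A i) + ennreal (e * (1/2) ^ Suc i)"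
        using fin[of i] e by (auto simp: ennreal_less_zero_iff)
      then have "(INF C\<in>{C. A i \<subseteq> (\<Union>k. C k) \<and> (\<forall>k. bounded (C k) \<and> diameter (C k) \<le> \<delta>)}. suminf (\<lambda>k. ?w (C k))) < 
          hausdorff_content d \<delta> (A i) + ennreal (e * (1/2) ^ Suc i)"
        by (simp only: hausdorff_content_def)
      then show ?thesis unfolding INF_less_iff by blast
    qed
    then have "\<exists>C. \<forall>i. (A i \<subseteq> (\<Union>k. C i k) \<and> (\<forall>k. bounded (C i k) \<and> diameter (C i k) \<le> \<delta>)) \<and>
        suminf (\<lambda>k. ?w (C i k)) < hausdorff_content d \<delta> (A i) + ennreal (e * (1/2) ^ Suc i)"
      by (intro choice allI)
    then obtain C where C: "\<And>i. A i \<subseteq> (\<Union>k. C i k)" "\<And>i k. bounded (C i k)" "\<And>i k. diameter (C i k) \<le> \<delta>"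
      and Cw: "\<And>i. suminf (\<lambda>k. ?w (C i k)) < hausdorff_content d \<delta> (A i) + ennreal (e * (1/2) ^ Suc i)"
      by blast
    define G where "G = (\<lambda>p. case p of (i,k) \<Rightarrow> C i k)"
    have "hausdorff_content d \<delta> (\<Union>i. A i) \<le> (suminf (\<lambda>n. ?w (G (prod_decode n))))"
    proof (rule hausdorff_content_le)
      show "(\<Union>i. A i) \<subseteq> (\<Union>n. G (prod_decode n))"
      proof
        fix x assume "x \<in> (\<Union>i. A i)"
        then obtain i k where "x \<in> C i k" using C(1) by blast
        then have "x \<in> G (prod_decode (prod_encode (i,k)))" by (simp add: G_def)
        then show "x \<in> (\<Union>n. G (prod_decode n))" by blast
      qed
    qed (auto simp: G_def C split: prod.split)
    also have "\<dots> = (suminf (\<lambda>i. suminf (\<lambda>k. ?w (C i k))))"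
      by (rule suminf_ennreal_2dimen[of "\<lambda>i. suminf (\<lambda>k. ?w (C i k))" "\<lambda>p. ?w (G p)"]) (simp add: G_def cong: if_cong)
    also have "\<dots> \<le> (suminf (\<lambda>i. hausdorff_content d \<delta> (A i) + ennreal (e * (1/2) ^ Suc i)))"
      by (intro suminf_le less_imp_le[OF Cw]) auto
    also have "\<dots> = (suminf (\<lambda>i. hausdorff_content d \<delta> (A i))) + (suminf (\<lambda>i. ennreal (e * (1/2) ^ Suc i)))"
      by (rule suminf_add[symmetric]) auto
    also have "(suminf (\<lambda>i. ennreal (e * (1/2) ^ Suc i))) = ennreal e"
      using e sums_mult[OF power_half_series, of e] by (intro suminf_ennreal_eq) auto
    finally show "hausdorff_content d \<delta> (\<Union>i. A i) \<le> (suminf (\<lambda>i. hausdorff_content d \<delta> (A i))) + ennreal e" .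
  qed
qed

text \<open>
  A set of diameter below \<open>e\<close> cannot meet both \<open>A\<close> and \<open>B\<close>, so that a cover of the union splits
  into covers of the two sets.
\<close>

lemma hausdorff_content_separated:
  assumes "\<delta> < e" and sep: "\<And>a b. a \<in> A \<Longrightarrow> b \<in> B \<Longrightarrow> e \<le> dist a b"
  shows "hausdorff_content d \<delta> A + hausdorff_content d \<delta> B \<le> hausdorff_content d \<delta> (A \<union> B)"
proof -
  let ?w = "\<lambda>C. if C = {} then 0 else ennreal (unit_ball_vol (real d) * (diameter C / 2) ^ d)"
  have "hausdorff_content d \<delta> A + hausdorff_content d \<delta> B \<le> (suminf (\<lambda>i. ?w (C i)))"
    if C: "A \<union> B \<subseteq> (\<Union>i. C i)" "\<forall>i. bounded (C i) \<and> diameter (C i) \<le> \<delta>" for C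
  proof -
    define X where "X i = (if C i \<inter> A = {} then {} else C i)" for i
    define Y where "Y i = (if C i \<inter> A = {} then C i else {})" for i
    have d0: "0 \<le> \<delta>" using C(2) diameter_ge_0 order_trans by blast
    have "hausdorff_content d \<delta> A \<le> (suminf (\<lambda>i. ?w (X i)))"
    proof (rule hausdorff_content_le)
      show "A \<subseteq> (\<Union>i. X i)"
      proof
        fix x assume x: "x \<in> A"
        then obtain i where "x \<in> C i" using C(1) by blast
        then show "x \<in> (\<Union>i. X i)" using x by (auto simp: X_def intro!: exI[of _ i])
      qed
    qed (use C d0 in \<open>auto simp: X_def\<close>)
    moreover have "hausdorff_content d \<delta> B \<le> (suminf (\<lambda>i. ?w (Y i)))"
    proof (rule hausdorff_content_le)
      show "B \<subseteq> (\<Union>i. Y i)"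
      proof
        fix b assume b: "b \<in> B"
        then obtain i where i: "b \<in> C i" using C by blast
        have "C i \<inter> A = {}"
        proof (rule ccontr)
          assume "C i \<inter> A \<noteq> {}"
          then obtain a where a: "a \<in> C i" "a \<in> A" by blast
          then have "dist a b \<le> diameter (C i)" using C(2) i diameter_bounded_bound by blast
          also have "\<dots> < e" using C(2) assms(1) le_less_trans by blast
          finally show False using sep[OF a(2) b] by simp
        qed
        then show "b \<in> (\<Union>i. Y i)" using i by (auto simp: Y_def)
      qed
    qed (use C d0 in \<open>auto simp: Y_def\<close>)
    ultimately have "hausdorff_content d \<delta> A + hausdorff_content d \<delta> B \<le> (suminf (\<lambda>i. ?w (X i))) + (suminf (\<lambda>i. ?w (Y i)))"
      by (rule add_mono)
    also have "\<dots> = (suminf (\<lambda>i. ?w (X i) + ?w (Y i)))" by (rule suminf_add) auto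
    also have "\<dots> = (suminf (\<lambda>i. ?w (C i)))" by (rule arg_cong[where f=suminf]) (auto simp: X_def Y_def)
    finally show ?thesis .
  qed
  then show ?thesis unfolding hausdorff_content_def[of d \<delta> "A \<union> B"] by (intro INF_greatest) auto
qed

lemma hausdorff_outer_measure:
  "outer_measure_space UNIV (\<lambda>B :: 'a::metric_space set. SUP \<delta>\<in>{0<..}. hausdorff_content d \<delta> B)"
  unfolding outer_measure_space_def
proof (intro conjI)
  have "hausdorff_content d \<delta> ({} :: 'a set) = 0" if "\<delta> > 0" for \<delta>
    using hausdorff_content_le[of "{} :: 'a set" "\<lambda>_. {}" \<delta> d] that by simp
  then show "positive UNIV (\<lambda>B :: 'a set. SUP \<delta>\<in>{0<..}. hausdorff_content d \<delta> B)"
    by (auto simp: positive_def intro!: SUP_eq_const)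
  show "increasing UNIV (\<lambda>B :: 'a set. SUP \<delta>\<in>{0<..}. hausdorff_content d \<delta> B)"
    by (auto simp: increasing_def intro!: SUP_mono' hausdorff_content_mono)
  show "countably_subadditive UNIV (\<lambda>B :: 'a set. SUP \<delta>\<in>{0<..}. hausdorff_content d \<delta> B)"
    unfolding countably_subadditive_def
  proof (safe intro!: SUP_least)
    fix A :: "nat \<Rightarrow> 'a set" and \<delta> :: real assume \<delta>: "0 < \<delta>"
    have "hausdorff_content d \<delta> (\<Union>i. A i) \<le> (suminf (\<lambda>i. hausdorff_content d \<delta> (A i)))"
      by (rule hausdorff_content_subadditive[OF \<delta>])
    also have "\<dots> \<le> (suminf (\<lambda>i. SUP \<delta>\<in>{0<..}. hausdorff_content d \<delta> (A i)))"
      using \<delta> by (intro suminf_le SUP_upper) auto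
    finally show "hausdorff_content d \<delta> (\<Union>i. A i) \<le> (suminf (\<lambda>i. SUP \<delta>\<in>{0<..}. hausdorff_content d \<delta> (A i)))" .
  qed
qed

lemma hausdorff_outer_separated:
  fixes A B :: "'a::metric_space set"
  assumes "0 < e" and sep: "\<And>a b. a \<in> A \<Longrightarrow> b \<in> B \<Longrightarrow> e \<le> dist a b"
  shows "(SUP \<delta>\<in>{0<..}. hausdorff_content d \<delta> A) + (SUP \<delta>\<in>{0<..}. hausdorff_content d \<delta> B)
    \<le> (SUP \<delta>\<in>{0<..}. hausdorff_content d \<delta> (A \<union> B))" (is "?a + ?b \<le> ?c")
proof -
  have *: "hausdorff_content d \<delta> A + hausdorff_content d \<delta>' B \<le> ?c" if "0 < \<delta>" "0 < \<delta>'" for \<delta> \<delta>'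
  proof -
    define \<eta> where "\<eta> = min (min \<delta> \<delta>') (e/2)"
    have \<eta>: "0 < \<eta>" "\<eta> < e" "\<eta> \<le> \<delta>" "\<eta> \<le> \<delta>'" using that assms(1) by (simp_all add: \<eta>_def)
    have "hausdorff_content d \<delta> A + hausdorff_content d \<delta>' B \<le> hausdorff_content d \<eta> A + hausdorff_content d \<eta> B"
      using \<eta> by (intro add_mono hausdorff_content_antimono)
    also have "\<dots> \<le> hausdorff_content d \<eta> (A \<union> B)"
      by (rule hausdorff_content_separated[OF \<eta>(2) sep])
    also have "\<dots> \<le> ?c" using \<eta> by (intro SUP_upper) auto
    finally show ?thesis .
  qed
  have "?a + ?b = (SUP \<delta>\<in>{0<..}. hausdorff_content d \<delta> A + ?b)"
    by (rule ennreal_SUP_add_left[symmetric]) (auto simp: gt_ex)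
  also have "\<dots> = (SUP \<delta>\<in>{0<..}. SUP \<delta>'\<in>{0<..}. hausdorff_content d \<delta> A + hausdorff_content d \<delta>' B)"
    by (intro SUP_cong refl ennreal_SUP_add_right) (auto simp: gt_ex intro: exI[of _ 1])
  also have "\<dots> \<le> ?c" using * by (intro SUP_least) auto
  finally show ?thesis .
qed

text \<open>
  The measure constructor yields the zero measure when the given set function is not countably
  additive on the sigma-algebra; here it is, by the metric property.
\<close>

lemma emeasure_hausdorff_measure:
  assumes "B \<in> sets borel"
  shows "emeasure (hausdorff_measure d) B = (SUP \<delta>\<in>{0<..}. hausdorff_content d \<delta> B)"
proof -
  let ?f = "\<lambda>B :: 'a set. SUP \<delta>\<in>{0<..}. hausdorff_content d \<delta> B"
  have ms: "measure_space UNIV (sets borel) ?f"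
    by (rule metric_outer_measure_borel[OF hausdorff_outer_measure hausdorff_outer_separated])
  have s: "sigma_sets UNIV (sets (borel :: 'a measure)) = sets borel"
    using sets.sigma_sets_eq[of "borel :: 'a measure"] by simp
  show ?thesis unfolding hausdorff_measure_def
    by (rule emeasure_measure_of_sigma[OF _ _ _ assms])
      (use ms in \<open>simp_all only: measure_space_def\<close>)
qed

lemma sets_hausdorff_measure [measurable_cong, simp]: "sets (hausdorff_measure d) = sets borel"
  unfolding hausdorff_measure_def
  using sets.sigma_sets_eq[of "borel"] by (subst sets_measure_of) auto

lemma space_hausdorff_measure [simp]: "space (hausdorff_measure d) = UNIV"
  unfolding hausdorff_measure_def by (subst space_measure_of) auto

section \<open>The isodiametric inequality\<close>

lemma nn_integral_lborel_affine:
  fixes f :: "'a::euclidean_space \<Rightarrow> ennreal"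
  assumes [measurable]: "f \<in> borel_measurable borel" and c: "c \<noteq> 0"
  shows "(\<integral>\<^sup>+x. f x \<partial>lborel) = ennreal (\<bar>c\<bar> ^ DIM('a)) * (\<integral>\<^sup>+x. f (t + c *\<^sub>R x) \<partial>lborel)"
  by (subst lborel_affine[OF c, of t]) (simp add: nn_integral_density nn_integral_distr nn_integral_cmult)

lemma nn_integral_lborel_shift:
  fixes f :: "'a::euclidean_space \<Rightarrow> ennreal"
  assumes [measurable]: "f \<in> borel_measurable borel"
  shows "(\<integral>\<^sup>+x. f (t + x) \<partial>lborel) = (\<integral>\<^sup>+x. f x \<partial>lborel)"
  using nn_integral_lborel_affine[of f 1 t] by simp

text \<open>
  Compare \<open>A\<close> with the unit ball \<open>B\<close>, which \<open>T\<close> preserves. By translation invariance and Fubini,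
  \<open>|T\<^sup>-\<^sup>1 A| |B|\<close> and \<open>|A| |B|\<close> are the same double integral.
\<close>

lemma distr_lborel_orthogonal_transformation:
  fixes T :: "'a::euclidean_space \<Rightarrow> 'a"
  assumes T: "orthogonal_transformation T"
  shows "distr lborel borel T = lborel"
proof (rule measure_eqI)
  have lin: "linear T" using T by (rule orthogonal_transformation_linear)
  obtain g where g: "orthogonal_transformation g" "\<And>x. g (T x) = x" "\<And>x. T (g x) = x"
    using orthogonal_transformation_inv[OF T] orthogonal_transformation_bij[OF T]
    by (metis bij_inv_eq_iff)
  have [measurable]: "T \<in> borel_measurable borel" "g \<in> borel_measurable borel"
    using T g(1) by (auto intro!: borel_measurable_continuous_onI linear_continuous_on
      simp: linear_conv_bounded_linear[symmetric] orthogonal_transformation_linear)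
  fix A assume "A \<in> sets (distr lborel borel T)"
  then have A[measurable]: "A \<in> sets borel" by simp
  define B where "B = (ball 0 1 :: 'a set)"
  have [measurable]: "B \<in> sets borel" by (simp add: B_def)
  let ?I = "\<lambda>X x. indicator X x :: ennreal"
  have "emeasure lborel (T -` A) * emeasure lborel B
      = (\<integral>\<^sup>+y. (\<integral>\<^sup>+x. ?I A (T x) \<partial>lborel) * ?I B y \<partial>lborel)"
    by (simp add: nn_integral_cmult indicator_vimage[unfolded comp_def, symmetric] flip: nn_integral_indicator)
       (simp add: indicator_def vimage_def nn_integral_cmult)
  also have "\<dots> = (\<integral>\<^sup>+y. (\<integral>\<^sup>+x. ?I A (T x) * ?I B y \<partial>lborel) \<partial>lborel)"
    by (simp add: nn_integral_multc)
  also have "\<dots> = (\<integral>\<^sup>+y. (\<integral>\<^sup>+x. ?I A (T (g y + x)) * ?I B y \<partial>lborel) \<partial>lborel)"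
    by (intro nn_integral_cong nn_integral_lborel_shift[symmetric]) measurable
  also have "\<dots> = (\<integral>\<^sup>+y. (\<integral>\<^sup>+x. ?I A (y + T x) * ?I B y \<partial>lborel) \<partial>lborel)"
    using lin by (simp add: linear_add g)
  also have "\<dots> = (\<integral>\<^sup>+x. (\<integral>\<^sup>+y. ?I A (y + T x) * ?I B y \<partial>lborel) \<partial>lborel)"
    by (rule lborel_pair.Fubini') measurable
  also have "\<dots> = (\<integral>\<^sup>+x. (\<integral>\<^sup>+y. ?I A y * ?I B (y - T x) \<partial>lborel) \<partial>lborel)"
  proof (rule nn_integral_cong)
    fix x
    have "(\<integral>\<^sup>+y. ?I A y * ?I B (y - T x) \<partial>lborel) = (\<integral>\<^sup>+y. ?I A (T x + y) * ?I B ((T x + y) - T x) \<partial>lborel)"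
      by (rule nn_integral_lborel_shift[symmetric]) measurable
    then show "(\<integral>\<^sup>+y. ?I A (y + T x) * ?I B y \<partial>lborel) = (\<integral>\<^sup>+y. ?I A y * ?I B (y - T x) \<partial>lborel)"
      by (simp add: add.commute)
  qed
  also have "\<dots> = (\<integral>\<^sup>+y. (\<integral>\<^sup>+x. ?I A y * ?I B (y - T x) \<partial>lborel) \<partial>lborel)"
    by (rule lborel_pair.Fubini') measurable
  also have "\<dots> = (\<integral>\<^sup>+y. ?I A y * (\<integral>\<^sup>+x. ?I B (y - T x) \<partial>lborel) \<partial>lborel)"
    by (intro nn_integral_cong nn_integral_cmult) measurable
  also have "\<dots> = (\<integral>\<^sup>+y. ?I A y * emeasure lborel B \<partial>lborel)"
  proof (intro nn_integral_cong arg_cong2[where f="(*)"] refl)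
    fix y
    have "?I B (y - T x) = ?I B (g y + (-1) *\<^sub>R x)" for x
    proof -
      have "y - T x = T (g y + (-1) *\<^sub>R x)" using lin by (simp add: linear_diff g)
      then have "norm (y - T x) = norm (g y + (-1) *\<^sub>R x)"
        using T by (simp add: orthogonal_transformation_norm)
      then show ?thesis by (simp add: B_def indicator_def)
    qed
    then have "(\<integral>\<^sup>+x. ?I B (y - T x) \<partial>lborel) = (\<integral>\<^sup>+x. ?I B (g y + (-1) *\<^sub>R x) \<partial>lborel)"
      by simp
    also have "\<dots> = (\<integral>\<^sup>+x. ?I B x \<partial>lborel)"
      by (subst nn_integral_lborel_affine[of "?I B" "-1" "g y"]) auto
    finally show "(\<integral>\<^sup>+x. ?I B (y - T x) \<partial>lborel) = emeasure lborel B" by simp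
  qed
  also have "\<dots> = emeasure lborel A * emeasure lborel B"
    by (simp add: nn_integral_multc)
  finally have eq: "emeasure lborel (T -` A) * emeasure lborel B = emeasure lborel A * emeasure lborel B" .
  have "emeasure lborel B = ennreal (unit_ball_vol (real DIM('a)))"
    unfolding B_def by (subst emeasure_ball) auto
  moreover have "unit_ball_vol (real DIM('a)) \<noteq> 0"
    by (rule less_imp_neq[THEN not_sym, OF unit_ball_vol_pos]) simp
  ultimately have "emeasure lborel B \<noteq> 0" "emeasure lborel B \<noteq> \<infinity>"
    by auto
  then have canc: "(X * emeasure lborel B) / emeasure lborel B = X" for X
    by (intro mult_divide_eq_ennreal) auto
  have "emeasure lborel (T -` A) = emeasure lborel A"
    by (subst (1 2) canc[symmetric]) (simp only: eq)
  moreover have "emeasure (distr lborel borel T) A = emeasure lborel (T -` A)"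
    by (subst emeasure_distr) auto
  ultimately show "emeasure (distr lborel borel T) A = emeasure lborel A" by simp
qed simp

abbreviation lborel_Pi :: "'i set \<Rightarrow> ('i \<Rightarrow> real) measure" where
  "lborel_Pi I \<equiv> Pi\<^sub>M I (\<lambda>_. lborel)"

lemma PiM_lborel_translate:
  fixes c :: "'i \<Rightarrow> real"
  assumes I: "finite I"
  shows "distr (lborel_Pi I) (lborel_Pi I) (\<lambda>f. \<lambda>i\<in>I. f i - c i) = lborel_Pi I"
proof -
  interpret product_sigma_finite "\<lambda>_::'i. lborel :: real measure" by standard
  show ?thesis
  proof (rule PiM_eqI[OF I])
    fix A :: "'i \<Rightarrow> real set" assume A: "\<And>i. i \<in> I \<Longrightarrow> A i \<in> sets lborel"
    have [measurable]: "A i \<in> sets borel" if "i \<in> I" for i using A[OF that] by simp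
    have "emeasure (distr (lborel_Pi I) (lborel_Pi I) (\<lambda>f. \<lambda>i\<in>I. f i - c i)) (Pi\<^sub>E I A)
      = emeasure (lborel_Pi I) ((\<lambda>f. \<lambda>i\<in>I. f i - c i) -` (Pi\<^sub>E I A) \<inter> space (lborel_Pi I))"
      using A I by (intro emeasure_distr sets_PiM_I_finite) auto
    also have "(\<lambda>f. \<lambda>i\<in>I. f i - c i) -` (Pi\<^sub>E I A) \<inter> space (lborel_Pi I) = Pi\<^sub>E I (\<lambda>i. (\<lambda>x. x - c i) -` A i)"
      by (auto simp: space_PiM PiE_def Pi_def)
    also have "emeasure (lborel_Pi I) \<dots> = (\<Prod>i\<in>I. emeasure lborel ((\<lambda>x. x - c i) -` A i))"
    proof (rule emeasure_PiM[OF I])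
      fix i assume "i \<in> I"
      then have "(\<lambda>x. x - c i) -` A i \<inter> space borel \<in> sets borel"
        by (intro measurable_sets[of _ borel borel]) auto
      then show "(\<lambda>x. x - c i) -` A i \<in> sets lborel" by simp
    qed
    also have "\<dots> = (\<Prod>i\<in>I. emeasure lborel (A i))"
    proof (rule prod.cong[OF refl])
      fix i assume i: "i \<in> I"
      then have m: "(\<lambda>x. x - c i) -` A i \<inter> space borel \<in> sets borel"
        by (intro measurable_sets[of _ borel borel]) auto
      have "emeasure lborel ((\<lambda>x. x - c i) -` A i) = (\<integral>\<^sup>+x. indicator ((\<lambda>x. x - c i) -` A i) x \<partial>lborel)"
        using m by (subst nn_integral_indicator) auto
      also have "\<dots> = (\<integral>\<^sup>+x. indicator (A i) (- c i + x) \<partial>lborel)"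
        by (intro nn_integral_cong) (auto simp: indicator_def)
      also have "\<dots> = (\<integral>\<^sup>+x. indicator (A i) x \<partial>lborel)"
        using i by (intro nn_integral_lborel_shift) measurable
      finally show "emeasure lborel ((\<lambda>x. x - c i) -` A i) = emeasure lborel (A i)"
        using i by simp
    qed
    finally show "emeasure (distr (lborel_Pi I) (lborel_Pi I) (\<lambda>f. \<lambda>i\<in>I. f i - c i)) (Pi\<^sub>E I A) = (\<Prod>i\<in>I. emeasure lborel (A i))" .
  qed simp
qed

lemma emeasure_PiM_cball:
  fixes c :: "'i \<Rightarrow> real"
  assumes I: "finite I" and r: "r > 0"
  shows "emeasure (lborel_Pi I) {f \<in> space (lborel_Pi I). (\<Sum>i\<in>I. (f i - c i)\<^sup>2) \<le> r\<^sup>2}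
    = ennreal (unit_ball_vol (real (card I)) * r ^ card I)"
proof -
  let ?P = "lborel_Pi I"
  let ?B = "{f. sqrt (\<Sum>i\<in>I. (f i)\<^sup>2) \<le> r} \<inter> space ?P"
  have B: "?B \<in> sets ?P" using I by measurable
  have "{f \<in> space ?P. (\<Sum>i\<in>I. (f i - c i)\<^sup>2) \<le> r\<^sup>2} = (\<lambda>f. \<lambda>i\<in>I. f i - c i) -` ?B \<inter> space ?P"
    using r by (auto simp: space_PiM real_sqrt_le_iff' sum_nonneg real_le_lsqrt intro: real_le_lsqrt sqrt_le_D)
  then have "emeasure ?P {f \<in> space ?P. (\<Sum>i\<in>I. (f i - c i)\<^sup>2) \<le> r\<^sup>2}
      = emeasure (distr ?P ?P (\<lambda>f. \<lambda>i\<in>I. f i - c i)) ?B"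
    using B by (subst emeasure_distr) auto
  also have "\<dots> = emeasure ?P ?B" by (subst PiM_lborel_translate[OF I]) simp
  finally show ?thesis by (simp only: emeasure_cball_aux[OF assms])
qed

text \<open>
  If all these distances were below \<open>a + b\<close>, then \<open>Sup X - Inf Y\<close> and \<open>Sup Y - Inf X\<close> would be
  at most \<open>a + b\<close>, and the lengths of \<open>X\<close> and \<open>Y\<close> would add up to at most \<open>2 a + 2 b\<close>.
\<close>

lemma spread_of_real_sets:
  fixes X Y :: "real set"
  assumes X: "X \<in> sets lborel" and Y: "Y \<in> sets lborel"
    and a: "ennreal (2 * a) < emeasure lborel X" and b: "ennreal (2 * b) < emeasure lborel Y"
    and "0 \<le> a" "0 \<le> b"
  shows "\<exists>s\<in>X. \<exists>t\<in>Y. a + b \<le> \<bar>s - t\<bar>"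
proof (rule ccontr)
  assume "\<not> ?thesis"
  then have lt: "\<bar>s - t\<bar> < a + b" if "s \<in> X" "t \<in> Y" for s t using that by force
  have ne: "X \<noteq> {}" "Y \<noteq> {}" using a b by auto
  then obtain x0 y0 where x0: "x0 \<in> X" and y0: "y0 \<in> Y" by auto
  have bX: "bdd_above X" "bdd_below X"
    using lt[OF _ y0] by (auto intro!: bdd_aboveI[of _ "y0 + (a+b)"] bdd_belowI[of _ "y0 - (a+b)"] simp: abs_less_iff) (smt (verit))+
  have bY: "bdd_above Y" "bdd_below Y"
    using lt[OF x0] by (auto intro!: bdd_aboveI[of _ "x0 + (a+b)"] bdd_belowI[of _ "x0 - (a+b)"] simp: abs_less_iff) (smt (verit))+
  have 1: "Sup X - (a + b) \<le> Inf Y"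
  proof (rule cInf_greatest[OF ne(2)])
    fix t assume t: "t \<in> Y"
    have "Sup X \<le> t + (a + b)" by (rule cSup_least[OF ne(1)]) (use lt[OF _ t] in \<open>force simp: abs_less_iff\<close>)
    then show "Sup X - (a + b) \<le> t" by simp
  qed
  have 2: "Sup Y - (a + b) \<le> Inf X"
  proof (rule cInf_greatest[OF ne(1)])
    fix s assume s: "s \<in> X"
    have "Sup Y \<le> s + (a + b)" by (rule cSup_least[OF ne(2)]) (use lt[OF s] in \<open>force simp: abs_less_iff\<close>)
    then show "Sup Y - (a + b) \<le> s" by simp
  qed
  have le: "Inf X \<le> Sup X" "Inf Y \<le> Sup Y"
    using x0 y0 bX bY by (meson cInf_lower cSup_upper order_trans)+
  have mX: "emeasure lborel X \<le> ennreal (Sup X - Inf X)"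
  proof -
    have "X \<subseteq> {Inf X..Sup X}" using bX by (auto intro: cInf_lower cSup_upper)
    then have "emeasure lborel X \<le> emeasure lborel {Inf X..Sup X}" by (rule emeasure_mono) simp
    then show ?thesis using le by simp
  qed
  have mY: "emeasure lborel Y \<le> ennreal (Sup Y - Inf Y)"
  proof -
    have "Y \<subseteq> {Inf Y..Sup Y}" using bY by (auto intro: cInf_lower cSup_upper)
    then have "emeasure lborel Y \<le> emeasure lborel {Inf Y..Sup Y}" by (rule emeasure_mono) simp
    then show ?thesis using le by simp
  qed
  have "2 * a < Sup X - Inf X" using less_le_trans[OF a mX] assms by (simp add: ennreal_less_iff)
  moreover have "2 * b < Sup Y - Inf Y" using less_le_trans[OF b mY] assms by (simp add: ennreal_less_iff)
  ultimately show False using 1 2 by linarith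
qed

text \<open>
  Steiner symmetrization: each line parallel to the \<open>i\<close>-th axis meets the new set in the open
  interval centred at 0 that is as long as its intersection with \<open>S\<close>.
\<close>

definition steiner :: "'i \<Rightarrow> 'i set \<Rightarrow> ('i \<Rightarrow> real) set \<Rightarrow> ('i \<Rightarrow> real) set" where
  "steiner i I S = {x \<in> space (lborel_Pi I). ennreal (2 * \<bar>x i\<bar>) < emeasure lborel {t. x(i := t) \<in> S}}"

lemma measurable_coordinate_slice:
  assumes S: "S \<in> sets (lborel_Pi I)" and i: "i \<in> I" and x: "x \<in> space (lborel_Pi I)"
  shows "{t. x(i := t) \<in> S} \<in> sets lborel"
proof -
  have "(\<lambda>t. x(i := t)) \<in> measurable lborel (lborel_Pi I)"
    using i x by (intro measurable_PiM_single') (auto simp: space_PiM PiE_def extensional_def)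
  from measurable_sets[OF this S] show ?thesis by (simp add: vimage_def)
qed

lemma measurable_slice_length:
  assumes S: "S \<in> sets (lborel_Pi I)" and i: "i \<in> I"
  shows "(\<lambda>x. emeasure lborel {t. x(i := t) \<in> S}) \<in> borel_measurable (lborel_Pi I)"
proof -
  have upd: "(\<lambda>(x, t). x(i := t)) \<in> measurable (lborel_Pi I \<Otimes>\<^sub>M lborel) (lborel_Pi I)"
    using i by (intro measurable_PiM_single')
      (auto simp: space_PiM space_pair_measure PiE_def extensional_def split_beta' fun_upd_def)
  have [measurable]: "(\<lambda>(x, t). indicator S (x(i := t)) :: ennreal) \<in> borel_measurable (lborel_Pi I \<Otimes>\<^sub>M lborel)"
    using measurable_compose[OF upd borel_measurable_indicator[OF S]] by (simp add: split_beta')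
  have "(\<lambda>x. \<integral>\<^sup>+t. indicator S (x(i := t)) \<partial>lborel) \<in> borel_measurable (lborel_Pi I)"
    by measurable
  moreover have "(\<integral>\<^sup>+t. indicator S (x(i := t)) \<partial>lborel) = emeasure lborel {t. x(i := t) \<in> S}"
    if "x \<in> space (lborel_Pi I)" for x
  proof -
    have "(\<integral>\<^sup>+t. indicator S (x(i := t)) \<partial>lborel) = (\<integral>\<^sup>+t. indicator {t. x(i := t) \<in> S} t \<partial>lborel)"
      by (simp add: indicator_def)
    then show ?thesis using measurable_coordinate_slice[OF S i that] by simp
  qed
  ultimately show ?thesis by (simp cong: measurable_cong)
qed

lemma sets_steiner:
  assumes S: "S \<in> sets (lborel_Pi I)" and i: "i \<in> I"
  shows "steiner i I S \<in> sets (lborel_Pi I)"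
proof -
  define g where "g x = emeasure lborel {t. x(i := t) \<in> S}" for x
  have [measurable]: "g \<in> borel_measurable (lborel_Pi I)"
    unfolding g_def by (rule measurable_slice_length[OF S i])
  have [measurable]: "(\<lambda>x. x i) \<in> borel_measurable (lborel_Pi I)"
    using measurable_component_singleton[OF i, of "\<lambda>_. lborel :: real measure"] by simp
  show ?thesis unfolding steiner_def g_def[symmetric] by measurable
qed

text \<open>
  Symmetrization keeps the lengths of the lines in direction \<open>i\<close>, so this is Fubini. The bound
  on distances confines these intersections to intervals, hence their lengths are finite.
\<close>

lemma emeasure_steiner:
  assumes I: "finite I" and i: "i \<in> I" and S: "S \<in> sets (lborel_Pi I)"
    and bd: "\<And>x y. x \<in> S \<Longrightarrow> y \<in> S \<Longrightarrow> (\<Sum>k\<in>I. (x k - y k)\<^sup>2) \<le> D\<^sup>2" and D: "0 \<le> D"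
  shows "emeasure (lborel_Pi I) (steiner i I S) = emeasure (lborel_Pi I) S"
proof -
  interpret product_sigma_finite "\<lambda>_::'a. lborel :: real measure" by standard
  define J where "J = I - {i}"
  have J: "I = insert i J" "finite J" "i \<notin> J" using I i by (auto simp: J_def)
  let ?l = "\<lambda>x. emeasure lborel {t. x(i := t) \<in> S}"
  have fub: "emeasure (lborel_Pi I) A = (\<integral>\<^sup>+x. emeasure lborel {t. x(i := t) \<in> A} \<partial>(lborel_Pi J))"
    if A: "A \<in> sets (lborel_Pi I)" for A
  proof -
    have "emeasure (lborel_Pi I) A = integral\<^sup>N (lborel_Pi (insert i J)) (indicator A)"
      using A J by simp
    also have "\<dots> = (\<integral>\<^sup>+x. \<integral>\<^sup>+t. indicator A (x(i := t)) \<partial>lborel \<partial>(lborel_Pi J))"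
      using A J by (intro product_nn_integral_insert) auto
    also have "\<dots> = (\<integral>\<^sup>+x. emeasure lborel {t. x(i := t) \<in> A} \<partial>(lborel_Pi J))"
    proof (rule nn_integral_cong)
      fix x assume x: "x \<in> space (lborel_Pi J)"
      have x': "x(i := 0) \<in> space (lborel_Pi I)"
        using x J by (auto simp: space_PiM PiE_def extensional_def)
      have "{t. x(i := t) \<in> A} \<in> sets lborel"
        using measurable_coordinate_slice[OF A i x'] by simp
      then have "emeasure lborel {t. x(i := t) \<in> A} = (\<integral>\<^sup>+t. indicator {t. x(i := t) \<in> A} t \<partial>lborel)"
        by simp
      then show "(\<integral>\<^sup>+t. indicator A (x(i := t)) \<partial>lborel) = emeasure lborel {t. x(i := t) \<in> A}"
        by (simp add: indicator_def)
    qed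
    finally show ?thesis .
  qed
  have "emeasure lborel {t. x(i := t) \<in> steiner i I S} = ?l x" if x: "x \<in> space (lborel_Pi J)" for x
  proof -
    have x': "x(i := t) \<in> space (lborel_Pi I)" for t
      using x J by (auto simp: space_PiM PiE_def extensional_def)
    have fin: "?l x < \<infinity>"
    proof (cases "{t. x(i := t) \<in> S} = {}")
      case False
      then obtain t0 where t0: "x(i := t0) \<in> S" by auto
      have "{t. x(i := t) \<in> S} \<subseteq> {t0 - D..t0 + D}"
      proof
        fix t assume t: "t \<in> {t. x(i := t) \<in> S}"
        have "(\<Sum>k\<in>I. ((x(i := t)) k - (x(i := t0)) k)\<^sup>2) = (t - t0)\<^sup>2"
          using J by (simp add: sum.insert) (rule sum.neutral, auto)
        then have "(t - t0)\<^sup>2 \<le> D\<^sup>2" using bd[of "x(i := t)" "x(i := t0)"] t t0 by simp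
        then have "\<bar>t - t0\<bar> \<le> D" using D by (simp add: abs_le_square_iff[symmetric])
        then show "t \<in> {t0 - D..t0 + D}" by (auto simp: abs_le_iff)
      qed
      then have "?l x \<le> emeasure lborel {t0 - D..t0 + D}" by (rule emeasure_mono) simp
      also have "\<dots> < \<infinity>" by (simp add: emeasure_lborel_Icc_eq)
      finally show ?thesis .
    qed simp
    then obtain l where l: "?l x = ennreal l" "0 \<le> l" by (cases "?l x") auto
    have "{t. x(i := t) \<in> steiner i I S} = {- (l/2) <..< l/2}"
      using l x' by (auto simp: steiner_def ennreal_less_iff abs_less_iff)
    then show ?thesis using l by simp
  qed
  then show ?thesis
    by (simp add: fub S sets_steiner[OF S i] cong: nn_integral_cong)
qed

text \<open>
  By the lemma on the spread of real sets, the lines through \<open>x\<close> and \<open>y\<close> contain points of \<open>S\<close>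
  whose \<open>i\<close>-th coordinates differ by at least \<open>|x i| + |y i|\<close>, while the other coordinates are
  unchanged.
\<close>

lemma steiner_diameter:
  assumes I: "finite I" and i: "i \<in> I" and S: "S \<in> sets (lborel_Pi I)"
    and bd: "\<And>x y. x \<in> S \<Longrightarrow> y \<in> S \<Longrightarrow> (\<Sum>k\<in>I. (x k - y k)\<^sup>2) \<le> D\<^sup>2"
    and x: "x \<in> steiner i I S" and y: "y \<in> steiner i I S"
  shows "(\<Sum>k\<in>I. (x k - y k)\<^sup>2) \<le> D\<^sup>2"
proof -
  have sp: "x \<in> space (lborel_Pi I)" "y \<in> space (lborel_Pi I)"
    using x y by (auto simp: steiner_def)
  have lx: "ennreal (2 * \<bar>x i\<bar>) < emeasure lborel {t. x(i := t) \<in> S}"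
    using x by (simp add: steiner_def)
  have ly: "ennreal (2 * \<bar>y i\<bar>) < emeasure lborel {t. y(i := t) \<in> S}"
    using y by (simp add: steiner_def)
  from spread_of_real_sets[OF measurable_coordinate_slice[OF S i sp(1)] measurable_coordinate_slice[OF S i sp(2)]
      lx ly abs_ge_zero abs_ge_zero]
  obtain s t where st: "x(i := s) \<in> S" "y(i := t) \<in> S" "\<bar>x i\<bar> + \<bar>y i\<bar> \<le> \<bar>s - t\<bar>" by blast
  have "(\<Sum>k\<in>I. (x k - y k)\<^sup>2) = (x i - y i)\<^sup>2 + (\<Sum>k\<in>I - {i}. (x k - y k)\<^sup>2)"
    using I i by (simp add: sum.remove)
  also have "(x i - y i)\<^sup>2 \<le> (s - t)\<^sup>2"
    using st(3) by (intro abs_le_square_iff[THEN iffD1]) linarith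
  also have "(s - t)\<^sup>2 + (\<Sum>k\<in>I - {i}. (x k - y k)\<^sup>2) = (\<Sum>k\<in>I. ((x(i := s)) k - (y(i := t)) k)\<^sup>2)"
    using I i by (simp add: sum.remove)
  also have "\<dots> \<le> D\<^sup>2" by (rule bd[OF st(1,2)])
  finally show ?thesis by simp
qed

text \<open>
  Symmetries that were obtained in other coordinates survive, so that the symmetrizations can be
  performed one after the other.
\<close>

lemma steiner_reflection:
  assumes sym: "\<And>x. x \<in> S \<Longrightarrow> x(k := - x k) \<in> S" and x: "x \<in> steiner i I S"
    and k: "k \<in> I"
  shows "x(k := - x k) \<in> steiner i I S"
proof -
  have sp: "x(k := - x k) \<in> space (lborel_Pi I)"
    using x k by (auto simp: steiner_def space_PiM PiE_def extensional_def)
  show ?thesis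
  proof (cases "k = i")
    case True then show ?thesis using x sp by (auto simp: steiner_def)
  next
    case False
    have "(x(k := - x k))(i := t) \<in> S \<longleftrightarrow> x(i := t) \<in> S" for t
    proof -
      have "(x(k := - x k))(i := t) = (x(i := t))(k := - (x(i := t)) k)"
        "x(i := t) = ((x(k := - x k))(i := t))(k := - ((x(k := - x k))(i := t)) k)"
        using False by (auto simp: fun_eq_iff)
      then show ?thesis using sym[of "x(i := t)"] sym[of "(x(k := - x k))(i := t)"] by metis
    qed
    then show ?thesis using x sp False by (auto simp: steiner_def)
  qed
qed

lemma steiner_reflection_self:
  assumes x: "x \<in> steiner i I S" and k: "i \<in> I"
  shows "x(i := - x i) \<in> steiner i I S"
proof -
  have "x(i := - x i) \<in> space (lborel_Pi I)"
    using x k by (auto simp: steiner_def space_PiM PiE_def extensional_def)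
  then show ?thesis using x by (simp add: steiner_def)
qed

lemma symmetrization_exists:
  assumes I: "finite I" and D: "0 \<le> D" and S: "S \<in> sets (lborel_Pi I)"
    and bd: "\<And>x y. x \<in> S \<Longrightarrow> y \<in> S \<Longrightarrow> (\<Sum>k\<in>I. (x k - y k)\<^sup>2) \<le> D\<^sup>2"
    and K: "finite K" "K \<subseteq> I"
  shows "\<exists>S' \<in> sets (lborel_Pi I). emeasure (lborel_Pi I) S' = emeasure (lborel_Pi I) S \<and>
     (\<forall>x\<in>S'. \<forall>y\<in>S'. (\<Sum>k\<in>I. (x k - y k)\<^sup>2) \<le> D\<^sup>2) \<and> (\<forall>k\<in>K. \<forall>x\<in>S'. x(k := - x k) \<in> S')"
  using K
proof (induction K rule: finite_induct)
  case empty then show ?case using S bd by blast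
next
  case (insert i K)
  have i: "i \<in> I" and KI: "K \<subseteq> I" using insert.prems by auto
  from insert.IH[OF KI] obtain S' where S'1: "S' \<in> sets (lborel_Pi I)"
    and S'2: "emeasure (lborel_Pi I) S' = emeasure (lborel_Pi I) S"
    and S'3: "\<forall>x\<in>S'. \<forall>y\<in>S'. (\<Sum>k\<in>I. (x k - y k)\<^sup>2) \<le> D\<^sup>2"
    and S'4: "\<forall>k\<in>K. \<forall>x\<in>S'. x(k := - x k) \<in> S'" by (elim bexE conjE)
  note S' = S'1 S'2 S'3[rule_format] S'4[rule_format]
  show ?case
  proof (intro bexI[of _ "steiner i I S'"] conjI ballI)
    have "emeasure (lborel_Pi I) (steiner i I S') = emeasure (lborel_Pi I) S'"
      by (rule emeasure_steiner[OF I i S'(1) _ D]) (rule S'(3))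
    then show "emeasure (lborel_Pi I) (steiner i I S') = emeasure (lborel_Pi I) S"
      using S'(2) by simp
    show "(\<Sum>k\<in>I. (x k - y k)\<^sup>2) \<le> D\<^sup>2" if "x \<in> steiner i I S'" "y \<in> steiner i I S'" for x y
      by (rule steiner_diameter[OF I i S'(1) _ that]) (rule S'(3))
    show "x(k := - x k) \<in> steiner i I S'" if "k \<in> insert i K" "x \<in> steiner i I S'" for k x
    proof (cases "k = i")
      case True then show ?thesis using steiner_reflection_self[OF that(2) i] by simp
    next
      case False
      then have k: "k \<in> K" "k \<in> I" using that KI by auto
      show ?thesis by (rule steiner_reflection[OF _ that(2) k(2)]) (rule S'(4)[OF k(1)])
    qed
    show "steiner i I S' \<in> sets (lborel_Pi I)" by (rule sets_steiner[OF S'(1) i])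
  qed
qed

text \<open>
  After symmetrization in all coordinates the set contains \<open>-x\<close> along with \<open>x\<close>, so that
  \<open>2 |x| \<le> D\<close>: it lies in a ball of radius \<open>D / 2\<close>.
\<close>

lemma isodiametric_PiM:
  assumes I: "finite I" and D: "0 \<le> D" and S: "S \<in> sets (lborel_Pi I)"
    and bd: "\<And>x y. x \<in> S \<Longrightarrow> y \<in> S \<Longrightarrow> (\<Sum>k\<in>I. (x k - y k)\<^sup>2) \<le> D\<^sup>2"
  shows "emeasure (lborel_Pi I) S \<le> ennreal (unit_ball_vol (real (card I)) * (D/2) ^ card I)"
proof -
  let ?P = "lborel_Pi I"
  have "\<exists>S' \<in> sets ?P. emeasure ?P S' = emeasure ?P S \<and>
     (\<forall>x\<in>S'. \<forall>y\<in>S'. (\<Sum>k\<in>I. (x k - y k)\<^sup>2) \<le> D\<^sup>2) \<and> (\<forall>k\<in>I. \<forall>x\<in>S'. x(k := - x k) \<in> S')"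
    by (rule symmetrization_exists[OF I D S _ I order_refl]) (rule bd)
  then obtain S' where S'1: "S' \<in> sets ?P" and S'2: "emeasure ?P S' = emeasure ?P S"
    and S'3: "\<forall>x\<in>S'. \<forall>y\<in>S'. (\<Sum>k\<in>I. (x k - y k)\<^sup>2) \<le> D\<^sup>2"
    and S'4: "\<forall>k\<in>I. \<forall>x\<in>S'. x(k := - x k) \<in> S'" by (elim bexE conjE)
  note S' = S'1 S'2 S'3[rule_format] S'4[rule_format]
  have flip: "(\<lambda>i. if i \<in> K then - x i else x i) \<in> S'" if "finite K" "K \<subseteq> I" "x \<in> S'" for K x
    using that
  proof (induction K rule: finite_induct)
    case (insert k K)
    then have "(\<lambda>i. if i \<in> K then - x i else x i)(k := - (if k \<in> K then - x k else x k)) \<in> S'"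
      by (intro S'(4)) auto
    also have "(\<lambda>i. if i \<in> K then - x i else x i)(k := - (if k \<in> K then - x k else x k)) = (\<lambda>i. if i \<in> insert k K then - x i else x i)"
      using insert by auto
    finally show ?case .
  qed simp
  have sub: "S' \<subseteq> {f \<in> space ?P. (\<Sum>i\<in>I. (f i - 0)\<^sup>2) \<le> (D/2)\<^sup>2}"
  proof
    fix x assume x: "x \<in> S'"
    have "(\<Sum>k\<in>I. (x k - (if k \<in> I then - x k else x k))\<^sup>2) \<le> D\<^sup>2"
      by (rule S'(3)[OF x flip[OF I order_refl x]])
    also have "(\<Sum>k\<in>I. (x k - (if k \<in> I then - x k else x k))\<^sup>2) = 4 * (\<Sum>k\<in>I. (x k)\<^sup>2)"
      unfolding sum_distrib_left by (intro sum.cong) (auto simp: power2_eq_square)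
    finally show "x \<in> {f \<in> space ?P. (\<Sum>i\<in>I. (f i - 0)\<^sup>2) \<le> (D/2)\<^sup>2}"
      using sets.sets_into_space[OF S'(1)] x by (auto simp: power2_eq_square)
  qed
  \<comment> \<open>The formula for balls needs a positive radius, and \<open>D\<close> may be 0.\<close>
  have bound: "emeasure ?P S \<le> ennreal (unit_ball_vol (real (card I)) * r ^ card I)" if r: "D/2 < r" for r
  proof -
    have "S' \<subseteq> {f \<in> space ?P. (\<Sum>i\<in>I. (f i - 0)\<^sup>2) \<le> r\<^sup>2}"
    proof -
      have "(D/2)\<^sup>2 \<le> r\<^sup>2" using r D by (intro power_mono) auto
      then show ?thesis using sub by fastforce
    qed
    then have "emeasure ?P S' \<le> emeasure ?P {f \<in> space ?P. (\<Sum>i\<in>I. (f i - 0)\<^sup>2) \<le> r\<^sup>2}"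
      using I by (intro emeasure_mono) measurable
    also have "\<dots> = ennreal (unit_ball_vol (real (card I)) * r ^ card I)"
      by (rule emeasure_PiM_cball[OF I]) (use r D in auto)
    finally show ?thesis using S' by simp
  qed
  have "((\<lambda>r. ennreal (unit_ball_vol (real (card I)) * r ^ card I)) \<longlongrightarrow> ennreal (unit_ball_vol (real (card I)) * (D/2) ^ card I)) (at_right (D/2))"
    by (intro tendsto_intros)
  then show ?thesis
    by (rule tendsto_lowerbound) (auto simp: eventually_at_right_less eventually_at_filter bound intro!: always_eventually)
qed

section \<open>Volumes of cones\<close>

text \<open>
  The hyperplane sections are written in coordinates because the isodiametric inequality is
  available for product measures.
\<close>

lemma emeasure_lborel_slices:
  fixes e :: "'a::euclidean_space"
  assumes e: "e \<in> Basis" and K: "K \<in> sets (borel :: 'a measure)"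
  defines "P \<equiv> lborel_Pi (Basis - {e})"
  shows "emeasure lborel K = (\<integral>\<^sup>+q. emeasure P {f \<in> space P. (\<Sum>b\<in>Basis - {e}. f b *\<^sub>R b) + q *\<^sub>R e \<in> K} \<partial>lborel)"
    and "\<And>q. {f \<in> space P. (\<Sum>b\<in>Basis - {e}. f b *\<^sub>R b) + q *\<^sub>R e \<in> K} \<in> sets P"
proof -
  interpret product_sigma_finite "\<lambda>_::'a. lborel :: real measure" by standard
  let ?J = "Basis - {e}"
  have B: "Basis = insert e ?J" using e by auto
  have [measurable]: "(\<lambda>f. \<Sum>b\<in>Basis. f b *\<^sub>R b) \<in> measurable (lborel_Pi (Basis :: 'a set)) borel"
    by measurable
  show m: "{f \<in> space P. (\<Sum>b\<in>Basis - {e}. f b *\<^sub>R b) + q *\<^sub>R e \<in> K} \<in> sets P" for q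
  proof -
    have "(\<lambda>f. (\<Sum>b\<in>Basis - {e}. f b *\<^sub>R b) + q *\<^sub>R e) \<in> measurable P borel"
      unfolding P_def by measurable
    from measurable_sets[OF this K] show ?thesis by (simp add: vimage_def Int_def conj_commute)
  qed
  have "emeasure lborel K = (\<integral>\<^sup>+x. indicator K x \<partial>lborel)" using K by simp
  also have "\<dots> = (\<integral>\<^sup>+f. indicator K (\<Sum>b\<in>Basis. f b *\<^sub>R b) \<partial>(lborel_Pi (Basis :: 'a set)))"
    using K by (subst lborel_eq) (simp add: nn_integral_distr del: nn_integral_indicator)
  also have "\<dots> = (\<integral>\<^sup>+f. indicator K (\<Sum>b\<in>Basis. f b *\<^sub>R b) \<partial>(lborel_Pi (insert e ?J)))"
    using B by simp
  also have "\<dots> = (\<integral>\<^sup>+q. \<integral>\<^sup>+f. indicator K (\<Sum>b\<in>Basis. (f(e := q)) b *\<^sub>R b) \<partial>P \<partial>lborel)"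
    unfolding P_def using K B by (intro product_nn_integral_insert_rev) auto
  also have "\<dots> = (\<integral>\<^sup>+q. emeasure P {f \<in> space P. (\<Sum>b\<in>Basis - {e}. f b *\<^sub>R b) + q *\<^sub>R e \<in> K} \<partial>lborel)"
  proof (rule nn_integral_cong)
    fix q
    have "(\<Sum>b\<in>Basis. (f(e := q)) b *\<^sub>R b) = (\<Sum>b\<in>?J. f b *\<^sub>R b) + q *\<^sub>R e" for f :: "'a \<Rightarrow> real"
      using e by (subst sum.remove[OF finite_Basis e]) (auto simp: add.commute intro!: sum.cong)
    then have "(\<integral>\<^sup>+f. indicator K (\<Sum>b\<in>Basis. (f(e := q)) b *\<^sub>R b) \<partial>P)
      = (\<integral>\<^sup>+f. indicator {f \<in> space P. (\<Sum>b\<in>Basis - {e}. f b *\<^sub>R b) + q *\<^sub>R e \<in> K} f \<partial>P)"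
      by (intro nn_integral_cong) (auto simp: indicator_def)
    then show "(\<integral>\<^sup>+f. indicator K (\<Sum>b\<in>Basis. (f(e := q)) b *\<^sub>R b) \<partial>P)
      = emeasure P {f \<in> space P. (\<Sum>b\<in>Basis - {e}. f b *\<^sub>R b) + q *\<^sub>R e \<in> K}"
      using m[of q] by simp
  qed
  finally show "emeasure lborel K = (\<integral>\<^sup>+q. emeasure P {f \<in> space P. (\<Sum>b\<in>Basis - {e}. f b *\<^sub>R b) + q *\<^sub>R e \<in> K} \<partial>lborel)" .
qed

lemma nn_integral_power_interval:
  assumes "0 \<le> h" "0 \<le> k"
  shows "(\<integral>\<^sup>+q. ennreal (k * q ^ d) * indicator {0<..<h} q \<partial>lborel) = ennreal (k * h ^ Suc d / real (Suc d))"
proof -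
  have "(\<integral>\<^sup>+q. ennreal (k * q ^ d) * indicator {0<..<h} q \<partial>lborel) = (\<integral>\<^sup>+q. ennreal (k * q ^ d) * indicator {0..h} q \<partial>lborel)"
    by (intro nn_integral_cong_AE AE_I[of _ _ "{0, h}"]) (auto simp: indicator_def emeasure_lborel_countable)
  also have "\<dots> = ennreal (k * h ^ Suc d / real (Suc d) - k * 0 ^ Suc d / real (Suc d))"
    using assms by (intro nn_integral_FTC_Icc) (auto intro!: derivative_eq_intros simp del: power_Suc of_nat_Suc)
  finally show ?thesis by simp
qed

lemma norm_sum_Basis_minus:
  fixes e :: "'a::euclidean_space"
  assumes e: "e \<in> Basis"
  shows "(norm (\<Sum>b\<in>Basis - {e}. f b *\<^sub>R b))\<^sup>2 = (\<Sum>b\<in>Basis - {e}. (f b)\<^sup>2)"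
proof -
  have "(\<Sum>b\<in>Basis - {e}. f b *\<^sub>R b) \<bullet> c = (if c = e then 0 else f c)" if "c \<in> Basis" for c
    using that by (auto simp: inner_sum_left inner_Basis if_distrib sum.delta' cong: if_cong)
  then have "(norm (\<Sum>b\<in>Basis - {e}. f b *\<^sub>R b))\<^sup>2 = (\<Sum>c\<in>Basis. (if c = e then 0 else f c)\<^sup>2)"
    by (subst norm_eq_sqrt_inner, subst euclidean_inner) (simp add: sum_nonneg power2_eq_square)
  also have "\<dots> = (\<Sum>b\<in>Basis - {e}. (f b)\<^sup>2)"
    using e by (simp add: sum.remove[of _ e])
  finally show ?thesis .
qed

lemma inner_sum_Basis_minus:
  fixes e :: "'a::euclidean_space"
  assumes e: "e \<in> Basis"
  shows "e \<bullet> ((\<Sum>b\<in>Basis - {e}. f b *\<^sub>R b) + q *\<^sub>R e) = q"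
  using e by (auto simp: inner_add_right inner_sum_right inner_Basis if_distrib sum.delta' cong: if_cong)

text \<open>
  The section at height \<open>q\<close> has diameter at most \<open>c q\<close>, so its volume is at most that of a ball
  of radius \<open>c q / 2\<close>. It remains to integrate \<open>q\<^sup>d\<close> from 0 to \<open>h\<close>.
\<close>

lemma cone_volume_le_Basis:
  fixes e :: "'a::euclidean_space"
  assumes e: "e \<in> Basis" and K: "K \<in> sets borel" and c: "0 \<le> c" and h: "0 \<le> h"
    and range: "\<And>y. y \<in> K \<Longrightarrow> 0 < e \<bullet> y \<and> e \<bullet> y < h"
    and slice: "\<And>y y'. y \<in> K \<Longrightarrow> y' \<in> K \<Longrightarrow> e \<bullet> y = e \<bullet> y' \<Longrightarrow> norm (y - y') \<le> c * (e \<bullet> y)"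
    and d: "Suc d = DIM('a)"
  shows "emeasure lborel K \<le> ennreal (unit_ball_vol (real d) * (c/2) ^ d * h ^ Suc d / real (Suc d))"
proof -
  define P where "P = lborel_Pi (Basis - {e})"
  have cd: "card (Basis - {e}) = d" using d e by simp
  let ?y = "\<lambda>f q. (\<Sum>b\<in>Basis - {e}. f b *\<^sub>R b) + q *\<^sub>R e"
  note slices = emeasure_lborel_slices[OF e K, folded P_def]
  have "emeasure P {f \<in> space P. ?y f q \<in> K} \<le> ennreal (unit_ball_vol (real d) * (c/2) ^ d * q ^ d) * indicator {0<..<h} q" for q
  proof (cases "0 < q \<and> q < h")
    case False
    then have emp: "{f \<in> space P. ?y f q \<in> K} = {}" using range inner_sum_Basis_minus[OF e] by fastforce
    show ?thesis by (subst emp) simp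
  next
    case True
    have "emeasure P {f \<in> space P. ?y f q \<in> K} \<le> ennreal (unit_ball_vol (real (card (Basis - {e}))) * (c * q / 2) ^ card (Basis - {e}))"
      unfolding P_def
    proof (rule isodiametric_PiM)
      show "{f \<in> space (lborel_Pi (Basis - {e})). ?y f q \<in> K} \<in> sets (lborel_Pi (Basis - {e}))"
        using slices(2) by (simp add: P_def)
      fix f g assume "f \<in> {f \<in> space (lborel_Pi (Basis - {e})). ?y f q \<in> K}"
        "g \<in> {f \<in> space (lborel_Pi (Basis - {e})). ?y f q \<in> K}"
      then have fg: "?y f q \<in> K" "?y g q \<in> K" by auto
      have "norm (?y f q - ?y g q) \<le> c * q"
        using slice[OF fg] inner_sum_Basis_minus[OF e] by simp
      moreover have "?y f q - ?y g q = (\<Sum>b\<in>Basis - {e}. (f b - g b) *\<^sub>R b)"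
        by (simp add: scaleR_diff_left sum_subtractf)
      ultimately have "(norm (\<Sum>b\<in>Basis - {e}. (f b - g b) *\<^sub>R b))\<^sup>2 \<le> (c * q)\<^sup>2"
        by (intro power_mono) auto
      then show "(\<Sum>k\<in>Basis - {e}. (f k - g k)\<^sup>2) \<le> (c * q)\<^sup>2"
        by (simp add: norm_sum_Basis_minus[OF e])
    qed (use c True in auto)
    also have "\<dots> = ennreal (unit_ball_vol (real d) * (c/2) ^ d * q ^ d) * indicator {0<..<h} q"
      using True unfolding cd by (simp add: power_mult_distrib power_divide mult.assoc)
    finally show ?thesis .
  qed
  then have "emeasure lborel K \<le> (\<integral>\<^sup>+q. ennreal (unit_ball_vol (real d) * (c/2) ^ d * q ^ d) * indicator {0<..<h} q \<partial>lborel)"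
    unfolding slices(1) by (intro nn_integral_mono) auto
  also have "\<dots> = ennreal (unit_ball_vol (real d) * (c/2) ^ d * h ^ Suc d / real (Suc d))"
    using c h by (intro nn_integral_power_interval) auto
  finally show ?thesis .
qed

text \<open>The section at height \<open>q\<close> contains the ball of radius \<open>c q\<close> about \<open>q p\<close>.\<close>

lemma cone_volume_ge_Basis:
  fixes e :: "'a::euclidean_space"
  assumes e: "e \<in> Basis" and K: "K \<in> sets borel" and c: "0 < c" and h: "0 \<le> h"
    and p: "e \<bullet> p = 1"
    and sub: "\<And>y. 0 < e \<bullet> y \<Longrightarrow> e \<bullet> y < h \<Longrightarrow> norm (y - (e \<bullet> y) *\<^sub>R p) \<le> c * (e \<bullet> y) \<Longrightarrow> y \<in> K"
    and d: "Suc d = DIM('a)"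
  shows "ennreal (unit_ball_vol (real d) * c ^ d * h ^ Suc d / real (Suc d)) \<le> emeasure lborel K"
proof -
  define P where "P = lborel_Pi (Basis - {e})"
  have cd: "card (Basis - {e}) = d" using d e by simp
  let ?y = "\<lambda>f q. (\<Sum>b\<in>Basis - {e}. f b *\<^sub>R b) + q *\<^sub>R e"
  note slices = emeasure_lborel_slices[OF e K, folded P_def]
  have pe: "p = (\<Sum>b\<in>Basis - {e}. (p \<bullet> b) *\<^sub>R b) + e"
    using euclidean_representation[of p] p e
    by (subst (asm) sum.remove[OF finite_Basis e]) (simp add: inner_commute add.commute)
  have "ennreal (unit_ball_vol (real d) * c ^ d * q ^ d) * indicator {0<..<h} q \<le> emeasure P {f \<in> space P. ?y f q \<in> K}" for q
  proof (cases "0 < q \<and> q < h")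
    case True
    have "ennreal (unit_ball_vol (real d) * c ^ d * q ^ d) * indicator {0<..<h} q
        = ennreal (unit_ball_vol (real (card (Basis - {e}))) * (c * q) ^ card (Basis - {e}))"
      using True unfolding cd by (simp add: power_mult_distrib mult.assoc)
    also have "\<dots> = emeasure P {f \<in> space P. (\<Sum>b\<in>Basis - {e}. (f b - q * (p \<bullet> b))\<^sup>2) \<le> (c * q)\<^sup>2}"
      unfolding P_def using c True by (intro emeasure_PiM_cball[symmetric]) auto
    also have "\<dots> \<le> emeasure P {f \<in> space P. ?y f q \<in> K}"
    proof (rule emeasure_mono[OF _ slices(2)], safe)
      fix f assume f: "(\<Sum>b\<in>Basis - {e}. (f b - q * (p \<bullet> b))\<^sup>2) \<le> (c * q)\<^sup>2"
      have "?y f q - q *\<^sub>R p = (\<Sum>b\<in>Basis - {e}. (f b - q * (p \<bullet> b)) *\<^sub>R b)"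
        by (subst pe) (simp add: scaleR_diff_left sum_subtractf scaleR_add_right scaleR_sum_right)
      then have "(norm (?y f q - q *\<^sub>R p))\<^sup>2 \<le> (c * q)\<^sup>2"
        using f by (simp add: norm_sum_Basis_minus[OF e])
      then have "norm (?y f q - q *\<^sub>R p) \<le> c * q"
        using c True by (auto intro: power2_le_imp_le)
      then show "?y f q \<in> K"
        using sub[of "?y f q"] inner_sum_Basis_minus[OF e, of f q] True by simp
    qed
    finally show ?thesis .
  qed auto
  then have "(\<integral>\<^sup>+q. ennreal (unit_ball_vol (real d) * c ^ d * q ^ d) * indicator {0<..<h} q \<partial>lborel) \<le> emeasure lborel K"
    unfolding slices(1) by (intro nn_integral_mono) auto
  also have "(\<integral>\<^sup>+q. ennreal (unit_ball_vol (real d) * c ^ d * q ^ d) * indicator {0<..<h} q \<partial>lborel) = ennreal (unit_ball_vol (real d) * c ^ d * h ^ Suc d / real (Suc d))"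
    using c h by (intro nn_integral_power_interval) auto
  finally show ?thesis .
qed

lemma emeasure_lborel_orthogonal_vimage:
  fixes T :: "'a::euclidean_space \<Rightarrow> 'a"
  assumes T: "orthogonal_transformation T" and K: "K \<in> sets borel"
  shows "T -` K \<in> sets borel" "emeasure lborel (T -` K) = emeasure lborel K"
proof -
  have [measurable]: "T \<in> borel_measurable borel"
    using T by (auto intro!: borel_measurable_continuous_onI linear_continuous_on
      simp: linear_conv_bounded_linear[symmetric] orthogonal_transformation_linear)
  show "T -` K \<in> sets borel" using measurable_sets[of T borel borel K] K by simp
  have "emeasure lborel K = emeasure (distr lborel borel T) K"
    by (simp add: distr_lborel_orthogonal_transformation[OF T])
  also have "\<dots> = emeasure lborel (T -` K)" using K by (simp add: emeasure_distr)
  finally show "emeasure lborel (T -` K) = emeasure lborel K" by simp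
qed

text \<open>A rotation takes \<open>\<nu>\<close> to a basis vector.\<close>

lemma cone_volume_le:
  fixes \<nu> :: "real^'n"
  assumes \<nu>: "norm \<nu> = 1" and K: "K \<in> sets borel" and c: "0 \<le> c" and h: "0 \<le> h"
    and range: "\<And>y. y \<in> K \<Longrightarrow> 0 < \<nu> \<bullet> y \<and> \<nu> \<bullet> y < h"
    and slice: "\<And>y y'. y \<in> K \<Longrightarrow> y' \<in> K \<Longrightarrow> \<nu> \<bullet> y = \<nu> \<bullet> y' \<Longrightarrow> norm (y - y') \<le> c * (\<nu> \<bullet> y)"
    and d: "Suc d = CARD('n)"
  shows "emeasure lborel K \<le> ennreal (unit_ball_vol (real d) * (c/2) ^ d * h ^ Suc d / real (Suc d))"
proof -
  obtain e :: "real^'n" where e: "e \<in> Basis" using SOME_Basis by blast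
  then have "norm e = 1" by simp
  then obtain T where T: "orthogonal_transformation T" "T e = \<nu>"
    by (rule orthogonal_transformation_exists_1[OF _ \<nu>])
  have in_eq: "\<nu> \<bullet> T y = e \<bullet> y" for y
    using T(1) unfolding T(2)[symmetric] by (simp add: orthogonal_transformation_def)
  have nm: "norm (T y - T y') = norm (y - y')" for y y'
    using orthogonal_transformation_norm[OF T(1), of "y - y'"]
    by (simp add: linear_diff[OF orthogonal_transformation_linear[OF T(1)]])
  note V = emeasure_lborel_orthogonal_vimage[OF T(1) K]
  have "emeasure lborel (T -` K) \<le> ennreal (unit_ball_vol (real d) * (c/2) ^ d * h ^ Suc d / real (Suc d))"
  proof (rule cone_volume_le_Basis[OF e V(1) c h])
    show "0 < e \<bullet> y \<and> e \<bullet> y < h" if "y \<in> T -` K" for y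
      using range[of "T y"] that by (simp add: in_eq)
    show "norm (y - y') \<le> c * (e \<bullet> y)" if "y \<in> T -` K" "y' \<in> T -` K" "e \<bullet> y = e \<bullet> y'" for y y'
      using slice[of "T y" "T y'"] that by (simp add: in_eq nm)
  qed (use d in simp)
  then show ?thesis by (simp add: V)
qed

lemma cone_volume_ge:
  fixes \<nu> p :: "real^'n"
  assumes \<nu>: "norm \<nu> = 1" and K: "K \<in> sets borel" and c: "0 < c" and h: "0 \<le> h"
    and p: "\<nu> \<bullet> p = 1"
    and sub: "\<And>y. 0 < \<nu> \<bullet> y \<Longrightarrow> \<nu> \<bullet> y < h \<Longrightarrow> norm (y - (\<nu> \<bullet> y) *\<^sub>R p) \<le> c * (\<nu> \<bullet> y) \<Longrightarrow> y \<in> K"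
    and d: "Suc d = CARD('n)"
  shows "ennreal (unit_ball_vol (real d) * c ^ d * h ^ Suc d / real (Suc d)) \<le> emeasure lborel K"
proof -
  obtain e :: "real^'n" where e: "e \<in> Basis" using SOME_Basis by blast
  then have "norm e = 1" by simp
  then obtain T where T: "orthogonal_transformation T" "T e = \<nu>"
    by (rule orthogonal_transformation_exists_1[OF _ \<nu>])
  have in_eq: "\<nu> \<bullet> T y = e \<bullet> y" for y
    using T(1) unfolding T(2)[symmetric] by (simp add: orthogonal_transformation_def)
  have lin: "linear T" using T(1) by (rule orthogonal_transformation_linear)
  obtain p' where "p = T p'" using surjD[OF orthogonal_transformation_surj[OF T(1)], of p] by blast
  then have p': "T p' = p" by simp
  note V = emeasure_lborel_orthogonal_vimage[OF T(1) K]
  have "ennreal (unit_ball_vol (real d) * c ^ d * h ^ Suc d / real (Suc d)) \<le> emeasure lborel (T -` K)"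
  proof (rule cone_volume_ge_Basis[OF e V(1) c h])
    show "e \<bullet> p' = 1" using p p' in_eq[of p'] by simp
    show "y \<in> T -` K" if y: "0 < e \<bullet> y" "e \<bullet> y < h" "norm (y - (e \<bullet> y) *\<^sub>R p') \<le> c * (e \<bullet> y)" for y
    proof -
      have "T (y - (e \<bullet> y) *\<^sub>R p') = T y - (e \<bullet> y) *\<^sub>R p"
        by (simp add: linear_diff[OF lin] linear_cmul[OF lin] p')
      then have "norm (T y - (e \<bullet> y) *\<^sub>R p) = norm (y - (e \<bullet> y) *\<^sub>R p')"
        using orthogonal_transformation_norm[OF T(1), of "y - (e \<bullet> y) *\<^sub>R p'"] by simp
      then show ?thesis using sub[of "T y"] y by (simp add: in_eq)
    qed
  qed (use d in simp)
  then show ?thesis by (simp add: V)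
qed

section \<open>Polar coordinates adapted to an ellipsoid\<close>

locale posdef_form =
  fixes A :: "real^'n^'n"
  assumes sym: "transpose A = A"
    and pos: "\<And>x. x \<noteq> 0 \<Longrightarrow> (A *v x) \<bullet> x > 0"
begin

text \<open>The norm whose open unit ball is the ellipsoid.\<close>

definition \<rho> :: "real^'n \<Rightarrow> real" where "\<rho> x = sqrt ((A *v x) \<bullet> x)"

abbreviation proj :: "real^'n \<Rightarrow> real^'n" where "proj y \<equiv> (1 / \<rho> y) *\<^sub>R y"

lemma form_sym: "(A *v x) \<bullet> y = (A *v y) \<bullet> x"
proof -
  have "(A *v x) \<bullet> y = x \<bullet> (A *v y)"
    using dot_lmul_matrix[of x A y] transpose_matrix_vector[of A x] sym by simp
  then show ?thesis by (simp add: inner_commute)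
qed

lemma form_nonneg: "(A *v x) \<bullet> x \<ge> 0"
  using pos[of x] by (cases "x = 0") auto

lemma rho_nonneg [simp]: "\<rho> x \<ge> 0" by (simp add: \<rho>_def form_nonneg)

lemma rho_not_neg [simp]: "\<not> \<rho> x < 0" by (simp add: not_less)

lemma rho_sq: "(\<rho> x)\<^sup>2 = (A *v x) \<bullet> x" by (simp add: \<rho>_def form_nonneg)

lemma rho_eq_0_iff [simp]: "\<rho> x = 0 \<longleftrightarrow> x = 0"
  using pos[of x] by (cases "x = 0") (auto simp: \<rho>_def)

lemma rho_pos_iff [simp]: "0 < \<rho> x \<longleftrightarrow> x \<noteq> 0"
  using rho_nonneg[of x] rho_eq_0_iff[of x] by linarith

lemma rho_scaleR: "\<rho> (c *\<^sub>R x) = \<bar>c\<bar> * \<rho> x"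
proof -
  have "(A *v (c *\<^sub>R x)) \<bullet> (c *\<^sub>R x) = c\<^sup>2 * ((A *v x) \<bullet> x)"
    by (simp add: matrix_vector_mult_scaleR power2_eq_square)
  then show ?thesis by (simp add: \<rho>_def real_sqrt_mult)
qed

lemma rho_add_sq: "(\<rho> (x + y))\<^sup>2 = (\<rho> x)\<^sup>2 + 2 * ((A *v x) \<bullet> y) + (\<rho> y)\<^sup>2"
  by (simp add: rho_sq matrix_vector_right_distrib inner_add_left inner_add_right form_sym[of y x])

lemma rho_diff_sq: "(\<rho> (x - y))\<^sup>2 = (\<rho> x)\<^sup>2 - 2 * ((A *v x) \<bullet> y) + (\<rho> y)\<^sup>2"
  by (simp add: rho_sq matrix_vector_mult_diff_distrib inner_diff_left inner_diff_right form_sym[of y x])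

lemma form_Cauchy_Schwarz: "(A *v x) \<bullet> y \<le> \<rho> x * \<rho> y"
proof (cases "x = 0 \<or> y = 0")
  case False
  then have p: "0 < \<rho> x" "0 < \<rho> y" by auto
  have "0 \<le> (\<rho> (\<rho> y *\<^sub>R x - \<rho> x *\<^sub>R y))\<^sup>2" by simp
  also have "\<dots> = 2 * (\<rho> x * \<rho> y) * (\<rho> x * \<rho> y - (A *v x) \<bullet> y)"
    unfolding rho_diff_sq by (simp add: rho_scaleR matrix_vector_mult_scaleR power2_eq_square algebra_simps)
  finally have "0 \<le> \<rho> x * \<rho> y - (A *v x) \<bullet> y"
    using mult_pos_pos[OF p] by (simp only: zero_le_mult_iff) linarith
  then show ?thesis by simp
qed auto

lemma continuous_rho [continuous_intros]: "continuous_on S f \<Longrightarrow> continuous_on S (\<lambda>x. \<rho> (f x))"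
  unfolding \<rho>_def
  by (intro continuous_intros continuous_on_compose2[OF linear_continuous_on[OF matrix_vector_mul_bounded_linear[of A], of UNIV]]) auto

lemma continuous_matrix [continuous_intros]: "continuous_on S f \<Longrightarrow> continuous_on S (\<lambda>x. A *v f x)"
  by (intro continuous_on_compose2[OF linear_continuous_on[OF matrix_vector_mul_bounded_linear[of A], of UNIV]]) auto

lemma measurable_rho [measurable]: "\<rho> \<in> borel_measurable borel"
  by (intro borel_measurable_continuous_onI continuous_intros)

lemma measurable_matrix [measurable]: "(\<lambda>x. A *v x) \<in> borel_measurable borel"
  by (intro borel_measurable_continuous_onI continuous_intros)

lemma measurable_proj [measurable]: "(\<lambda>y. proj y) \<in> borel_measurable borel"
  by measurable

lemma form_bounded: "\<exists>L>0. (\<forall>x. norm (A *v x) \<le> L * norm x)"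
  using bounded_linear.pos_bounded[OF matrix_vector_mul_bounded_linear[of A]] by (auto simp: mult.commute)

lemma rho_lower: "\<exists>l>0. \<forall>x. l * norm x \<le> \<rho> x"
proof -
  obtain e :: "real^'n" where "e \<in> Basis" using SOME_Basis by blast
  then have "e \<in> sphere 0 1" by simp
  then have ne: "sphere 0 1 \<noteq> ({} :: (real^'n) set)" by blast
  have "continuous_on (sphere 0 1) (\<lambda>x. \<rho> x)" by (intro continuous_intros)
  from continuous_attains_inf[OF compact_sphere ne this]
  obtain z where z: "z \<in> sphere 0 1" "\<And>y. y \<in> sphere 0 1 \<Longrightarrow> \<rho> z \<le> \<rho> y" by blast
  have "\<rho> z * norm x \<le> \<rho> x" for x
  proof (cases "x = 0")
    case False
    then have "(1 / norm x) *\<^sub>R x \<in> sphere 0 1" by simp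
    from z(2)[OF this] show ?thesis using False by (simp add: rho_scaleR field_simps)
  qed simp
  moreover have "0 < \<rho> z" using z by auto
  ultimately show ?thesis by blast
qed

lemma mem_ellipsoid_iff: "x \<in> ellipsoid A \<longleftrightarrow> \<rho> x < 1"
  by (simp add: ellipsoid_def \<rho>_def)

lemma open_ellipsoid: "open (ellipsoid A)"
proof -
  have "ellipsoid A = {x. \<rho> x < 1}" by (auto simp: mem_ellipsoid_iff)
  also have "open \<dots>" by (intro open_Collect_less continuous_intros)
  finally show ?thesis .
qed

lemma frontier_ellipsoid: "frontier (ellipsoid A) = {x. \<rho> x = 1}"
proof -
  have "closed {x. \<rho> x \<le> 1}" by (intro closed_Collect_le continuous_intros)
  then have "closure (ellipsoid A) \<subseteq> {x. \<rho> x \<le> 1}"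
    by (intro closure_minimal) (auto simp: mem_ellipsoid_iff)
  moreover have "x \<in> closure (ellipsoid A)" if "\<rho> x = 1" for x
  proof -
    have "(\<lambda>n. (1 - inverse (real (Suc n))) *\<^sub>R x) \<longlonglongrightarrow> (1 - 0) *\<^sub>R x"
      by (intro tendsto_intros LIMSEQ_inverse_real_of_nat)
    moreover have "(1 - inverse (real (Suc n))) *\<^sub>R x \<in> ellipsoid A" for n
    proof -
      have "0 < inverse (real (Suc n))" "inverse (real (Suc n)) \<le> 1" by (auto simp: field_simps)
      then show ?thesis using that by (simp add: mem_ellipsoid_iff rho_scaleR)
    qed
    ultimately show ?thesis unfolding closure_sequential
      by (intro exI[of _ "\<lambda>n. (1 - inverse (real (Suc n))) *\<^sub>R x"]) simp
  qed
  ultimately show ?thesis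
    by (auto simp: frontier_def interior_open[OF open_ellipsoid] mem_ellipsoid_iff)
qed

text \<open>
  A part of the boundary of the ellipsoid gets \<open>n\<close> times the volume of the cone over it with
  apex 0. The factor \<open>n\<close> normalises the measure for polar coordinates with radial density
  \<open>t\<^sup>n\<^sup>-\<^sup>1\<close>.
\<close>

definition cone_measure :: "(real^'n) measure" where
  "cone_measure = distr (density lborel (\<lambda>y. ennreal (real CARD('n)) * indicator {y. 0 < \<rho> y \<and> \<rho> y < 1} y)) borel (\<lambda>y. proj y)"

lemma sets_cone_measure [simp, measurable_cong]: "sets cone_measure = sets borel"
  and space_cone_measure [simp]: "space cone_measure = UNIV"
  by (simp_all add: cone_measure_def)

lemma nn_integral_cone_measure:
  assumes [measurable]: "f \<in> borel_measurable borel"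
  shows "(\<integral>\<^sup>+\<theta>. f \<theta> \<partial>cone_measure) = (\<integral>\<^sup>+y. ennreal (real CARD('n)) * indicator {y. 0 < \<rho> y \<and> \<rho> y < 1} y * f (proj y) \<partial>lborel)"
  unfolding cone_measure_def by (subst nn_integral_distr) (auto simp: nn_integral_density)

abbreviation solid_cone :: "(real^'n) set \<Rightarrow> (real^'n) set" where
  "solid_cone B \<equiv> {y. 0 < \<rho> y \<and> \<rho> y < 1 \<and> proj y \<in> B}"

lemma emeasure_cone_measure:
  assumes [measurable]: "B \<in> sets borel"
  shows "emeasure cone_measure B = ennreal (real CARD('n)) * emeasure lborel (solid_cone B)"
proof -
  have m: "(solid_cone B) \<in> sets lborel" by measurable
  have "emeasure cone_measure B = (\<integral>\<^sup>+\<theta>. indicator B \<theta> \<partial>cone_measure)" by simp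
  also have "\<dots> = (\<integral>\<^sup>+y. ennreal (real CARD('n)) * indicator (solid_cone B) y \<partial>lborel)"
    by (subst nn_integral_cone_measure) (auto intro!: nn_integral_cong simp: indicator_def)
  also have "\<dots> = ennreal (real CARD('n)) * emeasure lborel (solid_cone B)"
    using m by (subst nn_integral_cmult) auto
  finally show ?thesis .
qed

lemma rho_proj: "y \<noteq> 0 \<Longrightarrow> \<rho> (proj y) = 1"
  by (simp add: rho_scaleR)

lemma AE_cone_measure: "AE \<theta> in cone_measure. \<rho> \<theta> = 1"
proof (rule AE_I)
  show "emeasure cone_measure {\<theta>. \<rho> \<theta> \<noteq> 1} = 0"
  proof -
    have emp: "(solid_cone {\<theta>. \<rho> \<theta> \<noteq> 1}) = {}"
      using rho_proj by auto
    have m: "{\<theta>. \<rho> \<theta> \<noteq> 1} \<in> sets borel" by measurable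
    show ?thesis unfolding emeasure_cone_measure[OF m] emp by simp
  qed
  show "{\<theta>. \<rho> \<theta> \<noteq> 1} \<in> sets cone_measure" by measurable
qed auto

lemma finite_cone_measure: "finite_measure cone_measure"
proof
  obtain l where l: "l > 0" "\<And>x. l * norm x \<le> \<rho> x" using rho_lower by blast
  have "(solid_cone UNIV) \<subseteq> cball 0 (1/l)"
  proof
    fix y assume "y \<in> (solid_cone UNIV)"
    then have "l * norm y \<le> 1" using l(2)[of y] by auto
    then show "y \<in> cball 0 (1/l)" using l(1) by (simp add: field_simps)
  qed
  then have "emeasure lborel (solid_cone UNIV) \<le> emeasure lborel (cball (0::real^'n) (1/l))"
    by (intro emeasure_mono) auto
  also have "\<dots> < \<infinity>" using l by (subst emeasure_cball) auto
  finally have "emeasure cone_measure UNIV < \<infinity>"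
    by (subst emeasure_cone_measure) (auto simp: ennreal_mult_less_top)
  then show "emeasure cone_measure (space cone_measure) \<noteq> \<infinity>" by simp
qed

definition radial_measure :: "real measure" where
  "radial_measure = density lborel (\<lambda>t. ennreal (t ^ (CARD('n) - 1)) * indicator {0<..} t)"

lemma sets_radial_measure [simp, measurable_cong]: "sets radial_measure = sets borel"
  and space_radial_measure [simp]: "space radial_measure = UNIV"
  by (simp_all add: radial_measure_def)

lemma sigma_finite_radial_measure: "sigma_finite_measure radial_measure"
  unfolding radial_measure_def
  by (subst sigma_finite_measure.sigma_finite_iff_density_finite[OF sigma_finite_lborel]) (auto simp: ennreal_mult_eq_top_iff indicator_def)

text \<open>
  After insertion of the definition of the cone measure, replace \<open>t\<close> by \<open>t \<rho> y\<close> and then \<open>y\<close> by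
  \<open>x / t\<close>. What remains of the \<open>t\<close>-integral is \<open>n (\<rho> x)\<^sup>n\<close> times the integral of \<open>t\<^sup>-\<^sup>n\<^sup>-\<^sup>1\<close>
  over \<open>t > \<rho> x\<close>, which is 1.
\<close>

lemma nn_integral_polar:
  fixes F :: "real^'n \<Rightarrow> ennreal"
  assumes F[measurable]: "F \<in> borel_measurable borel"
  shows "(\<integral>\<^sup>+\<theta>. (\<integral>\<^sup>+t. F (t *\<^sub>R \<theta>) \<partial>radial_measure) \<partial>cone_measure) = (\<integral>\<^sup>+y. F y \<partial>lborel)"
proof -
  let ?n = "CARD('n)"
  let ?E = "indicator {y. 0 < \<rho> y \<and> \<rho> y < 1} :: real^'n \<Rightarrow> ennreal"
  let ?g = "\<lambda>t. ennreal (t ^ (?n - 1)) * indicator {0<..} t"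
  let ?d = "\<lambda>t y. ennreal (real ?n) * ?E y * ennreal (\<rho> y ^ ?n) * (?g t * F (t *\<^sub>R y))"
  let ?c = "\<lambda>x. ennreal (real ?n) * ennreal (\<rho> x ^ ?n) * F x"
  let ?k = "\<lambda>t x. indicator {0<..} (\<rho> x) * (ennreal (1 / t ^ (?n + 1)) * (if \<rho> x < t then 1 else 0))"
  have "(\<integral>\<^sup>+\<theta>. (\<integral>\<^sup>+t. F (t *\<^sub>R \<theta>) \<partial>radial_measure) \<partial>cone_measure)
      = (\<integral>\<^sup>+\<theta>. (\<integral>\<^sup>+t. ?g t * F (t *\<^sub>R \<theta>) \<partial>lborel) \<partial>cone_measure)"
    unfolding radial_measure_def by (intro nn_integral_cong nn_integral_density) measurable
  also have "\<dots> = (\<integral>\<^sup>+y. ennreal (real ?n) * ?E y * (\<integral>\<^sup>+t. ?g t * F (t *\<^sub>R proj y) \<partial>lborel) \<partial>lborel)"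
    by (subst nn_integral_cone_measure) auto
  also have "\<dots> = (\<integral>\<^sup>+y. (\<integral>\<^sup>+t. ?d t y \<partial>lborel) \<partial>lborel)"
  proof (rule nn_integral_cong)
    fix y
    show "ennreal (real ?n) * ?E y * (\<integral>\<^sup>+t. ?g t * F (t *\<^sub>R proj y) \<partial>lborel) =
      (\<integral>\<^sup>+t. ?d t y \<partial>lborel)"
    proof (cases "y = 0")
      case True then show ?thesis by simp
    next
      case False
      then have r: "0 < \<rho> y" by simp
      have "(\<integral>\<^sup>+t. ?g t * F (t *\<^sub>R proj y) \<partial>lborel) = ennreal \<bar>\<rho> y\<bar> * (\<integral>\<^sup>+t. ?g (0 + \<rho> y * t) * F ((0 + \<rho> y * t) *\<^sub>R proj y) \<partial>lborel)"
        using r by (intro nn_integral_real_affine) auto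
      also have "(\<integral>\<^sup>+t. ?g (0 + \<rho> y * t) * F ((0 + \<rho> y * t) *\<^sub>R proj y) \<partial>lborel)
        = (\<integral>\<^sup>+t. ennreal (\<rho> y ^ (?n - 1)) * (?g t * F (t *\<^sub>R y)) \<partial>lborel)"
      proof (rule nn_integral_cong)
        fix t
        show "?g (0 + \<rho> y * t) * F ((0 + \<rho> y * t) *\<^sub>R proj y) = ennreal (\<rho> y ^ (?n - 1)) * (?g t * F (t *\<^sub>R y))"
          using r by (cases "t > 0") (auto simp: power_mult_distrib ennreal_mult indicator_def zero_less_mult_iff mult.assoc)
      qed
      also have "\<dots> = ennreal (\<rho> y ^ (?n - 1)) * (\<integral>\<^sup>+t. ?g t * F (t *\<^sub>R y) \<partial>lborel)"
        by (rule nn_integral_cmult) measurable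
      also have "ennreal \<bar>\<rho> y\<bar> * (ennreal (\<rho> y ^ (?n - 1)) * (\<integral>\<^sup>+t. ?g t * F (t *\<^sub>R y) \<partial>lborel))
          = ennreal (\<rho> y ^ ?n) * (\<integral>\<^sup>+t. ?g t * F (t *\<^sub>R y) \<partial>lborel)"
      proof -
        have "\<rho> y ^ ?n = \<rho> y * \<rho> y ^ (?n - 1)" using power_eq_if[of "\<rho> y" ?n] by simp
        then show ?thesis using r by (simp add: ennreal_mult mult.assoc)
      qed
      finally show ?thesis by (subst nn_integral_cmult) (auto simp: mult.assoc)
    qed
  qed
  also have "\<dots> = (\<integral>\<^sup>+t. (\<integral>\<^sup>+y. ?d t y \<partial>lborel) \<partial>lborel)"
    by (rule lborel_pair.Fubini') measurable
  also have "\<dots> = (\<integral>\<^sup>+t. (\<integral>\<^sup>+x. ?c x * ?k t x \<partial>lborel) \<partial>lborel)"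
  proof (rule nn_integral_cong)
    fix t :: real
    show "(\<integral>\<^sup>+y. ?d t y \<partial>lborel) =
      (\<integral>\<^sup>+x. ?c x * ?k t x \<partial>lborel)"
    proof (cases "t > 0")
      case False
      then have z: "?k t x = 0" for x
        using order_le_less_trans[OF rho_nonneg, of x t] by (auto simp: indicator_def)
      have g: "?g t = 0" using False by (simp add: indicator_def)
      show ?thesis unfolding z g by simp
    next
      case True
      have "(\<integral>\<^sup>+y. ?d t y \<partial>lborel)
        = ennreal (\<bar>1/t\<bar> ^ DIM(real^'n)) * (\<integral>\<^sup>+x. ?d t (0 + (1/t) *\<^sub>R x) \<partial>lborel)"
        using True by (intro nn_integral_lborel_affine) auto
      also have "\<dots> = (\<integral>\<^sup>+x. ennreal (\<bar>1/t\<bar> ^ DIM(real^'n)) * ?d t (0 + (1/t) *\<^sub>R x) \<partial>lborel)"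
        by (rule nn_integral_cmult[symmetric]) measurable
      also have "\<dots> = (\<integral>\<^sup>+x. ?c x * ?k t x \<partial>lborel)"
      proof (rule nn_integral_cong)
        fix x :: "real^'n"
        show "ennreal (\<bar>1/t\<bar> ^ DIM(real^'n)) * ?d t (0 + (1/t) *\<^sub>R x)
          = ?c x * ?k t x"
        proof (cases "x \<noteq> 0 \<and> \<rho> x < t")
          case False
          then show ?thesis using True by (auto simp: rho_scaleR indicator_def)
        next
          case c: True
          have "ennreal (\<bar>1/t\<bar> ^ DIM(real^'n)) * ?d t (0 + (1/t) *\<^sub>R x)
            = ennreal (\<bar>1/t\<bar> ^ ?n) * (ennreal (real ?n) * ennreal ((\<rho> x / t) ^ ?n) * (ennreal (t ^ (?n - 1)) * F x))"
            using c True by (simp add: rho_scaleR indicator_def)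
          also have "\<dots> = ennreal (\<bar>1/t\<bar> ^ ?n * (\<rho> x / t) ^ ?n * t ^ (?n - 1)) * (ennreal (real ?n) * F x)"
            using True by (simp add: ennreal_mult mult_ac)
          also have "\<bar>1/t\<bar> ^ ?n * (\<rho> x / t) ^ ?n * t ^ (?n - 1) = \<rho> x ^ ?n * (1 / t ^ (?n + 1))"
          proof -
            have "t ^ ?n = t * t ^ (?n - 1)" using power_eq_if[of t ?n] by simp
            then show ?thesis using True by (simp add: power_divide field_simps)
          qed
          also have "ennreal (\<rho> x ^ ?n * (1 / t ^ (?n + 1))) * (ennreal (real ?n) * F x)
            = ?c x * ennreal (1 / t ^ (?n + 1))"
            using True by (simp only: ennreal_mult zero_le_power rho_nonneg zero_le_divide_1_iff less_imp_le mult_ac)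
          finally show ?thesis using c by (simp add: indicator_def)
        qed
      qed
      finally show ?thesis .
    qed
  qed
  also have "\<dots> = (\<integral>\<^sup>+x. (\<integral>\<^sup>+t. ?c x * ?k t x \<partial>lborel) \<partial>lborel)"
    by (rule lborel_pair.Fubini') measurable
  also have "\<dots> = (\<integral>\<^sup>+x. F x * indicator (- {0}) x \<partial>lborel)"
  proof (rule nn_integral_cong)
    fix x :: "real^'n"
    show "(\<integral>\<^sup>+t. ?c x * ?k t x \<partial>lborel)
      = F x * indicator (- {0}) x"
    proof (cases "x = 0")
      case False
      then have r: "0 < \<rho> x" by simp
      have "(\<integral>\<^sup>+t. ennreal (1 / t ^ (?n + 1)) * (if \<rho> x < t then 1 else 0) \<partial>lborel) = (\<integral>\<^sup>+t. ennreal (1 / t ^ (?n + 1)) * indicator {\<rho> x..} t \<partial>lborel)"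
        by (intro nn_integral_cong_AE AE_I[of _ _ "{\<rho> x}"]) (auto simp: indicator_def)
      also have "\<dots> = ennreal (0 - (- (1 / real ?n) * inverse (\<rho> x ^ ?n)))"
      proof (rule nn_integral_FTC_atLeast)
        fix t assume t: "\<rho> x \<le> t"
        then have t0: "0 < t" using r by linarith
        have "((\<lambda>t. inverse (t ^ ?n)) has_real_derivative - (inverse (t ^ ?n) * (real ?n * t ^ (?n - 1)) * inverse (t ^ ?n))) (at t)"
          using t0 by (auto intro!: derivative_eq_intros)
        moreover have "inverse (t ^ ?n) * (real ?n * t ^ (?n - 1)) * inverse (t ^ ?n) = real ?n * (1 / t ^ (?n + 1))"
        proof -
          have "t ^ ?n = t * t ^ (?n - 1)" using power_eq_if[of t ?n] by simp
          then show ?thesis using t0 by (simp add: field_simps)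
        qed
        ultimately have "((\<lambda>t. inverse (t ^ ?n)) has_real_derivative - (real ?n * (1 / t ^ (?n + 1)))) (at t)" by simp
        from DERIV_cmult[OF this, of "- (1 / real ?n)"]
        show "((\<lambda>t. - (1 / real ?n) * inverse (t ^ ?n)) has_real_derivative 1 / t ^ (?n + 1)) (at t)" by simp
        show "0 \<le> 1 / t ^ (?n + 1)" using t0 by simp
      next
        have "((\<lambda>t::real. inverse (t ^ ?n)) \<longlongrightarrow> 0) at_top"
          by (intro tendsto_inverse_0_at_top filterlim_pow_at_top filterlim_ident) simp
        from tendsto_mult_left[OF this, of "- (1 / real ?n)"]
        show "((\<lambda>t. - (1 / real ?n) * inverse (t ^ ?n)) \<longlongrightarrow> 0) at_top" by simp
      qed measurable
      finally have I: "(\<integral>\<^sup>+t. ennreal (1 / t ^ (?n + 1)) * (if \<rho> x < t then 1 else 0) \<partial>lborel) = ennreal (1 / (real ?n * \<rho> x ^ ?n))"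
        by (simp add: field_simps)
      have "(\<integral>\<^sup>+t. ?c x * ?k t x \<partial>lborel)
        = ?c x * (\<integral>\<^sup>+t. ennreal (1 / t ^ (?n + 1)) * (if \<rho> x < t then 1 else 0) \<partial>lborel)"
        using r by (subst nn_integral_cmult[symmetric]) (auto simp: indicator_def)
      also have "\<dots> = F x * (ennreal (real ?n) * ennreal (\<rho> x ^ ?n) * ennreal (1 / (real ?n * \<rho> x ^ ?n)))"
        unfolding I by (simp only: mult_ac)
      also have "ennreal (real ?n) * ennreal (\<rho> x ^ ?n) * ennreal (1 / (real ?n * \<rho> x ^ ?n)) = 1"
        using r by (simp flip: ennreal_mult)
      finally show ?thesis using False by simp
    qed simp
  qed
  also have "\<dots> = (\<integral>\<^sup>+y. F y \<partial>lborel)"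
    by (intro nn_integral_cong_AE AE_I[of _ _ "{0}"]) (auto simp: indicator_def)
  finally show ?thesis .
qed

lemma lborel_polar:
  "lborel = distr (cone_measure \<Otimes>\<^sub>M radial_measure) borel (\<lambda>(\<theta>, t). t *\<^sub>R \<theta>)"
proof (rule measure_eqI)
  interpret R: sigma_finite_measure radial_measure by (rule sigma_finite_radial_measure)
  fix B assume "B \<in> sets (lborel :: (real^'n) measure)"
  then have B[measurable]: "B \<in> sets borel" by simp
  have "emeasure (distr (cone_measure \<Otimes>\<^sub>M radial_measure) borel (\<lambda>(\<theta>, t). t *\<^sub>R \<theta>)) B
      = (\<integral>\<^sup>+y. indicator B y \<partial>distr (cone_measure \<Otimes>\<^sub>M radial_measure) borel (\<lambda>(\<theta>, t). t *\<^sub>R \<theta>))"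
    by simp
  also have "\<dots> = (\<integral>\<^sup>+p. indicator B (snd p *\<^sub>R fst p) \<partial>(cone_measure \<Otimes>\<^sub>M radial_measure))"
    by (subst nn_integral_distr) (auto simp: split_beta')
  also have "\<dots> = (\<integral>\<^sup>+\<theta>. (\<integral>\<^sup>+t. indicator B (t *\<^sub>R \<theta>) \<partial>radial_measure) \<partial>cone_measure)"
    by (subst R.nn_integral_fst[symmetric]) auto
  also have "\<dots> = (\<integral>\<^sup>+y. indicator B y \<partial>lborel)" by (rule nn_integral_polar) measurable
  finally show "emeasure lborel B = emeasure (distr (cone_measure \<Otimes>\<^sub>M radial_measure) borel (\<lambda>(\<theta>, t). t *\<^sub>R \<theta>)) B"
    by simp
qed simp

text \<open>
  As the cone measure is finite, a bound on the integrals along rays that is uniform in the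
  direction implies integrability.
\<close>

lemma integral_polar:
  fixes F :: "real^'n \<Rightarrow> real"
  assumes F[measurable]: "F \<in> borel_measurable borel"
    and bd: "\<And>\<theta>. \<rho> \<theta> = 1 \<Longrightarrow> (\<integral>\<^sup>+t. ennreal \<bar>F (t *\<^sub>R \<theta>)\<bar> \<partial>radial_measure) \<le> ennreal K"
  shows "integrable lborel F"
    and "(LINT y|lborel. F y) = (LINT \<theta>|cone_measure. (LINT t|radial_measure. F (t *\<^sub>R \<theta>)))"
proof -
  interpret R: sigma_finite_measure radial_measure by (rule sigma_finite_radial_measure)
  interpret C: finite_measure cone_measure by (rule finite_cone_measure)
  interpret pair_sigma_finite cone_measure radial_measure by standard
  have "(\<integral>\<^sup>+y. ennreal \<bar>F y\<bar> \<partial>lborel) = (\<integral>\<^sup>+\<theta>. (\<integral>\<^sup>+t. ennreal \<bar>F (t *\<^sub>R \<theta>)\<bar> \<partial>radial_measure) \<partial>cone_measure)"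
    by (rule nn_integral_polar[symmetric]) measurable
  also have "\<dots> \<le> (\<integral>\<^sup>+\<theta>. ennreal K \<partial>cone_measure)"
    using AE_cone_measure bd by (intro nn_integral_mono_AE) auto
  also have "\<dots> = ennreal K * emeasure cone_measure UNIV" by simp
  also have "\<dots> < \<infinity>" using C.emeasure_finite[of UNIV] by (simp add: ennreal_mult_eq_top_iff less_top[symmetric])
  finally show int: "integrable lborel F"
    by (intro integrableI_bounded) auto
  have m: "(\<lambda>p. snd p *\<^sub>R fst p) \<in> measurable (cone_measure \<Otimes>\<^sub>M radial_measure) borel" by measurable
  have lb: "lborel = distr (cone_measure \<Otimes>\<^sub>M radial_measure) borel (\<lambda>p. snd p *\<^sub>R fst p)"
    using lborel_polar by (simp add: split_beta')
  have "integrable (distr (cone_measure \<Otimes>\<^sub>M radial_measure) borel (\<lambda>p. snd p *\<^sub>R fst p)) F"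
    using int unfolding lb[symmetric] .
  then have int2: "integrable (cone_measure \<Otimes>\<^sub>M radial_measure) (\<lambda>p. F (snd p *\<^sub>R fst p))"
    by (subst (asm) integrable_distr_eq[OF m F])
  have "(LINT y|lborel. F y) = (LINT y|distr (cone_measure \<Otimes>\<^sub>M radial_measure) borel (\<lambda>p. snd p *\<^sub>R fst p). F y)"
    unfolding lb[symmetric] ..
  also have "\<dots> = (LINT p|(cone_measure \<Otimes>\<^sub>M radial_measure). F (snd p *\<^sub>R fst p))"
    by (rule integral_distr[OF m F])
  also have "\<dots> = (LINT \<theta>|cone_measure. (LINT t|radial_measure. F (t *\<^sub>R \<theta>)))"
    using integral_fst'[OF int2] by simp
  finally show "(LINT y|lborel. F y) = (LINT \<theta>|cone_measure. (LINT t|radial_measure. F (t *\<^sub>R \<theta>)))" .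
qed

end

section \<open>Surface measure of the ellipsoid\<close>

lemma eventually_at_right_0_obtain:
  assumes "eventually P (at_right (0::real))"
  obtains t where "0 < t" "P t"
proof -
  have "eventually (\<lambda>t. 0 < t \<and> P t) (at_right (0::real))"
    using assms eventually_at_right_less[of "0::real"] by eventually_elim auto
  from eventually_happens[OF this] show ?thesis using that by auto
qed

lemma mult_le_of_le_divide:
  fixes c t e :: real
  assumes "0 < c" "t \<le> e / c"
  shows "c * t \<le> e"
  using assms by (simp add: pos_le_divide_eq mult.commute)

lemma cone_constant_cancel:
  fixes N w x h :: real
  assumes "0 < N"
  shows "(N * real (Suc d)) * (w * (N * x) ^ d * (h / N) ^ Suc d / real (Suc d)) = w * x ^ d * h ^ Suc d"
  using assms by (simp add: power_mult_distrib power_divide)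

context posdef_form
begin

lemma norm_rho_one_bounded: "\<exists>M\<ge>1. \<forall>x. \<rho> x = 1 \<longrightarrow> norm x \<le> M"
proof -
  obtain l where l: "l > 0" "\<And>x. l * norm x \<le> \<rho> x" using rho_lower by blast
  have "norm x \<le> max 1 (1/l)" if "\<rho> x = 1" for x
  proof -
    have "norm x \<le> 1 / l" using l(2)[of x] l(1) that by (simp add: pos_le_divide_eq mult.commute)
    then show ?thesis by simp
  qed
  then show ?thesis by (intro exI[of _ "max 1 (1/l)"]) auto
qed

text \<open>
  Let \<open>a = A \<theta>0\<close>, so that \<open>a \<cdot> y = 1\<close> is the tangent hyperplane at \<open>\<theta>0\<close>. The cone over a small
  set \<open>C\<close> containing \<open>\<theta>0\<close> has height at most \<open>1 / |a|\<close> over the hyperplane through 0, and the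
  radial projection of \<open>C\<close> to the tangent hyperplane increases distances by a factor of at most
  \<open>1 + \<epsilon>\<close>. The volume bound for cones applies; the height accounts for the factor \<open>|A \<theta>0|\<close>.
\<close>

lemma cone_measure_upper:
  assumes d: "Suc d = CARD('n)" and \<epsilon>: "\<epsilon> > 0"
  shows "\<exists>\<delta>>0. \<forall>C \<theta>0 D. C \<in> sets borel \<longrightarrow> (\<forall>\<theta>\<in>C. \<rho> \<theta> = 1) \<longrightarrow> \<theta>0 \<in> C \<longrightarrow> 0 \<le> D \<longrightarrow> D \<le> \<delta> \<longrightarrow>
     (\<forall>x\<in>C. \<forall>y\<in>C. norm (x - y) \<le> D) \<longrightarrow>
     ennreal (norm (A *v \<theta>0)) * emeasure cone_measure C \<le> ennreal (unit_ball_vol (real d) * ((1 + \<epsilon>) * D / 2) ^ d)"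
proof -
  obtain L where L: "L > 0" "\<And>x. norm (A *v x) \<le> L * norm x" using form_bounded by blast
  obtain M where M: "M \<ge> 1" "\<And>x. \<rho> x = 1 \<Longrightarrow> norm x \<le> M" using norm_rho_one_bounded by blast
  \<comment> \<open>On sets of diameter \<open>t\<close>, this bounds the Lipschitz constant of the radial projection to the
    tangent hyperplane.\<close>
  let ?f = "\<lambda>t. 1 / (1 - L * t\<^sup>2 / 2) + M * (L * t) / (1 - L * t\<^sup>2 / 2)\<^sup>2"
  have "(?f \<longlongrightarrow> 1 / (1 - L * 0\<^sup>2 / 2) + M * (L * 0) / (1 - L * 0\<^sup>2 / 2)\<^sup>2) (at_right 0)"
    by (intro tendsto_intros) auto
  then have "eventually (\<lambda>t. ?f t < 1 + \<epsilon>) (at_right 0)"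
    by (rule order_tendstoD) (use \<epsilon> in auto)
  moreover have "((\<lambda>t. L * t\<^sup>2 / 2) \<longlongrightarrow> L * 0\<^sup>2 / 2) (at_right 0)" by (intro tendsto_intros) auto
  then have "eventually (\<lambda>t. L * t\<^sup>2 / 2 < 1) (at_right 0)"
    by (rule order_tendstoD) auto
  ultimately have "eventually (\<lambda>t. ?f t < 1 + \<epsilon> \<and> L * t\<^sup>2 / 2 < 1) (at_right 0)"
    by eventually_elim auto
  then obtain \<delta> where \<delta>: "0 < \<delta>" "?f \<delta> < 1 + \<epsilon>" "L * \<delta>\<^sup>2 / 2 < 1"
    by (elim eventually_at_right_0_obtain) auto
  define \<kappa> where "\<kappa> = L * \<delta>\<^sup>2 / 2"
  have \<kappa>: "0 < 1 - \<kappa>" "1 / (1 - \<kappa>) + M * (L * \<delta>) / (1 - \<kappa>)\<^sup>2 < 1 + \<epsilon>"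
    using \<delta> by (auto simp: \<kappa>_def)
  show ?thesis
  proof (intro exI[of _ \<delta>] conjI allI impI)
    fix C \<theta>0 D assume C[measurable]: "C \<in> sets borel" and C1: "\<forall>\<theta>\<in>C. \<rho> \<theta> = 1" and \<theta>0: "\<theta>0 \<in> C"
      and D: "0 \<le> D" "D \<le> \<delta>" and diam: "\<forall>x\<in>C. \<forall>y\<in>C. norm (x - y) \<le> D"
    define a where "a = A *v \<theta>0"
    have a1: "a \<bullet> \<theta>0 = 1" using rho_sq[of \<theta>0] C1 \<theta>0 by (simp add: a_def)
    then have a0: "0 < norm a" by auto
    let ?\<nu> = "(1 / norm a) *\<^sub>R a"
    let ?w = "unit_ball_vol (real d) * ((norm a * ((1 + \<epsilon>) * D)) / 2) ^ d * (1 / norm a) ^ Suc d / real (Suc d)"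
    define K where "K = (solid_cone C)"
    have K: "K \<in> sets borel" unfolding K_def by measurable
    have form_le: "\<bar>(A *v x) \<bullet> y\<bar> \<le> L * norm x * norm y" for x y
      using Cauchy_Schwarz_ineq2[of "A *v x" y] mult_right_mono[OF L(2)[of x], of "norm y"] by auto
    have \<alpha>: "a \<bullet> \<theta> = 1 - (\<rho> (\<theta> - \<theta>0))\<^sup>2 / 2" if "\<theta> \<in> C" for \<theta>
    proof -
      have "\<rho> \<theta> = 1" "\<rho> \<theta>0 = 1" using C1 \<theta>0 that by auto
      then have "(\<rho> (\<theta> - \<theta>0))\<^sup>2 = 2 - 2 * (a \<bullet> \<theta>)"
        by (simp add: rho_diff_sq a_def form_sym[of \<theta> \<theta>0])
      then show ?thesis by linarith
    qed
    have \<alpha>_low: "1 - \<kappa> \<le> a \<bullet> \<theta>" if "\<theta> \<in> C" for \<theta>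
    proof -
      have "(\<rho> (\<theta> - \<theta>0))\<^sup>2 \<le> L * norm (\<theta> - \<theta>0) * norm (\<theta> - \<theta>0)"
        using form_le[of "\<theta> - \<theta>0" "\<theta> - \<theta>0"] by (simp add: rho_sq)
      also have "\<dots> \<le> L * \<delta> * \<delta>"
        using diam that \<theta>0 D L(1) \<delta>(1) by (intro mult_mono mult_left_mono) (auto intro: order_trans)
      finally show ?thesis using \<alpha>[OF that] by (simp add: \<kappa>_def power2_eq_square)
    qed
    have \<alpha>_diff: "\<bar>a \<bullet> \<theta>' - a \<bullet> \<theta>\<bar> \<le> L * \<delta> * norm (\<theta> - \<theta>')" if "\<theta> \<in> C" "\<theta>' \<in> C" for \<theta> \<theta>'
    proof -
      have "(\<rho> (\<theta> - \<theta>0))\<^sup>2 - (\<rho> (\<theta>' - \<theta>0))\<^sup>2 = (A *v (\<theta> - \<theta>')) \<bullet> ((\<theta> - \<theta>0) + (\<theta>' - \<theta>0))"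
      proof -
        have "(\<rho> p)\<^sup>2 - (\<rho> p')\<^sup>2 = (A *v (p - p')) \<bullet> (p + p')" for p p'
          by (simp add: rho_sq matrix_vector_mult_diff_distrib inner_diff_left inner_add_right form_sym[of p' p])
        from this[of "\<theta> - \<theta>0" "\<theta>' - \<theta>0"] show ?thesis by simp
      qed
      then have "\<bar>(\<rho> (\<theta> - \<theta>0))\<^sup>2 - (\<rho> (\<theta>' - \<theta>0))\<^sup>2\<bar> \<le> L * norm (\<theta> - \<theta>') * norm ((\<theta> - \<theta>0) + (\<theta>' - \<theta>0))"
        using form_le[of "\<theta> - \<theta>'" "(\<theta> - \<theta>0) + (\<theta>' - \<theta>0)"] by simp
      also have "\<dots> \<le> L * norm (\<theta> - \<theta>') * (\<delta> + \<delta>)"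
      proof (intro mult_left_mono)
        show "norm ((\<theta> - \<theta>0) + (\<theta>' - \<theta>0)) \<le> \<delta> + \<delta>"
          using diam that \<theta>0 D(2) by (intro norm_triangle_mono) (auto intro: order_trans)
      qed (use L(1) in simp)
      finally show ?thesis using \<alpha>[OF that(1)] \<alpha>[OF that(2)] by (simp add: algebra_simps)
    qed
    have vol: "emeasure lborel K \<le> ennreal ?w"
    proof (rule cone_volume_le[where \<nu>="?\<nu>"])
      show "norm ?\<nu> = 1" using a0 by simp
      show "0 \<le> norm a * ((1 + \<epsilon>) * D)" using \<epsilon> D by simp
      show "0 \<le> 1 / norm a" by simp
      fix y assume y: "y \<in> K"
      have y1: "y = \<rho> y *\<^sub>R proj y" and ry: "0 < \<rho> y" "\<rho> y < 1" and py: "proj y \<in> C"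
        using y by (auto simp: K_def)
      have ay: "a \<bullet> y = \<rho> y * (a \<bullet> proj y)" using ry by simp
      have "0 < a \<bullet> y" using \<alpha>_low[OF py] \<kappa>(1) ry unfolding ay by (intro mult_pos_pos) auto
      moreover have "a \<bullet> y < 1"
        using form_Cauchy_Schwarz[of \<theta>0 y] C1 \<theta>0 ry by (simp add: a_def)
      ultimately show "0 < ?\<nu> \<bullet> y \<and> ?\<nu> \<bullet> y < 1 / norm a"
        using a0 by (simp add: divide_strict_right_mono)
      fix y' assume y': "y' \<in> K" and eq: "?\<nu> \<bullet> y = ?\<nu> \<bullet> y'"
      have ry': "0 < \<rho> y'" and py': "proj y' \<in> C" using y' by (auto simp: K_def)
      have ay': "a \<bullet> y' = \<rho> y' * (a \<bullet> proj y')" using ry' by simp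
      define q where "q = a \<bullet> y"
      have q: "0 < q" "a \<bullet> y' = q" using \<open>0 < a \<bullet> y\<close> eq a0 by (auto simp: q_def)
      define \<theta> \<theta>' where "\<theta> = proj y" and "\<theta>' = proj y'"
      have \<theta>: "\<theta> \<in> C" "\<theta>' \<in> C" using py py' by (auto simp: \<theta>_def \<theta>'_def)
      have al: "0 < a \<bullet> \<theta>" "0 < a \<bullet> \<theta>'" "1 - \<kappa> \<le> a \<bullet> \<theta>" "1 - \<kappa> \<le> a \<bullet> \<theta>'"
        using \<alpha>_low[OF \<theta>(1)] \<alpha>_low[OF \<theta>(2)] \<kappa>(1) by auto
      have "\<rho> y = q / (a \<bullet> \<theta>)" "\<rho> y' = q / (a \<bullet> \<theta>')"
        using ay ay' al q by (auto simp: q_def \<theta>_def \<theta>'_def field_simps)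
      then have yy: "y = (q / (a \<bullet> \<theta>)) *\<^sub>R \<theta>" "y' = (q / (a \<bullet> \<theta>')) *\<^sub>R \<theta>'"
        using ry ry' by (auto simp: \<theta>_def \<theta>'_def)
      let ?s = "(a \<bullet> \<theta>' - a \<bullet> \<theta>) / ((a \<bullet> \<theta>) * (a \<bullet> \<theta>'))"
      let ?v = "(1 / (a \<bullet> \<theta>)) *\<^sub>R (\<theta> - \<theta>') + ?s *\<^sub>R \<theta>'"
      have "y - y' = q *\<^sub>R ?v"
      proof -
        have c: "1 / (a \<bullet> \<theta>) - ?s = 1 / (a \<bullet> \<theta>')"
          using al by (simp add: field_simps)
        have "?v
          = (1 / (a \<bullet> \<theta>)) *\<^sub>R \<theta> - (1 / (a \<bullet> \<theta>) - ?s) *\<^sub>R \<theta>'"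
          by (simp add: scaleR_diff_right scaleR_diff_left)
        then have e: "?v
          = (1 / (a \<bullet> \<theta>)) *\<^sub>R \<theta> - (1 / (a \<bullet> \<theta>')) *\<^sub>R \<theta>'"
          unfolding c .
        show ?thesis unfolding e by (subst yy(1), subst yy(2)) (simp add: scaleR_diff_right)
      qed
      then have "norm (y - y') = q * norm ?v"
        using q by simp
      also have "\<dots> \<le> q * ((1 / (1 - \<kappa>)) * norm (\<theta> - \<theta>') + (L * \<delta> * norm (\<theta> - \<theta>') / (1 - \<kappa>)\<^sup>2) * M)"
      proof (intro mult_left_mono norm_triangle_mono)
        show "norm ((1 / (a \<bullet> \<theta>)) *\<^sub>R (\<theta> - \<theta>')) \<le> (1 / (1 - \<kappa>)) * norm (\<theta> - \<theta>')"
          using al \<kappa>(1) by (auto intro!: mult_right_mono divide_left_mono)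
        have "\<bar>a \<bullet> \<theta>' - a \<bullet> \<theta>\<bar> / ((a \<bullet> \<theta>) * (a \<bullet> \<theta>')) \<le> L * \<delta> * norm (\<theta> - \<theta>') / (1 - \<kappa>)\<^sup>2"
          using al \<kappa>(1) L(1) \<delta>(1) \<alpha>_diff[OF \<theta>] unfolding power2_eq_square
          by (intro frac_le mult_mono mult_pos_pos) auto
        moreover have "norm \<theta>' \<le> M" using M(2) C1 \<theta> by auto
        ultimately have "\<bar>a \<bullet> \<theta>' - a \<bullet> \<theta>\<bar> / ((a \<bullet> \<theta>) * (a \<bullet> \<theta>')) * norm \<theta>' \<le> (L * \<delta> * norm (\<theta> - \<theta>') / (1 - \<kappa>)\<^sup>2) * M"
          using L(1) \<delta>(1) by (intro mult_mono) auto
        then show "norm (?s *\<^sub>R \<theta>') \<le> (L * \<delta> * norm (\<theta> - \<theta>') / (1 - \<kappa>)\<^sup>2) * M"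
          using al by (simp add: abs_mult)
      qed (use q in simp)
      also have "\<dots> = q * ((1 / (1 - \<kappa>) + M * (L * \<delta>) / (1 - \<kappa>)\<^sup>2) * norm (\<theta> - \<theta>'))"
        by (simp add: algebra_simps)
      also have "\<dots> \<le> q * ((1 + \<epsilon>) * D)"
        using \<kappa>(2) q \<epsilon> diam \<theta> by (intro mult_left_mono mult_mono) auto
      also have "\<dots> = norm a * ((1 + \<epsilon>) * D) * (?\<nu> \<bullet> y)"
        using a0 by (simp add: q_def)
      finally show "norm (y - y') \<le> norm a * ((1 + \<epsilon>) * D) * (?\<nu> \<bullet> y)" .
    qed (use K d in auto)
    have "ennreal (norm a) * emeasure cone_measure C = ennreal (norm a * real (Suc d)) * emeasure lborel K"
      unfolding K_def by (subst emeasure_cone_measure[OF C]) (simp add: d ennreal_mult mult.assoc)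
    also have "\<dots> \<le> ennreal (norm a * real (Suc d)) * ennreal ?w"
      by (intro mult_left_mono vol) auto
    also have "\<dots> = ennreal ((norm a * real (Suc d)) * ?w)"
      using \<epsilon> D by (intro ennreal_mult[symmetric]) auto
    also have "(norm a * real (Suc d)) * ?w
       = unit_ball_vol (real d) * ((1 + \<epsilon>) * D / 2) ^ d"
      using cone_constant_cancel[OF a0, of d "unit_ball_vol (real d)" "(1 + \<epsilon>) * D / 2" 1] by simp
    finally show "ennreal (norm (A *v \<theta>0)) * emeasure cone_measure C \<le> ennreal (unit_ball_vol (real d) * ((1 + \<epsilon>) * D / 2) ^ d)"
      by (simp add: a_def)
  qed (rule \<delta>(1))
qed

text \<open>
  The cone over the cap contains the straight cone of height \<open>(1 - \<epsilon>) / |a|\<close> over the disc of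
  radius \<open>(1 - \<epsilon>) r\<close> in the tangent hyperplane \<open>a \<cdot> y = 1\<close>, with \<open>a = A \<theta>0\<close>: radial projection
  to the boundary moves the points of this disc by at most \<open>\<epsilon> r\<close>, since the boundary departs
  from its tangent hyperplane by \<open>O(r\<^sup>2)\<close>.
\<close>

lemma cone_measure_lower:
  assumes d: "Suc d = CARD('n)" and \<epsilon>: "0 < \<epsilon>" "\<epsilon> < 1"
  shows "\<exists>r0>0. \<forall>r \<theta>0. 0 < r \<longrightarrow> r \<le> r0 \<longrightarrow> \<rho> \<theta>0 = 1 \<longrightarrow>
     ennreal (unit_ball_vol (real d) * ((1 - \<epsilon>) * r) ^ d * (1 - \<epsilon>) ^ Suc d)
     \<le> ennreal (norm (A *v \<theta>0)) * emeasure cone_measure (cball \<theta>0 r \<inter> {\<theta>. \<rho> \<theta> = 1})"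
proof -
  obtain L where L: "L > 0" "\<And>x. norm (A *v x) \<le> L * norm x" using form_bounded by blast
  obtain M where M: "M \<ge> 1" "\<And>x. \<rho> x = 1 \<Longrightarrow> norm x \<le> M" using norm_rho_one_bounded by blast
  define r0 where "r0 = min 1 (\<epsilon> / ((M + 1) * L))"
  have r0: "0 < r0" "r0 \<le> 1" "(M + 1) * L * r0 \<le> \<epsilon>"
  proof -
    have p: "0 < (M + 1) * L" using M L by simp
    then show "0 < r0" "r0 \<le> 1" using \<epsilon> by (auto simp: r0_def)
    show "(M + 1) * L * r0 \<le> \<epsilon>" by (rule mult_le_of_le_divide[OF p]) (simp add: r0_def)
  qed
  show ?thesis
  proof (intro exI[of _ r0] conjI allI impI)
    fix r \<theta>0 assume r: "0 < r" "r \<le> r0" and \<theta>0: "\<rho> \<theta>0 = 1"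
    have Lr: "(M + 1) * (L * r) \<le> \<epsilon>"
    proof -
      have "(M + 1) * L * r \<le> (M + 1) * L * r0" using r M(1) L(1) by (intro mult_left_mono) auto
      then show ?thesis using r0(3) by (simp add: mult.assoc)
    qed
    have Lr2: "L * r\<^sup>2 \<le> \<epsilon>"
    proof -
      have "L * r\<^sup>2 = (1 * (L * r)) * r" by (simp add: power2_eq_square)
      also have "\<dots> \<le> ((M + 1) * (L * r)) * 1" using r r0 M(1) L(1) by (intro mult_mono) auto
      finally show ?thesis using Lr by simp
    qed
    define a where "a = A *v \<theta>0"
    have a1: "a \<bullet> \<theta>0 = 1" using rho_sq[of \<theta>0] \<theta>0 by (simp add: a_def)
    then have a0: "0 < norm a" by auto
    let ?\<nu> = "(1 / norm a) *\<^sub>R a"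
    let ?w = "unit_ball_vol (real d) * (norm a * ((1 - \<epsilon>) * r)) ^ d * ((1 - \<epsilon>) / norm a) ^ Suc d / real (Suc d)"
    define C where "C = cball \<theta>0 r \<inter> {\<theta>. \<rho> \<theta> = 1}"
    have C[measurable]: "C \<in> sets borel" unfolding C_def by measurable
    define K where "K = (solid_cone C)"
    have K: "K \<in> sets borel" unfolding K_def by measurable
    have vol: "ennreal ?w \<le> emeasure lborel K"
    proof (rule cone_volume_ge[where \<nu>="?\<nu>" and p="norm a *\<^sub>R \<theta>0"])
      show "norm ?\<nu> = 1" using a0 by simp
      show "0 < norm a * ((1 - \<epsilon>) * r)" using \<epsilon> r a0 by simp
      show "0 \<le> (1 - \<epsilon>) / norm a" using \<epsilon> by simp
      show "?\<nu> \<bullet> (norm a *\<^sub>R \<theta>0) = 1" using a1 a0 by simp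
      fix y assume y1: "0 < ?\<nu> \<bullet> y" and y2: "?\<nu> \<bullet> y < (1 - \<epsilon>) / norm a"
        and y3: "norm (y - (?\<nu> \<bullet> y) *\<^sub>R norm a *\<^sub>R \<theta>0) \<le> norm a * ((1 - \<epsilon>) * r) * (?\<nu> \<bullet> y)"
      define q where "q = a \<bullet> y"
      have q: "0 < q" "q < 1 - \<epsilon>" using y1 y2 a0 by (auto simp: q_def zero_less_divide_iff divide_less_cancel)
      have yq: "norm (y - q *\<^sub>R \<theta>0) \<le> (1 - \<epsilon>) * r * q" using y3 a0 by (simp add: q_def)
      define z where "z = (1 / q) *\<^sub>R y"
      have yz: "y = q *\<^sub>R z" using q by (simp add: z_def)
      have az: "a \<bullet> z = 1" using q by (simp add: z_def q_def)
      have zn: "norm (z - \<theta>0) \<le> (1 - \<epsilon>) * r"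
      proof -
        have "q * norm (z - \<theta>0) = norm (y - q *\<^sub>R \<theta>0)"
          using q by (simp add: yz scaleR_diff_right[symmetric])
        then have "q * norm (z - \<theta>0) \<le> q * ((1 - \<epsilon>) * r)" using yq by (simp add: mult_ac)
        then show ?thesis using q by simp
      qed
      then have zn': "norm (z - \<theta>0) \<le> r"
      proof -
        have "(1 - \<epsilon>) * r \<le> 1 * r" using \<epsilon> r by (intro mult_right_mono) auto
        then show ?thesis using zn by linarith
      qed
      \<comment> \<open>As \<open>z\<close> lies in the tangent hyperplane, \<open>z - \<theta>0\<close> is orthogonal to \<open>\<theta>0\<close> for the form of
        \<open>A\<close>.\<close>
      have rz: "(\<rho> z)\<^sup>2 = 1 + (\<rho> (z - \<theta>0))\<^sup>2"
        using rho_add_sq[of \<theta>0 "z - \<theta>0"] \<theta>0 az a1 by (simp add: a_def[symmetric] inner_diff_right)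
      have "(\<rho> (z - \<theta>0))\<^sup>2 \<le> L * r\<^sup>2"
      proof -
        have "(\<rho> (z - \<theta>0))\<^sup>2 \<le> norm (A *v (z - \<theta>0)) * norm (z - \<theta>0)"
          unfolding rho_sq by (rule norm_cauchy_schwarz)
        also have "\<dots> \<le> (L * norm (z - \<theta>0)) * norm (z - \<theta>0)" by (intro mult_right_mono L) auto
        also have "\<dots> = L * (norm (z - \<theta>0))\<^sup>2" by (simp add: power2_eq_square)
        also have "\<dots> \<le> L * r\<^sup>2" using zn' L(1) by (intro mult_left_mono power_mono) auto
        finally show ?thesis .
      qed
      then have rz2: "(\<rho> z)\<^sup>2 \<le> 1 + L * r\<^sup>2" using rz by simp
      have rz_ge: "1 \<le> \<rho> z"
        by (rule power2_le_imp_le) (use rz in auto)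
      have rz_le: "\<rho> z \<le> 1 + L * r\<^sup>2"
      proof (rule power2_le_imp_le)
        have "(1 + L * r\<^sup>2) * 1 \<le> (1 + L * r\<^sup>2) * (1 + L * r\<^sup>2)" using L(1) by (intro mult_left_mono) auto
        then show "(\<rho> z)\<^sup>2 \<le> (1 + L * r\<^sup>2)\<^sup>2" using rz2 by (simp add: power2_eq_square)
      qed (use L(1) in simp)
      have z0: "z \<noteq> 0" using rz_ge rho_eq_0_iff[of z] by linarith
      have ry: "\<rho> y = q * \<rho> z" using q by (simp add: yz rho_scaleR)
      have "\<rho> y < 1"
      proof -
        have "\<rho> y \<le> q * (1 + \<epsilon>)" unfolding ry using q rz_le Lr2 by (intro mult_left_mono) auto
        also have "\<dots> < (1 - \<epsilon>) * (1 + \<epsilon>)" using q \<epsilon> by (intro mult_strict_right_mono) auto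
        also have "\<dots> \<le> 1" by (simp add: algebra_simps)
        finally show ?thesis .
      qed
      moreover have "0 < \<rho> y" unfolding ry using q rz_ge by (intro mult_pos_pos) linarith+
      moreover have "proj y \<in> C"
      proof -
        have py: "proj y = (1 / \<rho> z) *\<^sub>R z" unfolding ry by (subst yz) (use q in simp)
        have "\<rho> (proj y) = 1" unfolding py by (rule rho_proj[OF z0])
        moreover have "norm ((1 / \<rho> z) *\<^sub>R z - z) \<le> \<epsilon> * r"
        proof -
          have "(1 / \<rho> z) *\<^sub>R z - z = (1 / \<rho> z - 1) *\<^sub>R z" by (simp add: scaleR_diff_left)
          then have "norm ((1 / \<rho> z) *\<^sub>R z - z) = \<bar>1 / \<rho> z - 1\<bar> * norm z" by simp
          also have "\<dots> \<le> (L * r\<^sup>2) * (M + 1)"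
          proof (rule mult_mono)
            have "1 - 1 / \<rho> z \<le> \<rho> z - 1"
            proof -
              have "0 \<le> (\<rho> z - 1)\<^sup>2 / \<rho> z" using rz_ge by simp
              also have "(\<rho> z - 1)\<^sup>2 / \<rho> z = (\<rho> z - 1) - (1 - 1 / \<rho> z)"
                using z0 by (simp add: power2_eq_square field_simps)
              finally show ?thesis by simp
            qed
            moreover have "1 / \<rho> z \<le> 1" using rz_ge z0 by (simp add: divide_le_eq)
            ultimately show "\<bar>1 / \<rho> z - 1\<bar> \<le> L * r\<^sup>2" using rz_le by linarith
            have "norm z \<le> norm \<theta>0 + norm (z - \<theta>0)" by (metis add.commute diff_add_cancel norm_triangle_ineq)
            then show "norm z \<le> M + 1" using M(2)[OF \<theta>0] zn' r r0 by linarith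
          qed (use L(1) in auto)
          also have "\<dots> = ((M + 1) * (L * r)) * r" by (simp add: power2_eq_square)
          also have "\<dots> \<le> \<epsilon> * r" using Lr r by (intro mult_right_mono) auto
          finally show ?thesis .
        qed
        moreover have "dist \<theta>0 (proj y) \<le> norm (z - \<theta>0) + norm ((1 / \<rho> z) *\<^sub>R z - z)"
          unfolding py using norm_triangle_ineq[of "(1 / \<rho> z) *\<^sub>R z - z" "z - \<theta>0"] by (simp add: dist_norm norm_minus_commute)
        ultimately show ?thesis using zn by (simp add: C_def algebra_simps)
      qed
      ultimately show "y \<in> K" by (simp add: K_def)
    qed (use K d in auto)
    have "unit_ball_vol (real d) * ((1 - \<epsilon>) * r) ^ d * (1 - \<epsilon>) ^ Suc d
      = (norm a * real (Suc d)) * ?w"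
      by (rule cone_constant_cancel[OF a0, symmetric])
    then have "ennreal (unit_ball_vol (real d) * ((1 - \<epsilon>) * r) ^ d * (1 - \<epsilon>) ^ Suc d)
      = ennreal (norm a * real (Suc d)) * ennreal ?w"
      using \<epsilon> r by (simp only:) (intro ennreal_mult, auto)
    also have "\<dots> \<le> ennreal (norm a * real (Suc d)) * emeasure lborel K"
      by (intro mult_left_mono vol) auto
    also have "\<dots> = ennreal (norm a) * emeasure cone_measure C"
      unfolding K_def by (subst emeasure_cone_measure[OF C]) (simp add: d ennreal_mult mult.assoc)
    finally show "ennreal (unit_ball_vol (real d) * ((1 - \<epsilon>) * r) ^ d * (1 - \<epsilon>) ^ Suc d)
     \<le> ennreal (norm (A *v \<theta>0)) * emeasure cone_measure (cball \<theta>0 r \<inter> {\<theta>. \<rho> \<theta> = 1})"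
      by (simp add: a_def C_def)
  qed (rule r0(1))
qed

text \<open>On the boundary of the ellipsoid this turns out to be the surface measure.\<close>

definition area_measure :: "(real^'n) measure" where
  "area_measure = density cone_measure (\<lambda>\<theta>. ennreal (norm (A *v \<theta>)))"

lemma sets_area_measure [simp, measurable_cong]: "sets area_measure = sets borel"
  and space_area_measure [simp]: "space area_measure = UNIV"
  by (simp_all add: area_measure_def)

lemma emeasure_area_measure:
  assumes "B \<in> sets borel"
  shows "emeasure area_measure B = (\<integral>\<^sup>+\<theta>. ennreal (norm (A *v \<theta>)) * indicator B \<theta> \<partial>cone_measure)"
  unfolding area_measure_def using assms by (intro emeasure_density) auto

text \<open>
  On a small set, \<open>|A \<theta>|\<close> is nearly constant. One factor \<open>1 + \<eta>\<close> is spent on this, and \<open>d\<close> of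
  them on the diameter.
\<close>

lemma area_measure_upper:
  assumes d: "Suc d = CARD('n)" and \<epsilon>: "\<epsilon> > 0"
  shows "\<exists>\<delta>>0. \<forall>C. C \<in> sets borel \<longrightarrow> C \<noteq> {} \<longrightarrow> (\<forall>\<theta>\<in>C. \<rho> \<theta> = 1) \<longrightarrow> bounded C \<longrightarrow> diameter C \<le> \<delta> \<longrightarrow>
     emeasure area_measure C \<le> ennreal ((1 + \<epsilon>) * (unit_ball_vol (real d) * (diameter C / 2) ^ d))"
proof -
  obtain L where L: "L > 0" "\<And>x. norm (A *v x) \<le> L * norm x" using form_bounded by blast
  obtain M where M: "M \<ge> 1" "\<And>x. \<rho> x = 1 \<Longrightarrow> norm x \<le> M" using norm_rho_one_bounded by blast
  have "((\<lambda>t::real. (1 + t) ^ Suc d) \<longlongrightarrow> (1 + 0) ^ Suc d) (at_right 0)" by (intro tendsto_intros)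
  then have "eventually (\<lambda>t::real. (1 + t) ^ Suc d < 1 + \<epsilon>) (at_right 0)"
    by (rule order_tendstoD) (use \<epsilon> in auto)
  then obtain \<eta> where \<eta>: "0 < \<eta>" "(1 + \<eta>) ^ Suc d < 1 + \<epsilon>" by (elim eventually_at_right_0_obtain) blast
  obtain \<delta>1 where \<delta>1: "\<delta>1 > 0" "\<And>C \<theta>0 D. C \<in> sets borel \<Longrightarrow> (\<forall>\<theta>\<in>C. \<rho> \<theta> = 1) \<Longrightarrow> \<theta>0 \<in> C \<Longrightarrow> 0 \<le> D \<Longrightarrow> D \<le> \<delta>1 \<Longrightarrow>
     (\<forall>x\<in>C. \<forall>y\<in>C. norm (x - y) \<le> D) \<Longrightarrow>
     ennreal (norm (A *v \<theta>0)) * emeasure cone_measure C \<le> ennreal (unit_ball_vol (real d) * ((1 + \<eta>) * D / 2) ^ d)"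
    using cone_measure_upper[OF d \<eta>(1)] by blast
  define \<delta> where "\<delta> = min \<delta>1 (\<eta> / (L * M))"
  have \<delta>: "0 < \<delta>" "\<delta> \<le> \<delta>1" "L * \<delta> * M \<le> \<eta>"
  proof -
    have p: "0 < L * M" using L M by simp
    show "0 < \<delta>" "\<delta> \<le> \<delta>1" using p \<eta> \<delta>1 by (auto simp: \<delta>_def)
    have "(L * M) * \<delta> \<le> \<eta>" by (rule mult_le_of_le_divide[OF p]) (simp add: \<delta>_def)
    then show "L * \<delta> * M \<le> \<eta>" by (simp add: mult_ac)
  qed
  show ?thesis
  proof (intro exI[of _ \<delta>] conjI allI impI)
    fix C assume C[measurable]: "C \<in> sets borel" and ne: "C \<noteq> {}" and C1: "\<forall>\<theta>\<in>C. \<rho> \<theta> = 1"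
      and bd: "bounded C" and diam: "diameter C \<le> \<delta>"
    obtain \<theta>0 where \<theta>0: "\<theta>0 \<in> C" using ne by blast
    have dC: "\<forall>x\<in>C. \<forall>y\<in>C. norm (x - y) \<le> diameter C"
      using diameter_bounded_bound[OF bd] by (auto simp: dist_norm)
    define a where "a = norm (A *v \<theta>0)"
    have "1 \<le> a * M"
    proof -
      have "1 = (A *v \<theta>0) \<bullet> \<theta>0" using rho_sq[of \<theta>0] C1 \<theta>0 by simp
      also have "\<dots> \<le> a * norm \<theta>0" unfolding a_def by (rule norm_cauchy_schwarz)
      also have "\<dots> \<le> a * M" using M(2) C1 \<theta>0 by (intro mult_left_mono) (auto simp: a_def)
      finally show ?thesis .
    qed
    have le: "norm (A *v \<theta>) \<le> (1 + \<eta>) * a" if "\<theta> \<in> C" for \<theta>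
    proof -
      have "norm (A *v \<theta>) \<le> a + norm (A *v (\<theta> - \<theta>0))"
        using norm_triangle_ineq[of "A *v \<theta>0" "A *v (\<theta> - \<theta>0)"] by (simp add: a_def matrix_vector_mult_diff_distrib)
      also have "norm (A *v (\<theta> - \<theta>0)) \<le> L * \<delta>"
        using L dC that \<theta>0 diam by (intro order_trans[OF L(2)] mult_left_mono) (auto intro: order_trans)
      also have "L * \<delta> \<le> L * \<delta> * (a * M)" using mult_left_mono[OF \<open>1 \<le> a * M\<close>, of "L * \<delta>"] L \<delta> by simp
      also have "\<dots> \<le> \<eta> * a" using mult_right_mono[OF \<delta>(3), of a] by (simp add: mult_ac a_def)
      finally show ?thesis by (simp add: algebra_simps)
    qed
    have "emeasure area_measure C \<le> (\<integral>\<^sup>+\<theta>. ennreal ((1 + \<eta>) * a) * indicator C \<theta> \<partial>cone_measure)"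
      unfolding emeasure_area_measure[OF C] using le by (intro nn_integral_mono) (auto simp: indicator_def intro!: ennreal_leI)
    also have "\<dots> = ennreal ((1 + \<eta>) * a) * emeasure cone_measure C"
      by (rule nn_integral_cmult_indicator) simp
    also have "\<dots> = ennreal (1 + \<eta>) * (ennreal a * emeasure cone_measure C)"
      using \<eta> by (simp add: ennreal_mult mult.assoc a_def)
    also have "\<dots> \<le> ennreal (1 + \<eta>) * ennreal (unit_ball_vol (real d) * ((1 + \<eta>) * diameter C / 2) ^ d)"
      unfolding a_def using diam \<delta> by (intro mult_left_mono \<delta>1(2)[OF C C1 \<theta>0 diameter_ge_0[OF bd] _ dC]) auto
    also have "\<dots> = ennreal ((1 + \<eta>) * (unit_ball_vol (real d) * ((1 + \<eta>) * diameter C / 2) ^ d))"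
      using \<eta> diameter_ge_0[OF bd] by (intro ennreal_mult[symmetric]) auto
    also have "(1 + \<eta>) * (unit_ball_vol (real d) * ((1 + \<eta>) * diameter C / 2) ^ d) = (1 + \<eta>) ^ Suc d * (unit_ball_vol (real d) * (diameter C / 2) ^ d)"
      by (simp add: power_mult_distrib power_divide)
    also have "ennreal \<dots> \<le> ennreal ((1 + \<epsilon>) * (unit_ball_vol (real d) * (diameter C / 2) ^ d))"
      using \<eta> diameter_ge_0[OF bd] by (intro ennreal_leI mult_right_mono) auto
    finally show "emeasure area_measure C \<le> ennreal ((1 + \<epsilon>) * (unit_ball_vol (real d) * (diameter C / 2) ^ d))" .
  qed (rule \<delta>(1))
qed

text \<open>
  One factor \<open>1 - \<eta>\<close> is spent on the variation of \<open>|A \<theta>|\<close>, and \<open>2 d + 1\<close> of them on the bound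
  for the cone measure.
\<close>

lemma area_measure_lower:
  assumes d: "Suc d = CARD('n)" and \<epsilon>: "0 < \<epsilon>" "\<epsilon> < 1"
  shows "\<exists>r0>0. \<forall>r \<theta>0. 0 < r \<longrightarrow> r \<le> r0 \<longrightarrow> \<rho> \<theta>0 = 1 \<longrightarrow>
     ennreal ((1 - \<epsilon>) * (unit_ball_vol (real d) * r ^ d)) \<le> emeasure area_measure (cball \<theta>0 r \<inter> {\<theta>. \<rho> \<theta> = 1})"
proof -
  obtain L where L: "L > 0" "\<And>x. norm (A *v x) \<le> L * norm x" using form_bounded by blast
  obtain M where M: "M \<ge> 1" "\<And>x. \<rho> x = 1 \<Longrightarrow> norm x \<le> M" using norm_rho_one_bounded by blast
  have "((\<lambda>t::real. (1 - t) ^ (2 * d + 2)) \<longlongrightarrow> (1 - 0) ^ (2 * d + 2)) (at_right 0)" by (intro tendsto_intros)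
  then have "eventually (\<lambda>t::real. 1 - \<epsilon> < (1 - t) ^ (2 * d + 2)) (at_right 0)"
    by (rule order_tendstoD) (use \<epsilon> in auto)
  moreover have "eventually (\<lambda>t::real. t < 1) (at_right 0)"
    by (rule order_tendstoD[OF tendsto_ident_at]) simp
  ultimately have "eventually (\<lambda>t::real. 1 - \<epsilon> < (1 - t) ^ (2 * d + 2) \<and> t < 1) (at_right 0)"
    by eventually_elim auto
  then obtain \<eta> where \<eta>: "0 < \<eta>" "1 - \<epsilon> < (1 - \<eta>) ^ (2 * d + 2)" "\<eta> < 1"
    by (elim eventually_at_right_0_obtain) auto
  obtain r1 where r1: "r1 > 0" "\<And>r \<theta>0. 0 < r \<Longrightarrow> r \<le> r1 \<Longrightarrow> \<rho> \<theta>0 = 1 \<Longrightarrow>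
     ennreal (unit_ball_vol (real d) * ((1 - \<eta>) * r) ^ d * (1 - \<eta>) ^ Suc d)
     \<le> ennreal (norm (A *v \<theta>0)) * emeasure cone_measure (cball \<theta>0 r \<inter> {\<theta>. \<rho> \<theta> = 1})"
    using cone_measure_lower[OF d \<eta>(1,3)] by blast
  define \<delta> where "\<delta> = min r1 (\<eta> / (L * M))"
  have \<delta>: "0 < \<delta>" "\<delta> \<le> r1" "L * \<delta> * M \<le> \<eta>"
  proof -
    have p: "0 < L * M" using L M by simp
    show "0 < \<delta>" "\<delta> \<le> r1" using p \<eta> r1 by (auto simp: \<delta>_def)
    have "(L * M) * \<delta> \<le> \<eta>" by (rule mult_le_of_le_divide[OF p]) (simp add: \<delta>_def)
    then show "L * \<delta> * M \<le> \<eta>" by (simp add: mult_ac)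
  qed
  show ?thesis
  proof (intro exI[of _ \<delta>] conjI allI impI)
    fix r \<theta>0 assume r: "0 < r" "r \<le> \<delta>" and \<theta>0: "\<rho> \<theta>0 = 1"
    define C where "C = cball \<theta>0 r \<inter> {\<theta>. \<rho> \<theta> = 1}"
    have C[measurable]: "C \<in> sets borel" unfolding C_def by measurable
    define a where "a = norm (A *v \<theta>0)"
    have a0: "0 \<le> a" by (simp add: a_def)
    have "1 \<le> a * M"
    proof -
      have "1 = (A *v \<theta>0) \<bullet> \<theta>0" using rho_sq[of \<theta>0] \<theta>0 by simp
      also have "\<dots> \<le> a * norm \<theta>0" unfolding a_def by (rule norm_cauchy_schwarz)
      also have "\<dots> \<le> a * M" using M(2) \<theta>0 by (intro mult_left_mono) (auto simp: a_def)
      finally show ?thesis .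
    qed
    have le: "(1 - \<eta>) * a \<le> norm (A *v \<theta>)" if "\<theta> \<in> C" for \<theta>
    proof -
      have "a \<le> norm (A *v \<theta>) + norm (A *v (\<theta>0 - \<theta>))"
        using norm_triangle_ineq[of "A *v \<theta>" "A *v (\<theta>0 - \<theta>)"] by (simp add: a_def matrix_vector_mult_diff_distrib)
      also have "norm (A *v (\<theta>0 - \<theta>)) \<le> L * \<delta>"
        using L that r by (intro order_trans[OF L(2)] mult_left_mono) (auto simp: C_def dist_norm)
      also have "L * \<delta> \<le> L * \<delta> * (a * M)" using mult_left_mono[OF \<open>1 \<le> a * M\<close>, of "L * \<delta>"] L \<delta> by simp
      also have "\<dots> \<le> \<eta> * a" using mult_right_mono[OF \<delta>(3), of a] by (simp add: mult_ac a_def)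
      finally show ?thesis by (simp add: algebra_simps)
    qed
    have "ennreal ((1 - \<epsilon>) * (unit_ball_vol (real d) * r ^ d)) \<le> ennreal ((1 - \<eta>) ^ (2 * d + 2) * (unit_ball_vol (real d) * r ^ d))"
      using \<eta> r by (intro ennreal_leI mult_right_mono) auto
    also have "(1 - \<eta>) ^ (2 * d + 2) * (unit_ball_vol (real d) * r ^ d) = (1 - \<eta>) * (unit_ball_vol (real d) * ((1 - \<eta>) * r) ^ d * (1 - \<eta>) ^ Suc d)"
    proof -
      have "(1 - \<eta>) ^ (2 * d + 2) = (1 - \<eta>) * ((1 - \<eta>) ^ d * (1 - \<eta>) ^ Suc d)"
        by (simp add: mult_2 power_add)
      then show ?thesis by (simp add: power_mult_distrib del: power_Suc)
    qed
    also have "ennreal \<dots> = ennreal (1 - \<eta>) * ennreal (unit_ball_vol (real d) * ((1 - \<eta>) * r) ^ d * (1 - \<eta>) ^ Suc d)"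
      using \<eta> r by (intro ennreal_mult) auto
    also have "\<dots> \<le> ennreal (1 - \<eta>) * (ennreal a * emeasure cone_measure C)"
      unfolding a_def C_def using r \<delta> \<theta>0 by (intro mult_left_mono r1(2)) auto
    also have "\<dots> = ennreal ((1 - \<eta>) * a) * emeasure cone_measure C"
      using \<eta> a0 by (simp add: ennreal_mult mult.assoc)
    also have "\<dots> = (\<integral>\<^sup>+\<theta>. ennreal ((1 - \<eta>) * a) * indicator C \<theta> \<partial>cone_measure)"
      by (rule nn_integral_cmult_indicator[symmetric]) simp
    also have "\<dots> \<le> emeasure area_measure C"
      unfolding emeasure_area_measure[OF C] using le by (intro nn_integral_mono) (auto simp: indicator_def intro!: ennreal_leI)
    finally show "ennreal ((1 - \<epsilon>) * (unit_ball_vol (real d) * r ^ d)) \<le> emeasure area_measure (cball \<theta>0 r \<inter> {\<theta>. \<rho> \<theta> = 1})"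
      by (simp add: C_def)
  qed (rule \<delta>(1))
qed

abbreviation sphere_A :: "(real^'n) set" where "sphere_A \<equiv> {\<theta>. \<rho> \<theta> = 1}"

lemma sphere_A_borel [measurable]: "sphere_A \<in> sets borel"
  by measurable

text \<open>
  Intersecting the closures of the covering sets with the boundary of the ellipsoid makes them
  Borel and does not increase their diameters.
\<close>

lemma area_le_hausdorff_content_cover:
  assumes d: "Suc d = CARD('n)" and \<epsilon>: "\<epsilon> > 0"
  shows "\<exists>\<delta>>0. \<forall>B\<in>sets borel. B \<subseteq> sphere_A \<longrightarrow>
    ennreal (1 / (1 + \<epsilon>)) * emeasure area_measure B \<le> hausdorff_content d \<delta> B"
proof -
  obtain \<delta> where \<delta>: "\<delta> > 0" and up: "\<And>C. C \<in> sets borel \<Longrightarrow> C \<noteq> {} \<Longrightarrow> (\<forall>\<theta>\<in>C. \<rho> \<theta> = 1) \<Longrightarrow> bounded C \<Longrightarrow> diameter C \<le> \<delta> \<Longrightarrow>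
     emeasure area_measure C \<le> ennreal ((1 + \<epsilon>) * (unit_ball_vol (real d) * (diameter C / 2) ^ d))"
    using area_measure_upper[OF d \<epsilon>] by blast
  let ?w = "\<lambda>C::(real^'n) set. if C = {} then 0 else ennreal (unit_ball_vol (real d) * (diameter C / 2) ^ d)"
  have "ennreal (1 / (1 + \<epsilon>)) * emeasure area_measure B \<le> suminf (\<lambda>i. ?w (C i))"
    if B: "B \<in> sets borel" "B \<subseteq> sphere_A" and C: "B \<subseteq> (\<Union>i. C i)" "\<forall>i. bounded (C i) \<and> diameter (C i) \<le> \<delta>" for B C
  proof -
    define C' where "C' i = closure (C i) \<inter> sphere_A" for i
    have C'[measurable]: "C' i \<in> sets borel" for i unfolding C'_def by measurable
    have bd: "bounded (C' i)" for i
      using C(2) bounded_closure[of "C i"] by (auto simp: C'_def intro: bounded_subset)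
    have dm: "diameter (C' i) \<le> diameter (C i)" for i
    proof -
      have "diameter (C' i) \<le> diameter (closure (C i))"
        using C(2) by (intro diameter_subset bounded_closure) (auto simp: C'_def)
      also have "\<dots> = diameter (C i)" using C(2) by (intro diameter_closure) auto
      finally show ?thesis .
    qed
    have le: "emeasure area_measure (C' i) \<le> ennreal (1 + \<epsilon>) * ?w (C i)" for i
    proof (cases "C' i = {}")
      case False
      then have ne: "C i \<noteq> {}" by (auto simp: C'_def)
      have "emeasure area_measure (C' i) \<le> ennreal ((1 + \<epsilon>) * (unit_ball_vol (real d) * (diameter (C' i) / 2) ^ d))"
        using False bd dm[of i] C(2) by (intro up) (auto simp: C'_def intro: order_trans)
      also have "\<dots> \<le> ennreal ((1 + \<epsilon>) * (unit_ball_vol (real d) * (diameter (C i) / 2) ^ d))"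
        using \<epsilon> dm[of i] diameter_ge_0[OF bd[of i]]
        by (intro ennreal_leI mult_left_mono power_mono divide_right_mono) auto
      also have "\<dots> = ennreal (1 + \<epsilon>) * ennreal (unit_ball_vol (real d) * (diameter (C i) / 2) ^ d)"
        using \<epsilon> C(2) diameter_ge_0[of "C i"] by (intro ennreal_mult) auto
      finally show ?thesis using ne by simp
    qed simp
    have "B \<subseteq> (\<Union>i. C' i)"
    proof
      fix x assume x: "x \<in> B"
      then obtain i where "x \<in> C i" using C by blast
      then show "x \<in> (\<Union>i. C' i)" using x B closure_subset[of "C i"] by (auto simp: C'_def intro!: exI[of _ i])
    qed
    then have "emeasure area_measure B \<le> emeasure area_measure (\<Union>i. C' i)"
      by (intro emeasure_mono) auto
    also have "\<dots> \<le> suminf (\<lambda>i. emeasure area_measure (C' i))"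
      by (intro emeasure_subadditive_countably) auto
    also have "\<dots> \<le> suminf (\<lambda>i. ennreal (1 + \<epsilon>) * ?w (C i))"
      by (intro suminf_le le) auto
    also have "\<dots> = ennreal (1 + \<epsilon>) * suminf (\<lambda>i. ?w (C i))"
      by (rule ennreal_suminf_cmult)
    finally have "ennreal (1 / (1 + \<epsilon>)) * emeasure area_measure B \<le> ennreal (1 / (1 + \<epsilon>)) * (ennreal (1 + \<epsilon>) * suminf (\<lambda>i. ?w (C i)))"
      by (rule mult_left_mono) simp
    also have "\<dots> = ennreal (1 / (1 + \<epsilon>) * (1 + \<epsilon>)) * suminf (\<lambda>i. ?w (C i))"
      using \<epsilon> by (subst ennreal_mult) (auto simp: mult.assoc)
    also have "1 / (1 + \<epsilon>) * (1 + \<epsilon>) = 1" using \<epsilon> by simp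
    finally show ?thesis by simp
  qed
  then show ?thesis unfolding hausdorff_content_def using \<delta>
    by (intro exI[of _ \<delta>] conjI ballI impI INF_greatest) auto
qed

lemma finite_area_measure: "finite_measure area_measure"
proof
  obtain L where L: "L > 0" "\<And>x. norm (A *v x) \<le> L * norm x" using form_bounded by blast
  obtain M where M: "M \<ge> 1" "\<And>x. \<rho> x = 1 \<Longrightarrow> norm x \<le> M" using norm_rho_one_bounded by blast
  have "AE \<theta> in cone_measure. ennreal (norm (A *v \<theta>)) * indicator UNIV \<theta> \<le> ennreal (L * M)"
    using AE_cone_measure
  proof eventually_elim
    case (elim \<theta>)
    have "norm (A *v \<theta>) \<le> L * M" using L M(2)[OF elim] by (intro order_trans[OF L(2)] mult_left_mono) auto
    then show ?case by (simp add: ennreal_leI)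
  qed
  then have "emeasure area_measure UNIV \<le> (\<integral>\<^sup>+\<theta>. ennreal (L * M) \<partial>cone_measure)"
    unfolding emeasure_area_measure[OF sets.top[of borel, unfolded space_borel]] by (rule nn_integral_mono_AE)
  also have "\<dots> < \<infinity>"
    using finite_measure.emeasure_finite[OF finite_cone_measure, of UNIV] by (simp add: ennreal_mult_eq_top_iff less_top[symmetric])
  finally show "emeasure area_measure (space area_measure) \<noteq> \<infinity>" by simp
qed

lemma area_le_hausdorff:
  assumes d: "Suc d = CARD('n)" and B: "B \<in> sets borel" "B \<subseteq> sphere_A"
  shows "emeasure area_measure B \<le> emeasure (hausdorff_measure d) B"
proof (rule ennreal_le_epsilon)
  fix e :: real assume X: "emeasure (hausdorff_measure d) B < top" and e: "0 < e"
  then obtain x where x: "emeasure (hausdorff_measure d) B = ennreal x" "0 \<le> x"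
    by (cases "emeasure (hausdorff_measure d) B") auto
  \<comment> \<open>The denominator is \<open>x + 1\<close> since \<open>x\<close> may be 0.\<close>
  define \<epsilon> where "\<epsilon> = e / (x + 1)"
  have \<epsilon>: "0 < \<epsilon>" using e x by (simp add: \<epsilon>_def)
  obtain \<delta> where \<delta>: "\<delta> > 0" "ennreal (1 / (1 + \<epsilon>)) * emeasure area_measure B \<le> hausdorff_content d \<delta> B"
    using area_le_hausdorff_content_cover[OF d \<epsilon>] B by blast
  have "hausdorff_content d \<delta> B \<le> ennreal x"
    unfolding x(1)[symmetric] emeasure_hausdorff_measure[OF B(1)] using \<delta> by (intro SUP_upper) auto
  then have "ennreal (1 / (1 + \<epsilon>)) * emeasure area_measure B \<le> ennreal x" using \<delta>(2) by (rule order_trans[rotated])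
  then have "ennreal (1 + \<epsilon>) * (ennreal (1 / (1 + \<epsilon>)) * emeasure area_measure B) \<le> ennreal (1 + \<epsilon>) * ennreal x"
    by (rule mult_left_mono) simp
  also have "ennreal (1 + \<epsilon>) * (ennreal (1 / (1 + \<epsilon>)) * emeasure area_measure B) = ennreal ((1 + \<epsilon>) * (1 / (1 + \<epsilon>))) * emeasure area_measure B"
    using \<epsilon> by (subst ennreal_mult) (auto simp: mult.assoc)
  also have "(1 + \<epsilon>) * (1 / (1 + \<epsilon>)) = 1" using \<epsilon> by simp
  also have "ennreal (1 + \<epsilon>) * ennreal x = ennreal ((1 + \<epsilon>) * x)" using \<epsilon> x by (simp add: ennreal_mult)
  also have "\<dots> \<le> ennreal (x + e)"
  proof (rule ennreal_leI)
    have "\<epsilon> * x \<le> \<epsilon> * (x + 1)" using \<epsilon> by (intro mult_left_mono) auto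
    also have "\<dots> = e" using x by (simp add: \<epsilon>_def)
    finally show "(1 + \<epsilon>) * x \<le> x + e" by (simp add: algebra_simps)
  qed
  finally show "emeasure area_measure B \<le> emeasure (hausdorff_measure d) B + ennreal e"
    using e x by (simp add: ennreal_plus)
qed

text \<open>
  Vitali's covering lemma provides disjoint small balls centred on the boundary such that, for
  every \<open>M\<close>, the first \<open>M\<close> balls and the fivefold dilates of the others cover the boundary. As
  the balls are disjoint, the lower bound for caps shows that their contents \<open>w k\<close> have a sum of
  at most the total area divided by \<open>1 - \<epsilon>\<close>, and the dilates only contribute \<open>5\<^sup>d\<close> times a tail
  of this convergent series.
\<close>

lemma hausdorff_content_sphere_le:
  assumes d: "Suc d = CARD('n)" and \<epsilon>: "0 < \<epsilon>" "\<epsilon> < 1" and \<delta>: "0 < \<delta>"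
  shows "hausdorff_content d \<delta> sphere_A \<le> ennreal (measure area_measure sphere_A / (1 - \<epsilon>))"
proof -
  interpret F: finite_measure area_measure by (rule finite_area_measure)
  let ?\<omega> = "unit_ball_vol (real d)"
  define T where "T = measure area_measure sphere_A"
  obtain r0 where r0: "r0 > 0" and low: "\<And>r \<theta>0. 0 < r \<Longrightarrow> r \<le> r0 \<Longrightarrow> \<rho> \<theta>0 = 1 \<Longrightarrow>
     ennreal ((1 - \<epsilon>) * (?\<omega> * r ^ d)) \<le> emeasure area_measure (cball \<theta>0 r \<inter> sphere_A)"
    using area_measure_lower[OF d \<epsilon>] by blast
  \<comment> \<open>The fivefold dilates must have diameter at most \<open>\<delta>\<close>.\<close>
  define R where "R = min r0 (\<delta> / 10)"
  have R: "0 < R" "R \<le> r0" "10 * R \<le> \<delta>" using r0 \<delta> by (auto simp: R_def)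
  define K where "K = {p :: (real^'n) \<times> real. \<rho> (fst p) = 1 \<and> 0 < snd p \<and> snd p \<le> R}"
  obtain C where C: "countable C" "C \<subseteq> K"
     and disj: "pairwise (\<lambda>i j. disjnt (cball (fst i) (snd i)) (cball (fst j) (snd j))) C"
     and cover: "\<And>i. i \<in> K \<Longrightarrow> \<exists>j. j \<in> C \<and> \<not> disjnt (cball (fst i) (snd i)) (cball (fst j) (snd j)) \<and>
                        cball (fst i) (snd i) \<subseteq> ball (fst j) (5 * snd j)"
    by (rule Vitali_covering_lemma_cballs_balls[of K snd R fst]) (auto simp: K_def)
  define J where "J = to_nat_on C ` C"
  define p where "p = inv_into C (to_nat_on C)"
  have inj: "inj_on (to_nat_on C) C" using C(1) by (rule inj_on_to_nat_on)
  have pC: "p k \<in> C" "to_nat_on C (p k) = k" if "k \<in> J" for k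
    using that unfolding J_def p_def by (auto intro: inv_into_into f_inv_into_f)
  have pJ: "to_nat_on C q \<in> J" "p (to_nat_on C q) = q" if "q \<in> C" for q
    using that inj by (auto simp: J_def p_def)
  have pK: "\<rho> (fst (p k)) = 1" "0 < snd (p k)" "snd (p k) \<le> R" if "k \<in> J" for k
    using pC(1)[OF that] C(2) by (auto simp: K_def)
  define w where "w k = (if k \<in> J then ?\<omega> * snd (p k) ^ d else 0)" for k
  have w0: "0 \<le> w k" for k using pK(2)[of k] by (auto simp: w_def intro!: mult_nonneg_nonneg less_imp_le)
  define cap where "cap k = (if k \<in> J then cball (fst (p k)) (snd (p k)) \<inter> sphere_A else {})" for k
  have cap_m[measurable]: "cap k \<in> sets borel" for k unfolding cap_def by simp measurable
  have cap_disj: "disjoint_family cap"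
    unfolding disjoint_family_on_def
  proof (intro ballI impI)
    fix k l :: nat assume kl: "k \<noteq> l"
    show "cap k \<inter> cap l = {}"
    proof (cases "k \<in> J \<and> l \<in> J")
      case True
      then have "p k \<noteq> p l" using pC(2)[of k] pC(2)[of l] kl by metis
      then have "disjnt (cball (fst (p k)) (snd (p k))) (cball (fst (p l)) (snd (p l)))"
        using disj True pC(1) unfolding pairwise_def by blast
      then show ?thesis by (auto simp: cap_def disjnt_def)
    qed (auto simp: cap_def)
  qed
  have w_cap: "ennreal ((1 - \<epsilon>) * w k) \<le> emeasure area_measure (cap k)" for k
    using low[OF pK(2) _ pK(1), of k k] pK(3)[of k] R(2) by (auto simp: w_def cap_def)
  have part: "(\<Sum>k<n. w k) \<le> T / (1 - \<epsilon>)" for n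
  proof -
    have "ennreal ((1 - \<epsilon>) * (\<Sum>k<n. w k)) = (\<Sum>k<n. ennreal ((1 - \<epsilon>) * w k))"
      using \<epsilon> w0 by (simp add: sum_distrib_left sum_ennreal)
    also have "\<dots> \<le> (\<Sum>k<n. emeasure area_measure (cap k))" by (intro sum_mono w_cap)
    also have "\<dots> = emeasure area_measure (\<Union>k<n. cap k)"
      using cap_disj by (intro sum_emeasure) (auto simp: disjoint_family_on_def)
    also have "\<dots> \<le> emeasure area_measure sphere_A"
      by (intro emeasure_mono) (auto simp: cap_def split: if_splits)
    also have "\<dots> = ennreal T" unfolding T_def by (rule F.emeasure_eq_measure)
    finally have "(1 - \<epsilon>) * (\<Sum>k<n. w k) \<le> T" by (simp add: ennreal_le_iff T_def)
    then show ?thesis using \<epsilon> by (simp add: pos_le_divide_eq mult.commute)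
  qed
  have summ: "summable w" by (rule summableI_nonneg_bounded[OF w0 part])
  have W: "suminf w \<le> T / (1 - \<epsilon>)" using summ part by (rule suminf_le_const)
  have bound: "hausdorff_content d \<delta> sphere_A \<le> ennreal (suminf w + 5 ^ d * suminf (\<lambda>k. w (k + M)))" for M
  proof -
    define X where "X k = (if k \<in> J then if k < M then cball (fst (p k)) (snd (p k)) else ball (fst (p k)) (5 * snd (p k)) else {})" for k
    define v where "v k = (if k < M then w k else 5 ^ d * w k)" for k
    have v0: "0 \<le> v k" for k using w0 by (simp add: v_def)
    have vle: "v k \<le> 5 ^ d * w k" for k
      using w0[of k] mult_right_mono[of 1 "5 ^ d" "w k"] by (simp add: v_def)
    have sv: "summable v" 
      by (rule summable_comparison_test'[OF summable_mult[OF summ, of "5 ^ d"], of 0]) (use v0 vle in auto)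
    have "hausdorff_content d \<delta> sphere_A \<le> suminf (\<lambda>k. if X k = {} then 0 else ennreal (?\<omega> * (diameter (X k) / 2) ^ d))"
    proof (rule hausdorff_content_le)
      show "sphere_A \<subseteq> (\<Union>k. X k)"
      proof
        fix x assume x: "x \<in> sphere_A"
        show "x \<in> (\<Union>k. X k)"
        proof (cases "\<exists>k\<in>J. k < M \<and> x \<in> cball (fst (p k)) (snd (p k))")
          case True then show ?thesis by (auto simp: X_def)
        next
          case False
          define G where "G = (\<Union>k\<in>J \<inter> {..<M}. cball (fst (p k)) (snd (p k)))"
          have "closed G" unfolding G_def by (intro closed_UN) auto
          moreover have "x \<notin> G" using False by (auto simp: G_def)
          ultimately have "open (- G)" "x \<in> - G" by (auto simp: open_Compl)
          then obtain e where "e > 0" "ball x e \<subseteq> - G" by (meson openE)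
          then have e: "e > 0" "ball x e \<inter> G = {}" by auto
          define r where "r = min R (e / 2)"
          have r: "0 < r" "r \<le> R" "r < e" using R e by (auto simp: r_def)
          then have "(x, r) \<in> K" using x by (simp add: K_def)
          from cover[OF this] obtain j where j: "j \<in> C" "\<not> disjnt (cball x r) (cball (fst j) (snd j))"
            "cball x r \<subseteq> ball (fst j) (5 * snd j)" by auto
          define k where "k = to_nat_on C j"
          have k: "k \<in> J" "p k = j" using pJ[OF j(1)] by (auto simp: k_def)
          \<comment> \<open>The small ball about \<open>x\<close> avoids the first \<open>M\<close> balls, hence meets a later one.\<close>
          have "\<not> k < M"
          proof
            assume "k < M"
            then have "cball (fst j) (snd j) \<subseteq> G" using k by (auto simp: G_def)
            moreover have "cball x r \<subseteq> ball x e" using r by auto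
            ultimately show False using j(2) e(2) by (auto simp: disjnt_def)
          qed
          moreover have "x \<in> ball (fst j) (5 * snd j)" using j(3) r centre_in_cball[of x r] by (auto simp del: mem_cball mem_ball)
          ultimately have "x \<in> X k" using k by (simp add: X_def)
          then show ?thesis by blast
        qed
      qed
      show "bounded (X k)" for k by (simp add: X_def)
      show "diameter (X k) \<le> \<delta>" for k
        using pK(2,3)[of k] R \<delta> by (auto simp: X_def)
    qed
    also have "\<dots> \<le> suminf (\<lambda>k. ennreal (v k))"
    proof (intro suminf_le)
      fix k
      show "(if X k = {} then 0 else ennreal (?\<omega> * (diameter (X k) / 2) ^ d)) \<le> ennreal (v k)"
      proof (cases "k \<in> J")
        case True
        then show ?thesis using pK(2)[OF True]
          by (auto simp: X_def v_def w_def power_mult_distrib mult_ac)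
      qed (simp add: X_def)
    qed auto
    also have "\<dots> = ennreal (suminf v)" using sv v0 by (intro suminf_ennreal2) auto
    also have "suminf v = suminf (\<lambda>k. v (k + M)) + (\<Sum>k<M. v k)" by (rule suminf_split_initial_segment[OF sv])
    also have "(\<Sum>k<M. v k) = (\<Sum>k<M. w k)" by (intro sum.cong) (auto simp: v_def)
    also have "suminf (\<lambda>k. v (k + M)) = 5 ^ d * suminf (\<lambda>k. w (k + M))"
      unfolding v_def using summ by (simp add: suminf_mult summable_iff_shift)
    finally have "hausdorff_content d \<delta> sphere_A \<le> ennreal (5 ^ d * suminf (\<lambda>k. w (k + M)) + (\<Sum>k<M. w k))" .
    also have "\<dots> \<le> ennreal (suminf w + 5 ^ d * suminf (\<lambda>k. w (k + M)))"
      using sum_le_suminf[OF summ, of "{..<M}"] w0 by (intro ennreal_leI) auto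
    finally show ?thesis .
  qed
  have "hausdorff_content d \<delta> sphere_A \<le> ennreal (T / (1 - \<epsilon>))"
  proof (rule ennreal_le_epsilon)
    fix e :: real assume e: "0 < e"
    then have "0 < e / 5 ^ d" by simp
    from suminf_exist_split[OF this summ] obtain M where M: "norm (suminf (\<lambda>k. w (k + M))) < e / 5 ^ d" by blast
    then have "suminf (\<lambda>k. w (k + M)) < e / 5 ^ d" by (simp add: abs_less_iff)
    then have "5 ^ d * suminf (\<lambda>k. w (k + M)) < e" by (simp add: pos_less_divide_eq mult.commute)
    then have "suminf w + 5 ^ d * suminf (\<lambda>k. w (k + M)) \<le> T / (1 - \<epsilon>) + e" using W by linarith
    then have "hausdorff_content d \<delta> sphere_A \<le> ennreal (T / (1 - \<epsilon>) + e)"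
      using bound[of M] by (meson ennreal_leI order_trans)
    also have "\<dots> = ennreal (T / (1 - \<epsilon>)) + ennreal e"
      using e \<epsilon> by (intro ennreal_plus) (auto simp: T_def)
    finally show "hausdorff_content d \<delta> sphere_A \<le> ennreal (T / (1 - \<epsilon>)) + ennreal e" .
  qed
  then show ?thesis by (simp add: T_def)
qed

lemma hausdorff_sphere_le:
  assumes d: "Suc d = CARD('n)"
  shows "emeasure (hausdorff_measure d) sphere_A \<le> emeasure area_measure sphere_A"
  unfolding emeasure_hausdorff_measure[OF sphere_A_borel]
proof (rule SUP_least)
  interpret F: finite_measure area_measure by (rule finite_area_measure)
  fix \<delta> :: real assume "\<delta> \<in> {0<..}"
  then have \<delta>: "0 < \<delta>" by simp
  have "((\<lambda>t. ennreal (measure area_measure sphere_A / (1 - t))) \<longlongrightarrow> ennreal (measure area_measure sphere_A / (1 - 0))) (at_right 0)"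
    by (intro tendsto_intros) auto
  moreover have "eventually (\<lambda>t::real. hausdorff_content d \<delta> sphere_A \<le> ennreal (measure area_measure sphere_A / (1 - t))) (at_right 0)"
  proof -
    have "eventually (\<lambda>t::real. t < 1) (at_right 0)"
      by (rule order_tendstoD[OF tendsto_ident_at]) simp
    with eventually_at_right_less[of "0::real"] show ?thesis
    proof eventually_elim
      case (elim t)
      then show ?case by (intro hausdorff_content_sphere_le[OF d _ _ \<delta>]) auto
    qed
  qed
  ultimately have "hausdorff_content d \<delta> sphere_A \<le> ennreal (measure area_measure sphere_A / (1 - 0))"
    by (rule tendsto_lowerbound) simp
  then show "hausdorff_content d \<delta> sphere_A \<le> emeasure area_measure sphere_A"
    by (simp add: F.emeasure_eq_measure)
qed

text \<open>
  One inequality holds for every Borel set, hence also for complements, and the reverse one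
  holds for the whole boundary, which has finite area.
\<close>

lemma hausdorff_eq_area:
  assumes d: "Suc d = CARD('n)" and B: "B \<in> sets borel" "B \<subseteq> sphere_A"
  shows "emeasure (hausdorff_measure d) B = emeasure area_measure B"
proof (rule antisym)
  interpret F: finite_measure area_measure by (rule finite_area_measure)
  let ?H = "emeasure (hausdorff_measure d)" and ?A = "emeasure area_measure"
  have m: "sphere_A - B \<in> sets borel" using B by (intro sets.Diff) auto
  have un: "B \<union> (sphere_A - B) = sphere_A" using B by auto
  have "?H B + ?A (sphere_A - B) \<le> ?H B + ?H (sphere_A - B)"
    by (intro add_left_mono area_le_hausdorff[OF d m]) auto
  also have "\<dots> = ?H sphere_A" using B m un plus_emeasure[of B "hausdorff_measure d" "sphere_A - B"] by simp
  also have "\<dots> \<le> ?A sphere_A" by (rule hausdorff_sphere_le[OF d])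
  also have "\<dots> = ?A B + ?A (sphere_A - B)" using B m un plus_emeasure[of B area_measure "sphere_A - B"] by simp
  finally show "?H B \<le> ?A B" using F.emeasure_finite[of "sphere_A - B"]
    by (simp add: add.commute[of _ "?A (sphere_A - B)"] ennreal_add_left_cancel_le)
  show "?A B \<le> ?H B" by (rule area_le_hausdorff[OF d B])
qed

text \<open>The weight \<open>1 / |A \<theta>|\<close> cancels the density of the surface measure.\<close>

lemma surface_integral_cone:
  fixes g :: "real^'n \<Rightarrow> real"
  assumes g[measurable]: "g \<in> borel_measurable borel"
  shows "(LINT \<theta>|surface_measure (frontier (ellipsoid A)). g \<theta> / norm (A *v \<theta>)) = (LINT \<theta>|cone_measure. g \<theta>)"
proof -
  define d where "d = DIM(real^'n) - 1"
  have d: "Suc d = CARD('n)" by (simp add: d_def)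
  let ?f = "\<lambda>\<theta>. g \<theta> / norm (A *v \<theta>)"
  have eq: "restrict_space (hausdorff_measure d) sphere_A = restrict_space area_measure sphere_A"
  proof (rule measure_eqI)
    fix B assume B: "B \<in> sets (restrict_space (hausdorff_measure d) sphere_A)"
    then have B': "B \<in> sets borel" "B \<subseteq> sphere_A"
      by (auto simp: sets_restrict_space_iff sphere_A_borel)
    show "emeasure (restrict_space (hausdorff_measure d) sphere_A) B = emeasure (restrict_space area_measure sphere_A) B"
      using B' hausdorff_eq_area[OF d B'] by (simp add: emeasure_restrict_space)
  qed (simp add: sets_restrict_space)
  have "(LINT \<theta>|surface_measure (frontier (ellipsoid A)). ?f \<theta>) = (LINT \<theta>|restrict_space area_measure sphere_A. ?f \<theta>)"
    unfolding surface_measure_def frontier_ellipsoid d_def[symmetric] eq ..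
  also have "\<dots> = (LINT \<theta>|area_measure. indicator sphere_A \<theta> *\<^sub>R ?f \<theta>)"
    by (rule integral_restrict_space) simp
  also have "\<dots> = (LINT \<theta>|cone_measure. norm (A *v \<theta>) *\<^sub>R (indicator sphere_A \<theta> *\<^sub>R ?f \<theta>))"
    unfolding area_measure_def by (rule integral_density) auto
  also have "\<dots> = (LINT \<theta>|cone_measure. g \<theta>)"
  proof (rule integral_cong_AE)
    show "AE \<theta> in cone_measure. norm (A *v \<theta>) *\<^sub>R (indicator sphere_A \<theta> *\<^sub>R ?f \<theta>) = g \<theta>"
      using AE_cone_measure
    proof eventually_elim
      case (elim \<theta>)
      have "A *v \<theta> \<noteq> 0"
      proof
        assume "A *v \<theta> = 0"
        then have "\<rho> \<theta> = 0" by (simp add: \<rho>_def)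
        then show False using elim by simp
      qed
      then show ?case using elim by simp
    qed
  qed measurable
  finally show ?thesis .
qed

end

section \<open>Moments of the central difference\<close>

text \<open>
  Up to the factor \<open>i!\<close>, the sum is the coefficient of \<open>x\<^sup>i\<close> in \<open>(1 - e\<^sup>x)\<^sup>N e\<^sup>-\<^sup>c\<^sup>x\<close>, which is
  divisible by \<open>x\<^sup>N\<close>.
\<close>

lemma alternating_power_sum_eq_0:
  fixes c :: real
  assumes "i < N"
  shows "(\<Sum>l\<le>N. (-1) ^ l * real (N choose l) * (real l - c) ^ i) = 0"
proof -
  define E where "E = (fps_exp 1 :: real fps)"
  have "(1 - E) ^ N * fps_exp (- c) = (\<Sum>l\<le>N. of_nat (N choose l) * (- E) ^ l * 1 ^ (N - l)) * fps_exp (- c)"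
    using binomial_ring[of "- E" 1 N] by simp
  also have "\<dots> = (\<Sum>l\<le>N. fps_const ((-1) ^ l * real (N choose l)) * fps_exp (real l - c))"
    unfolding sum_distrib_right
  proof (rule sum.cong[OF refl])
    fix l
    have "(- E) ^ l = fps_const ((-1) ^ l) * fps_exp (real l)"
    proof -
      have "(- E) ^ l = (-1) ^ l * E ^ l" by (rule power_minus)
      also have "E ^ l = fps_exp (real l)" by (simp add: E_def fps_exp_power_mult)
      also have "(-1 :: real fps) ^ l = fps_const ((-1) ^ l)" by (cases "even l") auto
      finally show ?thesis .
    qed
    moreover have "(of_nat (N choose l) :: real fps) = fps_const (real (N choose l))"
      by (simp add: fps_of_nat)
    moreover have "fps_exp (real l - c) = fps_exp (real l) * fps_exp (- c)"
      using fps_exp_add_mult[of "real l" "- c"] by simp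
    ultimately show "of_nat (N choose l) * (- E) ^ l * 1 ^ (N - l) * fps_exp (- c) =
        fps_const ((-1) ^ l * real (N choose l)) * fps_exp (real l - c)"
      by (simp add: mult_ac flip: fps_const_mult)
  qed
  finally have eq: "(1 - E) ^ N * fps_exp (- c) = (\<Sum>l\<le>N. fps_const ((-1) ^ l * real (N choose l)) * fps_exp (real l - c))" .
  have "fps_nth ((1 - E) ^ N * fps_exp (- c)) i = 0"
  proof -
    have "fps_nth (1 - E) 0 = 0" by (simp add: E_def)
    then have "fps_nth ((1 - E) ^ N) k = 0" if "k < N" for k
      using startsby_zero_power_prefix[of "1 - E" N] that by auto
    then show ?thesis using assms by (simp add: fps_mult_nth)
  qed
  then have "(\<Sum>l\<le>N. ((-1) ^ l * real (N choose l)) * ((real l - c) ^ i / fact i)) = 0"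
    unfolding eq by (simp add: fps_sum_nth)
  then have "(\<Sum>l\<le>N. (-1) ^ l * real (N choose l) * (real l - c) ^ i) / fact i = 0"
    by (simp add: sum_divide_distrib)
  then show ?thesis by simp
qed

definition diff_coeff :: "nat \<Rightarrow> int \<Rightarrow> real" where
  "diff_coeff m k = (-1) powi k * real ((2 * m) choose nat (int m - k))"

lemma central_diff_coeff: "central_diff m u x y = (\<Sum>k = - int m..int m. diff_coeff m k * u (x + of_int k *\<^sub>R y))"
  by (simp add: central_diff_def diff_coeff_def)

text \<open>
  The index \<open>l = m - k\<close> turns this into an alternating binomial sum. It is the reason why
  differences of order \<open>2 m\<close> annihilate polynomials of degree less than \<open>2 m\<close>.
\<close>

lemma central_moment_eq_0:
  assumes "i < 2 * m"
  shows "(\<Sum>k = - int m..int m. diff_coeff m k * of_int k ^ i) = 0"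
proof -
  have "(\<Sum>k = - int m..int m. diff_coeff m k * of_int k ^ i) = (\<Sum>l\<le>2 * m. diff_coeff m (int m - int l) * of_int (int m - int l) ^ i)"
    by (rule sum.reindex_bij_witness[of _ "\<lambda>l. int m - int l" "\<lambda>k. nat (int m - k)"]) auto
  also have "\<dots> = (\<Sum>l\<le>2 * m. (-1) ^ (m + i) * ((-1) ^ l * real ((2 * m) choose l) * (real l - real m) ^ i))"
  proof (rule sum.cong[OF refl])
    fix l
    have "(-1 :: real) powi (int m - int l) = (-1) ^ (m + l)"
      by (cases "even l"; cases "even m") (simp_all add: power_int_diff power_add)
    moreover have "(of_int (int m - int l) :: real) ^ i = (-1) ^ i * (real l - real m) ^ i"
      by (simp flip: power_mult_distrib)
    ultimately show "diff_coeff m (int m - int l) * of_int (int m - int l) ^ i =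
       (-1) ^ (m + i) * ((-1) ^ l * real ((2 * m) choose l) * (real l - real m) ^ i)"
      by (simp add: diff_coeff_def power_add)
  qed
  also have "\<dots> = 0"
    unfolding sum_distrib_left[symmetric] by (simp add: alternating_power_sum_eq_0[OF assms])
  finally show ?thesis .
qed

lemma diff_coeff_minus: "diff_coeff m (- int k) = diff_coeff m (int k)" if "k \<le> m"
proof -
  have "nat (int m + int k) = 2 * m - (m - k)" using that by simp
  moreover have "nat (int m - int k) = m - k" by simp
  moreover have "(2 * m) choose (m - k) = (2 * m) choose (2 * m - (m - k))"
    by (rule binomial_symmetric) simp
  ultimately show ?thesis by (simp add: diff_coeff_def power_int_minus) (metis inverse_minus_eq inverse_1 power_inverse)
qed

lemma sum_symmetric_int:
  fixes f :: "int \<Rightarrow> real"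
  shows "(\<Sum>k = - int m..int m. f k) = f 0 + (\<Sum>k = 1..m. f (int k) + f (- int k))"
proof (induction m)
  case (Suc m)
  have "{- int (Suc m)..int (Suc m)} = insert (int (Suc m)) (insert (- int (Suc m)) {- int m..int m})" by auto
  then show ?case using Suc by simp
qed simp

definition diff_weight :: "nat \<Rightarrow> nat \<Rightarrow> real" where "diff_weight m k = (-1) ^ k * real ((2 * m) choose (m - k))"

lemma diff_coeff_of_nat: "diff_coeff m (int k) = diff_weight m k"
proof -
  have "nat (int m - int k) = m - k" by simp
  then show ?thesis by (simp add: diff_coeff_def diff_weight_def)
qed

lemma central_diff_symmetric:
  "central_diff m (v :: real \<Rightarrow> real) 0 t = diff_weight m 0 * v 0 + (\<Sum>k = 1..m. diff_weight m k * (v (real k * t) + v (- (real k * t))))"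
proof -
  have "central_diff m v 0 t = diff_coeff m (int 0) * v 0 + (\<Sum>k = 1..m. diff_coeff m (int k) * v (real k * t) + diff_coeff m (- int k) * v (- (real k * t)))"
    unfolding central_diff_coeff sum_symmetric_int by simp
  also have "(\<Sum>k = 1..m. diff_coeff m (int k) * v (real k * t) + diff_coeff m (- int k) * v (- (real k * t)))
     = (\<Sum>k = 1..m. diff_weight m k * (v (real k * t) + v (- (real k * t))))"
    by (intro sum.cong refl) (simp add: diff_coeff_minus diff_coeff_of_nat distrib_left)
  finally show ?thesis by (simp only: diff_coeff_of_nat)
qed

lemma diff_weight_even_moment:
  assumes "1 \<le> i" "i < m"
  shows "(\<Sum>k = 1..m. diff_weight m k * real k ^ (2 * i)) = 0"
proof -
  have "0 = (\<Sum>k = - int m..int m. diff_coeff m k * of_int k ^ (2 * i))"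
    by (rule central_moment_eq_0[symmetric]) (use assms in simp)
  also have "\<dots> = (\<Sum>k = 1..m. diff_coeff m (int k) * real k ^ (2 * i) + diff_coeff m (- int k) * real k ^ (2 * i))"
    unfolding sum_symmetric_int using assms by simp
  also have "\<dots> = (\<Sum>k = 1..m. 2 * (diff_weight m k * real k ^ (2 * i)))"
    by (intro sum.cong refl) (simp add: diff_coeff_minus diff_coeff_of_nat)
  finally show ?thesis by (simp add: sum_distrib_left[symmetric])
qed

text \<open>
  The elements of \<open>Z\<close> are added in increasing order, and the new zero lies between the last two
  of them. The last clause keeps the zeros found before below it, which makes all of them
  distinct.
\<close>

lemma Rolle_zeros:
  fixes g g' :: "real \<Rightarrow> real"
  assumes der: "\<And>x. (g has_real_derivative g' x) (at x)"
    and "finite Z" "\<And>x. x \<in> Z \<Longrightarrow> g x = 0"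
  shows "\<exists>Z'. finite Z' \<and> card Z \<le> Suc (card Z') \<and> Z' \<inter> Z = {} \<and> (\<forall>x\<in>Z'. g' x = 0 \<and> (\<exists>a\<in>Z. x < a))"
  using assms(2,3)
proof (induction Z rule: finite_linorder_max_induct)
  case empty
  show ?case by (rule exI[of _ "{}"]) auto
next
  case (insert b Z)
  then obtain Z' where Z': "finite Z'" "card Z \<le> Suc (card Z')" "Z' \<inter> Z = {}" "\<forall>x\<in>Z'. g' x = 0 \<and> (\<exists>a\<in>Z. x < a)"
    by auto
  show ?case
  proof (cases "Z = {}")
    case True
    then show ?thesis by (intro exI[of _ "{}"]) auto
  next
    case False
    define y where "y = Max Z"
    have y: "y \<in> Z" "\<And>a. a \<in> Z \<Longrightarrow> a \<le> y" using False insert.hyps by (auto simp: y_def)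
    have yb: "y < b" using y insert.hyps by auto
    have "\<exists>x. y < x \<and> x < b \<and> DERIV g x :> 0"
    proof (rule Rolle[OF yb])
      show "g y = g b" using insert.prems y by auto
      show "continuous_on {y..b} g" using der by (meson DERIV_continuous_on has_field_derivative_at_within)
      show "\<And>x. y < x \<Longrightarrow> x < b \<Longrightarrow> g differentiable (at x)" using der real_differentiable_def by blast
    qed
    then obtain x where x: "y < x" "x < b" "DERIV g x :> 0" by blast
    have gx: "g' x = 0" using DERIV_unique[OF der x(3)] .
    have "x \<notin> Z'" using Z'(4) y x by force
    then have "card (insert b Z) \<le> Suc (card (insert x Z'))"
      using Z' insert.hyps by (simp add: card_insert_if)
    moreover have "insert x Z' \<inter> insert b Z = {}"
      using Z'(3,4) y x insert.hyps(2) by force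
    moreover have "\<forall>x\<in>insert x Z'. g' x = 0 \<and> (\<exists>a\<in>insert b Z. x < a)"
      using Z'(4) gx x by auto
    ultimately show ?thesis using Z'(1) by (intro exI[of _ "insert x Z'"]) auto
  qed
qed

text \<open>
  A non-trivial exponential sum has fewer real zeros than terms: division by one of the
  exponentials and differentiation remove a term and, by Rolle's theorem, at most one zero.
\<close>

lemma exponential_sum_zeros:
  fixes lam :: "'k \<Rightarrow> real" and c :: "'k \<Rightarrow> real"
  assumes "finite K" "inj_on lam K" "finite Z"
    "\<And>x. x \<in> Z \<Longrightarrow> (\<Sum>k\<in>K. c k * exp (lam k * x)) = 0" "card K \<le> card Z"
  shows "\<forall>k\<in>K. c k = 0"
  using assms
proof (induction K arbitrary: Z c lam rule: finite_induct)
  case (insert k0 K)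
  define g where "g x = c k0 + (\<Sum>k\<in>K. c k * exp ((lam k - lam k0) * x))" for x
  define g' where "g' x = (\<Sum>k\<in>K. (c k * (lam k - lam k0)) * exp ((lam k - lam k0) * x))" for x
  have der: "(g has_real_derivative g' x) (at x)" for x
    unfolding g_def g'_def by (auto intro!: derivative_eq_intros sum.cong)
  have g0: "g x = 0" if "x \<in> Z" for x
  proof -
    have "exp (lam k0 * x) * g x = (\<Sum>k\<in>insert k0 K. c k * exp (lam k * x))"
      using insert.hyps unfolding g_def
      by (simp add: distrib_left sum_distrib_left mult.left_commute left_diff_distrib exp_diff)
    then show ?thesis using insert.prems(3)[OF that] by simp
  qed
  obtain Z' where Z': "finite Z'" "card Z \<le> Suc (card Z')" "\<forall>x\<in>Z'. g' x = 0 \<and> (\<exists>a\<in>Z. x < a)"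
    using Rolle_zeros[OF der insert.prems(2) g0] by blast
  have "\<forall>k\<in>K. c k * (lam k - lam k0) = 0"
  proof (rule insert.IH[of "\<lambda>k. lam k - lam k0" Z'])
    show "inj_on (\<lambda>k. lam k - lam k0) K" using insert.prems(1) by (auto simp: inj_on_def)
    show "(\<Sum>k\<in>K. c k * (lam k - lam k0) * exp ((lam k - lam k0) * x)) = 0" if "x \<in> Z'" for x
      using Z'(3) that by (simp add: g'_def)
    show "card K \<le> card Z'" using insert.prems(4) insert.hyps Z'(2) by simp
  qed (rule Z'(1))
  moreover have "lam k \<noteq> lam k0" if "k \<in> K" for k
    using insert.prems(1) insert.hyps that by (auto simp: inj_on_def)
  ultimately have cK: "\<forall>k\<in>K. c k = 0" by auto
  have "Z \<noteq> {}" using insert.prems(4) insert.hyps by auto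
  then obtain x where "x \<in> Z" by blast
  from g0[OF this] have "c k0 = 0" using cK by (simp add: g_def)
  with cK show ?case by simp
qed simp

text \<open>
  These are the sums in the normalising constant of the fractional Laplacian, of non-integer and
  of integer order respectively.
\<close>

definition power_moment :: "nat \<Rightarrow> real \<Rightarrow> real" where "power_moment m s = (\<Sum>k = 1..m. diff_weight m k * real k powr (2 * s))"
definition log_moment :: "nat \<Rightarrow> real \<Rightarrow> real" where "log_moment m s = (\<Sum>k = 1..m. diff_weight m k * real k powr (2 * s) * ln (real k))"

lemma diff_weight_nonzero: "diff_weight m k \<noteq> 0"
  by (auto simp: diff_weight_def)

lemma power_moment_nat: assumes "1 \<le> i" "i < m" shows "power_moment m (real i) = 0"
proof -
  have "real k powr (2 * real i) = real k ^ (2 * i)" if "k \<in> {1..m}" for k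
    using that powr_realpow[of "real k" "2 * i"] by simp
  then show ?thesis unfolding power_moment_def using diff_weight_even_moment[OF assms] by simp
qed

text \<open>
  As a function of \<open>s\<close> this is an exponential sum with \<open>m\<close> terms and with the zeros
  \<open>1, \<dots>, m - 1\<close>; another zero would be too many.
\<close>

lemma power_moment_nonzero:
  assumes s: "0 < s" "s < real m" "s \<notin> \<nat>"
  shows "power_moment m s \<noteq> 0"
proof
  assume 0: "power_moment m s = 0"
  define Z where "Z = insert s (real ` {1..<m})"
  have "\<forall>k\<in>{1..m}. diff_weight m k = 0"
  proof (rule exponential_sum_zeros[where lam="\<lambda>k. 2 * ln (real k)" and Z=Z])
    show "inj_on (\<lambda>k. 2 * ln (real k)) {1..m}" by (auto simp: inj_on_def)
    show "finite Z" by (simp add: Z_def)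
    have "s \<notin> real ` {1..<m}" using s(3) by auto
    then show "card {1..m} \<le> card Z" using s by (simp add: Z_def card_image)
    fix x assume "x \<in> Z"
    then have "power_moment m x = 0" using 0 power_moment_nat by (auto simp: Z_def)
    then show "(\<Sum>k = 1..m. diff_weight m k * exp (2 * ln (real k) * x)) = 0"
      by (simp add: power_moment_def powr_def mult_ac)
  qed simp
  moreover have "1 \<le> m" using s by linarith
  ultimately show False using diff_weight_nonzero[of m 1] by auto
qed

text \<open>
  Twice the logarithmic moment is the derivative of the power moment, and has only \<open>m - 1\<close> terms
  as \<open>ln 1 = 0\<close>. Rolle's theorem gives \<open>m - 2\<close> zeros different from \<open>1, \<dots>, m - 1\<close>, so none of
  the latter is a zero.
\<close>

lemma log_moment_nonzero:
  assumes s: "1 \<le> i" "i < m"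
  shows "log_moment m (real i) \<noteq> 0"
proof
  assume 0: "log_moment m (real i) = 0"
  define g' where "g' x = (\<Sum>k = 1..m. diff_weight m k * (2 * ln (real k)) * exp (2 * ln (real k) * x))" for x
  have D: "power_moment m x = (\<Sum>k = 1..m. diff_weight m k * exp (2 * ln (real k) * x))" for x
    by (simp add: power_moment_def powr_def mult_ac)
  have der: "(power_moment m has_real_derivative g' x) (at x)" for x
    unfolding D[abs_def] g'_def by (auto intro!: derivative_eq_intros sum.cong)
  have z: "power_moment m x = 0" if "x \<in> real ` {1..<m}" for x using that power_moment_nat by auto
  have "\<exists>Z'. finite Z' \<and> card (real ` {1..<m}) \<le> Suc (card Z') \<and> Z' \<inter> real ` {1..<m} = {} \<and>
     (\<forall>x\<in>Z'. g' x = 0 \<and> (\<exists>a\<in>real ` {1..<m}. x < a))"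
    by (rule Rolle_zeros[OF der]) (auto intro: z)
  then obtain Z' where Z'0: "finite Z' \<and> card (real ` {1..<m}) \<le> Suc (card Z') \<and> Z' \<inter> real ` {1..<m} = {} \<and>
     (\<forall>x\<in>Z'. g' x = 0 \<and> (\<exists>a\<in>real ` {1..<m}. x < a))" by (rule exE)
  note Z' = Z'0[THEN conjunct1] Z'0[THEN conjunct2, THEN conjunct1]
    Z'0[THEN conjunct2, THEN conjunct2, THEN conjunct1] Z'0[THEN conjunct2, THEN conjunct2, THEN conjunct2]
  \<comment> \<open>The term with \<open>k = 1\<close> vanishes.\<close>
  have g'2: "g' x = (\<Sum>k = 2..m. diff_weight m k * (2 * ln (real k)) * exp (2 * ln (real k) * x))" for x
  proof -
    have "{1..m} = insert 1 {2..m}" using s by auto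
    then show ?thesis by (simp add: g'_def)
  qed
  have g'i: "g' (real i) = 0"
  proof -
    have "g' (real i) = 2 * log_moment m (real i)"
      unfolding g'_def log_moment_def sum_distrib_left by (intro sum.cong refl) (simp add: powr_def mult_ac)
    then show ?thesis using 0 by simp
  qed
  have "\<forall>k\<in>{2..m}. diff_weight m k * (2 * ln (real k)) = 0"
  proof (rule exponential_sum_zeros[where lam="\<lambda>k. 2 * ln (real k)" and Z="insert (real i) Z'"])
    show "inj_on (\<lambda>k. 2 * ln (real k)) {2..m}" by (auto simp: inj_on_def)
    have "real i \<notin> Z'" using Z'(3) s by auto
    then show "card {2..m} \<le> card (insert (real i) Z')" using Z'(1,2) s by (simp add: card_image)
    show "(\<Sum>k = 2..m. diff_weight m k * (2 * ln (real k)) * exp (2 * ln (real k) * x)) = 0" if "x \<in> insert (real i) Z'" for x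
      using that g'i Z'(4) g'2 by auto
  qed (use Z' in auto)
  then have "diff_weight m 2 * (2 * ln (real 2)) = 0" using s by auto
  then show False using diff_weight_nonzero[of m 2] by simp
qed

section \<open>Finite parts\<close>

text \<open>
  Hadamard's finite part at 0: \<open>F\<close> is the limit that is left after subtraction of finitely many
  multiples of negative powers of \<open>\<epsilon>\<close>.
\<close>

definition finite_part :: "(real \<Rightarrow> real) \<Rightarrow> real \<Rightarrow> bool" where
  "finite_part X F \<longleftrightarrow> (\<exists>S a. finite S \<and> (\<forall>e\<in>S. 0 < e) \<and>
     ((\<lambda>\<epsilon>. X \<epsilon> - (\<Sum>e\<in>S. a e * \<epsilon> powr (- e))) \<longlongrightarrow> F) (at_right 0))"

lemma finite_partI:
  assumes "finite S" "\<forall>e\<in>S. 0 < e" "((\<lambda>\<epsilon>. X \<epsilon> - (\<Sum>e\<in>S. a e * \<epsilon> powr (- e))) \<longlongrightarrow> F) (at_right 0)"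
  shows "finite_part X F"
  unfolding finite_part_def by (intro exI[of _ S] exI[of _ a] conjI assms)

lemma finite_part_tendsto: "(X \<longlongrightarrow> F) (at_right 0) \<Longrightarrow> finite_part X F"
  unfolding finite_part_def by (intro exI[of _ "{}"] exI[of _ "\<lambda>_. 0"]) auto

lemma finite_part_cong:
  assumes "finite_part X F" "eventually (\<lambda>\<epsilon>. X \<epsilon> = Y \<epsilon>) (at_right 0)"
  shows "finite_part Y F"
proof -
  obtain S a where S: "finite S" "\<forall>e\<in>S. 0 < e" and l: "((\<lambda>\<epsilon>. X \<epsilon> - (\<Sum>e\<in>S. a e * \<epsilon> powr (- e))) \<longlongrightarrow> F) (at_right 0)"
    using assms(1) unfolding finite_part_def by blast
  have "((\<lambda>\<epsilon>. Y \<epsilon> - (\<Sum>e\<in>S. a e * \<epsilon> powr (- e))) \<longlongrightarrow> F) (at_right 0)"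
    by (rule Lim_transform_eventually[OF l]) (use assms(2) in eventually_elim, simp)
  then show ?thesis by (rule finite_partI[OF S])
qed

lemma finite_part_add:
  assumes "finite_part X F" "finite_part Y G"
  shows "finite_part (\<lambda>\<epsilon>. X \<epsilon> + Y \<epsilon>) (F + G)"
proof -
  obtain S a where S: "finite S" "\<forall>e\<in>S. 0 < e" and l: "((\<lambda>\<epsilon>. X \<epsilon> - (\<Sum>e\<in>S. a e * \<epsilon> powr (- e))) \<longlongrightarrow> F) (at_right 0)"
    using assms(1) unfolding finite_part_def by blast
  obtain S' a' where S': "finite S'" "\<forall>e\<in>S'. 0 < e" and l': "((\<lambda>\<epsilon>. Y \<epsilon> - (\<Sum>e\<in>S'. a' e * \<epsilon> powr (- e))) \<longlongrightarrow> G) (at_right 0)"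
    using assms(2) unfolding finite_part_def by blast
  define A where "A e = (if e \<in> S then a e else 0) + (if e \<in> S' then a' e else 0)" for e
  have "(\<Sum>e\<in>S \<union> S'. A e * \<epsilon> powr (- e)) = (\<Sum>e\<in>S. a e * \<epsilon> powr (- e)) + (\<Sum>e\<in>S'. a' e * \<epsilon> powr (- e))" for \<epsilon>
  proof -
    have "(\<Sum>e\<in>S \<union> S'. A e * \<epsilon> powr (- e)) = (\<Sum>e\<in>S \<union> S'. if e \<in> S then a e * \<epsilon> powr (- e) else 0) + (\<Sum>e\<in>S \<union> S'. if e \<in> S' then a' e * \<epsilon> powr (- e) else 0)"
      unfolding sum.distrib[symmetric] by (intro sum.cong refl) (auto simp: A_def distrib_right)
    then show ?thesis using S(1) S'(1) by (simp add: sum.inter_restrict[symmetric] Int_absorb1 Int_absorb2)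
  qed
  then have "((\<lambda>\<epsilon>. (X \<epsilon> + Y \<epsilon>) - (\<Sum>e\<in>S \<union> S'. A e * \<epsilon> powr (- e))) \<longlongrightarrow> F + G) (at_right 0)"
    using tendsto_add[OF l l'] by (simp add: algebra_simps)
  moreover have "finite (S \<union> S')" "\<forall>e\<in>S \<union> S'. 0 < e" using S S' by auto
  ultimately show ?thesis by (intro finite_partI[of "S \<union> S'" _ A])
qed

lemma finite_part_cmult:
  assumes "finite_part X F"
  shows "finite_part (\<lambda>\<epsilon>. c * X \<epsilon>) (c * F)"
proof -
  obtain S a where S: "finite S" "\<forall>e\<in>S. 0 < e" and l: "((\<lambda>\<epsilon>. X \<epsilon> - (\<Sum>e\<in>S. a e * \<epsilon> powr (- e))) \<longlongrightarrow> F) (at_right 0)"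
    using assms(1) unfolding finite_part_def by blast
  have "((\<lambda>\<epsilon>. c * X \<epsilon> - (\<Sum>e\<in>S. (c * a e) * \<epsilon> powr (- e))) \<longlongrightarrow> c * F) (at_right 0)"
    using tendsto_mult_left[OF l, of c] by (simp add: right_diff_distrib sum_distrib_left mult.assoc)
  then show ?thesis by (rule finite_partI[OF S])
qed

lemma finite_part_sum:
  assumes "finite I" "\<And>i. i \<in> I \<Longrightarrow> finite_part (X i) (F i)"
  shows "finite_part (\<lambda>\<epsilon>. \<Sum>i\<in>I. X i \<epsilon>) (\<Sum>i\<in>I. F i)"
  using assms by (induction I rule: finite_induct) (auto intro: finite_part_add finite_part_tendsto)

lemma powr_tendsto_0_at_right: "0 < e \<Longrightarrow> ((\<lambda>\<epsilon>::real. \<epsilon> powr e) \<longlongrightarrow> 0) (at_right 0)"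
  by (rule tendsto_zero_powrI[OF tendsto_ident_at tendsto_const])
    (auto intro: eventually_mono[OF eventually_at_right_less])

lemma finite_part_powr:
  assumes "e \<noteq> 0"
  shows "finite_part (\<lambda>\<epsilon>. c * \<epsilon> powr e) 0"
proof (cases "e > 0")
  case True
  have "((\<lambda>\<epsilon>::real. \<epsilon> powr e) \<longlongrightarrow> 0) (at_right 0)"
    using True by (intro powr_tendsto_0_at_right) 
  from tendsto_mult_left[OF this, of c] show ?thesis by (intro finite_part_tendsto) simp
next
  case False
  then show ?thesis using assms by (intro finite_partI[where S="{-e}" and a="\<lambda>_. c"]) auto
qed

text \<open>
  Negative powers of \<open>k \<epsilon>\<close> are multiples of the same powers of \<open>\<epsilon>\<close>. A logarithm would spoil
  this.
\<close>

lemma finite_part_dilate: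
  assumes "finite_part X F" "0 < k"
  shows "finite_part (\<lambda>\<epsilon>. X (k * \<epsilon>)) F"
proof -
  obtain S a where S: "finite S" "\<forall>e\<in>S. 0 < e" and l: "((\<lambda>\<epsilon>. X \<epsilon> - (\<Sum>e\<in>S. a e * \<epsilon> powr (- e))) \<longlongrightarrow> F) (at_right 0)"
    using assms(1) unfolding finite_part_def by blast
  have fl: "filterlim (\<lambda>\<epsilon>. k * \<epsilon>) (at_right 0) (at_right 0)"
    using assms(2) filterlim_times_pos[OF filterlim_ident, of k 0 0] by simp
  have "((\<lambda>\<epsilon>. X (k * \<epsilon>) - (\<Sum>e\<in>S. a e * (k * \<epsilon>) powr (- e))) \<longlongrightarrow> F) (at_right 0)"
    using filterlim_compose[OF l fl] .
  then have "((\<lambda>\<epsilon>. X (k * \<epsilon>) - (\<Sum>e\<in>S. (a e * k powr (- e)) * \<epsilon> powr (- e))) \<longlongrightarrow> F) (at_right 0)"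
  proof (rule Lim_transform_eventually)
    show "\<forall>\<^sub>F \<epsilon> in at_right 0. X (k * \<epsilon>) - (\<Sum>e\<in>S. a e * (k * \<epsilon>) powr (- e)) = X (k * \<epsilon>) - (\<Sum>e\<in>S. (a e * k powr (- e)) * \<epsilon> powr (- e))"
      using eventually_at_right_less[of "0::real"]
    proof eventually_elim
      case (elim \<epsilon>)
      then show ?case using assms(2) by (simp add: powr_mult mult.assoc)
    qed
  qed
  then show ?thesis by (rule finite_partI[OF S])
qed

text \<open>
  Multiplication by the power with the largest exponent shows that its coefficient is 0.
\<close>

lemma sum_powr_limit_zero:
  assumes "finite S" "\<And>e. e \<in> S \<Longrightarrow> 0 < e"
    "((\<lambda>\<epsilon>. \<Sum>e\<in>S. a e * \<epsilon> powr (- e)) \<longlongrightarrow> c) (at_right (0::real))"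
  shows "c = 0"
  using assms
proof (induction S rule: finite_linorder_max_induct)
  case empty
  then show ?case by (simp add: tendsto_const_iff)
next
  case (insert b S)
  have b: "0 < b" using insert.prems by auto
  have nb: "b \<notin> S" using insert.hyps by auto
  have "a b = 0"
  proof -
    have z: "((\<lambda>\<epsilon>::real. \<epsilon> powr b) \<longlongrightarrow> 0) (at_right 0)" using b by (intro powr_tendsto_0_at_right)
    have 1: "((\<lambda>\<epsilon>. \<epsilon> powr b * (\<Sum>e\<in>insert b S. a e * \<epsilon> powr (- e))) \<longlongrightarrow> 0 * c) (at_right 0)"
      by (intro tendsto_mult z insert.prems(2))
    have "((\<lambda>\<epsilon>. a b + (\<Sum>e\<in>S. a e * \<epsilon> powr (b - e))) \<longlongrightarrow> a b + (\<Sum>e\<in>S. a e * 0)) (at_right 0)"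
      using insert.hyps by (intro tendsto_intros powr_tendsto_0_at_right) auto
    moreover have "((\<lambda>\<epsilon>. a b + (\<Sum>e\<in>S. a e * \<epsilon> powr (b - e))) \<longlongrightarrow> 0 * c) (at_right 0)"
    proof (rule Lim_transform_eventually[OF 1])
      show "\<forall>\<^sub>F \<epsilon> in at_right 0. \<epsilon> powr b * (\<Sum>e\<in>insert b S. a e * \<epsilon> powr (- e)) = a b + (\<Sum>e\<in>S. a e * \<epsilon> powr (b - e))"
        using eventually_at_right_less[of "0::real"]
      proof eventually_elim
        case (elim \<epsilon>)
        have "\<epsilon> powr b * (a e * \<epsilon> powr (- e)) = a e * \<epsilon> powr (b - e)" for e
          using powr_add[of \<epsilon> b "- e"] by simp
        then have "\<epsilon> powr b * (\<Sum>e\<in>insert b S. a e * \<epsilon> powr (- e)) = (\<Sum>e\<in>insert b S. a e * \<epsilon> powr (b - e))"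
          by (simp only: sum_distrib_left)
        also have "\<dots> = a b + (\<Sum>e\<in>S. a e * \<epsilon> powr (b - e))"
          using insert.hyps nb elim by simp
        finally show ?case .
      qed
    qed
    ultimately show ?thesis using tendsto_unique[of "at_right (0::real)"] by fastforce
  qed
  then have "((\<lambda>\<epsilon>. \<Sum>e\<in>S. a e * \<epsilon> powr (- e)) \<longlongrightarrow> c) (at_right 0)"
    using insert.prems(2) insert.hyps nb by simp
  then show ?case using insert.IH insert.prems(1) by auto
qed

lemma finite_part_unique:
  assumes "finite_part X F" "finite_part X G"
  shows "F = G"
proof -
  have "finite_part (\<lambda>\<epsilon>. X \<epsilon> + (-1) * X \<epsilon>) (F + (-1) * G)"
    by (intro finite_part_add finite_part_cmult assms)
  then obtain S a where S: "finite S" "\<forall>e\<in>S. 0 < e" and l: "((\<lambda>\<epsilon>. - (\<Sum>e\<in>S. a e * \<epsilon> powr (- e))) \<longlongrightarrow> F - G) (at_right 0)"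
    unfolding finite_part_def by auto
  have "((\<lambda>\<epsilon>. \<Sum>e\<in>S. (- a e) * \<epsilon> powr (- e)) \<longlongrightarrow> F - G) (at_right 0)"
    using l by (simp add: sum_negf)
  then have "F - G = 0" by (rule sum_powr_limit_zero[OF S(1), rotated]) (use S(2) in auto)
  then show ?thesis by simp
qed

section \<open>Powers of a quadratic polynomial on a line\<close>

lemma exp_Ln_of_real: "0 < y \<Longrightarrow> exp (complex_of_real \<gamma> * Ln (complex_of_real y)) = complex_of_real (y powr \<gamma>)"
  by (simp add: Ln_of_real powr_def exp_of_real flip: of_real_mult)

text \<open>
  The remainder is uniform in \<open>b\<close>: the power has a holomorphic extension to a disc whose radius
  depends only on \<open>u\<close> and \<open>B\<close>, it is bounded there independently of \<open>b\<close>, and Cauchy's estimates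
  control all coefficients.
\<close>

lemma taylor_quadratic_powr:
  assumes u: "u > 0" and B: "B \<ge> 0"
  shows "\<exists>r>0. \<exists>M\<ge>0. \<forall>b. \<bar>b\<bar> \<le> B \<longrightarrow> (\<exists>a::nat \<Rightarrow> real. \<forall>t. \<bar>t\<bar> \<le> r \<longrightarrow>
     0 < u - 2 * b * t - t\<^sup>2 \<and> \<bar>(u - 2 * b * t - t\<^sup>2) powr \<gamma> - (\<Sum>i<N. a i * t ^ i)\<bar> \<le> M * \<bar>t\<bar> ^ N)"
proof -
  define r1 where "r1 = min 1 (u / (2 * (2 * B + 1)))"
  have r1: "0 < r1" "r1 \<le> 1" "(2 * B + 1) * r1 \<le> u / 2"
  proof -
    show "0 < r1" "r1 \<le> 1" using u B by (auto simp: r1_def)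
    have "r1 \<le> u / (2 * (2 * B + 1))" by (simp add: r1_def)
    then show "(2 * B + 1) * r1 \<le> u / 2" using B by (simp add: field_simps)
  qed
  define r2 where "r2 = r1 / 2"
  have r2: "0 < r2" "r2 < r1" using r1 by (auto simp: r2_def)
  \<comment> \<open>On the disc, \<open>|w|\<close> lies between \<open>u/2\<close> and \<open>3u/2\<close>, and \<open>|w\<^sup>\<gamma>| = exp (\<gamma> ln |w|)\<close> since \<open>\<gamma>\<close> is
    real.\<close>
  define M0 where "M0 = exp (\<bar>\<gamma>\<bar> * (\<bar>ln (u/2)\<bar> + \<bar>ln (3*u/2)\<bar>))"
  have main: "\<exists>a::nat \<Rightarrow> real. \<forall>t. \<bar>t\<bar> \<le> r2/2 \<longrightarrow>
     0 < u - 2 * b * t - t\<^sup>2 \<and> \<bar>(u - 2 * b * t - t\<^sup>2) powr \<gamma> - (\<Sum>i<N. a i * t ^ i)\<bar> \<le> 2 * M0 / r2 ^ N * \<bar>t\<bar> ^ N"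
    if b: "\<bar>b\<bar> \<le> B" for b
  proof -
    define w where "w z = complex_of_real u - 2 * of_real b * z - z\<^sup>2" for z
    define f where "f z = exp (of_real \<gamma> * Ln (w z))" for z
    have small: "norm (w z - of_real u) \<le> u / 2" if "norm z \<le> r1" for z
    proof -
      have "norm (w z - of_real u) = norm (z * (2 * of_real b + z))"
        by (simp add: w_def power2_eq_square algebra_simps norm_minus_commute)
          (metis add.commute minus_add_distrib norm_minus_cancel uminus_add_conv_diff)
      also have "\<dots> \<le> r1 * (2 * B + 1)"
        unfolding norm_mult
      proof (intro mult_mono that)
        have "norm (2 * complex_of_real b + z) \<le> 2 * \<bar>b\<bar> + norm z"
          using norm_triangle_ineq[of "2 * complex_of_real b" z] by (simp add: norm_mult)
        then show "norm (2 * complex_of_real b + z) \<le> 2 * B + 1" using b that r1 by linarith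
      qed (use r1 in auto)
      finally show ?thesis using r1(3) by (simp add: mult.commute)
    qed
    have Re_w: "u / 2 \<le> Re (w z)" if "norm z \<le> r1" for z
      using small[OF that] abs_Re_le_cmod[of "w z - of_real u"] by (auto simp: abs_le_iff)
    have w_nonpos: "w z \<notin> \<real>\<^sub>\<le>\<^sub>0" if "norm z \<le> r1" for z
      using Re_w[OF that] u by (auto simp: complex_nonpos_Reals_iff)
    have f_bound: "norm (f z) \<le> M0" if "norm z \<le> r1" for z
    proof -
      have nw: "u / 2 \<le> norm (w z)" using Re_w[OF that] complex_Re_le_cmod[of "w z"] by linarith
      have "norm (w z) \<le> 3 * u / 2"
        using small[OF that] norm_triangle_sub[of "w z" "of_real u"] u by simp
      then have "ln (norm (w z)) \<le> ln (3*u/2)" "ln (u/2) \<le> ln (norm (w z))"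
        using nw u by (auto intro!: ln_mono)
      then have "\<bar>ln (norm (w z))\<bar> \<le> \<bar>ln (u/2)\<bar> + \<bar>ln (3*u/2)\<bar>" by linarith
      then have "\<bar>\<gamma>\<bar> * \<bar>ln (norm (w z))\<bar> \<le> \<bar>\<gamma>\<bar> * (\<bar>ln (u/2)\<bar> + \<bar>ln (3*u/2)\<bar>)" by (intro mult_left_mono) auto
      moreover have "\<gamma> * ln (norm (w z)) \<le> \<bar>\<gamma>\<bar> * \<bar>ln (norm (w z))\<bar>" by (metis abs_ge_self abs_mult)
      moreover have "w z \<noteq> 0" using nw u by auto
      ultimately show ?thesis unfolding f_def M0_def by simp
    qed
    have hol: "f holomorphic_on ball 0 r1"
      unfolding f_def w_def
    proof (intro holomorphic_intros)
      fix z assume "z \<in> ball (0::complex) r1"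
      then show "complex_of_real u - 2 * complex_of_real b * z - z\<^sup>2 \<notin> \<real>\<^sub>\<le>\<^sub>0"
        using w_nonpos[of z] by (simp add: w_def)
    qed
    define co where "co i = (deriv ^^ i) f 0 / fact i" for i
    have co_bound: "norm (co i) \<le> M0 / r2 ^ i" for i
    proof -
      have "norm ((deriv ^^ i) f 0) \<le> fact i * M0 / r2 ^ i"
      proof (rule Cauchy_inequality)
        show "f holomorphic_on ball 0 r2" by (rule holomorphic_on_subset[OF hol]) (use r2 in auto)
        show "continuous_on (cball 0 r2) f"
          by (rule holomorphic_on_imp_continuous_on[OF holomorphic_on_subset[OF hol]]) (use r2 in auto)
        show "norm (f x) \<le> M0" if "norm (0 - x) = r2" for x using f_bound[of x] that r2 by simp
      qed (rule r2(1))
      then show ?thesis by (simp add: co_def norm_divide field_simps)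
    qed
    show ?thesis
    proof (intro exI[of _ "\<lambda>i. Re (co i)"] allI impI)
      fix t :: real assume t: "\<bar>t\<bar> \<le> r2/2"
      have nt: "norm (complex_of_real t) \<le> r1" using t r2 by simp
      have wt: "w (of_real t) = of_real (u - 2 * b * t - t\<^sup>2)" by (simp add: w_def)
      have pos: "0 < u - 2 * b * t - t\<^sup>2" using Re_w[OF nt] u unfolding wt by simp
      have ft: "f (of_real t) = of_real ((u - 2 * b * t - t\<^sup>2) powr \<gamma>)"
        unfolding f_def wt by (rule exp_Ln_of_real[OF pos])
      have "complex_of_real t \<in> ball 0 r1" using t r2 by simp
      from holomorphic_power_series[OF hol this]
      have sums: "(\<lambda>i. co i * of_real t ^ i) sums f (of_real t)" by (simp add: co_def)
      have tail: "(\<lambda>i. co (i + N) * of_real t ^ (i + N)) sums (f (of_real t) - (\<Sum>i<N. co i * of_real t ^ i))"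
        using sums_split_initial_segment[OF sums, of N] by simp
      have tb: "norm (co (i + N) * of_real t ^ (i + N)) \<le> (M0 / r2 ^ N * \<bar>t\<bar> ^ N) * (1/2) ^ i" for i
      proof -
        have "norm (co (i + N) * of_real t ^ (i + N)) \<le> M0 / r2 ^ (i + N) * \<bar>t\<bar> ^ (i + N)"
          unfolding norm_mult norm_power using co_bound[of "i + N"] r2 by (intro mult_mono) (auto simp: M0_def)
        also have "\<dots> = (M0 / r2 ^ N * \<bar>t\<bar> ^ N) * (\<bar>t\<bar> / r2) ^ i"
          using r2 by (simp add: power_add power_divide field_simps)
        also have "\<dots> \<le> (M0 / r2 ^ N * \<bar>t\<bar> ^ N) * (1/2) ^ i"
          using t r2 by (intro mult_left_mono power_mono) (auto simp: M0_def field_simps)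
        finally show ?thesis .
      qed
      have geo: "(\<lambda>i. (M0 / r2 ^ N * \<bar>t\<bar> ^ N) * (1/2) ^ i) sums ((M0 / r2 ^ N * \<bar>t\<bar> ^ N) * 2)"
        using sums_mult[OF geometric_sums[of "1/2 :: real"], of "M0 / r2 ^ N * \<bar>t\<bar> ^ N"] by simp
      have "norm (f (of_real t) - (\<Sum>i<N. co i * of_real t ^ i)) \<le> (M0 / r2 ^ N * \<bar>t\<bar> ^ N) * 2"
        using norm_suminf_le[OF tb sums_summable[OF geo]] sums_unique[OF tail] sums_unique[OF geo] by simp
      moreover have "Re (f (of_real t) - (\<Sum>i<N. co i * of_real t ^ i)) = (u - 2 * b * t - t\<^sup>2) powr \<gamma> - (\<Sum>i<N. Re (co i) * t ^ i)"
        unfolding ft by (simp flip: of_real_power)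
      ultimately show "0 < u - 2 * b * t - t\<^sup>2 \<and> \<bar>(u - 2 * b * t - t\<^sup>2) powr \<gamma> - (\<Sum>i<N. Re (co i) * t ^ i)\<bar> \<le> 2 * M0 / r2 ^ N * \<bar>t\<bar> ^ N"
        using pos abs_Re_le_cmod[of "f (of_real t) - (\<Sum>i<N. co i * of_real t ^ i)"] by (simp add: mult_ac)
    qed
  qed
  have "0 < r2/2" "0 \<le> 2 * M0 / r2 ^ N" using r2 by (auto simp: M0_def)
  with main show ?thesis by blast
qed

text \<open>
  The function \<open>(1 - Ay \<cdot> y)\<^sub>+\<^sup>\<beta>\<close> at \<open>y = x + t \<theta>\<close>, where \<open>\<rho> \<theta> = 1\<close>, \<open>u = 1 - Ax \<cdot> x\<close> and
  \<open>b = Ax \<cdot> \<theta>\<close>.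
\<close>

definition slice :: "real \<Rightarrow> real \<Rightarrow> real \<Rightarrow> real \<Rightarrow> real" where
  "slice u b \<beta> t = (if 0 < u - 2 * b * t - t\<^sup>2 then (u - 2 * b * t - t\<^sup>2) powr \<beta> else 0)"

text \<open>The slice lives on the interval of this radius about \<open>-b\<close>.\<close>

definition half_chord :: "real \<Rightarrow> real \<Rightarrow> real" where "half_chord u b = sqrt (u + b\<^sup>2)"

lemma slice_nonneg [simp]: "0 \<le> slice u b \<beta> t" by (simp add: slice_def)

lemma slice_minus: "slice u b \<beta> (- t) = slice u (- b) \<beta> t" by (simp add: slice_def)

lemma slice_measurable [measurable]: "slice u b \<beta> \<in> borel_measurable borel"
  unfolding slice_def[abs_def] by measurable

lemma half_chord_sq: "0 < u \<Longrightarrow> (half_chord u b)\<^sup>2 = u + b\<^sup>2" by (simp add: half_chord_def add_nonneg_nonneg less_imp_le)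

lemma half_chord_gt: assumes "0 < u" shows "\<bar>b\<bar> < half_chord u b"
proof -
  have "sqrt (b\<^sup>2) < half_chord u b" unfolding half_chord_def using assms by (intro real_sqrt_less_mono) auto
  then show ?thesis by simp
qed

lemma half_chord_minus [simp]: "half_chord u (- b) = half_chord u b" by (simp add: half_chord_def)

lemma quadratic_factor: "0 < u \<Longrightarrow> u - 2 * b * t - t\<^sup>2 = (half_chord u b + b + t) * (half_chord u b - b - t)"
  using half_chord_sq[of u b] by (simp add: algebra_simps power2_eq_square)

lemma quadratic_pos_iff:
  assumes "0 < u"
  shows "0 < u - 2 * b * t - t\<^sup>2 \<longleftrightarrow> - (half_chord u b + b) < t \<and> t < half_chord u b - b"
  using half_chord_gt[OF assms, of b] unfolding quadratic_factor[OF assms] zero_less_mult_iff by auto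

lemma slice_eq_0: "0 < u \<Longrightarrow> half_chord u b - b \<le> t \<Longrightarrow> slice u b \<beta> t = 0"
  using quadratic_pos_iff[of u b t] by (auto simp: slice_def)

lemma powr_between:
  fixes x y t e :: real
  assumes "0 < x" "x \<le> t" "t \<le> y"
  shows "t powr e \<le> x powr e + y powr e"
proof (cases "e \<ge> 0")
  case True
  then have "t powr e \<le> y powr e" using assms by (intro powr_mono2) auto
  then show ?thesis by (simp add: add_increasing)
next
  case False
  then have "t powr e \<le> x powr e" using assms by (intro powr_mono2') auto
  then show ?thesis by (simp add: add_increasing2)
qed

text \<open>
  The mass of the slice with \<open>u = 1\<close> and \<open>b = 0\<close>; all others with exponent \<open>\<beta>\<close> are rescaled
  copies of it.
\<close>

definition unit_slice_mass :: "real \<Rightarrow> ennreal" where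
  "unit_slice_mass \<beta> = (\<integral>\<^sup>+z. ennreal (if \<bar>z\<bar> < 1 then (1 - z\<^sup>2) powr \<beta> else 0) \<partial>lborel)"

lemma unit_slice_mass_finite:
  assumes "-1 < \<beta>"
  shows "unit_slice_mass \<beta> < \<infinity>"
proof -
  have B: "((\<lambda>t. t powr \<beta> * (1 - t) powr \<beta>) has_integral Beta (\<beta> + 1) (\<beta> + 1)) {0..1}"
    using has_integral_Beta_real[of "\<beta> + 1" "\<beta> + 1"] assms by simp
  have 1: "unit_slice_mass \<beta> = ennreal \<bar>2\<bar> * (\<integral>\<^sup>+t. ennreal (if \<bar>-1 + 2 * t\<bar> < 1 then (1 - (-1 + 2 * t)\<^sup>2) powr \<beta> else 0) \<partial>lborel)"
  proof -
    have m: "(\<lambda>z::real. ennreal (if \<bar>z\<bar> < 1 then (1 - z\<^sup>2) powr \<beta> else 0)) \<in> borel_measurable borel"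
      by measurable
    show ?thesis using nn_integral_real_affine[OF m, of 2 "-1"] by (simp add: unit_slice_mass_def)
  qed
  have 2: "(\<integral>\<^sup>+t. ennreal (if \<bar>-1 + 2 * t\<bar> < 1 then (1 - (-1 + 2 * t)\<^sup>2) powr \<beta> else 0) \<partial>lborel)
     \<le> (\<integral>\<^sup>+t. ennreal (4 powr \<beta>) * (ennreal (t powr \<beta> * (1 - t) powr \<beta>) * indicator {0..1} t) \<partial>lborel)"
  proof (rule nn_integral_mono)
    fix t :: real
    show "ennreal (if \<bar>-1 + 2 * t\<bar> < 1 then (1 - (-1 + 2 * t)\<^sup>2) powr \<beta> else 0)
      \<le> ennreal (4 powr \<beta>) * (ennreal (t powr \<beta> * (1 - t) powr \<beta>) * indicator {0..1} t)"
    proof (cases "\<bar>-1 + 2 * t\<bar> < 1")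
      case True
      then have t: "0 < t" "t < 1" by auto
      have "1 - (-1 + 2 * t)\<^sup>2 = 4 * (t * (1 - t))" by (simp add: power2_eq_square algebra_simps)
      then have "(1 - (-1 + 2 * t)\<^sup>2) powr \<beta> = 4 powr \<beta> * (t powr \<beta> * (1 - t) powr \<beta>)"
        using t by (simp add: powr_mult)
      then show ?thesis using t True by (simp add: ennreal_mult)
    qed simp
  qed
  have 3: "(\<integral>\<^sup>+t. ennreal (4 powr \<beta>) * (ennreal (t powr \<beta> * (1 - t) powr \<beta>) * indicator {0..1} t) \<partial>lborel)
     = ennreal (4 powr \<beta>) * ennreal (Beta (\<beta> + 1) (\<beta> + 1))"
  proof -
    have "(\<integral>\<^sup>+t. ennreal (t powr \<beta> * (1 - t) powr \<beta>) * indicator {0..1} t \<partial>lborel) = ennreal (Beta (\<beta> + 1) (\<beta> + 1))"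
      by (rule nn_integral_has_integral_lebesgue'[where f="\<lambda>t. t powr \<beta> * (1 - t) powr \<beta>"]) (simp, rule B)
    moreover have "(\<integral>\<^sup>+t. ennreal (4 powr \<beta>) * (ennreal (t powr \<beta> * (1 - t) powr \<beta>) * indicator {0..1} t) \<partial>lborel)
      = ennreal (4 powr \<beta>) * (\<integral>\<^sup>+t. ennreal (t powr \<beta> * (1 - t) powr \<beta>) * indicator {0..1} t \<partial>lborel)"
      by (rule nn_integral_cmult) measurable
    ultimately show ?thesis by simp
  qed
  have "unit_slice_mass \<beta> \<le> ennreal \<bar>2\<bar> * (ennreal (4 powr \<beta>) * ennreal (Beta (\<beta> + 1) (\<beta> + 1)))"
    unfolding 1 using 2 unfolding 3 by (rule mult_left_mono) simp
  also have "\<dots> < \<infinity>" by (simp add: ennreal_mult_less_top)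
  finally show ?thesis .
qed

lemma nn_integral_slice:
  assumes u: "0 < u"
  shows "(\<integral>\<^sup>+t. ennreal (slice u b \<beta> t) \<partial>lborel) = ennreal (half_chord u b powr (2 * \<beta> + 1)) * unit_slice_mass \<beta>"
proof -
  let ?R = "half_chord u b"
  have R: "0 < ?R" using half_chord_gt[OF u, of b] by linarith
  have "(\<integral>\<^sup>+t. ennreal (slice u b \<beta> t) \<partial>lborel) = ennreal \<bar>?R\<bar> * (\<integral>\<^sup>+z. ennreal (slice u b \<beta> (- b + ?R * z)) \<partial>lborel)"
    by (rule nn_integral_real_affine) (use R in auto)
  also have "(\<integral>\<^sup>+z. ennreal (slice u b \<beta> (- b + ?R * z)) \<partial>lborel) = (\<integral>\<^sup>+z. ennreal (?R powr (2 * \<beta>)) * ennreal (if \<bar>z\<bar> < 1 then (1 - z\<^sup>2) powr \<beta> else 0) \<partial>lborel)"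
  proof (rule nn_integral_cong)
    fix z
    have q: "u - 2 * b * (- b + ?R * z) - (- b + ?R * z)\<^sup>2 = ?R\<^sup>2 * (1 - z\<^sup>2)"
      by (simp add: half_chord_sq[OF u] power_mult_distrib power2_diff power2_sum algebra_simps) (simp add: power2_eq_square)
    have iff: "0 < ?R\<^sup>2 * (1 - z\<^sup>2) \<longleftrightarrow> \<bar>z\<bar> < 1"
      using R by (simp add: zero_less_mult_iff abs_square_less_1)
    have "slice u b \<beta> (- b + ?R * z) = ?R powr (2 * \<beta>) * (if \<bar>z\<bar> < 1 then (1 - z\<^sup>2) powr \<beta> else 0)"
      unfolding slice_def q iff using R by (auto simp: powr_mult abs_square_less_1 powr_powr simp flip: powr_numeral)
    then show "ennreal (slice u b \<beta> (- b + ?R * z)) = ennreal (?R powr (2 * \<beta>)) * ennreal (if \<bar>z\<bar> < 1 then (1 - z\<^sup>2) powr \<beta> else 0)"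
      by (simp add: ennreal_mult)
  qed
  also have "\<dots> = ennreal (?R powr (2 * \<beta>)) * unit_slice_mass \<beta>"
    unfolding unit_slice_mass_def by (rule nn_integral_cmult) measurable
  also have "ennreal \<bar>?R\<bar> * (ennreal (?R powr (2 * \<beta>)) * unit_slice_mass \<beta>) = ennreal (?R powr (2 * \<beta> + 1)) * unit_slice_mass \<beta>"
    using R by (simp add: powr_add ennreal_mult mult_ac)
  finally show ?thesis .
qed

lemma slice_integrable:
  assumes u: "0 < u" and \<beta>: "-1 < \<beta>"
  shows "integrable lborel (slice u b \<beta>)"
proof (rule integrableI_bounded)
  have "(\<integral>\<^sup>+t. ennreal (norm (slice u b \<beta> t)) \<partial>lborel) = ennreal (half_chord u b powr (2 * \<beta> + 1)) * unit_slice_mass \<beta>"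
    using nn_integral_slice[OF u, of b \<beta>] by simp
  also have "\<dots> < \<infinity>" using unit_slice_mass_finite[OF \<beta>] by (simp add: ennreal_mult_less_top)
  finally show "(\<integral>\<^sup>+t. ennreal (norm (slice u b \<beta> t)) \<partial>lborel) < \<infinity>" .
qed measurable

lemma absolutely_integrable_on_lborel_iff:
  fixes f :: "real \<Rightarrow> real"
  assumes [measurable]: "f \<in> borel_measurable borel" "S \<in> sets borel"
  shows "f absolutely_integrable_on S \<longleftrightarrow> set_integrable lborel S f"
  unfolding set_integrable_def by (rule integrable_completion) measurable

lemma absolutely_integrable_bound:
  fixes f g :: "real \<Rightarrow> real"
  assumes [measurable]: "f \<in> borel_measurable borel" "S \<in> sets borel"
    and g: "g absolutely_integrable_on S" and le: "\<And>x. x \<in> S \<Longrightarrow> \<bar>f x\<bar> \<le> g x"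
  shows "f absolutely_integrable_on S"
proof (rule measurable_bounded_by_integrable_imp_absolutely_integrable)
  show "f \<in> borel_measurable (lebesgue_on S)"
    by (intro measurable_restrict_space1 measurable_completion) measurable
  show "g integrable_on S" using g by (rule set_lebesgue_integral_eq_integral)
qed (use le in auto)

lemma slice_powr_integrable:
  assumes u: "0 < u" and \<beta>: "-1 < \<beta>" and \<epsilon>: "0 < \<epsilon>"
  shows "(\<lambda>t. slice u b \<beta> t * t powr e) absolutely_integrable_on {\<epsilon>..}"
proof (rule absolutely_integrable_bound)
  let ?K = "\<epsilon> powr e + (\<bar>half_chord u b - b\<bar> + \<epsilon>) powr e"
  have "set_integrable lborel {\<epsilon>..} (\<lambda>t. ?K * slice u b \<beta> t)"
    using slice_integrable[OF u \<beta>, of b] unfolding set_integrable_def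
    by (intro integrable_mult_indicator) auto
  then show "(\<lambda>t. ?K * slice u b \<beta> t) absolutely_integrable_on {\<epsilon>..}"
    by (subst absolutely_integrable_on_lborel_iff) auto
  fix t assume t: "t \<in> {\<epsilon>..}"
  show "\<bar>slice u b \<beta> t * t powr e\<bar> \<le> ?K * slice u b \<beta> t"
  proof (cases "half_chord u b - b \<le> t")
    case True then show ?thesis using slice_eq_0[OF u True] by simp
  next
    case False
    then have "t powr e \<le> ?K" using t \<epsilon> by (intro powr_between) auto
    then have "slice u b \<beta> t * t powr e \<le> slice u b \<beta> t * ?K" by (intro mult_left_mono) auto
    then show ?thesis by (simp add: abs_mult mult.commute)
  qed
qed measurable

lemma powr_shift:
  fixes t :: real
  assumes "0 < t"
  shows "y = x + 1 \<Longrightarrow> t powr y = t powr x * t" "y = x + 2 \<Longrightarrow> t powr y = t powr x * t\<^sup>2"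
  using assms by (simp_all add: powr_add)

text \<open>
  The Mellin transform of a slice at \<open>a\<close>, cut off at \<open>\<epsilon>\<close> since it may diverge at 0.
\<close>

definition mellin_tail :: "real \<Rightarrow> real \<Rightarrow> real \<Rightarrow> real \<Rightarrow> real \<Rightarrow> real" where
  "mellin_tail u b \<beta> a \<epsilon> = integral {\<epsilon>..} (\<lambda>t. slice u b \<beta> t * t powr (a - 1))"

lemma mellin_tail_has_integral:
  assumes "0 < u" "-1 < \<beta>" "0 < \<epsilon>"
  shows "((\<lambda>t. slice u b \<beta> t * t powr (a - 1)) has_integral mellin_tail u b \<beta> a \<epsilon>) {\<epsilon>..}"
  unfolding mellin_tail_def by (rule integrable_integral[OF set_lebesgue_integral_eq_integral(1)[OF slice_powr_integrable[OF assms]]])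

text \<open>
  The derivative of \<open>(u - 2 b t - t\<^sup>2)\<^sup>\<beta>\<^sup>+\<^sup>1 t\<^sup>a\<close> is a combination of the integrands at \<open>a\<close>,
  \<open>a + 1\<close> and \<open>a + 2\<close>, and this function vanishes at the end of the slice.
\<close>

lemma mellin_tail_rec:
  assumes u: "0 < u" and \<beta>: "-1 < \<beta>" and \<epsilon>: "0 < \<epsilon>" "\<epsilon> < half_chord u b - b"
  shows "a * u * mellin_tail u b \<beta> a \<epsilon> - 2 * b * (\<beta> + 1 + a) * mellin_tail u b \<beta> (a + 1) \<epsilon> - (2 * (\<beta> + 1) + a) * mellin_tail u b \<beta> (a + 2) \<epsilon>
     = - ((u - 2 * b * \<epsilon> - \<epsilon>\<^sup>2) powr (\<beta> + 1) * \<epsilon> powr a)"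
proof -
  let ?q = "half_chord u b - b"
  let ?w = "\<lambda>t. u - 2 * b * t - t\<^sup>2"
  define H where "H t = a * u * (slice u b \<beta> t * t powr (a - 1)) - 2 * b * (\<beta> + 1 + a) * (slice u b \<beta> t * t powr (a + 1 - 1))
      - (2 * (\<beta> + 1) + a) * (slice u b \<beta> t * t powr (a + 2 - 1))" for t
  have H1: "(H has_integral (a * u * mellin_tail u b \<beta> a \<epsilon> - 2 * b * (\<beta> + 1 + a) * mellin_tail u b \<beta> (a + 1) \<epsilon> - (2 * (\<beta> + 1) + a) * mellin_tail u b \<beta> (a + 2) \<epsilon>)) {\<epsilon>..}"
    unfolding H_def by (intro has_integral_diff has_integral_mult_right mellin_tail_has_integral u \<beta> \<epsilon>)
  define G where "G t = ?w t powr (\<beta> + 1) * t powr a" for t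
  have wpos: "0 < ?w t" if "\<epsilon> \<le> t" "t < ?q" for t
    using that \<epsilon> half_chord_gt[OF u, of b] by (subst quadratic_pos_iff[OF u]) auto
  have wq: "?w ?q = 0" using quadratic_factor[OF u, of b ?q] by simp
  have "(H has_integral (G ?q - G \<epsilon>)) {\<epsilon>..?q}"
  proof (rule fundamental_theorem_of_calculus_interior)
    show "\<epsilon> \<le> ?q" using \<epsilon> by simp
    show "continuous_on {\<epsilon>..?q} G"
      unfolding G_def
    proof (intro continuous_on_mult continuous_on_powr' continuous_intros ballI conjI impI)
      show "0 \<le> ?w t" if "t \<in> {\<epsilon>..?q}" for t
        using wpos[of t] wq that by (cases "t = ?q") auto
    qed (use \<beta> \<epsilon> in auto)
    fix t assume t: "t \<in> {\<epsilon><..<?q}"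
    then have t0: "0 < t" "0 < ?w t" using \<epsilon> wpos by auto
    have "(G has_real_derivative ((\<beta> + 1) * ?w t powr \<beta> * (- 2 * b - 2 * t) * t powr a + a * t powr (a - 1) * ?w t powr (\<beta> + 1))) (at t)"
      unfolding G_def using t0 by (auto intro!: derivative_eq_intros)
    moreover have "(\<beta> + 1) * ?w t powr \<beta> * (- 2 * b - 2 * t) * t powr a + a * t powr (a - 1) * ?w t powr (\<beta> + 1) = H t"
    proof -
      have p: "t powr (a + 1 - 1) = t powr (a - 1) * t" "t powr (a + 2 - 1) = t powr (a - 1) * t\<^sup>2"
        "t powr a = t powr (a - 1) * t" "?w t powr (\<beta> + 1) = ?w t powr \<beta> * ?w t"
        using t0 by (intro powr_shift; simp)+
      have Vt: "slice u b \<beta> t = ?w t powr \<beta>" using t0 by (simp add: slice_def)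
      show ?thesis unfolding H_def Vt p
        by (simp add: algebra_simps power2_eq_square)
    qed
    ultimately show "(G has_vector_derivative H t) (at t)"
      by (simp add: has_real_derivative_iff_has_vector_derivative)
  qed
  moreover have "G ?q = 0" unfolding G_def wq by simp
  ultimately have H2: "(H has_integral - G \<epsilon>) {\<epsilon>..?q}" by simp
  have H3: "((\<lambda>t. if t \<in> {\<epsilon>..?q} then H t else 0) has_integral - G \<epsilon>) {\<epsilon>..}"
    using H2 by (subst has_integral_restrict) (use \<epsilon> in auto)
  have "(H has_integral - G \<epsilon>) {\<epsilon>..}"
    by (rule has_integral_eq[OF _ H3]) (auto simp: H_def slice_eq_0[OF u])
  from has_integral_unique[OF H1 this] show ?thesis by (simp add: G_def)
qed

lemma mellin_tail_raise:
  assumes u: "0 < u" and \<beta>: "-1 < \<beta>" and \<epsilon>: "0 < \<epsilon>"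
  shows "mellin_tail u b (\<beta> + 1) a \<epsilon> = u * mellin_tail u b \<beta> a \<epsilon> - 2 * b * mellin_tail u b \<beta> (a + 1) \<epsilon> - mellin_tail u b \<beta> (a + 2) \<epsilon>"
proof -
  have "((\<lambda>t. u * (slice u b \<beta> t * t powr (a - 1)) - 2 * b * (slice u b \<beta> t * t powr (a + 1 - 1)) - slice u b \<beta> t * t powr (a + 2 - 1))
     has_integral (u * mellin_tail u b \<beta> a \<epsilon> - 2 * b * mellin_tail u b \<beta> (a + 1) \<epsilon> - mellin_tail u b \<beta> (a + 2) \<epsilon>)) {\<epsilon>..}"
    by (intro has_integral_diff has_integral_mult_right mellin_tail_has_integral u \<beta> \<epsilon>)
  then have "((\<lambda>t. slice u b (\<beta> + 1) t * t powr (a - 1)) has_integral (u * mellin_tail u b \<beta> a \<epsilon> - 2 * b * mellin_tail u b \<beta> (a + 1) \<epsilon> - mellin_tail u b \<beta> (a + 2) \<epsilon>)) {\<epsilon>..}"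
  proof (rule has_integral_eq[rotated])
    fix t assume "t \<in> {\<epsilon>..}"
    then have t: "0 < t" using \<epsilon> by auto
    have p: "t powr (a + 1 - 1) = t powr (a - 1) * t" "t powr (a + 2 - 1) = t powr (a - 1) * t\<^sup>2"
      using t by (intro powr_shift; simp)+
    have Vw: "slice u b (\<beta> + 1) t = slice u b \<beta> t * (u - 2 * b * t - t\<^sup>2)"
      by (auto simp: slice_def powr_add)
    show "u * (slice u b \<beta> t * t powr (a - 1)) - 2 * b * (slice u b \<beta> t * t powr (a + 1 - 1)) - slice u b \<beta> t * t powr (a + 2 - 1) = slice u b (\<beta> + 1) t * t powr (a - 1)"
      unfolding p Vw by (simp add: algebra_simps)
  qed
  then show ?thesis unfolding mellin_tail_def by (rule integral_unique)
qed

lemma integral_atLeast_tendsto: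
  fixes f :: "real \<Rightarrow> real"
  assumes f: "f absolutely_integrable_on {0<..}"
  shows "((\<lambda>\<epsilon>. integral {\<epsilon>..} f) \<longlongrightarrow> integral {0<..} f) (at_right 0)"
proof -
  have int: "integrable lebesgue (\<lambda>t. indicator {0<..} t *\<^sub>R f t)" using f by (simp add: set_integrable_def)
  have eq: "integral {\<epsilon>..} f = (LINT t|lebesgue. indicator {\<epsilon>..} t *\<^sub>R f t)" if "0 < \<epsilon>" for \<epsilon>
  proof -
    have "f absolutely_integrable_on {\<epsilon>..}"
      by (rule set_integrable_subset[OF f]) (use that in auto)
    then show ?thesis using set_lebesgue_integral_eq_integral(2)[of "{\<epsilon>..}" f] by (simp add: set_lebesgue_integral_def)
  qed
  have eq0: "integral {0<..} f = (LINT t|lebesgue. indicator {0<..} t *\<^sub>R f t)"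
    using set_lebesgue_integral_eq_integral(2)[OF f] by (simp add: set_lebesgue_integral_def)
  have m: "(\<lambda>t. indicator {0<..} t *\<^sub>R f t) \<in> borel_measurable lebesgue" using int by auto
  have "((\<lambda>T. LINT t|lebesgue. indicator {1 / T..} t *\<^sub>R (indicator {0<..} t *\<^sub>R f t)) \<longlongrightarrow> (LINT t|lebesgue. indicator {0<..} t *\<^sub>R f t)) at_top"
  proof (rule integral_dominated_convergence_at_top[where w="\<lambda>t. norm (indicator {0<..} t *\<^sub>R f t)"])
    show "(\<lambda>t. indicator {1 / T..} t *\<^sub>R (indicator {0<..} t *\<^sub>R f t)) \<in> borel_measurable lebesgue" for T :: real
      by (rule borel_measurable_scaleR[OF _ m]) (rule borel_measurable_indicator, rule sets_completionI_sets, simp)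
    show "integrable lebesgue (\<lambda>t. norm (indicator {0<..} t *\<^sub>R f t))" by (rule integrable_norm[OF int])
    show "\<forall>\<^sub>F T in at_top. AE t in lebesgue. norm (indicator {1 / T..} t *\<^sub>R (indicator {0<..} t *\<^sub>R f t)) \<le> norm (indicator {0<..} t *\<^sub>R f t)"
      by (intro always_eventually allI AE_I2) (simp add: indicator_def)
    show "AE t in lebesgue. ((\<lambda>T. indicator {1 / T..} t *\<^sub>R (indicator {0<..} t *\<^sub>R f t)) \<longlongrightarrow> indicator {0<..} t *\<^sub>R f t) at_top"
    proof (intro AE_I2)
      fix t :: real
      show "((\<lambda>T. indicator {1 / T..} t *\<^sub>R (indicator {0<..} t *\<^sub>R f t)) \<longlongrightarrow> indicator {0<..} t *\<^sub>R f t) at_top"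
      proof (cases "0 < t")
        case True
        have "eventually (\<lambda>T. indicator {0<..} t *\<^sub>R f t = indicator {1 / T..} t *\<^sub>R (indicator {0<..} t *\<^sub>R f t)) at_top"
          using eventually_gt_at_top[of "1 / t"]
        proof eventually_elim
          case (elim T)
          then have "0 < T" using True by (meson less_trans zero_less_divide_1_iff)
          then have "1 / T \<le> t" using elim True by (simp add: field_simps)
          then show ?case by simp
        qed
        then show ?thesis by (rule Lim_transform_eventually[OF tendsto_const])
      qed simp
    qed
  qed (rule m)
  then have "((\<lambda>\<epsilon>. LINT t|lebesgue. indicator {1 / inverse \<epsilon>..} t *\<^sub>R (indicator {0<..} t *\<^sub>R f t)) \<longlongrightarrow> (LINT t|lebesgue. indicator {0<..} t *\<^sub>R f t)) (at_right 0)"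
    by (rule filterlim_compose[OF _ filterlim_inverse_at_top_right])
  then show ?thesis unfolding eq0
  proof (rule Lim_transform_eventually)
    show "\<forall>\<^sub>F \<epsilon> in at_right 0. (LINT t|lebesgue. indicator {1 / inverse \<epsilon>..} t *\<^sub>R (indicator {0<..} t *\<^sub>R f t)) = integral {\<epsilon>..} f"
      using eventually_at_right_less[of "0::real"]
    proof eventually_elim
      case (elim \<epsilon>)
      have ind: "(indicator {1 / inverse \<epsilon>..} t *\<^sub>R (indicator {0<..} t *\<^sub>R f t)) = indicator {\<epsilon>..} t *\<^sub>R f t" for t
      proof -
        have "1 / inverse \<epsilon> = \<epsilon>" by (simp add: inverse_eq_divide)
        moreover have "0 < t" if "\<epsilon> \<le> t" using that elim by linarith
        ultimately show ?thesis by (cases "\<epsilon> \<le> t") (auto simp: indicator_def)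
      qed
      show ?case unfolding ind by (rule eq[OF elim, symmetric])
    qed
  qed
qed

definition parity_sign :: "int \<Rightarrow> real" where "parity_sign l = (if even l then 1 else -1)"

lemma parity_sign_simps [simp]: "parity_sign 0 = 1" "parity_sign (l - 1) = - parity_sign l" "parity_sign (l - 2) = parity_sign l" "parity_sign (l + 1) = - parity_sign l"
  by (auto simp: parity_sign_def)

text \<open>
  The two halves of a line are combined because single halves have no finite part in general: in
  the boundary terms of the recurrences, the sign \<open>(-1)\<^sup>l\<close> removes half of the powers of \<open>\<epsilon>\<close>,
  among them all those which could have exponent 0. The exponents \<open>l - 2 \<beta>\<close> form a family that
  is closed under the recurrences, also when \<open>\<beta>\<close> is changed by 1.
\<close>

definition mellin_pair :: "real \<Rightarrow> real \<Rightarrow> real \<Rightarrow> int \<Rightarrow> real \<Rightarrow> real" where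
  "mellin_pair u b \<beta> l \<epsilon> = mellin_tail u b \<beta> (of_int l - 2 * \<beta>) \<epsilon> + parity_sign l * mellin_tail u (- b) \<beta> (of_int l - 2 * \<beta>) \<epsilon>"

lemma mellin_pair_rec:
  assumes u: "0 < u" and \<beta>: "-1 < \<beta>" and \<epsilon>: "0 < \<epsilon>" "\<epsilon> < half_chord u b - \<bar>b\<bar>"
  shows "(of_int l - 2 * \<beta> - 2) * u * mellin_pair u b \<beta> (l - 2) \<epsilon> - 2 * b * (of_int l - 1 - \<beta>) * mellin_pair u b \<beta> (l - 1) \<epsilon> - of_int l * mellin_pair u b \<beta> l \<epsilon>
    = - (\<epsilon> powr (of_int l - 2 * (\<beta> + 1)) * ((u - 2 * b * \<epsilon> - \<epsilon>\<^sup>2) powr (\<beta> + 1) + parity_sign l * (u + 2 * b * \<epsilon> - \<epsilon>\<^sup>2) powr (\<beta> + 1)))"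
proof -
  define a where "a = of_int l - 2 * (\<beta> + 1)"
  have a: "of_int (l - 2) - 2 * \<beta> = a" "of_int (l - 1) - 2 * \<beta> = a + 1" "of_int l - 2 * \<beta> = a + 2"
    "of_int l - 2 * \<beta> - 2 = a" "of_int l - 1 - \<beta> = \<beta> + 1 + a" "of_int l = 2 * (\<beta> + 1) + a"
    by (auto simp: a_def)
  have 1: "a * u * mellin_tail u b \<beta> a \<epsilon> - 2 * b * (\<beta> + 1 + a) * mellin_tail u b \<beta> (a + 1) \<epsilon> - (2 * (\<beta> + 1) + a) * mellin_tail u b \<beta> (a + 2) \<epsilon>
     = - ((u - 2 * b * \<epsilon> - \<epsilon>\<^sup>2) powr (\<beta> + 1) * \<epsilon> powr a)"
    by (rule mellin_tail_rec[OF u \<beta> \<epsilon>(1)]) (use \<epsilon> in linarith)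
  have 2: "a * u * mellin_tail u (- b) \<beta> a \<epsilon> - 2 * (- b) * (\<beta> + 1 + a) * mellin_tail u (- b) \<beta> (a + 1) \<epsilon> - (2 * (\<beta> + 1) + a) * mellin_tail u (- b) \<beta> (a + 2) \<epsilon>
     = - ((u - 2 * (- b) * \<epsilon> - \<epsilon>\<^sup>2) powr (\<beta> + 1) * \<epsilon> powr a)"
    by (rule mellin_tail_rec[OF u \<beta> \<epsilon>(1)]) (use \<epsilon> in \<open>simp; linarith\<close>)
  have "(a * u * (mellin_tail u b \<beta> a \<epsilon> + parity_sign l * mellin_tail u (- b) \<beta> a \<epsilon>) - 2 * b * (\<beta> + 1 + a) * (mellin_tail u b \<beta> (a + 1) \<epsilon> - parity_sign l * mellin_tail u (- b) \<beta> (a + 1) \<epsilon>)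
     - (2 * (\<beta> + 1) + a) * (mellin_tail u b \<beta> (a + 2) \<epsilon> + parity_sign l * mellin_tail u (- b) \<beta> (a + 2) \<epsilon>))
    = (a * u * mellin_tail u b \<beta> a \<epsilon> - 2 * b * (\<beta> + 1 + a) * mellin_tail u b \<beta> (a + 1) \<epsilon> - (2 * (\<beta> + 1) + a) * mellin_tail u b \<beta> (a + 2) \<epsilon>)
     + parity_sign l * (a * u * mellin_tail u (- b) \<beta> a \<epsilon> - 2 * (- b) * (\<beta> + 1 + a) * mellin_tail u (- b) \<beta> (a + 1) \<epsilon> - (2 * (\<beta> + 1) + a) * mellin_tail u (- b) \<beta> (a + 2) \<epsilon>)"
    by (simp add: algebra_simps)
  also have "\<dots> = - (\<epsilon> powr a * ((u - 2 * b * \<epsilon> - \<epsilon>\<^sup>2) powr (\<beta> + 1) + parity_sign l * (u + 2 * b * \<epsilon> - \<epsilon>\<^sup>2) powr (\<beta> + 1)))"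
    unfolding 1 2 by (simp add: algebra_simps)
  finally show ?thesis
    unfolding mellin_pair_def parity_sign_simps unfolding a(1) a(2) a_def[symmetric] unfolding a(4) a(5) unfolding a(3) unfolding a(6)
    by (simp add: algebra_simps)
qed

lemma mellin_pair_raise:
  assumes u: "0 < u" and \<beta>: "-1 < \<beta>" and \<epsilon>: "0 < \<epsilon>"
  shows "mellin_pair u b (\<beta> + 1) l \<epsilon> = u * mellin_pair u b \<beta> (l - 2) \<epsilon> - 2 * b * mellin_pair u b \<beta> (l - 1) \<epsilon> - mellin_pair u b \<beta> l \<epsilon>"
proof -
  define a where "a = of_int l - 2 * (\<beta> + 1)"
  have a: "of_int (l - 2) - 2 * \<beta> = a" "of_int (l - 1) - 2 * \<beta> = a + 1" "of_int l - 2 * \<beta> = a + 2" "of_int l - 2 * (\<beta> + 1) = a"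
    by (auto simp: a_def)
  show ?thesis unfolding mellin_pair_def a parity_sign_simps mellin_tail_raise[OF u \<beta> \<epsilon>] by (simp add: algebra_simps)
qed

text \<open>
  Expand both powers at 0. The terms \<open>\<epsilon>\<^sup>l\<^sup>+\<^sup>i\<^sup>-\<^sup>2\<^sup>\<gamma>\<close> with \<open>l + i\<close> odd cancel, and those with
  \<open>l + i\<close> even have a nonzero exponent because \<open>\<gamma>\<close> is not an integer.
\<close>

lemma finite_part_boundary:
  assumes u: "0 < u" and \<gamma>: "\<gamma> \<notin> \<int>"
  shows "finite_part (\<lambda>\<epsilon>. \<epsilon> powr (of_int l - 2 * \<gamma>) * ((u - 2 * b * \<epsilon> - \<epsilon>\<^sup>2) powr \<gamma> + parity_sign l * (u + 2 * b * \<epsilon> - \<epsilon>\<^sup>2) powr \<gamma>)) 0"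
proof -
  define \<kappa> where "\<kappa> = of_int l - 2 * \<gamma>"
  \<comment> \<open>Enough Taylor terms for the remainder to tend to 0 in spite of the power in front.\<close>
  define N where "N = nat \<lceil>\<bar>\<kappa>\<bar>\<rceil> + 1"
  have N: "0 < \<kappa> + real N" unfolding N_def by linarith
  obtain r M where rM: "r > 0" "M \<ge> 0" and ex: "\<And>b'. \<bar>b'\<bar> \<le> \<bar>b\<bar> \<Longrightarrow> (\<exists>a::nat \<Rightarrow> real. \<forall>t. \<bar>t\<bar> \<le> r \<longrightarrow>
     0 < u - 2 * b' * t - t\<^sup>2 \<and> \<bar>(u - 2 * b' * t - t\<^sup>2) powr \<gamma> - (\<Sum>i<N. a i * t ^ i)\<bar> \<le> M * \<bar>t\<bar> ^ N)"
    using taylor_quadratic_powr[OF u abs_ge_zero[of b], of \<gamma> N] by blast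
  obtain a :: "nat \<Rightarrow> real" where a: "\<And>t. \<bar>t\<bar> \<le> r \<Longrightarrow> \<bar>(u - 2 * b * t - t\<^sup>2) powr \<gamma> - (\<Sum>i<N. a i * t ^ i)\<bar> \<le> M * \<bar>t\<bar> ^ N"
    using ex[of b] by blast
  define P where "P \<epsilon> = (\<Sum>i<N. (a i * (1 + parity_sign l * (-1) ^ i)) * \<epsilon> powr (\<kappa> + real i))" for \<epsilon>
  have fpP: "finite_part P 0"
  proof -
    have "finite_part P (\<Sum>i<N. 0)" unfolding P_def
    proof (intro finite_part_sum)
      fix i assume "i \<in> {..<N}"
      show "finite_part (\<lambda>\<epsilon>. (a i * (1 + parity_sign l * (-1) ^ i)) * \<epsilon> powr (\<kappa> + real i)) 0"
      proof (cases "even (l + int i)")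
        case True
        have "\<kappa> + real i \<noteq> 0"
        proof
          assume "\<kappa> + real i = 0"
          then have "2 * \<gamma> = of_int (l + int i)" by (simp add: \<kappa>_def)
          moreover define c where "c = (l + int i) div 2"
          have "l + int i = 2 * c" using True by (simp add: c_def)
          ultimately have "\<gamma> = of_int c" by simp
          then show False using \<gamma> by simp
        qed
        then show ?thesis by (rule finite_part_powr)
      next
        case False
        then have "1 + parity_sign l * (-1) ^ i = 0" by (auto simp: parity_sign_def)
        then show ?thesis by (intro finite_part_tendsto) simp
      qed
    qed simp
    then show ?thesis by simp
  qed
  define X where "X \<epsilon> = \<epsilon> powr \<kappa> * ((u - 2 * b * \<epsilon> - \<epsilon>\<^sup>2) powr \<gamma> + parity_sign l * (u + 2 * b * \<epsilon> - \<epsilon>\<^sup>2) powr \<gamma>)" for \<epsilon>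
  have "((\<lambda>\<epsilon>. X \<epsilon> - P \<epsilon>) \<longlongrightarrow> 0) (at_right 0)"
  proof (rule Lim_null_comparison)
    have "((\<lambda>\<epsilon>::real. (2 * M) * \<epsilon> powr (\<kappa> + real N)) \<longlongrightarrow> (2 * M) * 0) (at_right 0)"
      by (intro tendsto_mult_left powr_tendsto_0_at_right N)
    then show "((\<lambda>\<epsilon>::real. (2 * M) * \<epsilon> powr (\<kappa> + real N)) \<longlongrightarrow> 0) (at_right 0)" by simp
    have "eventually (\<lambda>\<epsilon>::real. \<epsilon> < r) (at_right 0)"
      by (rule order_tendstoD[OF tendsto_ident_at]) (use rM in simp)
    with eventually_at_right_less[of "0::real"]
    show "\<forall>\<^sub>F \<epsilon> in at_right 0. norm (X \<epsilon> - P \<epsilon>) \<le> (2 * M) * \<epsilon> powr (\<kappa> + real N)"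
    proof eventually_elim
      case (elim \<epsilon>)
      then have e: "0 < \<epsilon>" "\<bar>\<epsilon>\<bar> \<le> r" "\<bar>- \<epsilon>\<bar> \<le> r" by auto
      define E1 where "E1 = (u - 2 * b * \<epsilon> - \<epsilon>\<^sup>2) powr \<gamma> - (\<Sum>i<N. a i * \<epsilon> ^ i)"
      define E2 where "E2 = (u + 2 * b * \<epsilon> - \<epsilon>\<^sup>2) powr \<gamma> - (\<Sum>i<N. a i * (- \<epsilon>) ^ i)"
      have E: "\<bar>E1\<bar> \<le> M * \<epsilon> ^ N" "\<bar>E2\<bar> \<le> M * \<epsilon> ^ N"
        using a[OF e(2)] a[OF e(3)] e by (auto simp: E1_def E2_def)
      have "P \<epsilon> = \<epsilon> powr \<kappa> * ((\<Sum>i<N. a i * \<epsilon> ^ i) + parity_sign l * (\<Sum>i<N. a i * (- \<epsilon>) ^ i))"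
        unfolding P_def sum_distrib_left sum.distrib[symmetric]
      proof (intro sum.cong refl)
        fix i
        have "\<epsilon> powr (\<kappa> + real i) = \<epsilon> powr \<kappa> * \<epsilon> ^ i" using e by (simp add: powr_add powr_realpow)
        moreover have "(- \<epsilon>) ^ i = (-1) ^ i * \<epsilon> ^ i" by (rule power_minus)
        ultimately show "a i * (1 + parity_sign l * (-1) ^ i) * \<epsilon> powr (\<kappa> + real i) = \<epsilon> powr \<kappa> * (a i * \<epsilon> ^ i + parity_sign l * (a i * (- \<epsilon>) ^ i))"
          by (simp add: algebra_simps)
      qed
      then have "X \<epsilon> - P \<epsilon> = \<epsilon> powr \<kappa> * (E1 + parity_sign l * E2)"
        unfolding X_def E1_def E2_def by (simp add: algebra_simps)
      moreover have "\<bar>E1 + parity_sign l * E2\<bar> \<le> 2 * (M * \<epsilon> ^ N)"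
        using E by (auto simp: parity_sign_def abs_le_iff)
      ultimately have "norm (X \<epsilon> - P \<epsilon>) \<le> \<epsilon> powr \<kappa> * (2 * (M * \<epsilon> ^ N))"
        by (simp add: abs_mult mult_left_mono)
      also have "\<dots> = (2 * M) * \<epsilon> powr (\<kappa> + real N)" using e by (simp add: powr_add powr_realpow)
      finally show ?case .
    qed
  qed
  from finite_part_add[OF fpP finite_part_tendsto[OF this]] show ?thesis by (simp add: X_def \<kappa>_def)
qed

section \<open>Finite parts of the Mellin integrals\<close>

text \<open>
  The substitution rule with separate names for the image and for the transformed integrand.
\<close>

lemma change_of_variables_on:
  fixes f g h :: "real \<Rightarrow> real"
  assumes S: "S \<in> sets lebesgue"
    and der: "\<And>x. x \<in> S \<Longrightarrow> (g has_field_derivative g' x) (at x)"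
    and inj: "inj_on g S" and img: "g ` S = T"
    and h: "\<And>x. x \<in> S \<Longrightarrow> \<bar>g' x\<bar> * f (g x) = h x"
  shows "(h absolutely_integrable_on S \<and> integral S h = I) \<longleftrightarrow> (f absolutely_integrable_on T \<and> integral T f = I)"
proof -
  have "(\<lambda>x. \<bar>g' x\<bar> * f (g x)) absolutely_integrable_on S \<and> integral S (\<lambda>x. \<bar>g' x\<bar> * f (g x)) = I
     \<longleftrightarrow> f absolutely_integrable_on (g ` S) \<and> integral (g ` S) f = I"
    by (rule has_absolute_integral_change_of_variables_1'[OF S _ inj]) (rule has_field_derivative_at_within[OF der])
  moreover have "(\<lambda>x. \<bar>g' x\<bar> * f (g x)) absolutely_integrable_on S \<longleftrightarrow> h absolutely_integrable_on S"
    by (rule set_integrable_cong) (auto simp: h)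
  moreover have "integral S (\<lambda>x. \<bar>g' x\<bar> * f (g x)) = integral S h"
    by (rule integral_cong) (rule h)
  ultimately show ?thesis by (simp add: img)
qed

lemma beta_integral_half_line:
  fixes \<beta> :: real
  assumes \<beta>: "-1 < \<beta>" "\<beta> < 0"
  shows "(\<lambda>r. r powr \<beta> / (1 + r)) absolutely_integrable_on {0<..} \<and> integral {0<..} (\<lambda>r. r powr \<beta> / (1 + r)) = Beta (\<beta> + 1) (- \<beta>)"
proof -
  let ?f = "\<lambda>t::real. t powr \<beta> * (1 - t) powr (- \<beta> - 1)"
  have "(?f has_integral Beta (\<beta> + 1) (- \<beta>)) {0..1}"
    using has_integral_Beta_real[of "\<beta> + 1" "- \<beta>"] \<beta> by simp
  then have hi: "(?f has_integral Beta (\<beta> + 1) (- \<beta>)) {0<..<1}"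
    by (simp add: has_integral_Icc_iff_Ioo)
  then have "?f integrable_on {0<..<1}" by (rule has_integral_integrable)
  then have "?f absolutely_integrable_on {0<..<1}"
    by (rule nonnegative_absolutely_integrable_1) auto
  then have f: "?f absolutely_integrable_on {0<..<1} \<and> integral {0<..<1} ?f = Beta (\<beta> + 1) (- \<beta>)"
    using integral_unique[OF hi] by simp
  show ?thesis
  proof (rule iffD2[OF change_of_variables_on[where f="?f" and g="\<lambda>r. r / (1 + r)" and g'="\<lambda>r. 1 / (1 + r)\<^sup>2"] f])
    show "{0::real<..} \<in> sets lebesgue" by (rule sets_completionI_sets) simp
    show "((\<lambda>r. r / (1 + r)) has_field_derivative 1 / (1 + r)\<^sup>2) (at r)" if "r \<in> {0<..}" for r :: real
      using that by (auto intro!: derivative_eq_intros simp: power2_eq_square field_simps)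
    show "inj_on (\<lambda>r::real. r / (1 + r)) {0<..}" by (auto simp: inj_on_def field_simps)
    show "(\<lambda>r::real. r / (1 + r)) ` {0<..} = {0<..<1}"
    proof (intro equalityI subsetI)
      fix y :: real assume y: "y \<in> {0<..<1}"
      then have "y = (y / (1 - y)) / (1 + y / (1 - y))" "y / (1 - y) \<in> {0<..}" by (auto simp: field_simps)
      then show "y \<in> (\<lambda>r. r / (1 + r)) ` {0<..}" by (rule image_eqI)
    qed auto
    fix r :: real assume "r \<in> {0<..}"
    then have r: "0 < r" by simp
    have "1 - r / (1 + r) = 1 / (1 + r)" using r by (simp add: field_simps)
    then have "?f (r / (1 + r)) = (r powr \<beta> / (1 + r) powr \<beta>) * (1 + r) powr (\<beta> + 1)"
      using r by (simp add: powr_divide powr_minus_divide powr_minus divide_simps flip: powr_minus) (simp add: powr_minus powr_add[symmetric] field_simps)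
    also have "\<dots> = r powr \<beta> * (1 + r)" using r by (simp add: powr_add)
    finally have e: "?f (r / (1 + r)) = r powr \<beta> * (1 + r)" .
    show "\<bar>1 / (1 + r)\<^sup>2\<bar> * ?f (r / (1 + r)) = r powr \<beta> / (1 + r)"
      unfolding e using r by (simp add: power2_eq_square)
  qed
qed

text \<open>
  The slice, up to a power of \<open>t\<close>, in the variable \<open>\<sigma> = 1/t - b/u\<close>. This choice completes the
  square and makes the result independent of the sign of \<open>b\<close>.
\<close>

definition inverted_slice :: "real \<Rightarrow> real \<Rightarrow> real \<Rightarrow> real \<Rightarrow> real" where
  "inverted_slice u b \<beta> \<sigma> = (u * \<sigma>\<^sup>2 - (half_chord u b)\<^sup>2 / u) powr \<beta>"

context
  fixes u b \<beta> :: real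
  assumes u: "0 < u"
begin

lemma inverted_slice_subst:
  assumes t: "0 < t"
  shows "u * (1 / t - b / u)\<^sup>2 - (half_chord u b)\<^sup>2 / u = (u - 2 * b * t - t\<^sup>2) / t\<^sup>2"
  using u t by (simp add: half_chord_sq[OF u] power2_diff power_divide field_simps) (simp add: power2_eq_square algebra_simps)

lemma inverted_slice_eq_slice:
  assumes t: "0 < t" "t \<le> half_chord u b - b"
  shows "inverted_slice u b \<beta> (1 / t - b / u) = slice u b \<beta> t * t powr (- 2 * \<beta>)"
proof -
  have R: "\<bar>b\<bar> < half_chord u b" by (rule half_chord_gt[OF u])
  have w: "0 \<le> u - 2 * b * t - t\<^sup>2"
    unfolding quadratic_factor[OF u] using t R by (intro mult_nonneg_nonneg) auto
  have "inverted_slice u b \<beta> (1 / t - b / u) = ((u - 2 * b * t - t\<^sup>2) / t\<^sup>2) powr \<beta>"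
    unfolding inverted_slice_def inverted_slice_subst[OF t(1)] ..
  also have "\<dots> = (u - 2 * b * t - t\<^sup>2) powr \<beta> / (t powr 2) powr \<beta>"
    using w t by (simp add: powr_divide)
  also have "\<dots> = (u - 2 * b * t - t\<^sup>2) powr \<beta> * t powr (- 2 * \<beta>)"
    using t by (simp only: powr_powr powr_minus divide_inverse mult_minus_left)
  also have "(u - 2 * b * t - t\<^sup>2) powr \<beta> = slice u b \<beta> t"
    using w by (auto simp: slice_def)
  finally show ?thesis .
qed

lemma inverse_endpoint: "1 / (half_chord u b - b) = (half_chord u b + b) / u"
proof -
  have "(half_chord u b + b) * (half_chord u b - b) = u" using half_chord_sq[OF u, of b] by (simp add: algebra_simps power2_eq_square)
  then show ?thesis using half_chord_gt[OF u, of b] u by (simp add: field_simps)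
qed

lemma sigma_image:
  "(\<lambda>t. 1 / t - b / u) ` {0<..<half_chord u b - b} = {half_chord u b / u<..}"
proof (intro equalityI subsetI)
  have R: "\<bar>b\<bar> < half_chord u b" by (rule half_chord_gt[OF u])
  fix \<sigma> assume "\<sigma> \<in> (\<lambda>t. 1 / t - b / u) ` {0<..<half_chord u b - b}"
  then obtain t where t: "\<sigma> = 1 / t - b / u" "0 < t" "t < half_chord u b - b" by auto
  have "1 / (half_chord u b - b) < 1 / t" using t by (intro divide_strict_left_mono) auto
  then show "\<sigma> \<in> {half_chord u b / u<..}" unfolding inverse_endpoint t(1) by (simp add: add_divide_distrib)
next
  have R: "\<bar>b\<bar> < half_chord u b" by (rule half_chord_gt[OF u])
  fix \<sigma> assume "\<sigma> \<in> {half_chord u b / u<..}"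
  then have s: "1 / (half_chord u b - b) < \<sigma> + b / u" unfolding inverse_endpoint by (simp add: add_divide_distrib)
  have "0 < 1 / (half_chord u b - b)" using R by auto
  then have p: "0 < \<sigma> + b / u" using s by linarith
  define t where "t = 1 / (\<sigma> + b / u)"
  have "t < 1 / (1 / (half_chord u b - b))" unfolding t_def using s p R by (intro divide_strict_left_mono mult_pos_pos) auto
  then have "t \<in> {0<..<half_chord u b - b}" using p by (simp add: t_def)
  moreover have "\<sigma> = 1 / t - b / u" by (simp add: t_def)
  ultimately show "\<sigma> \<in> (\<lambda>t. 1 / t - b / u) ` {0<..<half_chord u b - b}" by blast
qed

lemma sigma_image_closed:
  assumes \<epsilon>: "0 < \<epsilon>" "\<epsilon> < half_chord u b - b"
  shows "(\<lambda>t. 1 / t - b / u) ` {\<epsilon>..half_chord u b - b} = {half_chord u b / u..1 / \<epsilon> - b / u}"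
proof (intro equalityI subsetI)
  have R: "\<bar>b\<bar> < half_chord u b" by (rule half_chord_gt[OF u])
  fix \<sigma> assume "\<sigma> \<in> (\<lambda>t. 1 / t - b / u) ` {\<epsilon>..half_chord u b - b}"
  then obtain t where t: "\<sigma> = 1 / t - b / u" "\<epsilon> \<le> t" "t \<le> half_chord u b - b" by auto
  have "1 / (half_chord u b - b) \<le> 1 / t" "1 / t \<le> 1 / \<epsilon>" using t \<epsilon> by (auto intro!: divide_left_mono)
  then show "\<sigma> \<in> {half_chord u b / u..1 / \<epsilon> - b / u}" unfolding inverse_endpoint t(1) by (simp add: add_divide_distrib)
next
  have R: "\<bar>b\<bar> < half_chord u b" by (rule half_chord_gt[OF u])
  fix \<sigma> assume "\<sigma> \<in> {half_chord u b / u..1 / \<epsilon> - b / u}"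
  then have s: "1 / (half_chord u b - b) \<le> \<sigma> + b / u" "\<sigma> + b / u \<le> 1 / \<epsilon>" unfolding inverse_endpoint by (auto simp: add_divide_distrib)
  have "0 < 1 / (half_chord u b - b)" using R by auto
  then have p: "0 < \<sigma> + b / u" using s by linarith
  define t where "t = 1 / (\<sigma> + b / u)"
  have "t \<le> 1 / (1 / (half_chord u b - b))" unfolding t_def using s p R by (intro divide_left_mono mult_pos_pos) auto
  moreover have "1 / (1 / \<epsilon>) \<le> t" unfolding t_def using s p \<epsilon> by (intro divide_left_mono mult_pos_pos) auto
  ultimately have "t \<in> {\<epsilon>..half_chord u b - b}" by simp
  moreover have "\<sigma> = 1 / t - b / u" by (simp add: t_def)
  ultimately show "\<sigma> \<in> (\<lambda>t. 1 / t - b / u) ` {\<epsilon>..half_chord u b - b}" by blast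
qed

lemma sigma_inj: "S \<subseteq> {0<..} \<Longrightarrow> inj_on (\<lambda>t. 1 / t - b / u) S"
  by (auto simp: inj_on_def)

lemma sigma_deriv: "0 < t \<Longrightarrow> ((\<lambda>t. 1 / t - b / u) has_field_derivative - (1 / t\<^sup>2)) (at t)"
  by (auto intro!: derivative_eq_intros simp: power2_eq_square)

end

lemma inverted_slice_minus: "inverted_slice u (- b) \<beta> = inverted_slice u b \<beta>"
  by (simp add: inverted_slice_def fun_eq_iff half_chord_minus)

lemma mellin_tail_minus_one:
  assumes u: "0 < u" and \<beta>: "-1 < \<beta>" and \<epsilon>: "0 < \<epsilon>" "\<epsilon> < half_chord u b - b"
  shows "inverted_slice u b \<beta> absolutely_integrable_on {half_chord u b / u..1 / \<epsilon> - b / u} \<and>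
    integral {half_chord u b / u..1 / \<epsilon> - b / u} (inverted_slice u b \<beta>) = mellin_tail u b \<beta> (-1 - 2 * \<beta>) \<epsilon>"
proof -
  let ?q = "half_chord u b - b"
  let ?h = "\<lambda>t. slice u b \<beta> t * t powr (-1 - 2 * \<beta> - 1)"
  have A: "?h absolutely_integrable_on {\<epsilon>..}" by (rule slice_powr_integrable[OF u \<beta> \<epsilon>(1)])
  have A': "?h absolutely_integrable_on {\<epsilon>..?q}"
    by (rule set_integrable_subset[OF A]) auto
  have "integral {\<epsilon>..?q} ?h = integral {\<epsilon>..} ?h"
  proof -
    have "integral {\<epsilon>..?q} ?h = integral {\<epsilon>..} (\<lambda>t. if t \<in> {\<epsilon>..?q} then ?h t else 0)"
      by (subst integral_restrict_Int) (simp add: Int_absorb2 Int_absorb1)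
    also have "\<dots> = integral {\<epsilon>..} ?h"
      by (rule integral_cong) (auto simp: slice_eq_0[OF u])
    finally show ?thesis .
  qed
  with A' have "?h absolutely_integrable_on {\<epsilon>..?q} \<and> integral {\<epsilon>..?q} ?h = mellin_tail u b \<beta> (-1 - 2 * \<beta>) \<epsilon>"
    by (simp add: mellin_tail_def)
  then show ?thesis
  proof (rule iffD1[OF change_of_variables_on[where g="\<lambda>t. 1 / t - b / u" and g'="\<lambda>t. - (1 / t\<^sup>2)"], rotated -1])
    show "{\<epsilon>..?q} \<in> sets lebesgue" by (rule sets_completionI_sets) simp
    show "((\<lambda>t. 1 / t - b / u) has_field_derivative - (1 / t\<^sup>2)) (at t)" if "t \<in> {\<epsilon>..?q}" for t
      using that \<epsilon> by (intro sigma_deriv[OF u]) auto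
    show "inj_on (\<lambda>t. 1 / t - b / u) {\<epsilon>..?q}" using \<epsilon> by (intro sigma_inj[OF u]) auto
    show "(\<lambda>t. 1 / t - b / u) ` {\<epsilon>..?q} = {half_chord u b / u..1 / \<epsilon> - b / u}" by (rule sigma_image_closed[OF u \<epsilon>])
    fix t assume t: "t \<in> {\<epsilon>..?q}"
    then have t0: "0 < t" "t \<le> ?q" using \<epsilon> by auto
    have e: "t powr (- 2 * \<beta>) = t powr (-1 - 2 * \<beta> - 1) * t\<^sup>2"
      using t0 by (intro powr_shift(2)) auto
    show "\<bar>- (1 / t\<^sup>2)\<bar> * inverted_slice u b \<beta> (1 / t - b / u) = ?h t"
      unfolding inverted_slice_eq_slice[OF u t0] e using t0 by simp
  qed
qed

text \<open>
  In the variable \<open>\<sigma>\<close>, both halves integrate the same function from \<open>R/u\<close> on, up to \<open>1/\<epsilon> - b/u\<close>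
  and \<open>1/\<epsilon> + b/u\<close>. The difference is an integral over an interval of fixed length that moves to
  infinity, where the integrand tends to 0 because \<open>\<beta> < 0\<close>.
\<close>

lemma mellin_pair_minus_one_tendsto:
  assumes u: "0 < u" and \<beta>: "-1 < \<beta>" "\<beta> < 0"
  shows "((\<lambda>\<epsilon>. mellin_pair u b \<beta> (-1) \<epsilon>) \<longlongrightarrow> 0) (at_right 0)"
proof -
  define R where "R = half_chord u b"
  define c where "c = \<bar>b\<bar> / u"
  have R: "\<bar>b\<bar> < R" unfolding R_def by (rule half_chord_gt[OF u])
  have bound: "\<bar>mellin_pair u b \<beta> (-1) \<epsilon>\<bar> \<le> (2 * c) * (u * (1 / \<epsilon> - c)\<^sup>2 - R\<^sup>2 / u) powr \<beta>"
    if \<epsilon>: "0 < \<epsilon>" "\<epsilon> < R - \<bar>b\<bar>" "(R + 1) / u + c < 1 / \<epsilon>" for \<epsilon>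
  proof -
    define x y where "x = 1 / \<epsilon> - c" and "y = 1 / \<epsilon> + c"
    let ?K = "\<lambda>x. integral {R / u..x} (inverted_slice u b \<beta>)"
    have c0: "0 \<le> c" using u by (simp add: c_def)
    have "0 < 1 / u" using u by simp
    then have xy: "x \<le> y" "R / u < x"
      using \<epsilon>(3) c0 unfolding x_def y_def add_divide_distrib by linarith+
    have Y1: "inverted_slice u b \<beta> absolutely_integrable_on {R / u..1 / \<epsilon> - b / u}" "?K (1 / \<epsilon> - b / u) = mellin_tail u b \<beta> (-1 - 2 * \<beta>) \<epsilon>"
      using mellin_tail_minus_one[OF u \<beta>(1) \<epsilon>(1), of b] \<epsilon>(2) by (auto simp: R_def)
    have Y2: "inverted_slice u b \<beta> absolutely_integrable_on {R / u..1 / \<epsilon> + b / u}" "?K (1 / \<epsilon> + b / u) = mellin_tail u (- b) \<beta> (-1 - 2 * \<beta>) \<epsilon>"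
      using mellin_tail_minus_one[OF u \<beta>(1) \<epsilon>(1), of "- b"] \<epsilon>(2) by (auto simp: R_def inverted_slice_minus)
    have Zeq: "mellin_pair u b \<beta> (-1) \<epsilon> = ?K (1 / \<epsilon> - b / u) - ?K (1 / \<epsilon> + b / u)"
      using Y1(2) Y2(2) by (simp add: mellin_pair_def parity_sign_def)
    have abs: "\<bar>mellin_pair u b \<beta> (-1) \<epsilon>\<bar> = \<bar>?K y - ?K x\<bar>"
      unfolding Zeq x_def y_def c_def using u by (cases "0 \<le> b") (auto simp: abs_minus_commute)
    have inty: "inverted_slice u b \<beta> integrable_on {R / u..y}"
      using Y1(1) Y2(1) u unfolding y_def c_def
      by (cases "0 \<le> b") (auto intro: set_lebesgue_integral_eq_integral(1))
    have comb: "?K x + integral {x..y} (inverted_slice u b \<beta>) = ?K y"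
      using xy by (intro Henstock_Kurzweil_Integration.integral_combine[OF _ _ inty]) auto
    have intxy: "inverted_slice u b \<beta> integrable_on {x..y}"
      using xy by (intro integrable_subinterval_real[OF inty]) auto
    have kx: "0 \<le> inverted_slice u b \<beta> \<sigma>" "inverted_slice u b \<beta> \<sigma> \<le> inverted_slice u b \<beta> x" if "\<sigma> \<in> {x..y}" for \<sigma>
    proof -
      show "0 \<le> inverted_slice u b \<beta> \<sigma>" by (simp add: inverted_slice_def)
      have Ru: "0 < R / u" using R u by auto
      have x2: "(R / u)\<^sup>2 < x\<^sup>2" using xy(2) Ru by (intro power_strict_mono) auto
      have "R\<^sup>2 / u = u * (R / u)\<^sup>2" using u by (simp add: power_divide power2_eq_square)
      also have "\<dots> < u * x\<^sup>2" using x2 u by simp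
      finally have p: "0 < u * x\<^sup>2 - R\<^sup>2 / u" by simp
      have "x\<^sup>2 \<le> \<sigma>\<^sup>2" using that xy(2) Ru by (intro power_mono) auto
      then have "u * x\<^sup>2 \<le> u * \<sigma>\<^sup>2" using u by simp
      then show "inverted_slice u b \<beta> \<sigma> \<le> inverted_slice u b \<beta> x"
        unfolding inverted_slice_def R_def[symmetric] using p \<beta> by (intro powr_mono2') auto
    qed
    have "integral {x..y} (inverted_slice u b \<beta>) \<le> integral {x..y} (\<lambda>_. inverted_slice u b \<beta> x)"
      using kx by (intro integral_le intxy) auto
    also have "\<dots> = (2 * c) * inverted_slice u b \<beta> x" using xy by (simp add: x_def y_def)
    finally have "integral {x..y} (inverted_slice u b \<beta>) \<le> (2 * c) * inverted_slice u b \<beta> x" .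
    moreover have "0 \<le> integral {x..y} (inverted_slice u b \<beta>)"
      using kx by (intro integral_nonneg intxy) auto
    ultimately have "\<bar>?K y - ?K x\<bar> \<le> (2 * c) * inverted_slice u b \<beta> x" using comb by linarith
    then show ?thesis unfolding abs by (simp add: inverted_slice_def R_def x_def)
  qed
  have fl: "filterlim (\<lambda>\<epsilon>::real. u * (1 / \<epsilon> - c)\<^sup>2 - R\<^sup>2 / u) at_top (at_right 0)"
    using u by real_asymp
  have "((\<lambda>\<epsilon>. (2 * c) * (u * (1 / \<epsilon> - c)\<^sup>2 - R\<^sup>2 / u) powr \<beta>) \<longlongrightarrow> (2 * c) * 0) (at_right 0)"
    by (intro tendsto_mult_left tendsto_neg_powr[OF \<beta>(2) fl])
  then have lim: "((\<lambda>\<epsilon>. (2 * c) * (u * (1 / \<epsilon> - c)\<^sup>2 - R\<^sup>2 / u) powr \<beta>) \<longlongrightarrow> 0) (at_right 0)" by simp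
  have e1: "eventually (\<lambda>\<epsilon>::real. \<epsilon> < R - \<bar>b\<bar>) (at_right 0)"
    by (rule order_tendstoD[OF tendsto_ident_at]) (use R in simp)
  have "filterlim (\<lambda>\<epsilon>::real. 1 / \<epsilon>) at_top (at_right 0)" by real_asymp
  then have e2: "eventually (\<lambda>\<epsilon>::real. (R + 1) / u + c < 1 / \<epsilon>) (at_right 0)"
    by (simp add: filterlim_at_top_dense)
  show ?thesis
  proof (rule Lim_null_comparison[OF _ lim])
    show "\<forall>\<^sub>F \<epsilon> in at_right 0. norm (mellin_pair u b \<beta> (-1) \<epsilon>) \<le> (2 * c) * (u * (1 / \<epsilon> - c)\<^sup>2 - R\<^sup>2 / u) powr \<beta>"
      using eventually_at_right_less[of "0::real"] e1 e2
    proof eventually_elim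
      case (elim \<epsilon>)
      show ?case using bound[OF elim] by simp
    qed
  qed
qed

text \<open>
  In the variable \<open>\<sigma>\<close> the integrands have the denominators \<open>\<sigma> + b/u\<close> and \<open>\<sigma> - b/u\<close>. Their sum is
  \<open>r\<^sup>\<beta> / (1 + r)\<close> in the variable \<open>r = u \<sigma>\<^sup>2 - R\<^sup>2/u\<close>.
\<close>

lemma mellin_pair_zero_tendsto:
  assumes u: "0 < u" and \<beta>: "-1 < \<beta>" "\<beta> < 0"
  shows "((\<lambda>\<epsilon>. mellin_pair u b \<beta> 0 \<epsilon>) \<longlongrightarrow> Beta (\<beta> + 1) (- \<beta>)) (at_right 0)"
proof -
  define R where "R = half_chord u b"
  have R: "\<bar>b\<bar> < R" unfolding R_def by (rule half_chord_gt[OF u])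
  let ?S = "{R / u<..}"
  let ?h = "\<lambda>\<sigma>. 2 * u * \<sigma> * (inverted_slice u b \<beta> \<sigma> / (1 + (u * \<sigma>\<^sup>2 - R\<^sup>2 / u)))"
  have Ru: "0 < R / u" using R u by auto
  have pos: "0 < u * \<sigma>\<^sup>2 - R\<^sup>2 / u" if "\<sigma> \<in> ?S" for \<sigma>
  proof -
    have "(R / u)\<^sup>2 < \<sigma>\<^sup>2" using that Ru by (intro power_strict_mono) auto
    then have "u * (R / u)\<^sup>2 < u * \<sigma>\<^sup>2" using u by simp
    then show ?thesis using u by (simp add: power_divide power2_eq_square)
  qed
  have h: "?h absolutely_integrable_on ?S \<and> integral ?S ?h = Beta (\<beta> + 1) (- \<beta>)"
  proof (rule iffD2[OF change_of_variables_on[where f="\<lambda>r. r powr \<beta> / (1 + r)" and T="{0<..}" and g="\<lambda>\<sigma>. u * \<sigma>\<^sup>2 - R\<^sup>2 / u" and g'="\<lambda>\<sigma>. 2 * u * \<sigma>"] beta_integral_half_line[OF \<beta>]])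
    show "?S \<in> sets lebesgue" by (rule sets_completionI_sets) simp
    show "((\<lambda>\<sigma>. u * \<sigma>\<^sup>2 - R\<^sup>2 / u) has_field_derivative 2 * u * \<sigma>) (at \<sigma>)" for \<sigma>
      by (auto intro!: derivative_eq_intros)
    show "inj_on (\<lambda>\<sigma>. u * \<sigma>\<^sup>2 - R\<^sup>2 / u) ?S"
    proof (rule inj_onI)
      fix x y assume x: "x \<in> ?S" and y: "y \<in> ?S" and "u * x\<^sup>2 - R\<^sup>2 / u = u * y\<^sup>2 - R\<^sup>2 / u"
      then have e: "x\<^sup>2 = y\<^sup>2" using u by simp
      have xy: "0 \<le> x" "0 \<le> y" using x y Ru by auto
      show "x = y" by (rule power2_eq_imp_eq[OF e xy])
    qed
    show "(\<lambda>\<sigma>. u * \<sigma>\<^sup>2 - R\<^sup>2 / u) ` ?S = {0<..}"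
    proof (intro equalityI subsetI)
      fix y assume y: "y \<in> {0::real<..}"
      define \<sigma> where "\<sigma> = sqrt ((y + R\<^sup>2 / u) / u)"
      have "(R / u)\<^sup>2 < (y + R\<^sup>2 / u) / u" using y u by (simp add: power_divide power2_eq_square field_simps)
      then have "sqrt ((R / u)\<^sup>2) < \<sigma>" unfolding \<sigma>_def by (rule real_sqrt_less_mono)
      moreover have "sqrt ((R / u)\<^sup>2) = R / u" using Ru by (intro real_sqrt_unique) auto
      ultimately have "\<sigma> \<in> ?S" by simp
      moreover have "y = u * \<sigma>\<^sup>2 - R\<^sup>2 / u" unfolding \<sigma>_def using y u by (simp add: add_nonneg_nonneg)
      ultimately show "y \<in> (\<lambda>\<sigma>. u * \<sigma>\<^sup>2 - R\<^sup>2 / u) ` ?S" by blast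
    qed (use pos in auto)
    fix \<sigma> assume \<sigma>: "\<sigma> \<in> ?S"
    then have "0 < \<sigma>" using Ru by auto
    then show "\<bar>2 * u * \<sigma>\<bar> * ((u * \<sigma>\<^sup>2 - R\<^sup>2 / u) powr \<beta> / (1 + (u * \<sigma>\<^sup>2 - R\<^sup>2 / u))) = ?h \<sigma>"
      using u by (simp add: inverted_slice_def R_def abs_mult)
  qed
  define F where "F b' \<sigma> = inverted_slice u b \<beta> \<sigma> / (\<sigma> + b' / u)" for b' \<sigma>
  have den: "0 < \<sigma> + b' / u" if "\<sigma> \<in> ?S" "b' = b \<or> b' = - b" for \<sigma> b'
  proof -
    have "\<bar>b' / u\<bar> < R / u" using that(2) R u by (auto simp: abs_divide divide_strict_right_mono)
    moreover have "R / u < \<sigma>" using that(1) by simp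
    ultimately show ?thesis by linarith
  qed
  have hF: "?h \<sigma> = F b \<sigma> + F (- b) \<sigma>" if \<sigma>: "\<sigma> \<in> ?S" for \<sigma>
  proof -
    have d1: "0 < \<sigma> + b / u" and d2: "0 < \<sigma> + (- b) / u" using den[OF \<sigma>, of b] den[OF \<sigma>, of "- b"] by auto
    \<comment> \<open>Here \<open>R\<^sup>2 = u + b\<^sup>2\<close> enters: \<open>1 + r = u (\<sigma>\<^sup>2 - b\<^sup>2/u\<^sup>2)\<close>.\<close>
    have R2: "R\<^sup>2 / u = 1 + b\<^sup>2 / u" using half_chord_sq[OF u, of b] u by (simp add: R_def add_divide_distrib)
    have e: "1 + (u * \<sigma>\<^sup>2 - R\<^sup>2 / u) = u * ((\<sigma> + b / u) * (\<sigma> + (- b) / u))"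
      unfolding R2 using u by (simp add: field_simps power2_eq_square)
    show ?thesis unfolding F_def e using d1 d2 u
      by (simp add: add_frac_eq) (simp add: field_simps)
  qed
  have [measurable]: "inverted_slice u b \<beta> \<in> borel_measurable borel" unfolding inverted_slice_def[abs_def] by measurable
  have FI: "F b' absolutely_integrable_on ?S" if b': "b' = b \<or> b' = - b" for b'
  proof (rule absolutely_integrable_bound)
    show "F b' \<in> borel_measurable borel" unfolding F_def[abs_def] by measurable
    show "?h absolutely_integrable_on ?S" using h by simp
    fix \<sigma> assume \<sigma>: "\<sigma> \<in> ?S"
    have "0 \<le> F b \<sigma>" "0 \<le> F (- b) \<sigma>" using den[OF \<sigma>, of b] den[OF \<sigma>, of "- b"] by (auto simp: F_def inverted_slice_def intro!: divide_nonneg_pos)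
    then show "\<bar>F b' \<sigma>\<bar> \<le> ?h \<sigma>" unfolding hF[OF \<sigma>] using b' by auto
  qed simp
  have sumF: "integral ?S (F b) + integral ?S (F (- b)) = Beta (\<beta> + 1) (- \<beta>)"
  proof -
    have i: "F b integrable_on ?S" "F (- b) integrable_on ?S"
      using FI[of b] FI[of "- b"] by (auto intro: set_lebesgue_integral_eq_integral(1))
    have "integral ?S (\<lambda>\<sigma>. F b \<sigma> + F (- b) \<sigma>) = integral ?S (F b) + integral ?S (F (- b))"
      by (rule integral_add[OF i])
    moreover have "integral ?S (\<lambda>\<sigma>. F b \<sigma> + F (- b) \<sigma>) = integral ?S ?h"
      by (rule integral_cong, rule hF[symmetric])
    ultimately show ?thesis using h by simp
  qed
  have lim: "((\<lambda>\<epsilon>. mellin_tail u b' \<beta> (- 2 * \<beta>) \<epsilon>) \<longlongrightarrow> integral ?S (F b')) (at_right 0)" if b': "b' = b \<or> b' = - b" for b'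
  proof -
    have Rb: "half_chord u b' = R" "inverted_slice u b' \<beta> = inverted_slice u b \<beta>" using b' by (auto simp: R_def inverted_slice_minus)
    let ?q = "R - b'"
    let ?v = "\<lambda>t. slice u b' \<beta> t * t powr (- 2 * \<beta> - 1)"
    have v: "?v absolutely_integrable_on {0<..<?q} \<and> integral {0<..<?q} ?v = integral ?S (F b')"
    proof (rule iffD2[OF change_of_variables_on[where f="F b'" and T="?S" and g="\<lambda>t. 1 / t - b' / u" and g'="\<lambda>t. - (1 / t\<^sup>2)"]])
      show "F b' absolutely_integrable_on ?S \<and> integral ?S (F b') = integral ?S (F b')" using FI[OF b'] by simp
      show "{0<..<?q} \<in> sets lebesgue" by (rule sets_completionI_sets) simp
      show "((\<lambda>t. 1 / t - b' / u) has_field_derivative - (1 / t\<^sup>2)) (at t)" if "t \<in> {0<..<?q}" for t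
        using that by (intro sigma_deriv[OF u]) auto
      show "inj_on (\<lambda>t. 1 / t - b' / u) {0<..<?q}" by (intro sigma_inj[OF u]) auto
      show "(\<lambda>t. 1 / t - b' / u) ` {0<..<?q} = ?S" using sigma_image[OF u, of b'] by (simp add: Rb)
      fix t assume t: "t \<in> {0<..<?q}"
      then have t0: "0 < t" "t \<le> half_chord u b' - b'" by (auto simp: Rb)
      have e: "t powr (- 2 * \<beta>) = t powr (- 2 * \<beta> - 1) * t" using t0 by (intro powr_shift(1)) auto
      show "\<bar>- (1 / t\<^sup>2)\<bar> * F b' (1 / t - b' / u) = ?v t"
        unfolding F_def using inverted_slice_eq_slice[OF u t0, of \<beta>] e t0 by (simp add: Rb power2_eq_square)
    qed
    have z: "(if t \<in> {0<..} then ?v t else 0) = (if t \<in> {0<..<?q} then ?v t else 0)" for t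
      using slice_eq_0[OF u, of b' t \<beta>] by (auto simp: Rb)
    have vI: "?v absolutely_integrable_on {0<..}"
      using v absolutely_integrable_restrict_UNIV[of "{0<..<?q}" ?v] absolutely_integrable_restrict_UNIV[of "{0<..}" ?v]
      by (simp only: z)
    have "integral {0<..} ?v = integral {0<..<?q} ?v"
      using integral_restrict_UNIV[of "{0<..<?q}" ?v] integral_restrict_UNIV[of "{0<..}" ?v] by (simp only: z)
    then show ?thesis using integral_atLeast_tendsto[OF vI] v unfolding mellin_tail_def by simp
  qed
  have "((\<lambda>\<epsilon>. mellin_tail u b \<beta> (- 2 * \<beta>) \<epsilon> + mellin_tail u (- b) \<beta> (- 2 * \<beta>) \<epsilon>) \<longlongrightarrow> integral ?S (F b) + integral ?S (F (- b))) (at_right 0)"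
    by (intro tendsto_add lim) auto
  then show ?thesis unfolding sumF by (simp add: mellin_pair_def)
qed

text \<open>
  The recurrence, solved for its lowest level. The hypothesis on level \<open>l\<close> includes the factor
  \<open>l\<close>, so that at \<open>l = 0\<close> nothing needs to be known about that level.
\<close>

lemma finite_part_mellin_pair_down:
  assumes u: "0 < u" and \<beta>: "-1 < \<beta>" "\<beta> \<notin> \<int>" and l: "l \<le> 0"
    and 1: "finite_part (mellin_pair u b \<beta> (l - 1)) 0" and 0: "finite_part (\<lambda>\<epsilon>. of_int l * mellin_pair u b \<beta> l \<epsilon>) 0"
  shows "finite_part (mellin_pair u b \<beta> (l - 2)) 0"
proof -
  let ?c = "(of_int l - 2 * \<beta> - 2) * u"
  have c: "?c \<noteq> 0" using u \<beta> l by simp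
  have "\<beta> + 1 \<notin> \<int>" using \<beta>(2) by (metis Ints_1 Ints_diff add_diff_cancel_right')
  note B = finite_part_boundary[OF u this, of l b]
  let ?B = "\<lambda>\<epsilon>. \<epsilon> powr (of_int l - 2 * (\<beta> + 1)) * ((u - 2 * b * \<epsilon> - \<epsilon>\<^sup>2) powr (\<beta> + 1) + parity_sign l * (u + 2 * b * \<epsilon> - \<epsilon>\<^sup>2) powr (\<beta> + 1))"
  have "finite_part (\<lambda>\<epsilon>. (1 / ?c) * (((-1) * ?B \<epsilon> + (2 * b * (of_int l - 1 - \<beta>)) * mellin_pair u b \<beta> (l - 1) \<epsilon>) + of_int l * mellin_pair u b \<beta> l \<epsilon>))
     ((1 / ?c) * (((-1) * 0 + (2 * b * (of_int l - 1 - \<beta>)) * 0) + 0))"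
    by (intro finite_part_cmult finite_part_add B 1 0)
  then have "finite_part (mellin_pair u b \<beta> (l - 2)) ((1 / ?c) * (((-1) * 0 + (2 * b * (of_int l - 1 - \<beta>)) * 0) + 0))"
  proof (rule finite_part_cong)
    have "eventually (\<lambda>\<epsilon>::real. \<epsilon> < half_chord u b - \<bar>b\<bar>) (at_right 0)"
      by (rule order_tendstoD[OF tendsto_ident_at]) (use half_chord_gt[OF u, of b] in simp)
    with eventually_at_right_less[of "0::real"]
    show "\<forall>\<^sub>F \<epsilon> in at_right 0. (1 / ?c) * (((-1) * ?B \<epsilon> + (2 * b * (of_int l - 1 - \<beta>)) * mellin_pair u b \<beta> (l - 1) \<epsilon>) + of_int l * mellin_pair u b \<beta> l \<epsilon>) = mellin_pair u b \<beta> (l - 2) \<epsilon>"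
    proof eventually_elim
      case (elim \<epsilon>)
      have "((-1) * ?B \<epsilon> + (2 * b * (of_int l - 1 - \<beta>)) * mellin_pair u b \<beta> (l - 1) \<epsilon>) + of_int l * mellin_pair u b \<beta> l \<epsilon> = ?c * mellin_pair u b \<beta> (l - 2) \<epsilon>"
        using mellin_pair_rec[OF u \<beta>(1) elim, of l] by linarith
      then show ?case using c by simp
    qed
  qed
  then show ?thesis by simp
qed

lemma finite_part_mellin_pair_up:
  assumes u: "0 < u" and \<beta>: "-1 < \<beta>" "\<beta> \<notin> \<int>" and l: "l > 0"
    and 1: "finite_part (mellin_pair u b \<beta> (l - 1)) F1" and 2: "finite_part (mellin_pair u b \<beta> (l - 2)) F2"
  shows "finite_part (mellin_pair u b \<beta> l) (((of_int l - 2 * \<beta> - 2) * u * F2 - 2 * b * (of_int l - 1 - \<beta>) * F1) / of_int l)"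
proof -
  let ?c = "(of_int l - 2 * \<beta> - 2) * u"
  have "\<beta> + 1 \<notin> \<int>" using \<beta>(2) by (metis Ints_1 Ints_diff add_diff_cancel_right')
  note B = finite_part_boundary[OF u this, of l b]
  let ?B = "\<lambda>\<epsilon>. \<epsilon> powr (of_int l - 2 * (\<beta> + 1)) * ((u - 2 * b * \<epsilon> - \<epsilon>\<^sup>2) powr (\<beta> + 1) + parity_sign l * (u + 2 * b * \<epsilon> - \<epsilon>\<^sup>2) powr (\<beta> + 1))"
  let ?X = "\<lambda>\<epsilon>. (1 / of_int l) * ((?c * mellin_pair u b \<beta> (l - 2) \<epsilon> + (- (2 * b * (of_int l - 1 - \<beta>))) * mellin_pair u b \<beta> (l - 1) \<epsilon>) + ?B \<epsilon>)"
  have "finite_part ?X ((1 / of_int l) * ((?c * F2 + (- (2 * b * (of_int l - 1 - \<beta>))) * F1) + 0))"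
    by (intro finite_part_cmult finite_part_add B 1 2)
  then have "finite_part (mellin_pair u b \<beta> l) ((1 / of_int l) * ((?c * F2 + (- (2 * b * (of_int l - 1 - \<beta>))) * F1) + 0))"
  proof (rule finite_part_cong)
    have "eventually (\<lambda>\<epsilon>::real. \<epsilon> < half_chord u b - \<bar>b\<bar>) (at_right 0)"
      by (rule order_tendstoD[OF tendsto_ident_at]) (use half_chord_gt[OF u, of b] in simp)
    with eventually_at_right_less[of "0::real"]
    show "\<forall>\<^sub>F \<epsilon> in at_right 0. ?X \<epsilon> = mellin_pair u b \<beta> l \<epsilon>"
    proof eventually_elim
      case (elim \<epsilon>)
      have "(?c * mellin_pair u b \<beta> (l - 2) \<epsilon> + (- (2 * b * (of_int l - 1 - \<beta>))) * mellin_pair u b \<beta> (l - 1) \<epsilon>) + ?B \<epsilon> = of_int l * mellin_pair u b \<beta> l \<epsilon>"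
        using mellin_pair_rec[OF u \<beta>(1) elim, of l] unfolding mult_minus_left by linarith
      then show ?case using l by simp
    qed
  qed
  then show ?thesis by simp
qed

lemma not_int_between: "-1 < \<beta> \<Longrightarrow> \<beta> < 0 \<Longrightarrow> (\<beta>::real) \<notin> \<int>"
proof
  assume "-1 < \<beta>" "\<beta> < 0" "\<beta> \<in> \<int>"
  then obtain k where "\<beta> = of_int k" by (auto elim: Ints_cases)
  then have "-1 < k" "k < 0" using \<open>-1 < \<beta>\<close> \<open>\<beta> < 0\<close> by linarith+
  then show False by simp
qed

lemma finite_part_mellin_pair_negative:
  assumes u: "0 < u" and \<beta>: "-1 < \<beta>" "\<beta> < 0"
  shows "finite_part (mellin_pair u b \<beta> (- 1 - int n)) 0"
proof (induction n rule: nat_less_induct)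
  case (1 n)
  have nI: "\<beta> \<notin> \<int>" by (rule not_int_between[OF \<beta>])
  consider "n = 0" | "n = 1" | m where "n = m + 2" by (metis One_nat_def add_2_eq_Suc' not0_implies_Suc)
  then show ?case
  proof cases
    case 1
    then show ?thesis using finite_part_tendsto[OF mellin_pair_minus_one_tendsto[OF u \<beta>]] by simp
  next
    case 2
    have "finite_part (mellin_pair u b \<beta> (0 - 2)) 0"
    proof (rule finite_part_mellin_pair_down[OF u \<beta>(1) nI])
      show "finite_part (mellin_pair u b \<beta> (0 - 1)) 0" using finite_part_tendsto[OF mellin_pair_minus_one_tendsto[OF u \<beta>]] by simp
      show "finite_part (\<lambda>\<epsilon>. of_int 0 * mellin_pair u b \<beta> 0 \<epsilon>) 0" by (rule finite_part_tendsto) simp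
    qed simp
    then show ?thesis using 2 by simp
  next
    case (3 m)
    define l where "l = - 1 - int m"
    have "finite_part (mellin_pair u b \<beta> (l - 1)) 0" using 1[rule_format, of "m + 1"] 3 by (simp add: l_def algebra_simps)
    moreover have "finite_part (mellin_pair u b \<beta> l) 0" using 1[rule_format, of m] 3 by (simp add: l_def)
    then have "finite_part (\<lambda>\<epsilon>. of_int l * mellin_pair u b \<beta> l \<epsilon>) (of_int l * 0)" by (rule finite_part_cmult)
    ultimately have "finite_part (mellin_pair u b \<beta> (l - 2)) 0" by (intro finite_part_mellin_pair_down[OF u \<beta>(1) nI]) (auto simp: l_def)
    then show ?thesis using 3 by (simp add: l_def algebra_simps)
  qed
qed

text \<open>
  Increasing \<open>\<beta>\<close> by 1 expresses level \<open>l\<close> by the levels \<open>l\<close>, \<open>l - 1\<close> and \<open>l - 2\<close>, of which only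
  level 0 contributes when \<open>l = 0\<close>. The factor \<open>-1\<close> that results is that of the Gamma functions.
\<close>

lemma finite_part_mellin_pair_all:
  assumes u: "0 < u" and \<beta>0: "-1 < \<beta>0" "\<beta>0 < 0"
  shows "(\<forall>k::nat. finite_part (mellin_pair u b (\<beta>0 + real n) (- 1 - int k)) 0) \<and>
    finite_part (mellin_pair u b (\<beta>0 + real n) 0) (Gamma (\<beta>0 + real n + 1) * Gamma (- (\<beta>0 + real n)))"
proof (induction n)
  case 0
  have "Beta (\<beta>0 + 1) (- \<beta>0) = Gamma (\<beta>0 + 1) * Gamma (- \<beta>0)" by (simp add: Beta_def)
  then show ?case using finite_part_mellin_pair_negative[OF u \<beta>0] finite_part_tendsto[OF mellin_pair_zero_tendsto[OF u \<beta>0]] by simp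
next
  case (Suc n)
  define \<beta> where "\<beta> = \<beta>0 + real n"
  have \<beta>: "-1 < \<beta>" using \<beta>0 by (simp add: \<beta>_def)
  have neg: "finite_part (mellin_pair u b \<beta> (- 1 - int k)) 0" for k using Suc by (simp add: \<beta>_def)
  have zero: "finite_part (mellin_pair u b \<beta> 0) (Gamma (\<beta> + 1) * Gamma (- \<beta>))" using Suc by (simp add: \<beta>_def)
  have raise: "finite_part (mellin_pair u b (\<beta> + 1) l) (u * F2 + (- (2 * b)) * F1 + (-1) * F0)"
    if "finite_part (mellin_pair u b \<beta> (l - 2)) F2" "finite_part (mellin_pair u b \<beta> (l - 1)) F1" "finite_part (mellin_pair u b \<beta> l) F0" for l F2 F1 F0
  proof (rule finite_part_cong)
    show "finite_part (\<lambda>\<epsilon>. u * mellin_pair u b \<beta> (l - 2) \<epsilon> + (- (2 * b)) * mellin_pair u b \<beta> (l - 1) \<epsilon> + (-1) * mellin_pair u b \<beta> l \<epsilon>) (u * F2 + (- (2 * b)) * F1 + (-1) * F0)"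
      by (intro finite_part_add finite_part_cmult that)
    show "\<forall>\<^sub>F \<epsilon> in at_right 0. u * mellin_pair u b \<beta> (l - 2) \<epsilon> + (- (2 * b)) * mellin_pair u b \<beta> (l - 1) \<epsilon> + (-1) * mellin_pair u b \<beta> l \<epsilon> = mellin_pair u b (\<beta> + 1) l \<epsilon>"
      using eventually_at_right_less[of "0::real"]
      by eventually_elim (simp add: mellin_pair_raise[OF u \<beta>])
  qed
  have "finite_part (mellin_pair u b (\<beta> + 1) (- 1 - int k)) 0" for k
    using raise[of "- 1 - int k" 0 0 0] neg[of "k + 2"] neg[of "k + 1"] neg[of k] by (simp add: algebra_simps)
  moreover have "finite_part (mellin_pair u b (\<beta> + 1) 0) (Gamma (\<beta> + 1 + 1) * Gamma (- (\<beta> + 1)))"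
  proof -
    have g1: "Gamma (\<beta> + 1 + 1) = (\<beta> + 1) * Gamma (\<beta> + 1)"
      using \<beta> by (intro Gamma_plus1) (auto elim!: nonpos_Ints_cases)
    have nz: "- (\<beta> + 1) \<notin> \<int>\<^sub>\<le>\<^sub>0"
    proof
      assume "- (\<beta> + 1) \<in> \<int>\<^sub>\<le>\<^sub>0"
      then have "- (\<beta> + 1) \<in> \<int>" using nonpos_Ints_subset_Ints by blast
      then have "\<beta>0 \<in> \<int>" unfolding \<beta>_def
        by (metis Ints_1 Ints_diff Ints_minus Ints_of_nat add_diff_cancel_right' minus_minus)
      then show False using not_int_between[OF \<beta>0] by simp
    qed
    have "Gamma (- (\<beta> + 1) + 1) = (- (\<beta> + 1)) * Gamma (- (\<beta> + 1))"
      by (rule Gamma_plus1[OF nz])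
    then have g2: "Gamma (- \<beta>) = - (\<beta> + 1) * Gamma (- (\<beta> + 1))" by simp
    have "u * 0 + (- (2 * b)) * 0 + (-1) * (Gamma (\<beta> + 1) * Gamma (- \<beta>)) = Gamma (\<beta> + 1 + 1) * Gamma (- (\<beta> + 1))"
      unfolding g1 g2 by (simp add: algebra_simps)
    then show ?thesis using raise[of 0 0 0, OF _ _ zero] neg[of 1] neg[of 0] by simp
  qed
  ultimately show ?case by (simp add: \<beta>_def algebra_simps)
qed

definition finite_part_term :: "real \<Rightarrow> real \<Rightarrow> real \<Rightarrow> nat \<Rightarrow> nat \<Rightarrow> real" where
  "finite_part_term q b \<beta> l i = (if 2 * i \<le> l then (\<beta> gchoose i) * (- q) ^ i * ((2 * \<beta> - 2 * real i) gchoose (l - 2 * i)) * b ^ (l - 2 * i) else 0)"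

text \<open>
  For \<open>q = u + b\<^sup>2\<close> this is the coefficient of \<open>\<tau>\<^sup>l\<close> in
  \<open>(1 + 2 b \<tau> - u \<tau>\<^sup>2)\<^sup>\<beta> = ((1 + b \<tau>)\<^sup>2 - q \<tau>\<^sup>2)\<^sup>\<beta>\<close>, expanded in powers of \<open>q\<close>.
\<close>

definition finite_part_coeff :: "real \<Rightarrow> real \<Rightarrow> real \<Rightarrow> nat \<Rightarrow> real" where
  "finite_part_coeff q b \<beta> l = (\<Sum>i\<le>l. finite_part_term q b \<beta> l i)"

lemma finite_part_coeff_extend: "l \<le> n \<Longrightarrow> finite_part_coeff q b \<beta> l = (\<Sum>i\<le>n. finite_part_term q b \<beta> l i)"
  unfolding finite_part_coeff_def by (intro sum.mono_neutral_left) (auto simp: finite_part_term_def)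

text \<open>
  The recurrence \<open>finite_part_coeff_rec\<close> sorted by powers of \<open>q\<close>: its last term has a factor \<open>q\<close>
  and therefore meets the preceding index.
\<close>

lemma finite_part_term_rec:
  fixes l i :: nat
  shows "real (l + 2) * finite_part_term q b \<beta> (l + 2) i + 2 * b * (real l + 1 - \<beta>) * finite_part_term q b \<beta> (l + 1) i
     - (2 * \<beta> - real l) * b\<^sup>2 * finite_part_term q b \<beta> l i
     + (2 * \<beta> - real l) * (case i of 0 \<Rightarrow> 0 | Suc i' \<Rightarrow> q * finite_part_term q b \<beta> l i') = 0"
proof (cases "2 * i \<le> l + 2")
  case False
  then show ?thesis by (auto simp: finite_part_term_def split: nat.split)
next
  case True
  define r where "r = l + 2 - 2 * i"
  define a where "a = 2 * \<beta> - 2 * real i"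
  have l2: "l + 2 = r + 2 * i" using True by (simp add: r_def)
  have lr: "real l = real r + 2 * real i - 2" using arg_cong[OF l2, of real] by simp
  \<comment> \<open>\<open>X\<close>, \<open>Y\<close>, \<open>Z\<close> stand for \<open>a gchoose r\<close>, \<open>a gchoose (r - 1)\<close>, \<open>a gchoose (r - 2)\<close>, with the
    value 0 for negative lower index.\<close>
  define X where "X = a gchoose r"
  define Y where "Y = (if r = 0 then 0 else a gchoose (r - 1))"
  define Z where "Z = (if r \<le> 1 then 0 else a gchoose (r - 2))"
  let ?C = "\<beta> gchoose i"
  have XY: "real r * X = (a - real r + 1) * Y"
  proof (cases r)
    case (Suc k)
    then show ?thesis using gbinomial_mult_1[of a k] by (simp add: X_def Y_def algebra_simps)
  qed (simp add: Y_def)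
  have YZ: "(real r - 1) * Y = (a - real r + 2) * Z"
  proof (cases "r \<le> 1")
    case True
    then show ?thesis by (cases "r = 0") (auto simp: Y_def Z_def)
  next
    case False
    then obtain k where "r = Suc (Suc k)" by (metis Suc_le_D not_less_eq_eq One_nat_def Suc_leI not_le)
    then show ?thesis using gbinomial_mult_1[of a k] by (simp add: Y_def Z_def algebra_simps)
  qed
  have G2: "finite_part_term q b \<beta> (l + 2) i = ?C * (- q) ^ i * X * b ^ r"
    using True by (simp add: finite_part_term_def X_def a_def r_def)
  have G1: "b * finite_part_term q b \<beta> (l + 1) i = ?C * (- q) ^ i * Y * b ^ r"
  proof (cases "r = 0")
    case True then show ?thesis using l2 by (simp add: finite_part_term_def Y_def)
  next
    case False
    then have "2 * i \<le> l + 1" "l + 1 - 2 * i = r - 1" "b ^ r = b * b ^ (r - 1)"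
      using l2 by (auto simp: power_eq_if)
    then show ?thesis using False by (simp add: finite_part_term_def Y_def a_def)
  qed
  have G0: "b\<^sup>2 * finite_part_term q b \<beta> l i = ?C * (- q) ^ i * Z * b ^ r"
  proof (cases "r \<le> 1")
    case True then show ?thesis using l2 by (simp add: finite_part_term_def Z_def)
  next
    case False
    then have e: "2 * i \<le> l" "l - 2 * i = r - 2" using l2 by auto
    have "r = 2 + (r - 2)" using False by simp
    then have "b ^ r = b ^ (2 + (r - 2))" by (rule arg_cong)
    then have "b ^ r = b\<^sup>2 * b ^ (r - 2)" by (simp only: power_add)
    then show ?thesis using False e by (simp add: finite_part_term_def Z_def a_def)
  qed
  have G': "(2 * \<beta> - real l) * (case i of 0 \<Rightarrow> 0 | Suc i' \<Rightarrow> q * finite_part_term q b \<beta> l i') = - (2 * real i * (X + Y)) * ?C * (- q) ^ i * b ^ r"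
  proof (cases i)
    case (Suc i')
    have e: "2 * i' \<le> l" "l - 2 * i' = r" using l2 Suc by auto
    have a2: "2 * \<beta> - 2 * real i' = a + 2" using Suc by (simp add: a_def)
    have W: "(a + 2 - real r) * ((a + 2) gchoose r) = (a + 2) * (X + Y)"
    proof -
      have "(a + 2 - real r) * ((a + 2) gchoose r) = (a + 2) * ((a + 1) gchoose r)"
      proof -
        have "a + 2 - 1 = a + 1" by simp
        then show ?thesis using gbinomial_absorb_comp[of "a + 2" r] by (simp only:)
      qed
      also have "(a + 1) gchoose r = X + Y"
      proof (cases r)
        case (Suc k) then show ?thesis using gbinomial_Suc_Suc[of a k] by (simp add: X_def Y_def)
      qed (simp add: X_def Y_def)
      finally show ?thesis .
    qed
    have C: "(a + 2) * (\<beta> gchoose i') = 2 * real i * ?C"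
    proof -
      have "real (Suc i') * (\<beta> gchoose Suc i') = (\<beta> - real i') * (\<beta> gchoose i')"
        using gbinomial_mult_1[of \<beta> i'] by (simp add: algebra_simps)
      then show ?thesis using Suc by (simp add: a_def algebra_simps)
    qed
    have "(2 * \<beta> - real l) = a + 2 - real r" using lr by (simp add: a_def)
    then have "(2 * \<beta> - real l) * (q * finite_part_term q b \<beta> l i') = ((a + 2 - real r) * ((a + 2) gchoose r)) * (\<beta> gchoose i') * (q * (- q) ^ i' * b ^ r)"
      using e by (simp add: finite_part_term_def a2)
    also have "\<dots> = ((a + 2) * (\<beta> gchoose i')) * (X + Y) * (q * (- q) ^ i' * b ^ r)" unfolding W by simp
    also have "\<dots> = - (2 * real i * (X + Y)) * ?C * (- q) ^ i * b ^ r" unfolding C using Suc by simp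
    finally show ?thesis using Suc by simp
  qed simp
  have "real (l + 2) * finite_part_term q b \<beta> (l + 2) i + 2 * b * (real l + 1 - \<beta>) * finite_part_term q b \<beta> (l + 1) i
     - (2 * \<beta> - real l) * b\<^sup>2 * finite_part_term q b \<beta> l i
     + (2 * \<beta> - real l) * (case i of 0 \<Rightarrow> 0 | Suc i' \<Rightarrow> q * finite_part_term q b \<beta> l i')
    = real (l + 2) * finite_part_term q b \<beta> (l + 2) i + 2 * (real l + 1 - \<beta>) * (b * finite_part_term q b \<beta> (l + 1) i)
     - (2 * \<beta> - real l) * (b\<^sup>2 * finite_part_term q b \<beta> l i)
     + (2 * \<beta> - real l) * (case i of 0 \<Rightarrow> 0 | Suc i' \<Rightarrow> q * finite_part_term q b \<beta> l i')"
    by (simp add: mult_ac)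
  also have "\<dots> = (?C * (- q) ^ i * b ^ r) * (real (l + 2) * X + 2 * (real l + 1 - \<beta>) * Y - (2 * \<beta> - real l) * Z - 2 * real i * (X + Y))"
    unfolding G2 G1 G0 G' by (simp add: algebra_simps)
  also have "real (l + 2) * X + 2 * (real l + 1 - \<beta>) * Y - (2 * \<beta> - real l) * Z - 2 * real i * (X + Y)
    = real r * X - (a - real r + 1) * Y + ((real r - 1) * Y - (a - real r + 2) * Z)"
  proof -
    have "real (l + 2) = real r + 2 * real i" using lr by simp
    then show ?thesis unfolding lr a_def by (simp only:) (simp add: algebra_simps)
  qed
  also have "\<dots> = 0" using XY YZ by simp
  finally show ?thesis by simp
qed

lemma finite_part_coeff_rec:
  "real (l + 2) * finite_part_coeff q b \<beta> (l + 2) + 2 * b * (real l + 1 - \<beta>) * finite_part_coeff q b \<beta> (l + 1) + (2 * \<beta> - real l) * (q - b\<^sup>2) * finite_part_coeff q b \<beta> l = 0"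
proof -
  let ?T = "\<lambda>i. case i of 0 \<Rightarrow> 0 | Suc i' \<Rightarrow> q * finite_part_term q b \<beta> l i'"
  have s: "(\<Sum>i\<le>l + 2. ?T i) = q * finite_part_coeff q b \<beta> l"
  proof -
    have "{..l + 2} = {..Suc (l + 1)}" by simp
    then have "(\<Sum>i\<le>l + 2. ?T i) = (\<Sum>i\<le>l + 1. q * finite_part_term q b \<beta> l i)"
      by (simp only: sum.atMost_Suc_shift) simp
    then show ?thesis using finite_part_coeff_extend[of l "l + 1" q b \<beta>] by (simp only: sum_distrib_left[symmetric])
  qed
  have "0 = (\<Sum>i\<le>l + 2. real (l + 2) * finite_part_term q b \<beta> (l + 2) i + 2 * b * (real l + 1 - \<beta>) * finite_part_term q b \<beta> (l + 1) i
     - (2 * \<beta> - real l) * b\<^sup>2 * finite_part_term q b \<beta> l i + (2 * \<beta> - real l) * ?T i)"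
    using finite_part_term_rec by simp
  also have "\<dots> = real (l + 2) * (\<Sum>i\<le>l + 2. finite_part_term q b \<beta> (l + 2) i) + 2 * b * (real l + 1 - \<beta>) * (\<Sum>i\<le>l + 2. finite_part_term q b \<beta> (l + 1) i)
     - (2 * \<beta> - real l) * b\<^sup>2 * (\<Sum>i\<le>l + 2. finite_part_term q b \<beta> l i) + (2 * \<beta> - real l) * (\<Sum>i\<le>l + 2. ?T i)"
    by (simp only: sum.distrib sum_subtractf sum_distrib_left)
  also have "\<dots> = real (l + 2) * finite_part_coeff q b \<beta> (l + 2) + 2 * b * (real l + 1 - \<beta>) * finite_part_coeff q b \<beta> (l + 1)
     - (2 * \<beta> - real l) * b\<^sup>2 * finite_part_coeff q b \<beta> l + (2 * \<beta> - real l) * (q * finite_part_coeff q b \<beta> l)"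
    unfolding s using finite_part_coeff_extend[of "l + 2" "l + 2" q b \<beta>] finite_part_coeff_extend[of "l + 1" "l + 2" q b \<beta>] finite_part_coeff_extend[of l "l + 2" q b \<beta>] by simp
  finally show ?thesis by (simp add: algebra_simps)
qed

text \<open>
  For \<open>l \<ge> 0\<close>, the finite parts and the coefficients satisfy the same two-step recurrence with
  the same initial values.
\<close>

lemma finite_part_mellin_pair_value:
  assumes u: "0 < u" and \<beta>: "-1 < \<beta>" "\<beta> \<notin> \<int>"
  shows "finite_part (mellin_pair u b \<beta> (int l)) (Gamma (\<beta> + 1) * Gamma (- \<beta>) * finite_part_coeff (u + b\<^sup>2) b \<beta> l)"
    and "finite_part (mellin_pair u b \<beta> (- 1 - int k)) 0"
proof -
  \<comment> \<open>The shift that brings \<open>\<beta>\<close> into the interval from -1 to 0.\<close>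
  define n where "n = nat (\<lfloor>\<beta>\<rfloor> + 1)"
  define \<beta>0 where "\<beta>0 = \<beta> - real n"
  have "0 \<le> \<lfloor>\<beta>\<rfloor> + 1" using \<beta>(1) by linarith
  then have rn: "real n = of_int \<lfloor>\<beta>\<rfloor> + 1" by (simp add: n_def)
  have "of_int \<lfloor>\<beta>\<rfloor> \<noteq> \<beta>" using \<beta>(2) by (metis Ints_of_int)
  then have \<beta>0: "-1 < \<beta>0" "\<beta>0 < 0" unfolding \<beta>0_def rn by linarith+
  have \<beta>eq: "\<beta>0 + real n = \<beta>" by (simp add: \<beta>0_def)
  note all = finite_part_mellin_pair_all[OF u \<beta>0, of b n, unfolded \<beta>eq]
  show neg: "finite_part (mellin_pair u b \<beta> (- 1 - int k)) 0" for k using all by blast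
  define F0 where "F0 = Gamma (\<beta> + 1) * Gamma (- \<beta>)"
  have zero: "finite_part (mellin_pair u b \<beta> 0) F0" using all by (simp add: F0_def)
  have "finite_part (mellin_pair u b \<beta> (int l)) (F0 * finite_part_coeff (u + b\<^sup>2) b \<beta> l)"
  proof (induction l rule: nat_less_induct)
    case (1 l)
    consider "l = 0" | "l = 1" | m where "l = m + 2" by (metis One_nat_def add_2_eq_Suc' not0_implies_Suc)
    then show ?case
    proof cases
      case 1
      then show ?thesis using zero by (simp add: finite_part_coeff_def finite_part_term_def)
    next
      case 2
      have "finite_part (mellin_pair u b \<beta> 1) (((of_int 1 - 2 * \<beta> - 2) * u * 0 - 2 * b * (of_int 1 - 1 - \<beta>) * F0) / of_int 1)"
        using finite_part_mellin_pair_up[OF u \<beta>, of 1 b F0 0] zero neg[of 0] by simp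
      moreover have "finite_part_coeff (u + b\<^sup>2) b \<beta> 1 = 2 * \<beta> * b" by (simp add: finite_part_coeff_def finite_part_term_def)
      ultimately show ?thesis using 2 by (simp add: mult_ac)
    next
      case (3 m)
      let ?g = "finite_part_coeff (u + b\<^sup>2) b \<beta>"
      have f1: "finite_part (mellin_pair u b \<beta> (int l - 1)) (F0 * ?g (m + 1))" using 1[rule_format, of "m + 1"] 3 by (simp add: algebra_simps)
      have f2: "finite_part (mellin_pair u b \<beta> (int l - 2)) (F0 * ?g m)" using 1[rule_format, of m] 3 by simp
      have "finite_part (mellin_pair u b \<beta> (int l)) (((of_int (int l) - 2 * \<beta> - 2) * u * (F0 * ?g m) - 2 * b * (of_int (int l) - 1 - \<beta>) * (F0 * ?g (m + 1))) / of_int (int l))"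
        by (rule finite_part_mellin_pair_up[OF u \<beta> _ f1 f2]) (use 3 in simp)
      moreover have "((of_int (int l) - 2 * \<beta> - 2) * u * (F0 * ?g m) - 2 * b * (of_int (int l) - 1 - \<beta>) * (F0 * ?g (m + 1))) / of_int (int l) = F0 * ?g l"
      proof -
        have "real (m + 2) * ?g (m + 2) = (real m - 2 * \<beta>) * u * ?g m - 2 * b * (real m + 1 - \<beta>) * ?g (m + 1)"
          using finite_part_coeff_rec[of m "u + b\<^sup>2" b \<beta>] by (simp add: algebra_simps)
        then have "F0 * (real (m + 2) * ?g (m + 2)) = F0 * ((real m - 2 * \<beta>) * u * ?g m - 2 * b * (real m + 1 - \<beta>) * ?g (m + 1))"
          by simp
        then show ?thesis using 3 by (simp add: field_simps)
      qed
      ultimately show ?thesis by simp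
    qed
  qed
  then show "finite_part (mellin_pair u b \<beta> (int l)) (Gamma (\<beta> + 1) * Gamma (- \<beta>) * finite_part_coeff (u + b\<^sup>2) b \<beta> l)" by (simp add: F0_def)
qed

section \<open>The integral of the central difference along a line\<close>

lemma nn_integral_slice_dilate_le:
  assumes u: "0 < u" and k: "1 \<le> \<bar>k\<bar>"
  shows "(\<integral>\<^sup>+t. ennreal (slice u b \<beta> (k * t)) \<partial>lborel) \<le> ennreal (half_chord u b powr (2 * \<beta> + 1)) * unit_slice_mass \<beta>"
proof -
  let ?N = "\<integral>\<^sup>+t. ennreal (slice u b \<beta> (k * t)) \<partial>lborel"
  have "k \<noteq> 0" using k by auto
  then have "(\<integral>\<^sup>+t. ennreal (slice u b \<beta> t) \<partial>lborel) = ennreal \<bar>k\<bar> * (\<integral>\<^sup>+t. ennreal (slice u b \<beta> (0 + k * t)) \<partial>lborel)"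
    by (intro nn_integral_real_affine) measurable
  then have e: "(\<integral>\<^sup>+t. ennreal (slice u b \<beta> t) \<partial>lborel) = ennreal \<bar>k\<bar> * ?N" by simp
  have "ennreal 1 * ?N \<le> ennreal \<bar>k\<bar> * ?N" using k by (intro mult_right_mono ennreal_leI) auto
  then show ?thesis unfolding e[symmetric] nn_integral_slice[OF u] by simp
qed

lemma nn_integral_powr_near_0:
  assumes "-1 < e" "0 < r"
  shows "(\<integral>\<^sup>+t. ennreal (t powr e) * indicator {0..r} t \<partial>lborel) = ennreal (r powr (e + 1) / (e + 1))"
  using assms by (intro nn_integral_has_integral_lebesgue' has_integral_powr_from_0) auto

lemma nn_integral_powr_to_inf:
  assumes "e < -1" "0 < r"
  shows "(\<integral>\<^sup>+t. ennreal (t powr e) * indicator {r..} t \<partial>lborel) = ennreal (- (r powr (e + 1)) / (e + 1))"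
  using assms by (intro nn_integral_has_integral_lebesgue' has_integral_powr_to_inf) auto

lemma central_diff_real: "central_diff m v 0 t = (\<Sum>k = - int m..int m. diff_coeff m k * v (of_int k * t))" for v :: "real \<Rightarrow> real"
  by (simp add: central_diff_coeff)

lemma central_diff_slice_measurable [measurable]: "(\<lambda>t. central_diff m (slice u b \<beta>) 0 t) \<in> borel_measurable borel"
  unfolding central_diff_real by measurable

text \<open>
  The difference annihilates the Taylor polynomial, and the remainder is uniformly small.
\<close>

lemma central_diff_slice_near_0:
  assumes u: "0 < u" and B: "0 \<le> B" and m: "1 \<le> m"
  obtains r C where "0 < r" "0 \<le> C"
    "\<And>b t. \<bar>b\<bar> \<le> B \<Longrightarrow> 0 \<le> t \<Longrightarrow> t \<le> r \<Longrightarrow> \<bar>central_diff m (slice u b \<beta>) 0 t\<bar> \<le> C * t ^ (2 * m)"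
proof -
  obtain r0 M where r0: "0 < r0" and M: "0 \<le> M" and T: "\<And>b. \<bar>b\<bar> \<le> B \<Longrightarrow> (\<exists>a::nat \<Rightarrow> real. \<forall>t. \<bar>t\<bar> \<le> r0 \<longrightarrow>
     0 < u - 2 * b * t - t\<^sup>2 \<and> \<bar>(u - 2 * b * t - t\<^sup>2) powr \<beta> - (\<Sum>i<2 * m. a i * t ^ i)\<bar> \<le> M * \<bar>t\<bar> ^ (2 * m))"
    using taylor_quadratic_powr[OF u B, of \<beta> "2 * m"] by blast
  define C where "C = (\<Sum>k = - int m..int m. \<bar>diff_coeff m k\<bar> * (M * \<bar>of_int k\<bar> ^ (2 * m)))"
  show thesis
  proof (rule that[of "r0 / real m" C])
    show "0 < r0 / real m" using r0 m by simp
    show "0 \<le> C" unfolding C_def using M by (intro sum_nonneg mult_nonneg_nonneg) auto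
    fix b t :: real assume b: "\<bar>b\<bar> \<le> B" and t: "0 \<le> t" "t \<le> r0 / real m"
    obtain a :: "nat \<Rightarrow> real" where a: "\<And>t. \<bar>t\<bar> \<le> r0 \<Longrightarrow> 0 < u - 2 * b * t - t\<^sup>2 \<and> \<bar>(u - 2 * b * t - t\<^sup>2) powr \<beta> - (\<Sum>i<2 * m. a i * t ^ i)\<bar> \<le> M * \<bar>t\<bar> ^ (2 * m)"
      using T[OF b] by blast
    let ?p = "\<lambda>x. \<Sum>i<2 * m. a i * x ^ i"
    have zero: "(\<Sum>k = - int m..int m. diff_coeff m k * ?p (of_int k * t)) = 0"
    proof -
      have "(\<Sum>k = - int m..int m. diff_coeff m k * ?p (of_int k * t)) = (\<Sum>k = - int m..int m. \<Sum>i<2 * m. a i * t ^ i * (diff_coeff m k * of_int k ^ i))"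
        by (simp add: sum_distrib_left power_mult_distrib mult_ac)
      also have "\<dots> = (\<Sum>i<2 * m. a i * t ^ i * (\<Sum>k = - int m..int m. diff_coeff m k * of_int k ^ i))"
        by (subst sum.swap) (simp add: sum_distrib_left)
      also have "\<dots> = 0" by (intro sum.neutral ballI) (simp add: central_moment_eq_0)
      finally show ?thesis .
    qed
    have "central_diff m (slice u b \<beta>) 0 t = (\<Sum>k = - int m..int m. diff_coeff m k * (slice u b \<beta> (of_int k * t) - ?p (of_int k * t)))"
      unfolding central_diff_real using zero by (simp add: right_diff_distrib sum_subtractf)
    also have "\<bar>\<dots>\<bar> \<le> (\<Sum>k = - int m..int m. \<bar>diff_coeff m k * (slice u b \<beta> (of_int k * t) - ?p (of_int k * t))\<bar>)"
      by (rule sum_abs)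
    also have "\<dots> \<le> (\<Sum>k = - int m..int m. \<bar>diff_coeff m k\<bar> * (M * \<bar>of_int k\<bar> ^ (2 * m)) * t ^ (2 * m))"
    proof (rule sum_mono)
      fix k assume k: "k \<in> {- int m..int m}"
      then have km: "\<bar>real_of_int k\<bar> \<le> real m" by auto
      have "\<bar>real_of_int k * t\<bar> \<le> real m * (r0 / real m)" unfolding abs_mult using km t by (intro mult_mono) auto
      then have kr: "\<bar>real_of_int k * t\<bar> \<le> r0" using m by simp
      have "slice u b \<beta> (of_int k * t) = (u - 2 * b * (of_int k * t) - (of_int k * t)\<^sup>2) powr \<beta>"
        using a[OF kr] by (simp add: slice_def)
      then have "\<bar>slice u b \<beta> (of_int k * t) - ?p (of_int k * t)\<bar> \<le> M * \<bar>of_int k * t\<bar> ^ (2 * m)"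
        using a[OF kr] by simp
      also have "\<dots> = M * \<bar>of_int k\<bar> ^ (2 * m) * t ^ (2 * m)" using t by (simp add: abs_mult power_mult_distrib)
      finally show "\<bar>diff_coeff m k * (slice u b \<beta> (of_int k * t) - ?p (of_int k * t))\<bar> \<le> \<bar>diff_coeff m k\<bar> * (M * \<bar>of_int k\<bar> ^ (2 * m)) * t ^ (2 * m)"
        unfolding abs_mult mult.assoc by (intro mult_left_mono) (auto simp: mult_ac)
    qed
    also have "\<dots> = C * t ^ (2 * m)" unfolding C_def by (rule sum_distrib_right[symmetric])
    finally show "\<bar>central_diff m (slice u b \<beta>) 0 t\<bar> \<le> C * t ^ (2 * m)" .
  qed
qed

text \<open>
  Near 0 the difference is \<open>O(t\<^sup>2\<^sup>m)\<close>, and \<open>m > s\<close>. Away from 0, the terms with \<open>k \<noteq> 0\<close> are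
  dilates of integrable slices with a bounded weight, and the term with \<open>k = 0\<close> leaves the
  integral of \<open>t\<^sup>-\<^sup>1\<^sup>-\<^sup>2\<^sup>s\<close>.
\<close>

lemma central_diff_slice_uniform_bound:
  assumes u: "0 < u" and \<beta>: "-1 < \<beta>" and s: "0 < s" "s < real m" and B: "0 \<le> B"
  obtains K :: real where "\<And>b. \<bar>b\<bar> \<le> B \<Longrightarrow>
    (\<integral>\<^sup>+t. ennreal (\<bar>central_diff m (slice u b \<beta>) 0 t\<bar> * t powr (- 2 * s - 1)) * indicator {0<..} t \<partial>lborel) \<le> ennreal K"
proof -
  have m: "1 \<le> m" using s by (cases m) auto
  obtain r C where r: "0 < r" and C: "0 \<le> C" and near:
    "\<And>b t. \<bar>b\<bar> \<le> B \<Longrightarrow> 0 \<le> t \<Longrightarrow> t \<le> r \<Longrightarrow> \<bar>central_diff m (slice u b \<beta>) 0 t\<bar> \<le> C * t ^ (2 * m)"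
    using central_diff_slice_near_0[OF u B m] by blast
  let ?e = "- 2 * s - 1"
  define I where "I = {- int m..int m} - {0}"
  define R where "R = sqrt u powr (2 * \<beta> + 1) + sqrt (u + B\<^sup>2) powr (2 * \<beta> + 1)"
  define T where "T = ennreal C * ennreal (r powr (2 * real m + ?e + 1) / (2 * real m + ?e + 1))
      + ennreal (\<bar>diff_coeff m 0\<bar> * u powr \<beta>) * ennreal (- (r powr (?e + 1)) / (?e + 1))
      + (\<Sum>k\<in>I. ennreal (r powr ?e * \<bar>diff_coeff m k\<bar>) * (ennreal R * unit_slice_mass \<beta>))"
  have "T < \<infinity>" unfolding T_def using unit_slice_mass_finite[OF \<beta>]
    by (auto simp: I_def ennreal_mult_less_top less_top[symmetric] ennreal_add_eq_top ennreal_mult_eq_top_iff)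
  then have TK: "T = ennreal (enn2real T)" by simp
  show thesis
  proof (rule that[of "enn2real T"])
    fix b assume b: "\<bar>b\<bar> \<le> B"
    let ?d = "central_diff m (slice u b \<beta>) 0"
    have pw: "ennreal (\<bar>?d t\<bar> * t powr ?e) * indicator {0<..} t \<le>
       ennreal C * (ennreal (t powr (2 * real m + ?e)) * indicator {0..r} t)
       + ennreal (\<bar>diff_coeff m 0\<bar> * u powr \<beta>) * (ennreal (t powr ?e) * indicator {r..} t)
       + (\<Sum>k\<in>I. ennreal (r powr ?e * \<bar>diff_coeff m k\<bar>) * ennreal (slice u b \<beta> (of_int k * t)))" (is "_ \<le> ?X t") for t
    proof (cases "t \<le> 0")
      case True then show ?thesis by simp
    next
      case False
      then have t: "0 < t" by simp
      show ?thesis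
      proof (cases "t \<le> r")
        case True
        have "\<bar>?d t\<bar> * t powr ?e \<le> C * t ^ (2 * m) * t powr ?e"
          using near[OF b _ True] t by (intro mult_right_mono) auto
        also have "\<dots> = C * t powr (2 * real m + ?e)"
          using t by (simp only: powr_add) (simp add: powr_realpow[symmetric])
        finally have "ennreal (\<bar>?d t\<bar> * t powr ?e) \<le> ennreal C * ennreal (t powr (2 * real m + ?e))"
          using C by (simp add: ennreal_mult[symmetric] ennreal_leI)
        also have "\<dots> \<le> ?X t" using True t by (simp add: add.assoc)
        finally show ?thesis using t by simp
      next
        case False
        have I: "{- int m..int m} = insert 0 I" "finite I" "0 \<notin> I" by (auto simp: I_def)
        have "?d t = diff_coeff m 0 * slice u b \<beta> 0 + (\<Sum>k\<in>I. diff_coeff m k * slice u b \<beta> (of_int k * t))"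
          unfolding central_diff_real I(1) by (subst sum.insert[OF I(2,3)]) simp
        moreover have "slice u b \<beta> 0 = u powr \<beta>" using u by (simp add: slice_def)
        ultimately have "\<bar>?d t\<bar> \<le> \<bar>diff_coeff m 0 * u powr \<beta>\<bar> + \<bar>\<Sum>k\<in>I. diff_coeff m k * slice u b \<beta> (of_int k * t)\<bar>"
          using abs_triangle_ineq by simp
        moreover have "\<bar>\<Sum>k\<in>I. diff_coeff m k * slice u b \<beta> (of_int k * t)\<bar> \<le> (\<Sum>k\<in>I. \<bar>diff_coeff m k\<bar> * slice u b \<beta> (of_int k * t))"
          by (rule order_trans[OF sum_abs]) (simp add: abs_mult)
        ultimately have "\<bar>?d t\<bar> \<le> \<bar>diff_coeff m 0\<bar> * u powr \<beta> + (\<Sum>k\<in>I. \<bar>diff_coeff m k\<bar> * slice u b \<beta> (of_int k * t))"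
          by (simp add: abs_mult)
        then have "\<bar>?d t\<bar> * t powr ?e \<le> (\<bar>diff_coeff m 0\<bar> * u powr \<beta> + (\<Sum>k\<in>I. \<bar>diff_coeff m k\<bar> * slice u b \<beta> (of_int k * t))) * t powr ?e"
          by (intro mult_right_mono) auto
        also have "\<dots> = \<bar>diff_coeff m 0\<bar> * u powr \<beta> * t powr ?e + (\<Sum>k\<in>I. \<bar>diff_coeff m k\<bar> * slice u b \<beta> (of_int k * t)) * t powr ?e"
          by (rule distrib_right)
        also have "\<dots> \<le> \<bar>diff_coeff m 0\<bar> * u powr \<beta> * t powr ?e + (\<Sum>k\<in>I. \<bar>diff_coeff m k\<bar> * slice u b \<beta> (of_int k * t)) * r powr ?e"
        proof (intro add_left_mono mult_left_mono)
          show "t powr ?e \<le> r powr ?e" using False r s by (intro powr_mono2') auto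
          show "0 \<le> (\<Sum>k\<in>I. \<bar>diff_coeff m k\<bar> * slice u b \<beta> (of_int k * t))" by (intro sum_nonneg mult_nonneg_nonneg) auto
        qed
        also have "\<dots> = \<bar>diff_coeff m 0\<bar> * u powr \<beta> * t powr ?e + (\<Sum>k\<in>I. r powr ?e * \<bar>diff_coeff m k\<bar> * slice u b \<beta> (of_int k * t))"
          by (simp add: sum_distrib_left mult_ac)
        finally have "ennreal (\<bar>?d t\<bar> * t powr ?e) \<le> ennreal (\<bar>diff_coeff m 0\<bar> * u powr \<beta> * t powr ?e + (\<Sum>k\<in>I. r powr ?e * \<bar>diff_coeff m k\<bar> * slice u b \<beta> (of_int k * t)))"
          by (rule ennreal_leI)
        also have "\<dots> = ennreal (\<bar>diff_coeff m 0\<bar> * u powr \<beta> * t powr ?e) + ennreal (\<Sum>k\<in>I. r powr ?e * \<bar>diff_coeff m k\<bar> * slice u b \<beta> (of_int k * t))"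
          by (intro ennreal_plus sum_nonneg mult_nonneg_nonneg) auto
        also have "ennreal (\<Sum>k\<in>I. r powr ?e * \<bar>diff_coeff m k\<bar> * slice u b \<beta> (of_int k * t)) = (\<Sum>k\<in>I. ennreal (r powr ?e * \<bar>diff_coeff m k\<bar> * slice u b \<beta> (of_int k * t)))"
          by (intro sum_ennreal[symmetric] mult_nonneg_nonneg) auto
        also have "\<dots> = (\<Sum>k\<in>I. ennreal (r powr ?e * \<bar>diff_coeff m k\<bar>) * ennreal (slice u b \<beta> (of_int k * t)))"
          by (intro sum.cong refl ennreal_mult) auto
        also have "ennreal (\<bar>diff_coeff m 0\<bar> * u powr \<beta> * t powr ?e) = ennreal (\<bar>diff_coeff m 0\<bar> * u powr \<beta>) * ennreal (t powr ?e)"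
          by (intro ennreal_mult) auto
        finally show ?thesis using False t by simp
      qed
    qed
    have RR: "half_chord u b powr (2 * \<beta> + 1) \<le> R"
    proof -
      have "b\<^sup>2 \<le> B\<^sup>2" using b B by (simp add: abs_le_square_iff[symmetric])
      then show ?thesis unfolding R_def half_chord_def using u by (intro powr_between) (auto simp: add_pos_nonneg)
    qed
    have "(\<integral>\<^sup>+t. ennreal (\<bar>?d t\<bar> * t powr ?e) * indicator {0<..} t \<partial>lborel) \<le> (\<integral>\<^sup>+t. ?X t \<partial>lborel)"
      by (intro nn_integral_mono pw)
    also have "\<dots> = ennreal C * (\<integral>\<^sup>+t. ennreal (t powr (2 * real m + ?e)) * indicator {0..r} t \<partial>lborel)
       + ennreal (\<bar>diff_coeff m 0\<bar> * u powr \<beta>) * (\<integral>\<^sup>+t. ennreal (t powr ?e) * indicator {r..} t \<partial>lborel)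
       + (\<Sum>k\<in>I. ennreal (r powr ?e * \<bar>diff_coeff m k\<bar>) * (\<integral>\<^sup>+t. ennreal (slice u b \<beta> (of_int k * t)) \<partial>lborel))"
      by (simp add: nn_integral_add nn_integral_cmult nn_integral_sum)
    also have "\<dots> \<le> T" unfolding T_def
    proof (intro add_mono sum_mono mult_left_mono)
      show "(\<integral>\<^sup>+t. ennreal (t powr (2 * real m + ?e)) * indicator {0..r} t \<partial>lborel) \<le> ennreal (r powr (2 * real m + ?e + 1) / (2 * real m + ?e + 1))"
        using s r by (subst nn_integral_powr_near_0) auto
      show "(\<integral>\<^sup>+t. ennreal (t powr ?e) * indicator {r..} t \<partial>lborel) \<le> ennreal (- (r powr (?e + 1)) / (?e + 1))"
        using s r by (subst nn_integral_powr_to_inf) auto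
      fix k assume "k \<in> I"
      then have k1: "1 \<le> \<bar>real_of_int k\<bar>" by (auto simp: I_def)
      have "ennreal (half_chord u b powr (2 * \<beta> + 1)) * unit_slice_mass \<beta> \<le> ennreal R * unit_slice_mass \<beta>"
        using RR by (intro mult_right_mono ennreal_leI) auto
      then show "(\<integral>\<^sup>+t. ennreal (slice u b \<beta> (of_int k * t)) \<partial>lborel) \<le> ennreal R * unit_slice_mass \<beta>"
        using nn_integral_slice_dilate_le[OF u k1, of b \<beta>] by (rule order_trans[rotated])
    qed auto
    finally show "(\<integral>\<^sup>+t. ennreal (\<bar>?d t\<bar> * t powr ?e) * indicator {0<..} t \<partial>lborel) \<le> ennreal (enn2real T)"
      unfolding TK[symmetric] .
  qed
qed

lemma central_diff_slice_absolutely_integrable: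
  assumes u: "0 < u" and \<beta>: "-1 < \<beta>" and s: "0 < s" "s < real m"
  shows "(\<lambda>t. central_diff m (slice u b \<beta>) 0 t * t powr (- 2 * s - 1)) absolutely_integrable_on {0<..}"
proof -
  let ?f = "\<lambda>t. central_diff m (slice u b \<beta>) 0 t * t powr (- 2 * s - 1)"
  obtain K where K: "\<And>b'. \<bar>b'\<bar> \<le> \<bar>b\<bar> \<Longrightarrow>
    (\<integral>\<^sup>+t. ennreal (\<bar>central_diff m (slice u b' \<beta>) 0 t\<bar> * t powr (- 2 * s - 1)) * indicator {0<..} t \<partial>lborel) \<le> ennreal K"
    using central_diff_slice_uniform_bound[OF u \<beta> s abs_ge_zero[of b]] by blast
  have "(\<integral>\<^sup>+t. ennreal (norm (indicator {0<..} t *\<^sub>R ?f t)) \<partial>lborel)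
      = (\<integral>\<^sup>+t. ennreal (\<bar>central_diff m (slice u b \<beta>) 0 t\<bar> * t powr (- 2 * s - 1)) * indicator {0<..} t \<partial>lborel)"
    by (intro nn_integral_cong) (simp add: abs_mult indicator_def)
  also have "\<dots> < \<infinity>" using K[of b] by (rule order.strict_trans1) (simp_all)
  finally have "set_integrable lborel {0<..} ?f"
    unfolding set_integrable_def by (intro integrableI_bounded) auto
  then show ?thesis by (subst absolutely_integrable_on_lborel_iff) auto
qed

lemma slice_dilate_has_integral:
  assumes u: "0 < u" and \<beta>: "-1 < \<beta>" and k: "0 < k" and \<epsilon>: "0 < \<epsilon>"
  shows "((\<lambda>t. slice u b \<beta> (k * t) * t powr (a - 1)) has_integral k powr (- a) * mellin_tail u b \<beta> a (k * \<epsilon>)) {\<epsilon>..}"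
proof -
  let ?f = "\<lambda>t. slice u b \<beta> t * t powr (a - 1)"
  let ?h = "\<lambda>t. k powr a * (slice u b \<beta> (k * t) * t powr (a - 1))"
  have ke: "0 < k * \<epsilon>" using k \<epsilon> by simp
  have f: "?f absolutely_integrable_on {k * \<epsilon>..} \<and> integral {k * \<epsilon>..} ?f = mellin_tail u b \<beta> a (k * \<epsilon>)"
    using slice_powr_integrable[OF u \<beta> ke, of b "a - 1"] by (simp add: mellin_tail_def)
  have h: "?h absolutely_integrable_on {\<epsilon>..} \<and> integral {\<epsilon>..} ?h = mellin_tail u b \<beta> a (k * \<epsilon>)"
  proof (rule iffD2[OF change_of_variables_on[where f="?f" and T="{k * \<epsilon>..}" and g="\<lambda>t. k * t" and g'="\<lambda>t. k"] f])
    show "{\<epsilon>..} \<in> sets lebesgue" by (rule sets_completionI_sets) simp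
    show "((\<lambda>t. k * t) has_field_derivative k) (at t)" for t
      by (auto intro!: derivative_eq_intros)
    show "inj_on (\<lambda>t. k * t) {\<epsilon>..}" using k by (auto simp: inj_on_def)
    show "(\<lambda>t. k * t) ` {\<epsilon>..} = {k * \<epsilon>..}"
    proof (intro equalityI subsetI)
      fix y assume "y \<in> {k * \<epsilon>..}"
      then have "y = k * (y / k)" "y / k \<in> {\<epsilon>..}" using k by (auto simp: pos_le_divide_eq mult.commute)
      then show "y \<in> (\<lambda>t. k * t) ` {\<epsilon>..}" by (rule image_eqI)
    qed (use k in auto)
    fix t assume "t \<in> {\<epsilon>..}"
    then have t: "0 < t" using \<epsilon> by auto
    have e: "k powr a = k powr (a - 1) * k" using k by (intro powr_shift(1)) auto
    have "(k * t) powr (a - 1) = k powr (a - 1) * t powr (a - 1)" by (simp add: powr_mult)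
    then show "\<bar>k\<bar> * (slice u b \<beta> (k * t) * (k * t) powr (a - 1)) = ?h t" unfolding e using k by simp
  qed
  then have "?h integrable_on {\<epsilon>..}" by (intro set_lebesgue_integral_eq_integral(1)) simp
  then have "(?h has_integral mellin_tail u b \<beta> a (k * \<epsilon>)) {\<epsilon>..}" using h by (auto simp: has_integral_integral)
  then have "((\<lambda>t. k powr (- a) * ?h t) has_integral k powr (- a) * mellin_tail u b \<beta> a (k * \<epsilon>)) {\<epsilon>..}"
    by (rule has_integral_mult_right)
  moreover have "k powr (- a) * ?h t = slice u b \<beta> (k * t) * t powr (a - 1)" for t
  proof -
    have "k powr (- a) * k powr a = 1" using k by (simp add: powr_add[symmetric])
    then show ?thesis by (simp add: mult.assoc[symmetric])
  qed
  ultimately show ?thesis by simp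
qed

definition even_tail :: "real \<Rightarrow> real \<Rightarrow> real \<Rightarrow> real \<Rightarrow> real \<Rightarrow> real" where
  "even_tail u b \<beta> s \<epsilon> = mellin_tail u b \<beta> (- 2 * s) \<epsilon> + mellin_tail u (- b) \<beta> (- 2 * s) \<epsilon>"

text \<open>
  Away from 0 the difference may be integrated term by term, and dilation by \<open>k\<close> turns every
  term into the same function at \<open>k \<epsilon>\<close>.
\<close>

lemma central_diff_slice_truncated:
  assumes u: "0 < u" and \<beta>: "-1 < \<beta>" and s: "0 < s" and \<epsilon>: "0 < \<epsilon>"
  shows "integral {\<epsilon>..} (\<lambda>t. central_diff m (slice u b \<beta>) 0 t * t powr (- 2 * s - 1))
    = diff_weight m 0 * slice u b \<beta> 0 / (2 * s) * \<epsilon> powr (- 2 * s) + (\<Sum>k = 1..m. diff_weight m k * real k powr (2 * s) * even_tail u b \<beta> s (real k * \<epsilon>))"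
proof -
  let ?e = "- 2 * s - 1"
  have 1: "((\<lambda>t. diff_weight m 0 * slice u b \<beta> 0 * t powr ?e) has_integral diff_weight m 0 * slice u b \<beta> 0 * (- (\<epsilon> powr (?e + 1)) / (?e + 1))) {\<epsilon>..}"
    using s \<epsilon> by (intro has_integral_mult_right has_integral_powr_to_inf) auto
  have 2: "((\<lambda>t. diff_weight m k * (slice u b \<beta> (real k * t) * t powr ?e + slice u (- b) \<beta> (real k * t) * t powr ?e)) has_integral
     diff_weight m k * (real k powr (- (- 2 * s)) * mellin_tail u b \<beta> (- 2 * s) (real k * \<epsilon>) + real k powr (- (- 2 * s)) * mellin_tail u (- b) \<beta> (- 2 * s) (real k * \<epsilon>))) {\<epsilon>..}"
    if "k \<in> {1..m}" for k
    using that by (intro has_integral_mult_right has_integral_add slice_dilate_has_integral[OF u \<beta> _ \<epsilon>]) auto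
  have "((\<lambda>t. diff_weight m 0 * slice u b \<beta> 0 * t powr ?e + (\<Sum>k = 1..m. diff_weight m k * (slice u b \<beta> (real k * t) * t powr ?e + slice u (- b) \<beta> (real k * t) * t powr ?e)))
     has_integral diff_weight m 0 * slice u b \<beta> 0 * (- (\<epsilon> powr (?e + 1)) / (?e + 1))
       + (\<Sum>k = 1..m. diff_weight m k * (real k powr (- (- 2 * s)) * mellin_tail u b \<beta> (- 2 * s) (real k * \<epsilon>) + real k powr (- (- 2 * s)) * mellin_tail u (- b) \<beta> (- 2 * s) (real k * \<epsilon>)))) {\<epsilon>..}"
    by (intro has_integral_add 1 has_integral_sum 2) auto
  moreover have "diff_weight m 0 * slice u b \<beta> 0 * t powr ?e + (\<Sum>k = 1..m. diff_weight m k * (slice u b \<beta> (real k * t) * t powr ?e + slice u (- b) \<beta> (real k * t) * t powr ?e))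
     = central_diff m (slice u b \<beta>) 0 t * t powr ?e" for t
    unfolding central_diff_symmetric slice_minus by (simp only: distrib_right sum_distrib_right mult.assoc)
  moreover have "diff_weight m 0 * slice u b \<beta> 0 * (- (\<epsilon> powr (?e + 1)) / (?e + 1)) = diff_weight m 0 * slice u b \<beta> 0 / (2 * s) * \<epsilon> powr (- 2 * s)"
    using s by (simp add: field_simps)
  moreover have "diff_weight m k * (real k powr (- (- 2 * s)) * mellin_tail u b \<beta> (- 2 * s) (real k * \<epsilon>) + real k powr (- (- 2 * s)) * mellin_tail u (- b) \<beta> (- 2 * s) (real k * \<epsilon>))
     = diff_weight m k * real k powr (2 * s) * even_tail u b \<beta> s (real k * \<epsilon>)" for k
    by (simp add: even_tail_def distrib_left)
  ultimately have "((\<lambda>t. central_diff m (slice u b \<beta>) 0 t * t powr ?e) has_integral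
      diff_weight m 0 * slice u b \<beta> 0 / (2 * s) * \<epsilon> powr (- 2 * s) + (\<Sum>k = 1..m. diff_weight m k * real k powr (2 * s) * even_tail u b \<beta> s (real k * \<epsilon>))) {\<epsilon>..}"
    by (simp only:)
  then show ?thesis by (rule integral_unique)
qed

text \<open>
  The truncated integrals converge, and so their limit is their finite part. A logarithm
  \<open>g ln \<epsilon>\<close> contributes through \<open>ln (k \<epsilon>) = ln k + ln \<epsilon>\<close>; the hypothesis on \<open>g\<close> says that the
  multiples of \<open>ln \<epsilon>\<close> add up to 0.
\<close>

lemma central_diff_slice_integral:
  assumes u: "0 < u" and \<beta>: "-1 < \<beta>" and s: "0 < s" "s < real m"
    and X: "finite_part (\<lambda>\<epsilon>. even_tail u b \<beta> s \<epsilon> + g * ln \<epsilon>) F" and g: "g * power_moment m s = 0"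
  shows "integral {0<..} (\<lambda>t. central_diff m (slice u b \<beta>) 0 t * t powr (- 2 * s - 1)) = power_moment m s * F - g * log_moment m s"
proof -
  let ?f = "\<lambda>t. central_diff m (slice u b \<beta>) 0 t * t powr (- 2 * s - 1)"
  let ?X = "\<lambda>\<epsilon>. even_tail u b \<beta> s \<epsilon> + g * ln \<epsilon>"
  let ?c = "\<lambda>k. diff_weight m k * real k powr (2 * s)"
  have "finite_part (\<lambda>\<epsilon>. integral {\<epsilon>..} ?f) (integral {0<..} ?f)"
    by (intro finite_part_tendsto integral_atLeast_tendsto central_diff_slice_absolutely_integrable u \<beta> s)
  moreover have "finite_part (\<lambda>\<epsilon>. integral {\<epsilon>..} ?f) (0 + (\<Sum>k = 1..m. ?c k * F) + (- (g * log_moment m s)))"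
  proof (rule finite_part_cong)
    show "finite_part (\<lambda>\<epsilon>. diff_weight m 0 * slice u b \<beta> 0 / (2 * s) * \<epsilon> powr (- 2 * s) + (\<Sum>k = 1..m. ?c k * ?X (real k * \<epsilon>)) + (- (g * log_moment m s)))
        (0 + (\<Sum>k = 1..m. ?c k * F) + (- (g * log_moment m s)))"
    proof (intro finite_part_add finite_part_sum finite_part_cmult)
      show "finite_part (\<lambda>\<epsilon>. diff_weight m 0 * slice u b \<beta> 0 / (2 * s) * \<epsilon> powr (- 2 * s)) 0" using s by (intro finite_part_powr) auto
      show "finite_part (\<lambda>\<epsilon>. - (g * log_moment m s)) (- (g * log_moment m s))" by (intro finite_part_tendsto tendsto_const)
      show "finite_part (\<lambda>\<epsilon>. ?X (real k * \<epsilon>)) F" if "k \<in> {1..m}" for k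
        using that by (intro finite_part_dilate[OF X]) auto
    qed simp
    show "\<forall>\<^sub>F \<epsilon> in at_right 0. diff_weight m 0 * slice u b \<beta> 0 / (2 * s) * \<epsilon> powr (- 2 * s) + (\<Sum>k = 1..m. ?c k * ?X (real k * \<epsilon>)) + (- (g * log_moment m s)) = integral {\<epsilon>..} ?f"
      using eventually_at_right_less[of "0::real"]
    proof eventually_elim
      case (elim \<epsilon>)
      have "(\<Sum>k = 1..m. ?c k * ?X (real k * \<epsilon>)) = (\<Sum>k = 1..m. ?c k * even_tail u b \<beta> s (real k * \<epsilon>) + (g * (?c k * ln (real k)) + g * ln \<epsilon> * ?c k))"
        using elim by (intro sum.cong refl) (simp add: ln_mult algebra_simps)
      also have "\<dots> = (\<Sum>k = 1..m. ?c k * even_tail u b \<beta> s (real k * \<epsilon>)) + (g * log_moment m s + g * ln \<epsilon> * power_moment m s)"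
        by (simp only: sum.distrib sum_distrib_left log_moment_def power_moment_def)
      also have "g * ln \<epsilon> * power_moment m s = 0" using g by auto
      finally show ?case using central_diff_slice_truncated[OF u \<beta> s(1) elim, of m b] by simp
    qed
  qed
  ultimately have "integral {0<..} ?f = 0 + (\<Sum>k = 1..m. ?c k * F) + (- (g * log_moment m s))" by (rule finite_part_unique)
  then show ?thesis by (simp add: power_moment_def sum_distrib_right)
qed

lemma quadratic_power_expand:
  "(q - (t + b)\<^sup>2) ^ N = (\<Sum>l\<le>2 * N. (\<Sum>i\<le>N. real (N choose i) * q ^ i * (-1) ^ (N - i) * (real ((2 * (N - i)) choose l) * b ^ (2 * (N - i) - l))) * t ^ l)"
  for q t b :: real
proof -
  let ?c = "\<lambda>i l. real (N choose i) * q ^ i * (-1) ^ (N - i) * (real ((2 * (N - i)) choose l) * b ^ (2 * (N - i) - l))"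
  have e: "(t + b) ^ (2 * (N - i)) = (\<Sum>l\<le>2 * N. real ((2 * (N - i)) choose l) * t ^ l * b ^ (2 * (N - i) - l))" if "i \<le> N" for i
    unfolding binomial_ring by (intro sum.mono_neutral_left) auto
  have bin: "(q - (t + b)\<^sup>2) ^ N = (\<Sum>i\<le>N. real (N choose i) * q ^ i * (- ((t + b)\<^sup>2)) ^ (N - i))"
    using binomial_ring[of q "- ((t + b)\<^sup>2)" N] by simp
  have eq: "real (N choose i) * q ^ i * (- ((t + b)\<^sup>2)) ^ (N - i) = (\<Sum>l\<le>2 * N. ?c i l * t ^ l)"
    if iN: "i \<le> N" for i
  proof -
    have p: "(- ((t + b)\<^sup>2)) ^ (N - i) = (-1) ^ (N - i) * (t + b) ^ (2 * (N - i))"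
      by (subst power_minus) (simp add: power_mult)
    then have "real (N choose i) * q ^ i * (- ((t + b)\<^sup>2)) ^ (N - i) = (\<Sum>l\<le>2 * N. (real (N choose i) * q ^ i * (-1) ^ (N - i)) * (real ((2 * (N - i)) choose l) * t ^ l * b ^ (2 * (N - i) - l)))"
      by (simp only: p e[OF iN] sum_distrib_left mult.assoc)
    also have "\<dots> = (\<Sum>l\<le>2 * N. ?c i l * t ^ l)"
      by (intro sum.cong refl) (simp only: mult_ac)
    finally show ?thesis .
  qed
  have "(\<Sum>i\<le>N. real (N choose i) * q ^ i * (- ((t + b)\<^sup>2)) ^ (N - i)) = (\<Sum>i\<le>N. \<Sum>l\<le>2 * N. ?c i l * t ^ l)"
    by (intro sum.cong refl eq) simp
  also have "\<dots> = (\<Sum>l\<le>2 * N. (\<Sum>i\<le>N. ?c i l) * t ^ l)"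
    by (subst sum.swap) (simp only: sum_distrib_right)
  finally show ?thesis unfolding bin .
qed

text \<open>The coefficient of \<open>t\<^sup>l\<close> in \<open>(q - (t + b)\<^sup>2)\<^sup>N\<close>.\<close>

definition quadratic_power_coeff :: "real \<Rightarrow> real \<Rightarrow> nat \<Rightarrow> nat \<Rightarrow> real" where
  "quadratic_power_coeff q b N l = (\<Sum>i\<le>N. real (N choose i) * q ^ i * (-1) ^ (N - i) * (real ((2 * (N - i)) choose l) * b ^ (2 * (N - i) - l)))"

text \<open>
  For an integer exponent the slice is a polynomial near 0, and the integrand is a finite sum of
  powers of \<open>t\<close>. Only the coefficient of \<open>t\<^sup>2\<^sup>S\<close>, doubled by the two halves of the line, is
  integrated to a logarithm.
\<close>

lemma finite_part_even_tail:
  assumes u: "0 < u" and S: "1 \<le> S"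
  obtains F where "finite_part (\<lambda>\<epsilon>. even_tail u b (real N) (real S) \<epsilon> + 2 * quadratic_power_coeff (u + b\<^sup>2) b N (2 * S) * ln \<epsilon>) F"
proof -
  let ?\<beta> = "real N" and ?s = "real S"
  let ?e = "- 2 * ?s - 1"
  let ?c = "\<lambda>l. quadratic_power_coeff (u + b\<^sup>2) b N l * (1 + (-1) ^ l)"
  \<comment> \<open>A primitive of the integrand near 0.\<close>
  define G where "G t = (\<Sum>l\<le>2 * N. ?c l * (if l = 2 * S then ln t else t powr (real l - 2 * ?s) / (real l - 2 * ?s)))" for t
  define r where "r = (half_chord u b - \<bar>b\<bar>) / 2"
  have R: "\<bar>b\<bar> < half_chord u b" by (rule half_chord_gt[OF u])
  have r: "0 < r" "r < half_chord u b - \<bar>b\<bar>" using R by (auto simp: r_def)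
  let ?w = "\<lambda>t. slice u b ?\<beta> t * t powr ?e + slice u (- b) ?\<beta> t * t powr ?e"
  have \<beta>: "-1 < ?\<beta>" by simp
  have w: "?w t = (\<Sum>l\<le>2 * N. ?c l * t powr (real l - 2 * ?s - 1))" if t: "0 < t" "t \<le> r" for t
  proof -
    have V: "slice u b' ?\<beta> t = (\<Sum>l\<le>2 * N. quadratic_power_coeff (u + b\<^sup>2) b N l * (\<sigma> * t) ^ l)" if b': "b' = \<sigma> * b" "\<sigma> = 1 \<or> \<sigma> = -1" for b' \<sigma>
    proof -
      have "0 < u - 2 * b' * t - t\<^sup>2"
        unfolding quadratic_pos_iff[OF u] using t r b' by auto
      then have "slice u b' ?\<beta> t = (u - 2 * b' * t - t\<^sup>2) ^ N" by (simp add: slice_def powr_realpow)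
      also have "u - 2 * b' * t - t\<^sup>2 = (u + b\<^sup>2) - (\<sigma> * t + b)\<^sup>2"
        using b' by (auto simp: power2_eq_square algebra_simps)
      finally show ?thesis unfolding quadratic_power_expand quadratic_power_coeff_def .
    qed
    have "slice u b ?\<beta> t + slice u (- b) ?\<beta> t = (\<Sum>l\<le>2 * N. quadratic_power_coeff (u + b\<^sup>2) b N l * (1 * t) ^ l + quadratic_power_coeff (u + b\<^sup>2) b N l * (-1 * t) ^ l)"
      using V[of b 1] V[of "- b" "-1"] by (simp add: sum.distrib)
    also have "\<dots> = (\<Sum>l\<le>2 * N. ?c l * t ^ l)"
      by (intro sum.cong refl) (simp only: power_mult_distrib power_one distrib_left distrib_right mult_1 mult_1_right mult.assoc)
    finally have "?w t = (\<Sum>l\<le>2 * N. ?c l * t ^ l) * t powr ?e" by (simp only: distrib_right[symmetric])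
    also have "\<dots> = (\<Sum>l\<le>2 * N. ?c l * t powr (real l - 2 * ?s - 1))"
      unfolding sum_distrib_right
    proof (intro sum.cong refl)
      fix l
      have "t powr (real l - 2 * ?s - 1) = t powr (real l + ?e)" by (simp add: algebra_simps)
      also have "\<dots> = t ^ l * t powr ?e" using t by (simp only: powr_add powr_realpow)
      finally show "?c l * t ^ l * t powr ?e = ?c l * t powr (real l - 2 * ?s - 1)" by (simp only: mult.assoc)
    qed
    finally show ?thesis .
  qed
  have GD: "(G has_real_derivative ?w t) (at t)" if t: "0 < t" "t \<le> r" for t
  proof -
    have D: "((\<lambda>t. if l = 2 * S then ln t else t powr (real l - 2 * ?s) / (real l - 2 * ?s)) has_real_derivative t powr (real l - 2 * ?s - 1)) (at t)" for l
    proof (cases "l = 2 * S")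
      case True
      have "(ln has_real_derivative inverse t) (at t)" by (rule DERIV_ln[OF t(1)])
      moreover have "inverse t = t powr (real l - 2 * ?s - 1)" using True t by (simp add: powr_minus)
      ultimately show ?thesis using True by simp
    next
      case False
      then have "real l \<noteq> real (2 * S)" by (simp only: of_nat_eq_iff) simp
      then have nz: "real l - 2 * ?s \<noteq> 0" by simp
      have "((\<lambda>t. t powr (real l - 2 * ?s) / (real l - 2 * ?s)) has_real_derivative (real l - 2 * ?s) * t powr (real l - 2 * ?s - 1) / (real l - 2 * ?s)) (at t)"
        using t by (intro DERIV_cdivide has_real_derivative_powr)
      then show ?thesis using False nz by simp
    qed
    have "(G has_real_derivative (\<Sum>l\<le>2 * N. ?c l * t powr (real l - 2 * ?s - 1))) (at t)"
      unfolding G_def by (intro DERIV_sum DERIV_cmult D)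
    then show ?thesis using w[OF t] by simp
  qed
  have WG: "even_tail u b ?\<beta> ?s \<epsilon> = even_tail u b ?\<beta> ?s r + G r - G \<epsilon>" if \<epsilon>: "0 < \<epsilon>" "\<epsilon> < r" for \<epsilon>
  proof -
    have Wh: "(?w has_integral even_tail u b ?\<beta> ?s x) {x..}" if "0 < x" for x
      unfolding even_tail_def using that by (intro has_integral_add mellin_tail_has_integral u \<beta>) 
    have "(?w has_integral (G r - G \<epsilon>)) {\<epsilon>..r}"
    proof (rule fundamental_theorem_of_calculus)
      show "\<epsilon> \<le> r" using \<epsilon> by simp
      fix t assume "t \<in> {\<epsilon>..r}"
      then have "(G has_real_derivative ?w t) (at t)" using \<epsilon> by (intro GD) auto
      then have "(G has_real_derivative ?w t) (at t within {\<epsilon>..r})" by (rule has_field_derivative_at_within)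
      then show "(G has_vector_derivative ?w t) (at t within {\<epsilon>..r})"
        by (simp only: has_real_derivative_iff_has_vector_derivative)
    qed
    then have "(?w has_integral ((G r - G \<epsilon>) + even_tail u b ?\<beta> ?s r)) ({\<epsilon>..r} \<union> {r..})"
    proof (rule has_integral_Un[OF _ Wh[OF r(1)]])
      have "{\<epsilon>..r} \<inter> {r..} = {r}" using \<epsilon> by auto
      then show "negligible ({\<epsilon>..r} \<inter> {r..})" by simp
    qed
    moreover have "{\<epsilon>..r} \<union> {r..} = {\<epsilon>..}" using \<epsilon> by auto
    ultimately have "(?w has_integral ((G r - G \<epsilon>) + even_tail u b ?\<beta> ?s r)) {\<epsilon>..}" by simp
    then show ?thesis using has_integral_unique[OF Wh[OF \<epsilon>(1)]] by simp
  qed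
  have c2S: "(if 2 * S \<le> 2 * N then ?c (2 * S) else 0) = 2 * quadratic_power_coeff (u + b\<^sup>2) b N (2 * S)"
    by (auto simp: quadratic_power_coeff_def binomial_eq_0)
  let ?X = "\<lambda>\<epsilon>. (even_tail u b ?\<beta> ?s r + G r) + (\<Sum>l\<in>{..2 * N} - {2 * S}. - ?c l / (real l - 2 * ?s) * \<epsilon> powr (real l - 2 * ?s))"
  have "finite_part ?X (even_tail u b ?\<beta> ?s r + G r + (\<Sum>l\<in>{..2 * N} - {2 * S}. 0))"
  proof (rule finite_part_add[OF _ finite_part_sum])
    show "finite_part (\<lambda>\<epsilon>. even_tail u b ?\<beta> ?s r + G r) (even_tail u b ?\<beta> ?s r + G r)" by (intro finite_part_tendsto tendsto_const)
    fix l assume "l \<in> {..2 * N} - {2 * S}"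
    then have "real l \<noteq> real (2 * S)" by (simp only: of_nat_eq_iff) simp
    then show "finite_part (\<lambda>\<epsilon>. - ?c l / (real l - 2 * ?s) * \<epsilon> powr (real l - 2 * ?s)) 0" by (intro finite_part_powr) simp
  qed simp
  then have "finite_part (\<lambda>\<epsilon>. even_tail u b ?\<beta> ?s \<epsilon> + 2 * quadratic_power_coeff (u + b\<^sup>2) b N (2 * S) * ln \<epsilon>) (even_tail u b ?\<beta> ?s r + G r + (\<Sum>l\<in>{..2 * N} - {2 * S}. 0))"
  proof (rule finite_part_cong)
    have "eventually (\<lambda>\<epsilon>::real. \<epsilon> < r) (at_right 0)"
      by (rule order_tendstoD[OF tendsto_ident_at]) (use r in simp)
    with eventually_at_right_less[of "0::real"]
    show "\<forall>\<^sub>F \<epsilon> in at_right 0. ?X \<epsilon> = even_tail u b ?\<beta> ?s \<epsilon> + 2 * quadratic_power_coeff (u + b\<^sup>2) b N (2 * S) * ln \<epsilon>"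
    proof eventually_elim
      case (elim \<epsilon>)
      let ?h = "\<lambda>l. ?c l * (if l = 2 * S then ln \<epsilon> else \<epsilon> powr (real l - 2 * ?s) / (real l - 2 * ?s))"
      have "G \<epsilon> = (if 2 * S \<le> 2 * N then ?h (2 * S) else 0) + (\<Sum>l\<in>{..2 * N} - {2 * S}. ?h l)"
      proof (cases "2 * S \<le> 2 * N")
        case True
        then show ?thesis unfolding G_def using sum.remove[of "{..2 * N}" "2 * S" ?h] by simp
      next
        case False
        then have "{..2 * N} - {2 * S} = {..2 * N}" by auto
        then show ?thesis unfolding G_def using False by simp
      qed
      also have "(if 2 * S \<le> 2 * N then ?h (2 * S) else 0) = (if 2 * S \<le> 2 * N then ?c (2 * S) else 0) * ln \<epsilon>" by simp
      also have "\<dots> = 2 * quadratic_power_coeff (u + b\<^sup>2) b N (2 * S) * ln \<epsilon>" unfolding c2S ..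
      also have "(\<Sum>l\<in>{..2 * N} - {2 * S}. ?h l) = - (\<Sum>l\<in>{..2 * N} - {2 * S}. - ?c l / (real l - 2 * ?s) * \<epsilon> powr (real l - 2 * ?s))"
        unfolding sum_negf[symmetric] by (intro sum.cong refl) auto
      finally show ?case unfolding WG[OF elim] by simp
    qed
  qed
  then show thesis by (rule that)
qed

section \<open>Constants\<close>

text \<open>
  The common value, up to constants, of the two quantities that determine the integral: the
  finite part for non-integer \<open>s\<close> and the coefficient of the logarithm for integer \<open>s\<close>.
\<close>

definition value_poly :: "real \<Rightarrow> nat \<Rightarrow> real \<Rightarrow> real \<Rightarrow> real" where
  "value_poly s j q b = (\<Sum>k\<le>j. (-1) ^ k * ((s + real j) gchoose (j - k)) * ((2 * s + 2 * real k) gchoose (2 * k)) * q ^ (j - k) * b ^ (2 * k))"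

lemma finite_part_coeff_value_poly: "finite_part_coeff q b (s + real j) (2 * j) = (-1) ^ j * value_poly s j q b"
proof -
  have "finite_part_coeff q b (s + real j) (2 * j) = (\<Sum>i\<le>j. finite_part_term q b (s + real j) (2 * j) i)"
    unfolding finite_part_coeff_def by (intro sum.mono_neutral_right) (auto simp: finite_part_term_def)
  also have "\<dots> = (\<Sum>k\<le>j. finite_part_term q b (s + real j) (2 * j) (j - k))"
    by (rule sum.reindex_bij_witness[where i="\<lambda>k. j - k" and j="\<lambda>k. j - k"]) auto
  also have "\<dots> = (\<Sum>k\<le>j. (-1) ^ j * ((-1) ^ k * ((s + real j) gchoose (j - k)) * ((2 * s + 2 * real k) gchoose (2 * k)) * q ^ (j - k) * b ^ (2 * k)))"
  proof (rule sum.cong[OF refl])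
    fix k assume "k \<in> {..j}"
    then have k: "k \<le> j" by simp
    have e: "2 * (s + real j) - 2 * real (j - k) = 2 * s + 2 * real k" "2 * j - 2 * (j - k) = 2 * k" using k by auto
    have "(- q) ^ (j - k) = (-1) ^ (j - k) * q ^ (j - k)" by (rule power_minus)
    also have "(-1 :: real) ^ (j - k) = (-1) ^ j * (-1) ^ k" using k by (cases "even j"; cases "even k") auto
    finally have q: "(- q) ^ (j - k) = (-1) ^ j * (-1) ^ k * q ^ (j - k)" .
    show "finite_part_term q b (s + real j) (2 * j) (j - k) = (-1) ^ j * ((-1) ^ k * ((s + real j) gchoose (j - k)) * ((2 * s + 2 * real k) gchoose (2 * k)) * q ^ (j - k) * b ^ (2 * k))"
      unfolding finite_part_term_def e q by simp
  qed
  finally show ?thesis unfolding value_poly_def sum_distrib_left .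
qed

text \<open>
  The duplication formulas for \<open>(2 s + 1) \<cdots> (2 s + 2 k)\<close> and \<open>(2 k)!\<close> have the same power of 4.
\<close>

lemma gbinomial_double:
  fixes s :: real
  shows "((2 * s + 2 * real k) gchoose (2 * k)) = pochhammer (s + 1/2) k * pochhammer (s + 1) k / (pochhammer (1/2) k * fact k)"
proof -
  have "((2 * s + 2 * real k) gchoose (2 * k)) = pochhammer (2 * (s + 1/2)) (2 * k) / fact (2 * k)"
    unfolding gbinomial_pochhammer' by (simp add: algebra_simps)
  also have "pochhammer (2 * (s + 1/2)) (2 * k) = 2 ^ (2 * k) * pochhammer (s + 1/2) k * pochhammer (s + 1) k"
    unfolding pochhammer_double by (simp add: add.assoc)
  also have "fact (2 * k) = 2 ^ (2 * k) * pochhammer (1/2) k * (fact k :: real)"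
    unfolding fact_double by simp
  finally show ?thesis by simp
qed

lemma gbinomial_pochhammer_quotient:
  fixes s :: real
  assumes s: "0 < s" and k: "k \<le> j"
  shows "((s + real j) gchoose (j - k)) = pochhammer (s + 1) j / (pochhammer (s + 1) k * fact (j - k))"
proof -
  have "((s + real j) gchoose (j - k)) = pochhammer (s + 1 + real k) (j - k) / fact (j - k)"
    unfolding gbinomial_pochhammer' using k by (simp add: of_nat_diff algebra_simps)
  moreover have "pochhammer (s + 1) j = pochhammer (s + 1) k * pochhammer (s + 1 + real k) (j - k)"
    by (rule pochhammer_product[OF k])
  moreover have "pochhammer (s + 1) k > 0" using s by (intro pochhammer_pos) auto
  ultimately show ?thesis by simp
qed

lemma Gamma_shift: "0 < x \<Longrightarrow> Gamma (x + real n) = pochhammer x n * Gamma x" for x :: real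
proof -
  assume x: "0 < x"
  then have "x \<notin> \<int>\<^sub>\<le>\<^sub>0" by (auto elim!: nonpos_Ints_cases)
  then have "pochhammer x n = Gamma (x + of_nat n) / Gamma x" by (rule pochhammer_Gamma)
  moreover have "Gamma x \<noteq> 0" using x by (simp add: Gamma_eq_zero_iff \<open>x \<notin> \<int>\<^sub>\<le>\<^sub>0\<close>)
  ultimately show ?thesis by simp
qed

text \<open>
  The identity holds term by term once all Gamma functions and binomial coefficients are written
  with Pochhammer symbols.
\<close>

lemma rhs_const_value_poly:
  assumes s: "0 < s"
  shows "4 powr s * Gamma (real n / 2 + s) / (2 * pi powr (real n / 2)) * Gamma (s + 1) * value_poly s j q b
    = rhs_const n s j * (\<Sum>k = 0..j. (-1) ^ k * (Gamma (s + 1/2 + real k) / Gamma (1/2 + real k)) * real (j choose k) * (q ^ (j - k) * b ^ (2 * k)))"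
proof -
  define P where "P = 4 powr s * Gamma (real n / 2 + s) / (2 * pi powr (real n / 2))"
  have fours: "4 powr s = 2 * (2::real) powr (2 * s - 1)"
  proof -
    have "(4::real) powr s = (2 powr 2) powr s" by simp
    also have "\<dots> = 2 powr (1 + (2 * s - 1))" by (simp only: powr_powr) simp
    also have "\<dots> = 2 * 2 powr (2 * s - 1)" by (simp only: powr_add) simp
    finally show ?thesis .
  qed
  have pis: "pi powr (real n / 2) = pi powr ((real n - 1) / 2) * sqrt pi"
  proof -
    have "pi powr (real n / 2) = pi powr ((real n - 1) / 2 + 1 / 2)" by (simp add: field_simps)
    also have "\<dots> = pi powr ((real n - 1) / 2) * pi powr (1 / 2)" by (rule powr_add)
    finally show ?thesis by (simp add: powr_half_sqrt)
  qed
  have G1: "Gamma (1 + s + real j) = pochhammer (s + 1) j * Gamma (s + 1)"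
    using Gamma_shift[of "s + 1" j] s by (simp add: add_ac)
  have G2: "Gamma (1 + real j) = fact j" by (simp add: Gamma_fact)
  have "0 < Gamma (1/2 + s)" using s by (intro Gamma_real_pos) simp
  then have Gnz: "Gamma (1/2 + s) \<noteq> 0" by simp
  have C: "rhs_const n s j = P * Gamma (s + 1) * (sqrt pi * pochhammer (s + 1) j / (Gamma (1/2 + s) * fact j))"
    unfolding rhs_const_def P_def fours pis G1 G2 using Gnz by (simp add: divide_simps)
  have "value_poly s j q b = (sqrt pi * pochhammer (s + 1) j / (Gamma (1/2 + s) * fact j)) *
     (\<Sum>k = 0..j. (-1) ^ k * (Gamma (s + 1/2 + real k) / Gamma (1/2 + real k)) * real (j choose k) * (q ^ (j - k) * b ^ (2 * k)))"
    unfolding value_poly_def sum_distrib_left atMost_atLeast0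
  proof (rule sum.cong[OF refl])
    fix k assume "k \<in> {0..j}"
    then have k: "k \<le> j" by simp
    have g1: "Gamma (s + 1/2 + real k) = pochhammer (s + 1/2) k * Gamma (1/2 + s)"
      using Gamma_shift[of "s + 1/2" k] s by (simp add: add_ac)
    have g2: "Gamma (1/2 + real k) = pochhammer (1/2) k * sqrt pi"
      using Gamma_shift[of "1/2" k] by (simp add: Gamma_one_half_real)
    have bin: "real (j choose k) = fact j / (fact k * fact (j - k))" by (rule binomial_fact[OF k])
    have pos: "0 < pochhammer (s + 1) k" "0 < pochhammer (1/2::real) k" using s by (auto intro!: pochhammer_pos)
    show "(-1) ^ k * ((s + real j) gchoose (j - k)) * ((2 * s + 2 * real k) gchoose (2 * k)) * q ^ (j - k) * b ^ (2 * k)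
      = (sqrt pi * pochhammer (s + 1) j / (Gamma (1/2 + s) * fact j)) * ((-1) ^ k * (Gamma (s + 1/2 + real k) / Gamma (1/2 + real k)) * real (j choose k) * (q ^ (j - k) * b ^ (2 * k)))"
      unfolding gbinomial_double gbinomial_pochhammer_quotient[OF s k] g1 g2 bin
      using pos Gnz by (simp add: divide_simps)
  qed
  then show ?thesis unfolding C P_def[symmetric] by simp
qed

lemma frac_laplacian_const_nonint:
  assumes "s \<notin> \<nat>"
  shows "frac_laplacian_const n m s = 4 powr s * Gamma (real n / 2 + s) / (pi powr (real n / 2) * Gamma (- s)) * inverse (power_moment m s)"
  using assms by (simp add: frac_laplacian_const_def power_moment_def diff_weight_def)

text \<open>The logarithmic moment may be summed from \<open>k = 2\<close> because \<open>ln 1 = 0\<close>.\<close>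

lemma frac_laplacian_const_nat:
  assumes S: "1 \<le> S" "S < m"
  shows "frac_laplacian_const n m (real S) = 4 powr real S * Gamma (real n / 2 + real S) * fact S / (2 * pi powr (real n / 2)) * inverse ((-1) ^ Suc S * log_moment m (real S))"
proof -
  have "(\<Sum>k = 2..m. (-1) powi (int k - \<lfloor>real S\<rfloor> + 1) * real ((2 * m) choose (m - k)) * real k powr (2 * real S) * ln (real k))
    = (\<Sum>k = 2..m. (-1) ^ Suc S * (diff_weight m k * real k powr (2 * real S) * ln (real k)))"
  proof (rule sum.cong[OF refl])
    fix k
    have "(-1 :: real) powi (int k - \<lfloor>real S\<rfloor> + 1) = (-1) ^ Suc S * (-1) ^ k"
      by (cases "even k"; cases "even S") (simp_all add: power_int_minus_left)
    then show "(-1) powi (int k - \<lfloor>real S\<rfloor> + 1) * real ((2 * m) choose (m - k)) * real k powr (2 * real S) * ln (real k)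
       = (-1) ^ Suc S * (diff_weight m k * real k powr (2 * real S) * ln (real k))"
      by (simp add: diff_weight_def)
  qed
  also have "\<dots> = (-1) ^ Suc S * (\<Sum>k = 2..m. diff_weight m k * real k powr (2 * real S) * ln (real k))"
    by (simp only: sum_distrib_left)
  also have "(\<Sum>k = 2..m. diff_weight m k * real k powr (2 * real S) * ln (real k)) = log_moment m (real S)"
    unfolding log_moment_def by (intro sum.mono_neutral_left) (auto simp: not_le less_Suc_eq numeral_2_eq_2)
  finally show ?thesis by (simp add: frac_laplacian_const_def)
qed

lemma quadratic_power_coeff_value_poly:
  "quadratic_power_coeff q b (S + j) (2 * S) = (-1) ^ S * value_poly (real S) j q b"
proof -
  let ?g = "\<lambda>i. real ((S + j) choose i) * q ^ i * (-1) ^ (S + j - i) * (real ((2 * (S + j - i)) choose (2 * S)) * b ^ (2 * (S + j - i) - 2 * S))"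
  have "quadratic_power_coeff q b (S + j) (2 * S) = (\<Sum>i\<le>S + j. ?g i)" by (simp add: quadratic_power_coeff_def)
  also have "\<dots> = (\<Sum>i\<le>j. ?g i)"
    by (intro sum.mono_neutral_right) (auto simp: binomial_eq_0)
  also have "\<dots> = (\<Sum>k\<le>j. ?g (j - k))"
    by (rule sum.reindex_bij_witness[where i="\<lambda>k. j - k" and j="\<lambda>k. j - k"]) auto
  also have "\<dots> = (\<Sum>k\<le>j. (-1) ^ S * ((-1) ^ k * ((real S + real j) gchoose (j - k)) * ((2 * real S + 2 * real k) gchoose (2 * k)) * q ^ (j - k) * b ^ (2 * k)))"
  proof (rule sum.cong[OF refl])
    fix k assume "k \<in> {..j}"
    then have k: "k \<le> j" by simp
    have e: "S + j - (j - k) = S + k" "2 * (S + k) - 2 * S = 2 * k" using k by auto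
    have c1: "(real S + real j) gchoose (j - k) = real ((S + j) choose (j - k))"
      using binomial_gbinomial[of "S + j" "j - k", where 'a=real] by simp
    have "(2 * (S + k)) choose (2 * S) = (2 * (S + k)) choose (2 * k)"
      using binomial_symmetric[of "2 * S" "2 * (S + k)"] by simp
    then have c2: "(2 * real S + 2 * real k) gchoose (2 * k) = real ((2 * (S + k)) choose (2 * S))"
      using binomial_gbinomial[of "2 * (S + k)" "2 * k", where 'a=real] by simp
    show "?g (j - k) = (-1) ^ S * ((-1) ^ k * ((real S + real j) gchoose (j - k)) * ((2 * real S + 2 * real k) gchoose (2 * k)) * q ^ (j - k) * b ^ (2 * k))"
      unfolding e c1 c2 by (simp add: power_add)
  qed
  finally show ?thesis unfolding value_poly_def sum_distrib_left .
qed

lemma quadratic_power_coeff_eq_0: "N < S \<Longrightarrow> quadratic_power_coeff q b N (2 * S) = 0"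
  by (simp add: quadratic_power_coeff_def binomial_eq_0)

definition difference_integral :: "nat \<Rightarrow> real \<Rightarrow> real \<Rightarrow> int \<Rightarrow> real \<Rightarrow> real" where
  "difference_integral m s u j b = integral {0<..} (\<lambda>t. central_diff m (slice u b (s + of_int j)) 0 t * t powr (- 2 * s - 1))"

text \<open>
  The power moment or the logarithmic moment, which carry the dependence on \<open>m\<close>, cancel. For
  non-integer \<open>s\<close> the other constants agree by \<open>\<Gamma>(-s) = (-s-j)(1-s-j) \<cdots> (-s-1) \<Gamma>(-s-j)\<close>.
\<close>

lemma difference_integral_value:
  assumes u: "0 < u" and \<beta>: "-1 < s + of_int j" and s: "0 < s" "s < real m"
  shows "frac_laplacian_const n m s / 2 * difference_integral m s u j b
    = (if j < 0 then 0 else 4 powr s * Gamma (real n / 2 + s) / (2 * pi powr (real n / 2)) * Gamma (s + 1) * value_poly s (nat j) (u + b\<^sup>2) b)"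
proof (cases "s \<in> \<nat>")
  case False
  define \<beta>' where "\<beta>' = s + of_int j"
  have "s \<notin> \<int>" using False s by (auto simp: Ints_def Nats_altdef1 of_int_0_less_iff dest!: less_imp_le)
  then have \<beta>Z: "\<beta>' \<notin> \<int>" unfolding \<beta>'_def by (metis Ints_diff Ints_of_int add_diff_cancel_right')
  have b1: "-1 < \<beta>'" using \<beta> by (simp add: \<beta>'_def)
  have WZ: "even_tail u b \<beta>' s = mellin_pair u b \<beta>' (2 * j)"
    by (simp add: even_tail_def mellin_pair_def parity_sign_def \<beta>'_def fun_eq_iff)
  have val: "difference_integral m s u j b = power_moment m s * F" if "finite_part (mellin_pair u b \<beta>' (2 * j)) F" for F
    using central_diff_slice_integral[OF u b1 s, of b 0 F] that unfolding difference_integral_def \<beta>'_def[symmetric] WZ by simp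
  show ?thesis
  proof (cases "j < 0")
    case True
    then have "2 * j = -1 - int (nat (- 2 * j - 1))" by simp
    then have "finite_part (mellin_pair u b \<beta>' (2 * j)) 0" using finite_part_mellin_pair_value(2)[OF u b1 \<beta>Z, of b "nat (- 2 * j - 1)"] by simp
    then show ?thesis using val True by simp
  next
    case j0: False
    define J where "J = nat j"
    have jJ: "j = int J" using j0 by (simp add: J_def)
    have \<beta>J: "\<beta>' = s + real J" by (simp add: \<beta>'_def jJ)
    have "finite_part (mellin_pair u b \<beta>' (2 * j)) (Gamma (\<beta>' + 1) * Gamma (- \<beta>') * finite_part_coeff (u + b\<^sup>2) b \<beta>' (2 * J))"
      using finite_part_mellin_pair_value(1)[OF u b1 \<beta>Z, of b "2 * J"] by (simp add: jJ)
    then have J1: "difference_integral m s u j b = power_moment m s * (Gamma (\<beta>' + 1) * Gamma (- \<beta>') * finite_part_coeff (u + b\<^sup>2) b \<beta>' (2 * J))" by (rule val)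
    have D: "power_moment m s \<noteq> 0" using power_moment_nonzero[OF s False] .
    have nz: "x \<notin> \<int>\<^sub>\<le>\<^sub>0" if "x \<notin> \<int>" for x :: real using that nonpos_Ints_subset_Ints by blast
    have ms: "- s \<notin> \<int>" "- \<beta>' \<notin> \<int>" using \<open>s \<notin> \<int>\<close> \<beta>Z by (simp_all add: minus_in_Ints_iff)
    have g0: "Gamma (- s) \<noteq> 0" "Gamma (- \<beta>') \<noteq> 0" using nz[OF ms(1)] nz[OF ms(2)] by (simp_all add: Gamma_eq_zero_iff)
    have "pochhammer (- \<beta>') J = Gamma (- \<beta>' + of_nat J) / Gamma (- \<beta>')" by (rule pochhammer_Gamma[OF nz[OF ms(2)]])
    moreover have "- \<beta>' + of_nat J = - s" by (simp add: \<beta>J)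
    moreover have "pochhammer (- \<beta>') J = (-1) ^ J * pochhammer (s + 1) J"
      unfolding pochhammer_minus by (simp add: \<beta>J)
    ultimately have gs: "Gamma (- s) = (-1) ^ J * pochhammer (s + 1) J * Gamma (- \<beta>')" using g0 by simp
    have gb: "Gamma (\<beta>' + 1) = pochhammer (s + 1) J * Gamma (s + 1)"
      using Gamma_shift[of "s + 1" J] s by (simp add: \<beta>J add_ac)
    have pp: "pochhammer (s + 1) J > 0" using s by (intro pochhammer_pos) auto
    have sq: "(-1 :: real) ^ J * (-1) ^ J = 1" by (simp flip: power_mult_distrib)
    have quot: "Gamma (\<beta>' + 1) * Gamma (- \<beta>') * (-1) ^ J / Gamma (- s) = Gamma (s + 1)"
      unfolding gs gb using pp g0 sq by (simp add: divide_simps)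
    have "frac_laplacian_const n m s / 2 * difference_integral m s u j b
      = 4 powr s * Gamma (real n / 2 + s) / (2 * pi powr (real n / 2)) * (Gamma (\<beta>' + 1) * Gamma (- \<beta>') * (-1) ^ J / Gamma (- s)) * value_poly s J (u + b\<^sup>2) b"
      unfolding frac_laplacian_const_nonint[OF False] J1 \<beta>J finite_part_coeff_value_poly unfolding \<beta>J[symmetric]
      using D by (simp add: field_simps)
    then show ?thesis unfolding quot using j0 by (simp add: J_def)
  qed
next
  case True
  then obtain S where S: "s = real S" by (auto simp: Nats_def)
  have S1: "1 \<le> S" "S < m" using s by (auto simp: S)
  define N where "N = nat (int S + j)"
  have "0 \<le> int S + j"
  proof -
    have "real_of_int (-1) < real_of_int (int S + j)" using \<beta> by (simp add: S)
    then show ?thesis unfolding of_int_less_iff by simp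
  qed
  then have jN: "int S + j = int N" by (simp add: N_def)
  have \<beta>N: "s + of_int j = real N"
  proof -
    have "real_of_int (int S + j) = real_of_int (int N)" unfolding jN ..
    then show ?thesis by (simp add: S)
  qed
  obtain F where F: "finite_part (\<lambda>\<epsilon>. even_tail u b (real N) (real S) \<epsilon> + 2 * quadratic_power_coeff (u + b\<^sup>2) b N (2 * S) * ln \<epsilon>) F"
    using finite_part_even_tail[OF u S1(1)] by blast
  have D: "power_moment m (real S) = 0" by (rule power_moment_nat[OF S1])
  have J: "difference_integral m s u j b = - (2 * quadratic_power_coeff (u + b\<^sup>2) b N (2 * S) * log_moment m (real S))"
    unfolding difference_integral_def \<beta>N using central_diff_slice_integral[OF u _ _ _ F, of m] s D by (simp add: S)
  show ?thesis
  proof (cases "j < 0")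
    case True
    then have "N < S" using jN by linarith
    then show ?thesis using True J by (simp add: quadratic_power_coeff_eq_0)
  next
    case False
    then have NS: "N = S + nat j" using jN by linarith
    have L: "log_moment m (real S) \<noteq> 0" by (rule log_moment_nonzero[OF S1])
    have sq: "(-1 :: real) ^ S * (-1) ^ S = 1" by (simp flip: power_mult_distrib)
    have G: "Gamma (real S + 1) = fact S" using Gamma_fact[of S, where 'a=real] by (simp add: add.commute)
    have "frac_laplacian_const n m (real S) / 2 * (- (2 * ((-1) ^ S * value_poly (real S) (nat j) (u + b\<^sup>2) b) * log_moment m (real S)))
      = 4 powr real S * Gamma (real n / 2 + real S) / (2 * pi powr (real n / 2)) * fact S * ((-1) ^ S * (-1) ^ S) * value_poly (real S) (nat j) (u + b\<^sup>2) b"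
      unfolding frac_laplacian_const_nat[OF S1] using L by (simp add: divide_simps)
    moreover have "difference_integral m s u j b = - (2 * ((-1) ^ S * value_poly (real S) (nat j) (u + b\<^sup>2) b) * log_moment m (real S))"
      unfolding J NS quadratic_power_coeff_value_poly ..
    ultimately show ?thesis using False unfolding S sq G by simp
  qed
qed

section \<open>Polynomials and their degree\<close>

definition monomial_fun :: "('n::finite \<Rightarrow> nat) \<Rightarrow> real^'n \<Rightarrow> real" where
  "monomial_fun \<alpha> x = (\<Prod>i\<in>UNIV. (x $ i) ^ \<alpha> i)"

text \<open>
  Polynomial functions of degree at most \<open>d\<close>. Closure properties are inductions that do not
  mention coefficients.
\<close>

inductive poly_le :: "nat \<Rightarrow> (real^'n \<Rightarrow> real) \<Rightarrow> bool" where
  poly_le_monomial: "(\<Sum>i\<in>UNIV. \<alpha> i) \<le> d \<Longrightarrow> poly_le d (\<lambda>x. c * monomial_fun \<alpha> x)"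
| poly_le_add: "poly_le d f \<Longrightarrow> poly_le d g \<Longrightarrow> poly_le d (\<lambda>x. f x + g x)"

lemma poly_le_const: "poly_le d (\<lambda>x. c)"
  using poly_le_monomial[of "\<lambda>_. 0" d c] by (simp add: monomial_fun_def)

lemma poly_le_cmult: "poly_le d f \<Longrightarrow> poly_le d (\<lambda>x. c * f x)"
proof (induction rule: poly_le.induct)
  case (poly_le_monomial \<alpha> d c')
  then show ?case using poly_le.poly_le_monomial[of \<alpha> d "c * c'"] by (simp add: mult.assoc)
next
  case (poly_le_add d f g)
  then show ?case using poly_le.poly_le_add[OF poly_le_add.IH] by (simp add: distrib_left)
qed

lemma poly_le_sum: "finite I \<Longrightarrow> (\<And>i. i \<in> I \<Longrightarrow> poly_le d (f i)) \<Longrightarrow> poly_le d (\<lambda>x. \<Sum>i\<in>I. f i x)"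
  by (induction I rule: finite_induct) (auto intro: poly_le_const poly_le_add)

lemma monomial_fun_add: "monomial_fun \<alpha> x * monomial_fun \<gamma> x = monomial_fun (\<lambda>i. \<alpha> i + \<gamma> i) x"
  by (simp add: monomial_fun_def power_add prod.distrib)

lemma poly_le_mult: "poly_le d f \<Longrightarrow> poly_le e g \<Longrightarrow> poly_le (d + e) (\<lambda>x. f x * g x)"
proof (induction rule: poly_le.induct)
  case (poly_le_monomial \<alpha> d c)
  from poly_le_monomial(2,1) show ?case
  proof (induction rule: poly_le.induct)
    case (poly_le_monomial \<gamma> e c')
    have "poly_le (d + e) (\<lambda>x. (c * c') * monomial_fun (\<lambda>i. \<alpha> i + \<gamma> i) x)"
      using poly_le_monomial by (intro poly_le.poly_le_monomial) (simp add: sum.distrib)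
    then show ?case by (simp add: monomial_fun_add[symmetric] mult_ac)
  next
    case (poly_le_add e f g)
    show ?case
      using poly_le.poly_le_add[OF poly_le_add.IH(1)[OF poly_le_add.prems] poly_le_add.IH(2)[OF poly_le_add.prems]]
      by (simp add: distrib_left)
  qed
next
  case (poly_le_add d f1 f2)
  show ?case
    using poly_le.poly_le_add[OF poly_le_add.IH(1)[OF poly_le_add.prems] poly_le_add.IH(2)[OF poly_le_add.prems]]
    by (simp add: distrib_right)
qed

lemma poly_le_power: "poly_le d f \<Longrightarrow> poly_le (d * k) (\<lambda>x. f x ^ k)"
proof (induction k)
  case (Suc k)
  then show ?case using poly_le_mult[of d f "d * k" "\<lambda>x. f x ^ k"] by simp
qed (simp add: poly_le_const)

lemma poly_le_coord: "poly_le 1 (\<lambda>x :: real^'n. x $ (i :: 'n))"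
proof -
  have "monomial_fun (\<lambda>j. if j = i then 1 else 0) x = x $ i" for x :: "(real, 'n) vec"
    unfolding monomial_fun_def by (subst prod.remove[of UNIV i]) (auto intro!: prod.neutral)
  moreover have "poly_le 1 (\<lambda>x::real^'n. 1 * monomial_fun (\<lambda>j. if j = i then 1 else 0) x)"
    by (rule poly_le_monomial) simp
  ultimately show ?thesis by simp
qed

lemma poly_le_linear: "poly_le 1 (\<lambda>x. ((A::real^'n^'n) *v x) $ i)"
proof -
  have "poly_le 1 (\<lambda>x. \<Sum>j\<in>UNIV. A $ i $ j * x $ j)"
    by (rule poly_le_sum[OF _ poly_le_cmult[OF poly_le_coord]]) simp
  then show ?thesis by (simp add: matrix_vector_mult_def)
qed

lemma eval_poly_superset:
  assumes "finite K" "Poly_Mapping.keys p \<subseteq> K"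
  shows "eval_poly p x = (\<Sum>\<alpha>\<in>K. Poly_Mapping.lookup p \<alpha> * monomial_fun \<alpha> x)"
  unfolding eval_poly_def monomial_fun_def using assms
  by (intro sum.mono_neutral_left) (auto simp: in_keys_iff)

lemma poly_le_imp_eval_poly: "poly_le d f \<Longrightarrow> \<exists>p. f = eval_poly p \<and> total_degree p \<le> d"
proof (induction rule: poly_le.induct)
  case (poly_le_monomial \<alpha> d c)
  let ?p = "Poly_Mapping.single \<alpha> c"
  have "(\<lambda>x. c * monomial_fun \<alpha> x) = eval_poly ?p"
    using eval_poly_superset[of "{\<alpha>}" ?p] by (auto simp: fun_eq_iff split: if_splits)
  moreover have "total_degree ?p \<le> d" using poly_le_monomial by (simp add: total_degree_def)
  ultimately show ?case by blast
next
  case (poly_le_add d f g)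
  obtain p where p: "f = eval_poly p" "total_degree p \<le> d" using poly_le_add.IH(1) by blast
  obtain q where q: "g = eval_poly q" "total_degree q \<le> d" using poly_le_add.IH(2) by blast
  let ?K = "Poly_Mapping.keys p \<union> Poly_Mapping.keys q"
  have K: "Poly_Mapping.keys (p + q) \<subseteq> ?K" by (rule keys_add)
  have "(\<lambda>x. f x + g x) = eval_poly (p + q)"
  proof
    fix x
    show "f x + g x = eval_poly (p + q) x"
      unfolding p(1) q(1) using eval_poly_superset[of ?K p x] eval_poly_superset[of ?K q x] eval_poly_superset[of ?K "p + q" x] K
      by (simp add: lookup_add distrib_right sum.distrib)
  qed
  moreover have "total_degree (p + q) \<le> d"
    using p(2) q(2) K unfolding total_degree_def by (auto simp: Max_le_iff)
  ultimately show ?case by blast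
qed

lemma eval_poly_growth:
  assumes "total_degree p < d"
  shows "(\<lambda>N. eval_poly p (real N *\<^sub>R x) / real N ^ d) \<longlonglongrightarrow> 0"
proof -
  have "(\<lambda>N. \<Sum>\<alpha>\<in>Poly_Mapping.keys p. Poly_Mapping.lookup p \<alpha> * monomial_fun \<alpha> x * (real N ^ (\<Sum>i\<in>UNIV. \<alpha> i) / real N ^ d)) \<longlonglongrightarrow> (\<Sum>\<alpha>\<in>Poly_Mapping.keys p. Poly_Mapping.lookup p \<alpha> * monomial_fun \<alpha> x * 0)"
  proof (intro tendsto_sum tendsto_mult_left)
    fix \<alpha> assume "\<alpha> \<in> Poly_Mapping.keys p"
    then have "(\<Sum>i\<in>UNIV. \<alpha> i) \<le> total_degree p" unfolding total_degree_def by (intro Max_ge) auto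
    then have "(\<Sum>i\<in>UNIV. \<alpha> i) < d" using assms by simp
    then obtain r where r: "d = (\<Sum>i\<in>UNIV. \<alpha> i) + Suc r" using less_imp_Suc_add by auto
    have "(\<lambda>N. (1 / real N) ^ Suc r) \<longlonglongrightarrow> 0 ^ Suc r" by (intro tendsto_power lim_1_over_n)
    then have "(\<lambda>N. (1 / real N) ^ Suc r) \<longlonglongrightarrow> 0" by simp
    moreover have "\<forall>\<^sub>F N in sequentially. (1 / real N) ^ Suc r = real N ^ (\<Sum>i\<in>UNIV. \<alpha> i) / real N ^ d"
      using eventually_gt_at_top[of 0]
    proof eventually_elim
      case (elim N)
      then show ?case unfolding r power_add by (simp add: power_one_over)
    qed
    ultimately show "(\<lambda>N. real N ^ (\<Sum>i\<in>UNIV. \<alpha> i) / real N ^ d) \<longlonglongrightarrow> 0" by (rule Lim_transform_eventually)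
  qed
  moreover have "eval_poly p (real N *\<^sub>R x) / real N ^ d = (\<Sum>\<alpha>\<in>Poly_Mapping.keys p. Poly_Mapping.lookup p \<alpha> * monomial_fun \<alpha> x * (real N ^ (\<Sum>i\<in>UNIV. \<alpha> i) / real N ^ d))" for N
    by (simp add: eval_poly_def monomial_fun_def power_mult_distrib prod.distrib power_sum sum_divide_distrib mult_ac)
  ultimately show ?thesis by simp
qed

text \<open>For a polynomial of degree less than \<open>d\<close> the limit would be 0.\<close>

lemma polynomial_of_degree_eqI:
  assumes f: "poly_le d f" and lim: "(\<lambda>N. f (real N *\<^sub>R x) / real N ^ d) \<longlonglongrightarrow> L" and L: "L \<noteq> 0"
  shows "polynomial_of_degree f d"
proof -
  obtain p where p: "f = eval_poly p" "total_degree p \<le> d" using poly_le_imp_eval_poly[OF f] by blast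
  have "\<not> total_degree p < d"
  proof
    assume "total_degree p < d"
    from eval_poly_growth[OF this, of x] lim L show False unfolding p(1) by (blast dest: LIMSEQ_unique)
  qed
  then show ?thesis unfolding polynomial_of_degree_def using p by (intro exI[of _ p]) simp
qed

lemma polynomial_of_degree_0: "polynomial_of_degree (\<lambda>x :: real^'a. 0) 0"
proof -
  obtain p :: "('a \<Rightarrow> nat) \<Rightarrow>\<^sub>0 real" where "(\<lambda>x. 0) = eval_poly p" "total_degree p \<le> 0"
    using poly_le_imp_eval_poly[OF poly_le_const[of 0 0]] by blast
  then show ?thesis unfolding polynomial_of_degree_def by (intro exI[of _ p]) simp
qed

section \<open>Integrals over the boundary as polynomials\<close>

context posdef_form
begin

text \<open>
  Only values on the boundary of the ellipsoid matter, where the cone measure lives.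
\<close>

definition sphere_bounded :: "(real^'n \<Rightarrow> real) \<Rightarrow> bool" where
  "sphere_bounded h \<longleftrightarrow> h \<in> borel_measurable borel \<and> (\<exists>B. \<forall>\<theta>. \<rho> \<theta> = 1 \<longrightarrow> \<bar>h \<theta>\<bar> \<le> B)"

lemma sphere_bounded_measurable: "sphere_bounded h \<Longrightarrow> h \<in> borel_measurable borel"
  by (simp add: sphere_bounded_def)

lemma sphere_bounded_integrable: "sphere_bounded h \<Longrightarrow> integrable cone_measure h"
proof -
  assume h: "sphere_bounded h"
  then obtain B where B: "\<And>\<theta>. \<rho> \<theta> = 1 \<Longrightarrow> \<bar>h \<theta>\<bar> \<le> B" by (auto simp: sphere_bounded_def)
  have m: "h \<in> borel_measurable cone_measure" using h by (simp add: sphere_bounded_def measurable_cong_sets[OF sets_cone_measure refl])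
  show ?thesis
    by (rule finite_measure.integrable_const_bound[OF finite_cone_measure _ m, of B])
      (use AE_cone_measure in eventually_elim, use B in simp)
qed

lemma sphere_bounded_mult:
  assumes "sphere_bounded f" "sphere_bounded g"
  shows "sphere_bounded (\<lambda>\<theta>. f \<theta> * g \<theta>)"
proof -
  obtain B where B: "\<And>\<theta>. \<rho> \<theta> = 1 \<Longrightarrow> \<bar>f \<theta>\<bar> \<le> B" using assms(1) by (auto simp: sphere_bounded_def)
  obtain C where C: "\<And>\<theta>. \<rho> \<theta> = 1 \<Longrightarrow> \<bar>g \<theta>\<bar> \<le> C" using assms(2) by (auto simp: sphere_bounded_def)
  have "\<bar>f \<theta> * g \<theta>\<bar> \<le> \<bar>B\<bar> * \<bar>C\<bar>" if "\<rho> \<theta> = 1" for \<theta>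
    unfolding abs_mult using B[OF that] C[OF that] by (intro mult_mono) auto
  then show ?thesis using assms unfolding sphere_bounded_def by (auto intro!: borel_measurable_times)
qed

lemma sphere_bounded_add:
  assumes "sphere_bounded f" "sphere_bounded g"
  shows "sphere_bounded (\<lambda>\<theta>. f \<theta> + g \<theta>)"
proof -
  obtain B where B: "\<And>\<theta>. \<rho> \<theta> = 1 \<Longrightarrow> \<bar>f \<theta>\<bar> \<le> B" using assms(1) by (auto simp: sphere_bounded_def)
  obtain C where C: "\<And>\<theta>. \<rho> \<theta> = 1 \<Longrightarrow> \<bar>g \<theta>\<bar> \<le> C" using assms(2) by (auto simp: sphere_bounded_def)
  have "\<bar>f \<theta> + g \<theta>\<bar> \<le> B + C" if "\<rho> \<theta> = 1" for \<theta>
    using B[OF that] C[OF that] by linarith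
  then show ?thesis using assms unfolding sphere_bounded_def by (auto intro!: borel_measurable_add)
qed

lemma sphere_bounded_const: "sphere_bounded (\<lambda>\<theta>. c)"
  by (auto simp: sphere_bounded_def)

lemma sphere_bounded_power: "sphere_bounded f \<Longrightarrow> sphere_bounded (\<lambda>\<theta>. f \<theta> ^ k)"
  by (induction k) (auto intro: sphere_bounded_mult sphere_bounded_const)

lemma sphere_bounded_inner: "sphere_bounded (\<lambda>\<theta>. z \<bullet> \<theta>)"
proof -
  obtain M where M: "\<And>x. \<rho> x = 1 \<Longrightarrow> norm x \<le> M" using norm_rho_one_bounded by blast
  have "\<bar>z \<bullet> \<theta>\<bar> \<le> norm z * M" if "\<rho> \<theta> = 1" for \<theta>
    using Cauchy_Schwarz_ineq2[of z \<theta>] M[OF that] by (meson mult_left_mono norm_ge_zero order_trans)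
  then show ?thesis by (auto simp: sphere_bounded_def)
qed

lemma sphere_bounded_coord: "sphere_bounded (\<lambda>\<theta>. \<theta> $ i)"
  using sphere_bounded_inner[of "axis i 1"] by (simp add: inner_axis')

lemma rho_upper: "\<exists>L>0. \<forall>x. \<rho> x \<le> L * norm x"
proof -
  obtain L where L: "0 < L" "\<And>x. norm (A *v x) \<le> L * norm x" using form_bounded by blast
  have "\<rho> x \<le> sqrt L * norm x" for x
  proof -
    have "(A *v x) \<bullet> x \<le> norm (A *v x) * norm x" by (rule norm_cauchy_schwarz)
    also have "\<dots> \<le> L * norm x * norm x" using L(2)[of x] by (intro mult_right_mono) auto
    also have "\<dots> = L * (norm x)\<^sup>2" by (simp add: power2_eq_square)
    finally have "\<rho> x \<le> sqrt (L * (norm x)\<^sup>2)" unfolding \<rho>_def by (rule real_sqrt_le_mono)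
    then show ?thesis by (simp add: real_sqrt_mult)
  qed
  then show ?thesis using L(1) by (intro exI[of _ "sqrt L"]) auto
qed

definition sphere_weight :: "real \<Rightarrow> real^'n \<Rightarrow> real" where
  "sphere_weight s \<theta> = 1 / norm \<theta> powr (real CARD('n) + 2 * s)"

lemma sphere_weight_nonneg: "0 \<le> sphere_weight s \<theta>" by (simp add: sphere_weight_def)

lemma sphere_weight_pos: assumes "\<rho> \<theta> = 1" shows "0 < sphere_weight s \<theta>"
proof -
  have "\<theta> \<noteq> 0" using assms rho_eq_0_iff[of \<theta>] by auto
  then show ?thesis by (simp add: sphere_weight_def)
qed

lemma sphere_weight_bounded: assumes s: "0 < s" shows "sphere_bounded (sphere_weight s)"
proof -
  obtain L where L: "0 < L" "\<And>x. \<rho> x \<le> L * norm x" using rho_upper by blast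
  have "\<bar>sphere_weight s \<theta>\<bar> \<le> 1 / (1 / L) powr (real CARD('n) + 2 * s)" if "\<rho> \<theta> = 1" for \<theta>
  proof -
    have "1 / L \<le> norm \<theta>" using L(2)[of \<theta>] L(1) that by (simp add: field_simps)
    then have "(1 / L) powr (real CARD('n) + 2 * s) \<le> norm \<theta> powr (real CARD('n) + 2 * s)"
      using L(1) s by (intro powr_mono2) auto
    moreover have "0 < (1 / L) powr (real CARD('n) + 2 * s)" using L(1) by simp
    ultimately show ?thesis by (simp add: sphere_weight_def frac_le)
  qed
  then show ?thesis unfolding sphere_bounded_def by (auto simp: sphere_weight_def[abs_def])
qed

lemma emeasure_cone_measure_pos: "emeasure cone_measure UNIV \<noteq> 0"
proof
  assume "emeasure cone_measure UNIV = 0"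
  then have "emeasure lborel {y. 0 < \<rho> y \<and> \<rho> y < 1} = 0"
    using emeasure_cone_measure[of UNIV] by simp
  moreover have "open {y. 0 < \<rho> y \<and> \<rho> y < 1}"
    by (intro open_Collect_conj open_Collect_less continuous_intros)
  moreover have "{y. 0 < \<rho> y \<and> \<rho> y < 1} \<noteq> {}"
  proof -
    obtain v :: "real^'n" where v: "v \<noteq> 0" using nonempty_Basis nonzero_Basis by blast
    have "\<rho> ((1 / (2 * \<rho> v)) *\<^sub>R v) = 1 / 2" using v by (simp add: rho_scaleR)
    then show ?thesis by (intro ex_in_conv[THEN iffD1] exI[of _ "(1 / (2 * \<rho> v)) *\<^sub>R v"]) (simp only: mem_Collect_eq, simp)
  qed
  ultimately have "{y. 0 < \<rho> y \<and> \<rho> y < 1} \<in> null_sets lborel" "\<not> negligible {y. 0 < \<rho> y \<and> \<rho> y < 1}"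
    using open_not_negligible by (auto simp del: rho_pos_iff)
  then show False using null_sets_completionI by (auto simp: negligible_iff_null_sets simp del: rho_pos_iff)
qed

text \<open>
  One factor \<open>Ax \<cdot> \<theta>\<close> is expanded in coordinates; the coordinates of \<open>\<theta>\<close> are absorbed into \<open>h\<close>.
\<close>

lemma poly_le_form_integral:
  "sphere_bounded h \<Longrightarrow> poly_le r (\<lambda>x. LINT \<theta>|cone_measure. ((A *v x) \<bullet> \<theta>) ^ r * h \<theta>)"
proof (induction r arbitrary: h)
  case 0
  show ?case by (simp add: poly_le_const)
next
  case (Suc r)
  have "(LINT \<theta>|cone_measure. ((A *v x) \<bullet> \<theta>) ^ Suc r * h \<theta>) = (\<Sum>i\<in>UNIV. (A *v x) $ i * (LINT \<theta>|cone_measure. ((A *v x) \<bullet> \<theta>) ^ r * (\<theta> $ i * h \<theta>)))" for x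
  proof -
    have I: "integrable cone_measure (\<lambda>\<theta>. (A *v x) $ i * (((A *v x) \<bullet> \<theta>) ^ r * (\<theta> $ i * h \<theta>)))" for i
      by (intro sphere_bounded_integrable sphere_bounded_mult sphere_bounded_const sphere_bounded_power sphere_bounded_inner sphere_bounded_coord Suc.prems)
    have e: "((A *v x) \<bullet> \<theta>) ^ Suc r * h \<theta> = (\<Sum>i\<in>UNIV. (A *v x) $ i * (((A *v x) \<bullet> \<theta>) ^ r * (\<theta> $ i * h \<theta>)))" for \<theta>
    proof -
      define D where "D = (A *v x) \<bullet> \<theta>"
      have D: "D = (\<Sum>i\<in>UNIV. (A *v x) $ i * \<theta> $ i)" by (simp add: D_def inner_vec_def)
      define P where "P = D ^ r"
      have "D * (P * h \<theta>) = (\<Sum>i\<in>UNIV. (A *v x) $ i * (P * (\<theta> $ i * h \<theta>)))"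
        unfolding D sum_distrib_right by (intro sum.cong refl) (simp only: mult_ac)
      then show ?thesis unfolding P_def D_def by simp
    qed
    have "(LINT \<theta>|cone_measure. ((A *v x) \<bullet> \<theta>) ^ Suc r * h \<theta>) = (\<Sum>i\<in>UNIV. LINT \<theta>|cone_measure. (A *v x) $ i * (((A *v x) \<bullet> \<theta>) ^ r * (\<theta> $ i * h \<theta>)))"
      unfolding e by (rule Bochner_Integration.integral_sum) (rule I)
    then show ?thesis by simp
  qed
  moreover have "poly_le (1 + r) (\<lambda>x. (A *v x) $ i * (LINT \<theta>|cone_measure. ((A *v x) \<bullet> \<theta>) ^ r * (\<theta> $ i * h \<theta>)))" for i
    by (intro poly_le_mult poly_le_linear Suc.IH sphere_bounded_mult sphere_bounded_coord Suc.prems)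
  then have "poly_le (1 + r) (\<lambda>x. \<Sum>i\<in>UNIV. (A *v x) $ i * (LINT \<theta>|cone_measure. ((A *v x) \<bullet> \<theta>) ^ r * (\<theta> $ i * h \<theta>)))"
    by (intro poly_le_sum) auto
  ultimately show ?case by simp
qed

lemma poly_le_one_minus_form: "poly_le 2 (\<lambda>x. 1 - (A *v x) \<bullet> x)"
proof -
  have "poly_le (1 + 1) (\<lambda>x. 1 + (-1) * (\<Sum>i\<in>UNIV. (A *v x) $ i * x $ i))"
    by (intro poly_le_add poly_le_const poly_le_cmult poly_le_sum poly_le_mult poly_le_linear poly_le_coord) simp
  then show ?thesis by (simp add: inner_vec_def numeral_2_eq_2)
qed

definition rhs_integral :: "real \<Rightarrow> nat \<Rightarrow> nat \<Rightarrow> real^'n \<Rightarrow> real" where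
  "rhs_integral s j k x = (LINT \<theta>|cone_measure. (1 - (A *v x) \<bullet> x + ((A *v x) \<bullet> \<theta>)\<^sup>2) ^ (j - k) * ((A *v x) \<bullet> \<theta>) ^ (2 * k) * sphere_weight s \<theta>)"

lemma poly_le_rhs_integral:
  assumes s: "0 < s" and k: "k \<le> j"
  shows "poly_le (2 * j) (rhs_integral s j k)"
proof -
  let ?u = "\<lambda>x. 1 - (A *v x) \<bullet> x"
  let ?r = "\<lambda>i. 2 * (j - k - i) + 2 * k"
  have eq: "rhs_integral s j k x = (\<Sum>i\<le>j - k. real ((j - k) choose i) * (?u x ^ i * (LINT \<theta>|cone_measure. ((A *v x) \<bullet> \<theta>) ^ ?r i * sphere_weight s \<theta>)))" for x
  proof -
    have I: "integrable cone_measure (\<lambda>\<theta>. real ((j - k) choose i) * (?u x ^ i * (((A *v x) \<bullet> \<theta>) ^ ?r i * sphere_weight s \<theta>)))" for i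
      by (intro sphere_bounded_integrable sphere_bounded_mult sphere_bounded_const sphere_bounded_power sphere_bounded_inner sphere_weight_bounded s)
    have e: "(?u x + ((A *v x) \<bullet> \<theta>)\<^sup>2) ^ (j - k) * ((A *v x) \<bullet> \<theta>) ^ (2 * k) * sphere_weight s \<theta> = (\<Sum>i\<le>j - k. real ((j - k) choose i) * (?u x ^ i * (((A *v x) \<bullet> \<theta>) ^ ?r i * sphere_weight s \<theta>)))" for \<theta>
      unfolding binomial_ring sum_distrib_right by (intro sum.cong refl) (simp add: power_add power_mult mult_ac)
    have "rhs_integral s j k x = (\<Sum>i\<le>j - k. LINT \<theta>|cone_measure. real ((j - k) choose i) * (?u x ^ i * (((A *v x) \<bullet> \<theta>) ^ ?r i * sphere_weight s \<theta>)))"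
      unfolding rhs_integral_def e by (rule Bochner_Integration.integral_sum) (rule I)
    then show ?thesis by simp
  qed
  have "poly_le (2 * j) (\<lambda>x. real ((j - k) choose i) * (?u x ^ i * (LINT \<theta>|cone_measure. ((A *v x) \<bullet> \<theta>) ^ ?r i * sphere_weight s \<theta>)))" if "i \<in> {..j - k}" for i
  proof -
    have "2 * i + ?r i = 2 * j" using that k by auto
    moreover have "poly_le (2 * i + ?r i) (\<lambda>x. real ((j - k) choose i) * (?u x ^ i * (LINT \<theta>|cone_measure. ((A *v x) \<bullet> \<theta>) ^ ?r i * sphere_weight s \<theta>)))"
      by (intro poly_le_cmult poly_le_mult poly_le_power poly_le_one_minus_form poly_le_form_integral sphere_weight_bounded s)
    ultimately show ?thesis by (simp only:)
  qed
  then have "poly_le (2 * j) (\<lambda>x. \<Sum>i\<le>j - k. real ((j - k) choose i) * (?u x ^ i * (LINT \<theta>|cone_measure. ((A *v x) \<bullet> \<theta>) ^ ?r i * sphere_weight s \<theta>)))"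
    by (intro poly_le_sum) auto
  then show ?thesis unfolding eq[symmetric] .
qed

text \<open>
  Up to the sign \<open>(-1)\<^sup>j\<^sup>-\<^sup>k\<close>, the coefficient of \<open>N\<^sup>2\<^sup>j\<close> in the integral at \<open>N x\<close>.
\<close>

definition top_integral :: "real \<Rightarrow> nat \<Rightarrow> nat \<Rightarrow> real^'n \<Rightarrow> real" where
  "top_integral s j k x = (LINT \<theta>|cone_measure. ((\<rho> x)\<^sup>2 - ((A *v x) \<bullet> \<theta>)\<^sup>2) ^ (j - k) * ((A *v x) \<bullet> \<theta>) ^ (2 * k) * sphere_weight s \<theta>)"

lemma rhs_integral_growth:
  assumes s: "0 < s" and k: "k \<le> j"
  shows "(\<lambda>N. rhs_integral s j k (real N *\<^sub>R x) / real N ^ (2 * j)) \<longlonglongrightarrow> (-1) ^ (j - k) * top_integral s j k x"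
proof -
  let ?a = "\<lambda>\<theta>. (A *v x) \<bullet> \<theta>"
  let ?f = "\<lambda>N \<theta>. ((1 / real N)\<^sup>2 - ((\<rho> x)\<^sup>2 - (?a \<theta>)\<^sup>2)) ^ (j - k) * ?a \<theta> ^ (2 * k) * sphere_weight s \<theta>"
  let ?g = "\<lambda>\<theta>. (- ((\<rho> x)\<^sup>2 - (?a \<theta>)\<^sup>2)) ^ (j - k) * ?a \<theta> ^ (2 * k) * sphere_weight s \<theta>"
  let ?b = "\<lambda>\<theta>. (1 + ((\<rho> x)\<^sup>2 + (?a \<theta>)\<^sup>2)) ^ (j - k) * ?a \<theta> ^ (2 * k) * sphere_weight s \<theta>"
  have [measurable]: "sphere_weight s \<in> borel_measurable borel" using sphere_weight_bounded[OF s] by (rule sphere_bounded_measurable)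
  have "(\<lambda>N. LINT \<theta>|cone_measure. ?f N \<theta>) \<longlonglongrightarrow> (LINT \<theta>|cone_measure. ?g \<theta>)"
  proof (rule integral_dominated_convergence[where w="?b"])
    show "integrable cone_measure ?b"
      by (intro sphere_bounded_integrable sphere_bounded_mult sphere_bounded_add sphere_bounded_const sphere_bounded_power sphere_bounded_inner sphere_weight_bounded s)
    show "AE \<theta> in cone_measure. (\<lambda>N. ?f N \<theta>) \<longlonglongrightarrow> ?g \<theta>"
    proof (intro AE_I2)
      fix \<theta>
      have "(\<lambda>N. ?f N \<theta>) \<longlonglongrightarrow> (0\<^sup>2 - ((\<rho> x)\<^sup>2 - (?a \<theta>)\<^sup>2)) ^ (j - k) * ?a \<theta> ^ (2 * k) * sphere_weight s \<theta>"
        by (intro tendsto_intros lim_1_over_n)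
      then show "(\<lambda>N. ?f N \<theta>) \<longlonglongrightarrow> ?g \<theta>" by simp
    qed
    fix N
    show "AE \<theta> in cone_measure. norm (?f N \<theta>) \<le> ?b \<theta>"
    proof (intro AE_I2)
      fix \<theta>
      have "(1 / real N)\<^sup>2 \<le> 1" by (cases "N = 0") (auto simp: power_le_one)
      moreover have "0 \<le> (1 / real N)\<^sup>2" "0 \<le> (\<rho> x)\<^sup>2" "0 \<le> (?a \<theta>)\<^sup>2" by auto
      ultimately have "\<bar>(1 / real N)\<^sup>2 - ((\<rho> x)\<^sup>2 - (?a \<theta>)\<^sup>2)\<bar> \<le> 1 + ((\<rho> x)\<^sup>2 + (?a \<theta>)\<^sup>2)" by linarith
      then have "\<bar>(1 / real N)\<^sup>2 - ((\<rho> x)\<^sup>2 - (?a \<theta>)\<^sup>2)\<bar> ^ (j - k) \<le> (1 + ((\<rho> x)\<^sup>2 + (?a \<theta>)\<^sup>2)) ^ (j - k)"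
        by (intro power_mono) auto
      then show "norm (?f N \<theta>) \<le> ?b \<theta>"
        unfolding real_norm_def abs_mult power_abs using sphere_weight_nonneg[of s \<theta>]
        by (simp add: power_mult mult_right_mono)
    qed
  qed measurable
  moreover have "(LINT \<theta>|cone_measure. ?g \<theta>) = (-1) ^ (j - k) * top_integral s j k x"
  proof -
    have "?g \<theta> = (-1) ^ (j - k) * (((\<rho> x)\<^sup>2 - (?a \<theta>)\<^sup>2) ^ (j - k) * ?a \<theta> ^ (2 * k) * sphere_weight s \<theta>)" for \<theta>
      by (subst power_minus) (simp only: mult.assoc)
    then show ?thesis unfolding top_integral_def by (simp only: integral_mult_right_zero)
  qed
  moreover have "\<forall>\<^sub>F N in sequentially. (LINT \<theta>|cone_measure. ?f N \<theta>) = rhs_integral s j k (real N *\<^sub>R x) / real N ^ (2 * j)"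
    using eventually_gt_at_top[of 0]
  proof eventually_elim
    case (elim N)
    have "?f N \<theta> = (1 - (A *v (real N *\<^sub>R x)) \<bullet> (real N *\<^sub>R x) + ((A *v (real N *\<^sub>R x)) \<bullet> \<theta>)\<^sup>2) ^ (j - k) * ((A *v (real N *\<^sub>R x)) \<bullet> \<theta>) ^ (2 * k) * sphere_weight s \<theta> / real N ^ (2 * j)" for \<theta>
    proof -
      have 1: "1 - (A *v (real N *\<^sub>R x)) \<bullet> (real N *\<^sub>R x) + ((A *v (real N *\<^sub>R x)) \<bullet> \<theta>)\<^sup>2 = (real N)\<^sup>2 * ((1 / real N)\<^sup>2 - ((\<rho> x)\<^sup>2 - (?a \<theta>)\<^sup>2))"
      proof -
        have "(real N)\<^sup>2 * (1 / real N)\<^sup>2 = 1" using elim by (simp add: power_divide)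
        then have "(real N)\<^sup>2 * ((1 / real N)\<^sup>2 - ((\<rho> x)\<^sup>2 - (?a \<theta>)\<^sup>2)) = 1 - (real N)\<^sup>2 * ((\<rho> x)\<^sup>2 - (?a \<theta>)\<^sup>2)"
          by (simp only: right_diff_distrib)
        moreover have "A *v (real N *\<^sub>R x) = real N *\<^sub>R (A *v x)" by (simp add: matrix_vector_mult_scaleR)
        ultimately show ?thesis
          by (simp only: inner_scaleR_left inner_scaleR_right rho_sq) (simp add: power2_eq_square algebra_simps)
      qed
      have 2: "(A *v (real N *\<^sub>R x)) \<bullet> \<theta> = real N * ?a \<theta>" by (simp add: matrix_vector_mult_scaleR)
      have "2 * j = 2 * (j - k) + 2 * k" using k by simp
      then have "real N ^ (2 * j) = real N ^ (2 * (j - k) + 2 * k)" by (rule arg_cong)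
      also have "\<dots> = ((real N)\<^sup>2) ^ (j - k) * real N ^ (2 * k)" by (simp only: power_add power_mult)
      finally have 3: "real N ^ (2 * j) = ((real N)\<^sup>2) ^ (j - k) * real N ^ (2 * k)" .
      show ?thesis unfolding 1 unfolding 2 3 power_mult_distrib using elim by simp
    qed
    then show ?case unfolding rhs_integral_def by simp
  qed
  ultimately show ?thesis by (auto intro: Lim_transform_eventually)
qed

lemma form_sq_le: "\<rho> \<theta> = 1 \<Longrightarrow> ((A *v x) \<bullet> \<theta>)\<^sup>2 \<le> (\<rho> x)\<^sup>2"
proof -
  assume 1: "\<rho> \<theta> = 1"
  have "\<rho> (- \<theta>) = 1" using rho_scaleR[of "-1" \<theta>] 1 by simp
  then have "\<bar>(A *v x) \<bullet> \<theta>\<bar> \<le> \<rho> x" using form_Cauchy_Schwarz[of x \<theta>] form_Cauchy_Schwarz[of x "- \<theta>"] 1 by auto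
  then show ?thesis by (metis abs_le_square_iff abs_of_nonneg rho_nonneg)
qed

lemma top_integral_nonneg: "0 \<le> top_integral s j k x"
  unfolding top_integral_def
proof (intro integral_nonneg_AE)
  show "AE \<theta> in cone_measure. 0 \<le> ((\<rho> x)\<^sup>2 - ((A *v x) \<bullet> \<theta>)\<^sup>2) ^ (j - k) * ((A *v x) \<bullet> \<theta>) ^ (2 * k) * sphere_weight s \<theta>"
    using AE_cone_measure
  proof eventually_elim
    case (elim \<theta>)
    have "0 \<le> ((\<rho> x)\<^sup>2 - ((A *v x) \<bullet> \<theta>)\<^sup>2) ^ (j - k)" using form_sq_le[OF elim, of x] by (intro zero_le_power) simp
    moreover have "0 \<le> ((A *v x) \<bullet> \<theta>) ^ (2 * k)" by (simp add: power_mult)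
    ultimately show ?case by (intro mult_nonneg_nonneg sphere_weight_nonneg)
  qed
qed

text \<open>
  On the boundary, \<open>(\<rho> x)\<^sup>2 - (Ax \<cdot> \<theta>)\<^sup>2\<close> and \<open>(Ax \<cdot> \<theta>)\<^sup>2\<close> are nonnegative with the positive sum
  \<open>(\<rho> x)\<^sup>2\<close>, so they cannot both vanish.
\<close>

lemma top_integral_pos:
  assumes s: "0 < s" and x: "x \<noteq> 0"
  shows "0 < top_integral s j 0 x + top_integral s j j x"
proof -
  let ?a = "\<lambda>\<theta>. (A *v x) \<bullet> \<theta>"
  let ?h = "\<lambda>\<theta>. (((\<rho> x)\<^sup>2 - (?a \<theta>)\<^sup>2) ^ j + ((?a \<theta>)\<^sup>2) ^ j) * sphere_weight s \<theta>"
  have I0: "integrable cone_measure (\<lambda>\<theta>. ((\<rho> x)\<^sup>2 + (-1) * (?a \<theta>)\<^sup>2) ^ j * sphere_weight s \<theta>)"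
    and I1: "integrable cone_measure (\<lambda>\<theta>. ((?a \<theta>)\<^sup>2) ^ j * sphere_weight s \<theta>)"
    by (intro sphere_bounded_integrable sphere_bounded_mult sphere_bounded_add sphere_bounded_const sphere_bounded_power sphere_bounded_inner sphere_weight_bounded s)+
  have I0': "integrable cone_measure (\<lambda>\<theta>. ((\<rho> x)\<^sup>2 - (?a \<theta>)\<^sup>2) ^ j * sphere_weight s \<theta>)" using I0 by simp
  have eq: "top_integral s j 0 x + top_integral s j j x = (LINT \<theta>|cone_measure. ?h \<theta>)"
    unfolding top_integral_def distrib_right using Bochner_Integration.integral_add[OF I0' I1] by (simp add: power_mult)
  have hI: "integrable cone_measure ?h" unfolding distrib_right by (intro Bochner_Integration.integrable_add I0' I1)
  have hpos: "AE \<theta> in cone_measure. 0 < ?h \<theta>"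
    using AE_cone_measure
  proof eventually_elim
    case (elim \<theta>)
    let ?p = "(\<rho> x)\<^sup>2 - (?a \<theta>)\<^sup>2" and ?q = "(?a \<theta>)\<^sup>2"
    have "0 \<le> ?p" "0 \<le> ?q" using form_sq_le[OF elim, of x] by auto
    moreover have "0 < ?p + ?q" using x by (simp add: zero_less_power2)
    ultimately have "0 < ?p \<or> 0 < ?q" by linarith
    then have "0 < ?p ^ j + ?q ^ j"
    proof
      assume "0 < ?p" then show ?thesis using \<open>0 \<le> ?q\<close> by (intro add_pos_nonneg) auto
    next
      assume "0 < ?q" then show ?thesis using \<open>0 \<le> ?p\<close> by (intro add_nonneg_pos) auto
    qed
    then show ?case using sphere_weight_pos[OF elim, of s] by (intro mult_pos_pos)
  qed
  have "0 \<le> (LINT \<theta>|cone_measure. ?h \<theta>)" using hpos by (intro integral_nonneg_AE) (auto elim: eventually_mono)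
  moreover have "(LINT \<theta>|cone_measure. ?h \<theta>) \<noteq> 0"
  proof
    assume "(LINT \<theta>|cone_measure. ?h \<theta>) = 0"
    moreover have "AE \<theta> in cone_measure. 0 \<le> ?h \<theta>" using hpos by (auto elim: eventually_mono)
    ultimately have "AE \<theta> in cone_measure. ?h \<theta> = 0" using integral_nonneg_eq_0_iff_AE[OF hI] by blast
    with hpos have "AE \<theta> in cone_measure. False" by eventually_elim auto
    then have "emeasure cone_measure UNIV = 0" by (subst (asm) AE_iff_measurable[where N=UNIV]) auto
    then show False using emeasure_cone_measure_pos by simp
  qed
  ultimately show ?thesis unfolding eq by linarith
qed

text \<open>
  The sign \<open>(-1)\<^sup>k\<close> of the \<open>k\<close>-th term is made up for by the sign \<open>(-1)\<^sup>j\<^sup>-\<^sup>k\<close> of its leading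
  part, so all leading parts have the same sign.
\<close>

lemma rhs_combination_degree:
  assumes s: "0 < s" and c: "\<And>k. k \<le> j \<Longrightarrow> 0 < c k" and C: "C \<noteq> 0"
  shows "polynomial_of_degree (\<lambda>x. C * (\<Sum>k = 0..j. (-1) ^ k * c k * rhs_integral s j k x)) (2 * j)"
proof -
  obtain x :: "real^'n" where x: "x \<noteq> 0" using nonempty_Basis nonzero_Basis by blast
  show ?thesis
  proof (rule polynomial_of_degree_eqI)
    show "poly_le (2 * j) (\<lambda>x. C * (\<Sum>k = 0..j. (-1) ^ k * c k * rhs_integral s j k x))"
      by (intro poly_le_cmult poly_le_sum poly_le_rhs_integral[OF s]) auto
    have "(\<lambda>N. C * (\<Sum>k = 0..j. (-1) ^ k * c k * (rhs_integral s j k (real N *\<^sub>R x) / real N ^ (2 * j))))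
       \<longlonglongrightarrow> C * (\<Sum>k = 0..j. (-1) ^ k * c k * ((-1) ^ (j - k) * top_integral s j k x))"
      by (intro tendsto_mult_left tendsto_sum rhs_integral_growth s) simp
    then show "(\<lambda>N. C * (\<Sum>k = 0..j. (-1) ^ k * c k * rhs_integral s j k (real N *\<^sub>R x)) / real N ^ (2 * j))
       \<longlonglongrightarrow> C * (\<Sum>k = 0..j. (-1) ^ k * c k * ((-1) ^ (j - k) * top_integral s j k x))"
      by (simp only: times_divide_eq_right[symmetric] sum_divide_distrib)
    have "(\<Sum>k = 0..j. (-1) ^ k * c k * ((-1) ^ (j - k) * top_integral s j k x)) = (-1) ^ j * (\<Sum>k = 0..j. c k * top_integral s j k x)"
      unfolding sum_distrib_left
    proof (intro sum.cong refl)
      fix k assume "k \<in> {0..j}"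
      then have "j = k + (j - k)" by simp
      then have "(-1 :: real) ^ j = (-1) ^ (k + (j - k))" by simp
      then have e: "(-1 :: real) ^ j = (-1) ^ k * (-1) ^ (j - k)" by (simp only: power_add)
      show "(-1) ^ k * c k * ((-1) ^ (j - k) * top_integral s j k x) = (-1) ^ j * (c k * top_integral s j k x)"
        unfolding e by simp
    qed
    moreover have "0 < (\<Sum>k = 0..j. c k * top_integral s j k x)"
    proof -
      have nn: "0 \<le> c k * top_integral s j k x" if "k \<in> {0..j}" for k
        using that c[of k] top_integral_nonneg[of s j k x] by (auto intro!: mult_nonneg_nonneg)
      obtain k where k: "k \<in> {0..j}" "0 < top_integral s j k x"
      proof -
        have "0 < top_integral s j 0 x \<or> 0 < top_integral s j j x" using top_integral_pos[OF s x, of j] by linarith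
        then show thesis using that[of 0] that[of j] by auto
      qed
      show ?thesis by (rule sum_pos2[OF _ k(1) _ nn]) (use k c[of k] in auto)
    qed
    ultimately show "C * (\<Sum>k = 0..j. (-1) ^ k * c k * ((-1) ^ (j - k) * top_integral s j k x)) \<noteq> 0"
      using C by simp
  qed
qed

end

section \<open>The fractional Laplacian of a power\<close>

lemma central_diff_cong_line:
  assumes "\<And>\<tau>. f (x + \<tau> *\<^sub>R y) = g \<tau>"
  shows "central_diff m f x (t *\<^sub>R y) = central_diff m g 0 (t :: real)"
  using assms by (simp add: central_diff_def)

context posdef_form
begin

lemma ellipsoid_power_line:
  assumes "\<rho> \<theta> = 1"
  shows "ellipsoid_power A \<beta> (x + \<tau> *\<^sub>R \<theta>) = slice (1 - (A *v x) \<bullet> x) ((A *v x) \<bullet> \<theta>) \<beta> \<tau>"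
proof -
  have "(\<rho> (x + \<tau> *\<^sub>R \<theta>))\<^sup>2 = (A *v x) \<bullet> x + 2 * ((A *v x) \<bullet> \<theta>) * \<tau> + \<tau>\<^sup>2"
    unfolding rho_add_sq rho_scaleR using assms by (simp add: rho_sq)
  then have e: "1 - (A *v (x + \<tau> *\<^sub>R \<theta>)) \<bullet> (x + \<tau> *\<^sub>R \<theta>) = 1 - (A *v x) \<bullet> x - 2 * ((A *v x) \<bullet> \<theta>) * \<tau> - \<tau>\<^sup>2"
    unfolding rho_sq by simp
  show ?thesis
    unfolding ellipsoid_power_def slice_def ellipsoid_def mem_Collect_eq e[symmetric] by simp
qed

lemma ellipsoid_power_measurable [measurable]: "ellipsoid_power A \<beta> \<in> borel_measurable borel"
proof -
  have "ellipsoid_power A \<beta> = (\<lambda>x. if \<rho> x < 1 then (1 - (\<rho> x)\<^sup>2) powr \<beta> else 0)"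
    by (simp add: ellipsoid_power_def mem_ellipsoid_iff rho_sq fun_eq_iff)
  then show ?thesis by simp
qed

lemma integral_radial_measure:
  fixes f :: "real \<Rightarrow> real"
  assumes [measurable]: "f \<in> borel_measurable borel"
  shows "(LINT t|radial_measure. f t) = (LINT t|lborel. (if 0 < t then t ^ (CARD('n) - 1) else 0) * f t)"
    and "(\<integral>\<^sup>+t. ennreal (f t) \<partial>radial_measure) = (\<integral>\<^sup>+t. ennreal (if 0 < t then t ^ (CARD('n) - 1) else 0) * ennreal (f t) \<partial>lborel)"
proof -
  have e: "radial_measure = density lborel (\<lambda>t. ennreal (if 0 < t then t ^ (CARD('n) - 1) else 0))"
    unfolding radial_measure_def by (intro arg_cong2[where f=density] refl ext) (simp add: indicator_def)
  show "(LINT t|radial_measure. f t) = (LINT t|lborel. (if 0 < t then t ^ (CARD('n) - 1) else 0) * f t)"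
    unfolding e by (subst integral_density) auto
  show "(\<integral>\<^sup>+t. ennreal (f t) \<partial>radial_measure) = (\<integral>\<^sup>+t. ennreal (if 0 < t then t ^ (CARD('n) - 1) else 0) * ennreal (f t) \<partial>lborel)"
    unfolding e by (subst nn_integral_density) auto
qed

definition laplace_kernel :: "nat \<Rightarrow> real \<Rightarrow> int \<Rightarrow> real^'n \<Rightarrow> real^'n \<Rightarrow> real" where
  "laplace_kernel m s j x y = central_diff m (ellipsoid_power A (s + of_int j)) x y / norm y powr (real CARD('n) + 2 * s)"

lemma laplace_kernel_measurable [measurable]: "laplace_kernel m s j x \<in> borel_measurable borel"
  unfolding laplace_kernel_def[abs_def] central_diff_def by measurable

lemma laplace_kernel_ray:
  assumes \<theta>: "\<rho> \<theta> = 1" and t: "0 < t"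
  shows "t ^ (CARD('n) - 1) * laplace_kernel m s j x (t *\<^sub>R \<theta>)
    = sphere_weight s \<theta> * (central_diff m (slice (1 - (A *v x) \<bullet> x) ((A *v x) \<bullet> \<theta>) (s + of_int j)) 0 t * t powr (- 2 * s - 1))"
proof -
  let ?n = "real CARD('n)"
  have cd: "central_diff m (ellipsoid_power A (s + of_int j)) x (t *\<^sub>R \<theta>) = central_diff m (slice (1 - (A *v x) \<bullet> x) ((A *v x) \<bullet> \<theta>) (s + of_int j)) 0 t"
    by (rule central_diff_cong_line) (rule ellipsoid_power_line[OF \<theta>])
  have N: "norm (t *\<^sub>R \<theta>) powr (?n + 2 * s) = t powr (?n + 2 * s) * norm \<theta> powr (?n + 2 * s)"
    using t by (simp add: powr_mult)
  have E: "t ^ (CARD('n) - 1) / t powr (?n + 2 * s) = t powr (- 2 * s - 1)"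
  proof -
    have "t ^ (CARD('n) - 1) = t powr (real (CARD('n) - 1))" by (rule powr_realpow[OF t, symmetric])
    also have "real (CARD('n) - 1) = ?n - 1" by (simp add: of_nat_diff)
    finally have "t ^ (CARD('n) - 1) / t powr (?n + 2 * s) = t powr ((?n - 1) - (?n + 2 * s))" by (simp only: powr_diff)
    moreover have "(?n - 1) - (?n + 2 * s) = - 2 * s - 1" by simp
    ultimately show ?thesis by (simp only:)
  qed
  have "p * (c / (q * r)) = 1 / r * (c * (p / q))" for p c q r :: real by (simp add: mult_ac)
  then show ?thesis
    unfolding laplace_kernel_def cd sphere_weight_def N E[symmetric] .
qed

lemma rhs_poly_cone:
  "rhs_poly A s j x = (if j < 0 then 0 else rhs_const CARD('n) s (nat j) *
     (\<Sum>k = 0..nat j. (-1) ^ k * (Gamma (s + 1/2 + real k) / Gamma (1/2 + real k) * real (nat j choose k)) * rhs_integral s (nat j) k x))"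
proof -
  have "(LINT \<theta>|surface_measure (frontier (ellipsoid A)).
      (1 - (A *v x) \<bullet> x + ((A *v x) \<bullet> \<theta>)\<^sup>2) ^ (nat j - k) * ((A *v x) \<bullet> \<theta>) ^ (2 * k)
            / (norm \<theta> powr (real CARD('n) + 2 * s) * norm (A *v \<theta>))) = rhs_integral s (nat j) k x" for k
  proof -
    let ?g = "\<lambda>\<theta>. (1 - (A *v x) \<bullet> x + ((A *v x) \<bullet> \<theta>)\<^sup>2) ^ (nat j - k) * ((A *v x) \<bullet> \<theta>) ^ (2 * k) * sphere_weight s \<theta>"
    have "?g \<in> borel_measurable borel" unfolding sphere_weight_def by measurable
    from surface_integral_cone[OF this] show ?thesis
      unfolding rhs_integral_def by (simp add: sphere_weight_def divide_simps)
  qed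
  then show ?thesis unfolding rhs_poly_def by (simp add: mult.assoc)
qed

text \<open>
  In polar coordinates the inner integral is \<open>|\<theta>|\<^sup>-\<^sup>n\<^sup>-\<^sup>2\<^sup>s\<close> times the one-dimensional integral
  with \<open>b = Ax \<cdot> \<theta>\<close>, and \<open>|b| \<le> \<rho> x\<close> makes the bounds uniform.
\<close>

lemma laplace_kernel_integral:
  assumes s: "0 < s" "s < real m" and \<beta>: "-1 < s + of_int j" and x: "x \<in> ellipsoid A"
  shows "integrable lborel (laplace_kernel m s j x)"
    and "frac_laplacian_const CARD('n) m s / 2 * (LINT y|lborel. laplace_kernel m s j x y) = rhs_poly A s j x"
proof -
  define u where "u = 1 - (A *v x) \<bullet> x"
  have u: "0 < u" using x by (simp add: u_def ellipsoid_def)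
  let ?b = "\<lambda>\<theta>. (A *v x) \<bullet> \<theta>"
  let ?d = "\<lambda>\<theta> t. central_diff m (slice u (?b \<theta>) (s + of_int j)) 0 t"
  let ?w = "sphere_weight s"
  let ?T = "\<lambda>k \<theta>. (-1) ^ k * (Gamma (s + 1/2 + real k) / Gamma (1/2 + real k) * real (nat j choose k)) * ((u + (?b \<theta>)\<^sup>2) ^ (nat j - k) * ?b \<theta> ^ (2 * k) * ?w \<theta>)"
  obtain K where K: "\<And>b. \<bar>b\<bar> \<le> \<rho> x \<Longrightarrow>
    (\<integral>\<^sup>+t. ennreal (\<bar>central_diff m (slice u b (s + of_int j)) 0 t\<bar> * t powr (- 2 * s - 1)) * indicator {0<..} t \<partial>lborel) \<le> ennreal K"
    using central_diff_slice_uniform_bound[OF u \<beta> s rho_nonneg[of x]] by blast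
  obtain B where B: "\<And>\<theta>. \<rho> \<theta> = 1 \<Longrightarrow> \<bar>?w \<theta>\<bar> \<le> B" using sphere_weight_bounded[OF s(1)] by (auto simp: sphere_bounded_def)
  have bd: "(\<integral>\<^sup>+t. ennreal \<bar>laplace_kernel m s j x (t *\<^sub>R \<theta>)\<bar> \<partial>radial_measure) \<le> ennreal (B * \<bar>K\<bar>)" if \<theta>: "\<rho> \<theta> = 1" for \<theta>
  proof -
    have b: "\<bar>?b \<theta>\<bar> \<le> \<rho> x" using form_sq_le[OF \<theta>, of x] abs_le_square_iff[of "?b \<theta>" "\<rho> x"] by simp
    have B0: "0 \<le> B" "?w \<theta> \<le> B" using B[OF \<theta>] by auto
    have "(\<integral>\<^sup>+t. ennreal \<bar>laplace_kernel m s j x (t *\<^sub>R \<theta>)\<bar> \<partial>radial_measure)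
      = (\<integral>\<^sup>+t. ennreal (if 0 < t then t ^ (CARD('n) - 1) else 0) * ennreal \<bar>laplace_kernel m s j x (t *\<^sub>R \<theta>)\<bar> \<partial>lborel)"
      by (rule integral_radial_measure) measurable
    also have "\<dots> = (\<integral>\<^sup>+t. ennreal (?w \<theta>) * (ennreal (\<bar>?d \<theta> t\<bar> * t powr (- 2 * s - 1)) * indicator {0<..} t) \<partial>lborel)"
    proof (intro nn_integral_cong)
      fix t :: real
      show "ennreal (if 0 < t then t ^ (CARD('n) - 1) else 0) * ennreal \<bar>laplace_kernel m s j x (t *\<^sub>R \<theta>)\<bar>
        = ennreal (?w \<theta>) * (ennreal (\<bar>?d \<theta> t\<bar> * t powr (- 2 * s - 1)) * indicator {0<..} t)"
      proof (cases "0 < t")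
        case True
        have "t ^ (CARD('n) - 1) * \<bar>laplace_kernel m s j x (t *\<^sub>R \<theta>)\<bar> = \<bar>t ^ (CARD('n) - 1) * laplace_kernel m s j x (t *\<^sub>R \<theta>)\<bar>"
          using True by (simp add: abs_mult)
        also have "\<dots> = ?w \<theta> * (\<bar>?d \<theta> t\<bar> * t powr (- 2 * s - 1))"
          unfolding laplace_kernel_ray[OF \<theta> True] u_def[symmetric] using sphere_weight_nonneg[of s \<theta>] by (simp add: abs_mult)
        finally show ?thesis using True sphere_weight_nonneg[of s \<theta>] by (simp add: ennreal_mult[symmetric])
      qed simp
    qed
    also have "\<dots> = ennreal (?w \<theta>) * (\<integral>\<^sup>+t. ennreal (\<bar>?d \<theta> t\<bar> * t powr (- 2 * s - 1)) * indicator {0<..} t \<partial>lborel)"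
      by (rule nn_integral_cmult) measurable
    also have "\<dots> \<le> ennreal B * ennreal \<bar>K\<bar>"
      using K[OF b] B0 by (intro mult_mono ennreal_leI) (auto intro: order_trans ennreal_leI)
    also have "\<dots> = ennreal (B * \<bar>K\<bar>)" using B0 by (simp add: ennreal_mult)
    finally show ?thesis .
  qed
  show int: "integrable lborel (laplace_kernel m s j x)"
    by (rule integral_polar(1)[OF laplace_kernel_measurable bd])
  have polar: "(LINT y|lborel. laplace_kernel m s j x y) = (LINT \<theta>|cone_measure. (LINT t|radial_measure. laplace_kernel m s j x (t *\<^sub>R \<theta>)))"
    by (rule integral_polar(2)[OF laplace_kernel_measurable bd])
  have ray: "(LINT t|radial_measure. laplace_kernel m s j x (t *\<^sub>R \<theta>)) = ?w \<theta> * difference_integral m s u j (?b \<theta>)" if \<theta>: "\<rho> \<theta> = 1" for \<theta>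
  proof -
    let ?f = "\<lambda>t. ?d \<theta> t * t powr (- 2 * s - 1)"
    have ai: "?f absolutely_integrable_on {0<..}"
      by (rule central_diff_slice_absolutely_integrable[OF u \<beta> s])
    then have si: "set_integrable lborel {0<..} ?f" by (subst (asm) absolutely_integrable_on_lborel_iff) auto
    have "(LINT t|radial_measure. laplace_kernel m s j x (t *\<^sub>R \<theta>)) = (LINT t|lborel. (if 0 < t then t ^ (CARD('n) - 1) else 0) * laplace_kernel m s j x (t *\<^sub>R \<theta>))"
      by (rule integral_radial_measure) measurable
    also have "\<dots> = (LINT t|lborel. ?w \<theta> * (indicator {0<..} t *\<^sub>R ?f t))"
      by (intro Bochner_Integration.integral_cong refl)
        (use laplace_kernel_ray[OF \<theta>, of _ m s j x, folded u_def] in \<open>auto simp: indicator_def\<close>)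
    also have "\<dots> = ?w \<theta> * (LINT t:{0<..}|lborel. ?f t)"
      unfolding set_lebesgue_integral_def by simp
    also have "(LINT t:{0<..}|lborel. ?f t) = difference_integral m s u j (?b \<theta>)"
      unfolding difference_integral_def by (rule set_borel_integral_eq_integral(2)[OF si])
    finally show ?thesis .
  qed
  let ?c = "frac_laplacian_const CARD('n) m s / 2"
  have "?c * (LINT y|lborel. laplace_kernel m s j x y) = (LINT \<theta>|cone_measure. ?c * (LINT t|radial_measure. laplace_kernel m s j x (t *\<^sub>R \<theta>)))"
    unfolding polar by simp
  also have "\<dots> = (LINT \<theta>|cone_measure. (if j < 0 then 0 else rhs_const CARD('n) s (nat j) *
      (\<Sum>k = 0..nat j. ?T k \<theta>)))"
  proof (rule integral_cong_AE)
    show "AE \<theta> in cone_measure. ?c * (LINT t|radial_measure. laplace_kernel m s j x (t *\<^sub>R \<theta>)) = (if j < 0 then 0 else rhs_const CARD('n) s (nat j) *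
      (\<Sum>k = 0..nat j. ?T k \<theta>))"
      using AE_cone_measure
    proof eventually_elim
      case (elim \<theta>)
      have "?c * (LINT t|radial_measure. laplace_kernel m s j x (t *\<^sub>R \<theta>)) = ?w \<theta> * (?c * difference_integral m s u j (?b \<theta>))"
        unfolding ray[OF elim] by simp
      also have "\<dots> = (if j < 0 then 0 else ?w \<theta> * (rhs_const CARD('n) s (nat j) *
          (\<Sum>k = 0..nat j. (-1) ^ k * (Gamma (s + 1/2 + real k) / Gamma (1/2 + real k)) * real (nat j choose k) * ((u + (?b \<theta>)\<^sup>2) ^ (nat j - k) * ?b \<theta> ^ (2 * k)))))"
        unfolding difference_integral_value[OF u \<beta> s] rhs_const_value_poly[OF s(1)] by simp
      finally show ?case by (simp add: sum_distrib_left mult_ac)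
    qed
    interpret sigma_finite_measure radial_measure by (rule sigma_finite_radial_measure)
    have "(\<lambda>(\<theta>, t). laplace_kernel m s j x (t *\<^sub>R \<theta>)) \<in> borel_measurable (cone_measure \<Otimes>\<^sub>M radial_measure)" by measurable
    then show "(\<lambda>\<theta>. ?c * (LINT t|radial_measure. laplace_kernel m s j x (t *\<^sub>R \<theta>))) \<in> borel_measurable cone_measure" by measurable
    show "(\<lambda>\<theta>. (if j < 0 then 0 else rhs_const CARD('n) s (nat j) *
      (\<Sum>k = 0..nat j. ?T k \<theta>))) \<in> borel_measurable cone_measure"
      unfolding sphere_weight_def by measurable
  qed
  also have "\<dots> = rhs_poly A s j x"
  proof -
    have I: "integrable cone_measure (\<lambda>\<theta>. ?T k \<theta>)" for k
      by (intro integrable_mult_right sphere_bounded_integrable sphere_bounded_mult sphere_bounded_add sphere_bounded_const sphere_bounded_power sphere_bounded_inner sphere_weight_bounded s)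
    note sumI = Bochner_Integration.integral_sum[of "{0..nat j}", OF I]
    show ?thesis
      unfolding rhs_poly_cone rhs_integral_def u_def[symmetric]
      by (cases "j < 0") (simp_all only: if_True if_False integral_mult_right_zero sumI integral_zero)
  qed
  finally show "?c * (LINT y|lborel. laplace_kernel m s j x y) = rhs_poly A s j x" .
qed

lemma rhs_poly_degree:
  assumes s: "0 < s"
  shows "polynomial_of_degree (rhs_poly A s j) (nat (2 * j))"
proof (cases "j < 0")
  case True
  then have "rhs_poly A s j = (\<lambda>x. 0)" by (simp add: rhs_poly_cone fun_eq_iff)
  then show ?thesis using True polynomial_of_degree_0 by simp
next
  case False
  have G: "0 < Gamma y" if "0 < y" for y :: real using that by (rule Gamma_real_pos)
  have "polynomial_of_degree (\<lambda>x. rhs_const CARD('n) s (nat j) *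
     (\<Sum>k = 0..nat j. (-1) ^ k * (Gamma (s + 1/2 + real k) / Gamma (1/2 + real k) * real (nat j choose k)) * rhs_integral s (nat j) k x)) (2 * nat j)"
  proof (rule rhs_combination_degree[OF s])
    show "0 < Gamma (s + 1/2 + real k) / Gamma (1/2 + real k) * real (nat j choose k)" if "k \<le> nat j" for k
      using s that by (intro mult_pos_pos divide_pos_pos G) (auto simp: zero_less_binomial add_pos_nonneg)
    have "0 < Gamma (real CARD('n) / 2 + s)" "0 < Gamma (1 + s + real (nat j))" "0 < Gamma (1/2 + s)" "0 < Gamma (1 + real (nat j))"
      using s by (auto intro!: G add_pos_nonneg add_nonneg_pos)
    then have "0 < rhs_const CARD('n) s (nat j)"
      unfolding rhs_const_def by (intro divide_pos_pos mult_pos_pos) simp_all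
    then show "rhs_const CARD('n) s (nat j) \<noteq> 0" by simp
  qed
  moreover have "rhs_poly A s j = (\<lambda>x. rhs_const CARD('n) s (nat j) *
     (\<Sum>k = 0..nat j. (-1) ^ k * (Gamma (s + 1/2 + real k) / Gamma (1/2 + real k) * real (nat j choose k)) * rhs_integral s (nat j) k x))"
    using False by (simp only: rhs_poly_cone fun_eq_iff if_False simp_thms)
  moreover have "nat (2 * j) = 2 * nat j" using False by (simp add: nat_mult_distrib)
  ultimately show ?thesis by (simp only:)
qed

end

theorem theorem1p2:
  fixes A :: "real ^ 'n ^ 'n" and s :: real and j :: int and m :: nat
  assumes "CARD('n) \<ge> 2"
    and "s > 0"
    and "transpose A = A"
    and "\<And>x. x \<noteq> 0 \<Longrightarrow> (A *v x) \<bullet> x > 0"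
    and "j \<ge> - \<lfloor>s\<rfloor> - 1"
    and "s + real_of_int j > -1"
    and "real m > s"
  shows "(\<forall>x \<in> ellipsoid A.
            has_frac_laplacian m s (ellipsoid_power A (s + real_of_int j)) x (rhs_poly A s j x)) \<and>
         (\<forall>x. x \<notin> ellipsoid A \<longrightarrow> ellipsoid_power A (s + real_of_int j) x = 0) \<and>
         polynomial_of_degree (rhs_poly A s j) (nat (2 * j))"
proof -
  interpret posdef_form A by unfold_locales (fact assms)+
  have "has_frac_laplacian m s (ellipsoid_power A (s + real_of_int j)) x (rhs_poly A s j x)" if "x \<in> ellipsoid A" for x
    using laplace_kernel_integral[OF assms(2,7,6) that] unfolding has_frac_laplacian_def laplace_kernel_def by simp
  moreover have "polynomial_of_degree (rhs_poly A s j) (nat (2 * j))" by (rule rhs_poly_degree[OF assms(2)])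
  ultimately show ?thesis by (simp add: ellipsoid_power_def)
qed

end
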